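(* Let $(\mathscr A,\tau)$ be a noncommutative probability space, $\{W_t\}_{t\ge 0}$ a free Brownian motion in it, $l\ge 1$, and let $\alpha,\beta^i,\gamma^i:\mathscr A_{sa}\to\mathscr A_{sa}$ ($i=1,\dots,l$) be maps satisfying the standing assumptions in the context. Assume: (A-1) each $f\in\{\alpha,\beta^1,\dots,\beta^l,\gamma^1,\dots,\gamma^l\}$ is locally operator Lipschitz in the $L^2$-norm: for every $M>0$ there is a constant $L_f(M)>0$ with $\|f(U)-f(V)\|_2\le L_f(M)\|U-V\|_2$ for all $U,V\in\mathscr A_{sa}$ with $\|U\|_2,\|V\|_2\le M$; (A-2) there exist constants $L_1\in\mathbb R$ and $L_2>0$ such that for every $U\in L^2(\mathscr A,\tau)_{sa}$, $$2\tau\bigl(U\alpha(U)\bigr)+\Bigl(\sum_{i=1}^l\|\beta^i(U)\|_2\,\|\gamma^i(U)\|_2\Bigr)^2\le L_1\|U\|_2^2+L_2 .$$ Then for every initial value $U_0\in\mathscr A_{sa}$ that is free from $\{W_t\}_{t\ge 0}$ there exists a unique (global) solution $\{U_t\}_{t\in[0,\infty)}$ of the free stochastic differential equation $$dU_t=\alpha(U_t)\,dt+\sum_{i=1}^l\beta^i(U_t)\,dW_t\,\gamma^i(U_t)$$ with initial value $U_0$, such that $U_t\in L^2(\mathscr A,\tau)_{sa}$ for all $t\ge 0$. Moreover, the solution is uniformly bounded in the $L^2$-norm and the map $t\mapsto U_t$ is $L^2$-norm continuous.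
   Context: A noncommutative probability space $(\mathscr A,\tau)$ is a von Neumann algebra $\mathscr A$ with a faithful normal tracial state $\tau$. $\mathscr A_{sa}$ is the set of self-adjoint elements, $\|\cdot\|$ the operator norm, $\langle X,Y\rangle=\tau(X^*Y)$, $\|X\|_2=\tau(X^*X)^{1/2}$; $L^2(\mathscr A,\tau)$ is the completion of $\mathscr A$ for $\|\cdot\|_2$ and $L^2(\mathscr A,\tau)_{sa}$ its set of self-adjoint elements. $W^*(S)$ denotes the von Neumann subalgebra generated by $S$. "Free" means freely independent with respect to $\tau$: subalgebras are free if $\tau(X_1\cdots X_n)=0$ whenever all $\tau(X_k)=0$ and consecutive $X_k$ come from different subalgebras. A free Brownian motion is a family $W_t\in\mathscr A_{sa}$ with $W_0=0$ such that for $0\le s<t$, $W_t-W_s$ is free from $W^*(W_r:0\le r\le s)$ and has the centered semicircular distribution of variance $t-s$. For $U_0\in\mathscr A_{sa}$ free from $\{W_t\}_{t\ge0}$ put $\mathscr A_{\le t}=W^*(U_0,W_r:r\le t)$. Free stochastic integral: for processes $b_t,c_t\in L^2(\mathscr A_{\le t},\tau)$ with $\int_0^T\|b_t\|_2^2\|c_t\|_2^2\,dt<\infty$, $\int_0^T b_t\,dW_t\,c_t\in L^2(\mathscr A,\tau)$ is the $L^2$-limit of sums $\sum_k b_{t_{k-1}}(W_{t_k}-W_{t_{k-1}})c_{t_{k-1}}$ for simple adapted processes, extended by the free Itô isometry $\|\int_0^T b_t\,dW_t\,c_t\|_2^2=\int_0^T\|b_t\|_2^2\|c_t\|_2^2\,dt$.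 Standing assumptions on the coefficients: (i) (causality) operators do not leave their generated subalgebras under the coefficient maps: $f(U)\in W^*(U)$ for $U\in\mathscr A_{sa}$ and $f\in\{\alpha,\beta^i,\gamma^i\}$ (e.g. one-variable polynomials or functional calculus); (ii) for adapted self-adjoint processes $V$, the sum $\sum_{i=1}^l\int_0^t\beta^i(V_s)\,dW_s\,\gamma^i(V_s)$ is self-adjoint. Under (A-1) each coefficient extends uniquely by $L^2$-continuity to a map $L^2(\mathscr A,\tau)_{sa}\to L^2(\mathscr A,\tau)_{sa}$, denoted by the same letter. A (global) solution with initial value $U_0$ is a process $t\mapsto U_t\in L^2(\mathscr A,\tau)_{sa}$, $t\ge0$, adapted in the sense that $U_t\in L^2(\mathscr A_{\le t},\tau)$, satisfying for all $t\ge 0$ $$U_t=U_0+\int_0^t\alpha(U_s)\,ds+\sum_{i=1}^l\int_0^t\beta^i(U_s)\,dW_s\,\gamma^i(U_s).$$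
   Formalization: "Uniformly bounded in the L²-norm" is proved as bounded on every [0,T], and on all of [0,∞) when L_1<0; over all t≥0 it is false for L_1≥0: α(U)=U, β=γ=0, U_0=1 gives U_t=e^t. *)

theory Defs
  imports "HOL-Analysis.Analysis" "HOL-Library.FuncSet"
begin

section \<open>Complex Hilbert spaces and bounded operators\<close>

text \<open>
  The real inner product, and hence the norm and the topology, of a complex Hilbert space is the
  real part of the complex one. The complex inner product is linear in its second argument.
\<close>

class complex_hilbert_space = real_inner + complete_space +
  fixes scaleC :: "complex \<Rightarrow> 'a \<Rightarrow> 'a" (infixr \<open>*\<^sub>C\<close> 75)
    and cinner :: "'a \<Rightarrow> 'a \<Rightarrow> complex"
  assumes scaleC_add_right: "c *\<^sub>C (x + y) = c *\<^sub>C x + c *\<^sub>C y"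
    and scaleC_add_left: "(c + d) *\<^sub>C x = c *\<^sub>C x + d *\<^sub>C x"
    and scaleC_scaleC: "c *\<^sub>C d *\<^sub>C x = (c * d) *\<^sub>C x"
    and scaleC_of_real: "complex_of_real r *\<^sub>C x = r *\<^sub>R x"
    and cinner_commute: "cinner x y = cnj (cinner y x)"
    and cinner_add_right: "cinner x (y + z) = cinner x y + cinner x z"
    and cinner_scaleC_right: "cinner x (c *\<^sub>C y) = c * cinner x y"
    and inner_eq_Re_cinner: "inner x y = Re (cinner x y)"

text \<open>
  Bounded operators are elements of the library type of bounded real-linear maps; the
  complex-linear ones are singled out by \<open>bounded_ops\<close>. The operator norm is the same for the
  real and for the complex structure.
\<close>

definition bounded_ops :: "('h::complex_hilbert_space \<Rightarrow>\<^sub>L 'h) set" where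
  "bounded_ops = {T. \<forall>c x. blinfun_apply T (c *\<^sub>C x) = c *\<^sub>C blinfun_apply T x}"

definition scalar_op :: "complex \<Rightarrow> ('h::complex_hilbert_space \<Rightarrow>\<^sub>L 'h)" where
  "scalar_op c = Blinfun (\<lambda>x. c *\<^sub>C x)"

lemma norm_scaleC: "norm (c *\<^sub>C (x::'h::complex_hilbert_space)) = cmod c * norm x"
proof -
  have left: "cinner (c *\<^sub>C x) y = cnj c * cinner x y" for y
    by (metis cinner_commute cinner_scaleC_right complex_cnj_mult)
  have "cinner (c *\<^sub>C x) (c *\<^sub>C x) = (c * cnj c) * cinner x x"
    by (simp add: left cinner_scaleC_right)
  also have "c * cnj c = complex_of_real ((cmod c)\<^sup>2)"
    by (rule complex_norm_square[symmetric])
  finally have "Re (cinner (c *\<^sub>C x) (c *\<^sub>C x)) = (cmod c)\<^sup>2 * Re (cinner x x)"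
    by (simp only: times_complex.sel Re_complex_of_real Im_complex_of_real mult_zero_left diff_zero)
  then have "(norm (c *\<^sub>C x))\<^sup>2 = (cmod c * norm x)\<^sup>2"
    by (simp add: power2_norm_eq_inner inner_eq_Re_cinner power_mult_distrib)
  then show ?thesis
    by (simp add: power2_eq_iff_nonneg)
qed

lemma scalar_op_apply [simp]: "blinfun_apply (scalar_op c) x = c *\<^sub>C x"
proof -
  have "bounded_linear (\<lambda>x::'a. c *\<^sub>C x)"
  proof (rule bounded_linear_intro[where K = "cmod c"])
    show "c *\<^sub>C (x + y) = c *\<^sub>C x + c *\<^sub>C y" for x y :: 'a
      by (rule scaleC_add_right)
    show "c *\<^sub>C r *\<^sub>R x = r *\<^sub>R c *\<^sub>C x" for r and x :: 'a
      by (metis scaleC_of_real scaleC_scaleC mult.commute)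
    show "norm (c *\<^sub>C x) \<le> norm x * cmod c" for x :: 'a
      by (simp add: norm_scaleC mult.commute)
  qed
  then show ?thesis
    by (simp add: scalar_op_def bounded_linear_Blinfun_apply)
qed

definition op_adj :: "('h::complex_hilbert_space \<Rightarrow>\<^sub>L 'h) \<Rightarrow> ('h \<Rightarrow>\<^sub>L 'h)" where
  "op_adj T = (THE S. \<forall>x y. cinner (blinfun_apply S x) y = cinner x (blinfun_apply T y))"

definition op_prod :: "('h::complex_hilbert_space \<Rightarrow>\<^sub>L 'h) list \<Rightarrow> ('h \<Rightarrow>\<^sub>L 'h)" where
  "op_prod Ts = foldr (o\<^sub>L) Ts id_blinfun"

definition op_le :: "('h::complex_hilbert_space \<Rightarrow>\<^sub>L 'h) \<Rightarrow> ('h \<Rightarrow>\<^sub>L 'h) \<Rightarrow> bool" where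
  "op_le S T \<longleftrightarrow> (\<forall>x. Re (cinner x (blinfun_apply S x)) \<le> Re (cinner x (blinfun_apply T x)))"

definition sa_part :: "('h::complex_hilbert_space \<Rightarrow>\<^sub>L 'h) set \<Rightarrow> ('h \<Rightarrow>\<^sub>L 'h) set" where
  "sa_part A = {T \<in> A. op_adj T = T}"


section \<open>Noncommutative probability spaces\<close>

definition von_neumann_algebra :: "('h::complex_hilbert_space \<Rightarrow>\<^sub>L 'h) set \<Rightarrow> bool" where
  "von_neumann_algebra A \<longleftrightarrow>
     A \<subseteq> bounded_ops \<and> id_blinfun \<in> A \<and>
     (\<forall>S\<in>A. \<forall>T\<in>A. S + T \<in> A \<and> S o\<^sub>L T \<in> A) \<and>
     (\<forall>c. \<forall>T\<in>A. scalar_op c o\<^sub>L T \<in> A) \<and>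
     (\<forall>T\<in>A. op_adj T \<in> A) \<and>
     closedin strong_operator_topology A"

text \<open>The von Neumann algebra generated by a set of operators, written $W^*(S)$.\<close>

definition vn_generated :: "('h::complex_hilbert_space \<Rightarrow>\<^sub>L 'h) set \<Rightarrow> ('h \<Rightarrow>\<^sub>L 'h) set" where
  "vn_generated S = \<Inter>{N. von_neumann_algebra N \<and> S \<subseteq> N}"

text \<open>
  Normality: the functional preserves least upper bounds of upward directed sets of self-adjoint
  elements (equivalently, of bounded increasing nets).
\<close>

definition normal_functional ::
    "('h::complex_hilbert_space \<Rightarrow>\<^sub>L 'h) set \<Rightarrow> (('h \<Rightarrow>\<^sub>L 'h) \<Rightarrow> complex) \<Rightarrow> bool" where
  "normal_functional A \<tau> \<longleftrightarrow>
     (\<forall>D S. D \<subseteq> sa_part A \<and> D \<noteq> {} \<and>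
        (\<forall>X\<in>D. \<forall>Y\<in>D. \<exists>Z\<in>D. op_le X Z \<and> op_le Y Z) \<and>
        S \<in> sa_part A \<and> (\<forall>X\<in>D. op_le X S) \<and>
        (\<forall>R\<in>sa_part A. (\<forall>X\<in>D. op_le X R) \<longrightarrow> op_le S R) \<longrightarrow>
        Re (\<tau> S) = (SUP X\<in>D. Re (\<tau> X)))"

definition nc_prob_space ::
    "('h::complex_hilbert_space \<Rightarrow>\<^sub>L 'h) set \<Rightarrow> (('h \<Rightarrow>\<^sub>L 'h) \<Rightarrow> complex) \<Rightarrow> bool" where
  "nc_prob_space A \<tau> \<longleftrightarrow>
     von_neumann_algebra A \<and>
     (\<forall>X\<in>A. \<forall>Y\<in>A. \<tau> (X + Y) = \<tau> X + \<tau> Y) \<and>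
     (\<forall>c. \<forall>X\<in>A. \<tau> (scalar_op c o\<^sub>L X) = c * \<tau> X) \<and>
     (\<forall>X\<in>A. \<tau> (op_adj X o\<^sub>L X) \<in> \<real>\<^sub>\<ge>\<^sub>0) \<and>
     \<tau> id_blinfun = 1 \<and>
     (\<forall>X\<in>A. \<forall>Y\<in>A. \<tau> (X o\<^sub>L Y) = \<tau> (Y o\<^sub>L X)) \<and>
     (\<forall>X\<in>A. \<tau> (op_adj X o\<^sub>L X) = 0 \<longrightarrow> X = 0) \<and>
     normal_functional A \<tau>"

text \<open>
  Freeness of a family of subalgebras. A list entry \<open>(i, X)\<close> is an element \<open>X\<close> of the subalgebra
  with index \<open>i\<close>.
\<close>

definition free_family ::
    "(('h::complex_hilbert_space \<Rightarrow>\<^sub>L 'h) \<Rightarrow> complex) \<Rightarrow> 'i set \<Rightarrow> ('i \<Rightarrow> ('h \<Rightarrow>\<^sub>L 'h) set) \<Rightarrow> bool" where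
  "free_family \<tau> I B \<longleftrightarrow>
     (\<forall>xs. xs \<noteq> [] \<and> (\<forall>(i, X)\<in>set xs. i \<in> I \<and> X \<in> B i \<and> \<tau> X = 0) \<and>
           distinct_adj (map fst xs) \<longrightarrow>
           \<tau> (op_prod (map snd xs)) = 0)"

text \<open>Two sets of operators are free if the von Neumann algebras they generate are.\<close>

definition free_from ::
    "(('h::complex_hilbert_space \<Rightarrow>\<^sub>L 'h) \<Rightarrow> complex) \<Rightarrow> ('h \<Rightarrow>\<^sub>L 'h) set \<Rightarrow> ('h \<Rightarrow>\<^sub>L 'h) set \<Rightarrow> bool" where
  "free_from \<tau> S T \<longleftrightarrow>
     free_family \<tau> UNIV (\<lambda>first::bool. if first then vn_generated S else vn_generated T)"

text \<open>
  The distribution of a bounded self-adjoint element is the compactly supported probability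
  measure with the same moments; the semicircle law of variance \<open>v > 0\<close> has density
  $\sqrt{4v - x^2}/(2\pi v)$ on $[-2\sqrt v, 2\sqrt v]$.
\<close>

definition centered_semicircular ::
    "(('h::complex_hilbert_space \<Rightarrow>\<^sub>L 'h) \<Rightarrow> complex) \<Rightarrow> real \<Rightarrow> ('h \<Rightarrow>\<^sub>L 'h) \<Rightarrow> bool" where
  "centered_semicircular \<tau> v X \<longleftrightarrow>
     (\<forall>n. \<tau> (op_prod (replicate n X)) =
        complex_of_real (integral {- 2 * sqrt v..2 * sqrt v}
          (\<lambda>x. x ^ n * (sqrt (4 * v - x\<^sup>2) / (2 * pi * v)))))"

definition free_brownian_motion ::
    "('h::complex_hilbert_space \<Rightarrow>\<^sub>L 'h) set \<Rightarrow> (('h \<Rightarrow>\<^sub>L 'h) \<Rightarrow> complex) \<Rightarrow> (real \<Rightarrow> ('h \<Rightarrow>\<^sub>L 'h)) \<Rightarrow> bool" where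
  "free_brownian_motion A \<tau> W \<longleftrightarrow>
     (\<forall>t\<ge>0. W t \<in> sa_part A) \<and> W 0 = 0 \<and>
     (\<forall>s t. 0 \<le> s \<and> s < t \<longrightarrow>
        free_from \<tau> {W t - W s} (W ` {0..s}) \<and>
        centered_semicircular \<tau> (t - s) (W t - W s))"

text \<open>The algebra $\mathscr A_{\le t}$ generated by the initial value and the past of \<open>W\<close>.\<close>

definition past ::
    "(real \<Rightarrow> ('h::complex_hilbert_space \<Rightarrow>\<^sub>L 'h)) \<Rightarrow> ('h \<Rightarrow>\<^sub>L 'h) \<Rightarrow> real \<Rightarrow> ('h \<Rightarrow>\<^sub>L 'h) set" where
  "past W U0 t = vn_generated (insert U0 (W ` {0..t}))"


section \<open>The space $L^2(\mathscr A,\tau)$\<close>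

text \<open>
  The completion of \<open>A\<close> for the norm $\tau(X^*X)^{1/2}$ is given as a Hilbert space (the type \<open>'k\<close>)
  with a linear embedding \<open>\<iota>\<close> of \<open>A\<close> that is isometric and has dense range; this determines the
  pair up to a unique unitary.
\<close>

definition L2_completion ::
    "('h::complex_hilbert_space \<Rightarrow>\<^sub>L 'h) set \<Rightarrow> (('h \<Rightarrow>\<^sub>L 'h) \<Rightarrow> complex) \<Rightarrow>
     (('h \<Rightarrow>\<^sub>L 'h) \<Rightarrow> 'k::complex_hilbert_space) \<Rightarrow> bool" where
  "L2_completion A \<tau> \<iota> \<longleftrightarrow>
     (\<forall>X\<in>A. \<forall>Y\<in>A. \<iota> (X + Y) = \<iota> X + \<iota> Y) \<and>
     (\<forall>c. \<forall>X\<in>A. \<iota> (scalar_op c o\<^sub>L X) = c *\<^sub>C \<iota> X) \<and>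
     (\<forall>X\<in>A. \<forall>Y\<in>A. cinner (\<iota> X) (\<iota> Y) = \<tau> (op_adj X o\<^sub>L Y)) \<and>
     closure (\<iota> ` A) = UNIV"

text \<open>$L^2(N,\tau)$ inside $L^2(\mathscr A,\tau)$ for a subalgebra \<open>N\<close> of \<open>A\<close>.\<close>

definition L2_sub ::
    "(('h::complex_hilbert_space \<Rightarrow>\<^sub>L 'h) \<Rightarrow> 'k::complex_hilbert_space) \<Rightarrow> ('h \<Rightarrow>\<^sub>L 'h) set \<Rightarrow> 'k set" where
  "L2_sub \<iota> N = closure (\<iota> ` N)"

text \<open>The involution of $L^2(\mathscr A,\tau)$, that is, the continuous extension of $X \mapsto X^*$.\<close>

definition L2_adj ::
    "('h::complex_hilbert_space \<Rightarrow>\<^sub>L 'h) set \<Rightarrow> (('h \<Rightarrow>\<^sub>L 'h) \<Rightarrow> 'k::complex_hilbert_space) \<Rightarrow> 'k \<Rightarrow> 'k" where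
  "L2_adj A \<iota> = (THE J. continuous_on UNIV J \<and> (\<forall>X\<in>A. J (\<iota> X) = \<iota> (op_adj X)))"

definition L2_sa ::
    "('h::complex_hilbert_space \<Rightarrow>\<^sub>L 'h) set \<Rightarrow> (('h \<Rightarrow>\<^sub>L 'h) \<Rightarrow> 'k::complex_hilbert_space) \<Rightarrow> 'k set" where
  "L2_sa A \<iota> = {\<xi>. L2_adj A \<iota> \<xi> = \<xi>}"

text \<open>
  $\tau(\xi\eta)$ for $\xi,\eta\in L^2(\mathscr A,\tau)$, extended from \<open>A\<close> by
  $\tau(XY) = \langle X^*, Y\rangle$.
\<close>

definition L2_trace_mult ::
    "('h::complex_hilbert_space \<Rightarrow>\<^sub>L 'h) set \<Rightarrow> (('h \<Rightarrow>\<^sub>L 'h) \<Rightarrow> 'k::complex_hilbert_space) \<Rightarrow>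
     'k \<Rightarrow> 'k \<Rightarrow> complex" where
  "L2_trace_mult A \<iota> \<xi> \<eta> = cinner (L2_adj A \<iota> \<xi>) \<eta>"

text \<open>
  The unique $L^2$-continuous extension of a map on the self-adjoint elements of \<open>A\<close> to the
  self-adjoint elements of $L^2(\mathscr A,\tau)$. It is \<open>undefined\<close> off \<open>L2_sa\<close>, which makes the
  description unique.
\<close>

definition L2_extension ::
    "('h::complex_hilbert_space \<Rightarrow>\<^sub>L 'h) set \<Rightarrow> (('h \<Rightarrow>\<^sub>L 'h) \<Rightarrow> 'k::complex_hilbert_space) \<Rightarrow>
     (('h \<Rightarrow>\<^sub>L 'h) \<Rightarrow> ('h \<Rightarrow>\<^sub>L 'h)) \<Rightarrow> 'k \<Rightarrow> 'k" where
  "L2_extension A \<iota> f =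
     (THE g. g \<in> L2_sa A \<iota> \<rightarrow>\<^sub>E L2_sa A \<iota> \<and> continuous_on (L2_sa A \<iota>) g \<and>
             (\<forall>U\<in>sa_part A. g (\<iota> U) = \<iota> (f U)))"


section \<open>The free stochastic integral\<close>

text \<open>
  \<open>F\<close> is a filtration of subalgebras. A simple adapted process is constant on the
  intervals \<open>[p k, p (k + 1))\<close> of a partition of \<open>[0, T]\<close>.
\<close>

definition simple_adapted ::
    "(real \<Rightarrow> ('h::complex_hilbert_space \<Rightarrow>\<^sub>L 'h) set) \<Rightarrow> real \<Rightarrow> nat \<Rightarrow> (nat \<Rightarrow> real) \<Rightarrow>
     (real \<Rightarrow> ('h \<Rightarrow>\<^sub>L 'h)) \<Rightarrow> bool" where
  "simple_adapted F T n p b \<longleftrightarrow>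
     p 0 = 0 \<and> p n = T \<and>
     (\<forall>k<n. p k < p (Suc k) \<and> b (p k) \<in> F (p k) \<and> (\<forall>s\<in>{p k..<p (Suc k)}. b s = b (p k)))"

definition simple_integral ::
    "(real \<Rightarrow> ('h::complex_hilbert_space \<Rightarrow>\<^sub>L 'h)) \<Rightarrow> nat \<Rightarrow> (nat \<Rightarrow> real) \<Rightarrow>
     (real \<Rightarrow> ('h \<Rightarrow>\<^sub>L 'h)) \<Rightarrow> (real \<Rightarrow> ('h \<Rightarrow>\<^sub>L 'h)) \<Rightarrow> ('h \<Rightarrow>\<^sub>L 'h)" where
  "simple_integral W n p b c = (\<Sum>k<n. b (p k) o\<^sub>L (W (p (Suc k)) - W (p k)) o\<^sub>L c (p k))"

text \<open>
  $\|b\otimes c - b'\otimes c'\|^2$ in the Hilbert space tensor product, expanded with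
  $\langle b\otimes c, b'\otimes c'\rangle = \langle b,b'\rangle\langle c,c'\rangle$.
\<close>

definition tensor_dist_sq :: "'k::complex_hilbert_space \<Rightarrow> 'k \<Rightarrow> 'k \<Rightarrow> 'k \<Rightarrow> real" where
  "tensor_dist_sq b c b' c' =
     (norm b)\<^sup>2 * (norm c)\<^sup>2 - 2 * Re (cinner b b' * cinner c c') + (norm b')\<^sup>2 * (norm c')\<^sup>2"

text \<open>
  \<open>has_free_integral \<iota> W F T b c \<xi>\<close> means $\int_0^T b_t\,dW_t\,c_t = \xi$. For simple processes the
  free Ito isometry, polarised, reads
  $\|\int b\,dW\,c - \int b'\,dW\,c'\|_2^2 = \int_0^T \|b_t\otimes c_t - b'_t\otimes c'_t\|^2\,dt$;
  the integral is extended from simple processes by continuity with respect to the right-hand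
  side. The scalar integrands are nonnegative, so their gauge integral is the Lebesgue integral.
\<close>

definition has_free_integral ::
    "(('h::complex_hilbert_space \<Rightarrow>\<^sub>L 'h) \<Rightarrow> 'k::complex_hilbert_space) \<Rightarrow> (real \<Rightarrow> ('h \<Rightarrow>\<^sub>L 'h)) \<Rightarrow>
     (real \<Rightarrow> ('h \<Rightarrow>\<^sub>L 'h) set) \<Rightarrow> real \<Rightarrow> (real \<Rightarrow> 'k) \<Rightarrow> (real \<Rightarrow> 'k) \<Rightarrow> 'k \<Rightarrow> bool" where
  "has_free_integral \<iota> W F T b c \<xi> \<longleftrightarrow>
     (\<forall>t\<in>{0..T}. b t \<in> L2_sub \<iota> (F t) \<and> c t \<in> L2_sub \<iota> (F t)) \<and>
     (\<lambda>t. (norm (b t))\<^sup>2 * (norm (c t))\<^sup>2) integrable_on {0..T} \<and>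
     (\<exists>n p bs cs.
        (\<forall>m. simple_adapted F T (n m) (p m) (bs m) \<and> simple_adapted F T (n m) (p m) (cs m)) \<and>
        (\<forall>m. (\<lambda>t. tensor_dist_sq (b t) (c t) (\<iota> (bs m t)) (\<iota> (cs m t))) integrable_on {0..T}) \<and>
        (\<lambda>m. integral {0..T} (\<lambda>t. tensor_dist_sq (b t) (c t) (\<iota> (bs m t)) (\<iota> (cs m t))))
          \<longlonglongrightarrow> 0 \<and>
        (\<lambda>m. \<iota> (simple_integral W (n m) (p m) (bs m) (cs m))) \<longlonglongrightarrow> \<xi>)"


section \<open>Coefficients and solutions\<close>

definition causal ::
    "('h::complex_hilbert_space \<Rightarrow>\<^sub>L 'h) set \<Rightarrow> (('h \<Rightarrow>\<^sub>L 'h) \<Rightarrow> ('h \<Rightarrow>\<^sub>L 'h)) \<Rightarrow> bool" where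
  "causal A f \<longleftrightarrow> (\<forall>U\<in>sa_part A. f U \<in> vn_generated {U})"

text \<open>
  Self-adjointness of $\sum_{i=1}^l\int_0^t\beta^i(V_s)\,dW_s\,\gamma^i(V_s)$ whenever \<open>V\<close> is an
  adapted process of self-adjoint operators and the integrals exist.
\<close>

definition sa_preserving ::
    "('h::complex_hilbert_space \<Rightarrow>\<^sub>L 'h) set \<Rightarrow> (('h \<Rightarrow>\<^sub>L 'h) \<Rightarrow> 'k::complex_hilbert_space) \<Rightarrow>
     (real \<Rightarrow> ('h \<Rightarrow>\<^sub>L 'h)) \<Rightarrow> (real \<Rightarrow> ('h \<Rightarrow>\<^sub>L 'h) set) \<Rightarrow> nat \<Rightarrow>
     (nat \<Rightarrow> ('h \<Rightarrow>\<^sub>L 'h) \<Rightarrow> ('h \<Rightarrow>\<^sub>L 'h)) \<Rightarrow> (nat \<Rightarrow> ('h \<Rightarrow>\<^sub>L 'h) \<Rightarrow> ('h \<Rightarrow>\<^sub>L 'h)) \<Rightarrow> bool" where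
  "sa_preserving A \<iota> W F l \<beta> \<gamma> \<longleftrightarrow>
     (\<forall>V t \<xi>. (\<forall>s\<ge>0. V s \<in> sa_part (F s)) \<and> 0 \<le> t \<and>
        (\<forall>i\<in>{1..l}. has_free_integral \<iota> W F t (\<lambda>s. \<iota> (\<beta> i (V s))) (\<lambda>s. \<iota> (\<gamma> i (V s))) (\<xi> i)) \<longrightarrow>
        (\<Sum>i=1..l. \<xi> i) \<in> L2_sa A \<iota>)"

definition locally_L2_lipschitz ::
    "('h::complex_hilbert_space \<Rightarrow>\<^sub>L 'h) set \<Rightarrow> (('h \<Rightarrow>\<^sub>L 'h) \<Rightarrow> 'k::complex_hilbert_space) \<Rightarrow>
     (('h \<Rightarrow>\<^sub>L 'h) \<Rightarrow> ('h \<Rightarrow>\<^sub>L 'h)) \<Rightarrow> bool" where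
  "locally_L2_lipschitz A \<iota> f \<longleftrightarrow>
     (\<forall>M>0. \<exists>L>0. \<forall>U\<in>sa_part A. \<forall>V\<in>sa_part A.
        norm (\<iota> U) \<le> M \<and> norm (\<iota> V) \<le> M \<longrightarrow> norm (\<iota> (f U - f V)) \<le> L * norm (\<iota> (U - V)))"

text \<open>
  The drift is a vector-valued gauge integral, since the Bochner integral of the library needs a
  separable space. Only the values \<open>U t\<close> with \<open>t \<ge> 0\<close> matter.
\<close>

definition free_SDE_solution ::
    "('h::complex_hilbert_space \<Rightarrow>\<^sub>L 'h) set \<Rightarrow> (('h \<Rightarrow>\<^sub>L 'h) \<Rightarrow> 'k::complex_hilbert_space) \<Rightarrow>
     (real \<Rightarrow> ('h \<Rightarrow>\<^sub>L 'h)) \<Rightarrow> nat \<Rightarrow> (('h \<Rightarrow>\<^sub>L 'h) \<Rightarrow> ('h \<Rightarrow>\<^sub>L 'h)) \<Rightarrow>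
     (nat \<Rightarrow> ('h \<Rightarrow>\<^sub>L 'h) \<Rightarrow> ('h \<Rightarrow>\<^sub>L 'h)) \<Rightarrow> (nat \<Rightarrow> ('h \<Rightarrow>\<^sub>L 'h) \<Rightarrow> ('h \<Rightarrow>\<^sub>L 'h)) \<Rightarrow>
     ('h \<Rightarrow>\<^sub>L 'h) \<Rightarrow> (real \<Rightarrow> 'k) \<Rightarrow> bool" where
  "free_SDE_solution A \<iota> W l \<alpha> \<beta> \<gamma> U0 U \<longleftrightarrow>
     (\<forall>t\<ge>0. U t \<in> L2_sa A \<iota> \<and> U t \<in> L2_sub \<iota> (past W U0 t)) \<and>
     (\<forall>t\<ge>0. \<exists>\<zeta> \<xi>.
        ((\<lambda>s. L2_extension A \<iota> \<alpha> (U s)) has_integral \<zeta>) {0..t} \<and>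
        (\<forall>i\<in>{1..l}. has_free_integral \<iota> W (past W U0) t
           (\<lambda>s. L2_extension A \<iota> (\<beta> i) (U s)) (\<lambda>s. L2_extension A \<iota> (\<gamma> i) (U s)) (\<xi> i)) \<and>
        U t = \<iota> U0 + \<zeta> + (\<Sum>i=1..l. \<xi> i))"

end

theory Submission
  imports Defs
begin

text \<open>
  The coefficients are composed with a radial retraction, which makes them bounded and globally
  Lipschitz. The free Ito isometry then makes the Picard map a contraction for an exponentially
  weighted norm, and a Dini form of Ito's formula for \<open>\<parallel>U t\<parallel>\<^sup>2\<close> together with (A-2) shows that
  the solution never leaves the ball on which the retraction is the identity.

  The isometry needs that an increment of \<open>W\<close> is free from the von Neumann algebra of \<open>U0\<close> and the past,
  while freeness is given only for the two factors. For alternating products this is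
  combinatorial; it passes to the whole algebra because a unital *-algebra is
  \<open>\<parallel>_\<parallel>\<^sub>2\<close>-dense in the von Neumann algebra it generates. For the latter, normality of the trace and
  Zorn's lemma give elements \<open>g\<close> with \<open>\<parallel>Y g\<parallel>\<^sub>2 \<le> \<parallel>Y \<eta>\<parallel>\<close> for all \<open>Y\<close>. The resulting intertwiners from
  the given representation to the standard one carry bicommutant elements to operators that
  leave the closure of the *-algebra invariant.
\<close>


section \<open>Hilbert spaces and adjoints\<close>

text \<open>An integrand is a pair \<open>(b, c)\<close>, but a difference of two pairs is only an
  element of a Hilbert tensor product. That product is realised inside \<open>'k\<close> itself:
  over the past of \<open>T\<close>, the map \<open>(b, c) \<mapsto> b (W (T + 1) - W T) c\<close>
  preserves the tensor inner product. Stochastic integrals thereby become limits of vector-valued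
  step functions, and the estimates on them become triangle inequalities.

  Density of a *-algebra in L^2 cannot be argued on \<open>'h\<close> directly, since that
  representation need not contain a vector implementing the trace.

  The radius of the retraction has to be fixed before the truncated equation is solved. It is read
  off from an explicit exponential barrier for the squared norm on \<open>[0, T]\<close>. (A-2) is
  invoked only at times where the squared norm touches the barrier, and there the retraction is
  still the identity; an inequality for right increments at such times is enough.

  A solution is by definition only integrable in time. Its continuity is deduced from the isometry,
  and the resulting boundedness on \<open>[0, T]\<close> lets local Lipschitz constants decide
  uniqueness.\<close>

instance complex_hilbert_space \<subseteq> banach ..

lemma norm_add_sq: "(norm (u + v))\<^sup>2 = (norm u)\<^sup>2 + 2 * inner u v + (norm v)\<^sup>2" for u v :: "'a::real_inner"
  by (simp add: power2_norm_eq_inner inner_add_left inner_add_right inner_commute)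

lemma norm_diff_sq: "(norm (u - v))\<^sup>2 = (norm u)\<^sup>2 - 2 * inner u v + (norm v)\<^sup>2" for u v :: "'a::real_inner"
  by (simp add: power2_norm_eq_inner inner_diff_left inner_diff_right inner_commute)

text \<open>A minimising sequence for the distance is Cauchy by the parallelogram law, and at the
  limit no motion along \<open>z\<close> can decrease the distance. Only the real structure enters,
  because some of the subspaces met later, such as the self-adjoint vectors, are merely
  real.\<close>

lemma closed_subspace_projection:
  fixes S :: "'a::{real_inner,complete_space} set"
  assumes "closed S" "subspace S"
  obtains y where "y \<in> S" "\<And>z. z \<in> S \<Longrightarrow> inner (x - y) z = 0"
proof -
  define d where "d = infdist x S"
  have ne: "S \<noteq> {}" using assms(2) subspace_0 by blast
  have d_le: "d \<le> norm (x - z)" if "z \<in> S" for z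
    using infdist_le[OF that, of x] by (simp add: d_def dist_norm)
  have d0: "d \<ge> 0" by (simp add: d_def infdist_nonneg)
  have "\<exists>y\<in>S. norm (x - y) < d + 1 / Suc n" for n :: nat
  proof (rule ccontr)
    assume "\<not> ?thesis"
    then have "\<And>y. y \<in> S \<Longrightarrow> d + 1 / Suc n \<le> dist x y" by (force simp: dist_norm)
    then have "d + 1 / Suc n \<le> infdist x S"
      using ne by (auto simp: infdist_def intro!: cINF_greatest)
    then show False by (simp add: d_def)
  qed
  then obtain y where y: "\<And>n. y n \<in> S" "\<And>n::nat. norm (x - y n) < d + 1 / Suc n" by metis
  \<comment> \<open>The midpoint of \<open>u\<close> and \<open>v\<close> lies in \<open>S\<close>,
    so its distance from \<open>x\<close> is at least \<open>d\<close>.\<close>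
  have par: "(norm (u - v))\<^sup>2 \<le> 2 * (norm (x - u))\<^sup>2 + 2 * (norm (x - v))\<^sup>2 - 4 * d\<^sup>2"
    if "u \<in> S" "v \<in> S" for u v
  proof -
    have "(1/2) *\<^sub>R (u + v) \<in> S" using that assms(2) by (simp add: subspace_add subspace_scale)
    from d_le[OF this] have "d\<^sup>2 \<le> (norm (x - (1/2) *\<^sub>R (u + v)))\<^sup>2" using d0 by (simp add: power_mono)
    also have "4 * \<dots> = (norm ((x - u) + (x - v)))\<^sup>2"
    proof -
      have "(x - u) + (x - v) = 2 *\<^sub>R (x - (1/2) *\<^sub>R (u + v))" by (simp add: algebra_simps scaleR_2)
      then show ?thesis by (simp only: norm_scaleR) (simp add: power_mult_distrib)
    qed
    finally have "4 * d\<^sup>2 \<le> (norm ((x - u) + (x - v)))\<^sup>2" by simp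
    moreover have "(norm ((x - u) + (x - v)))\<^sup>2 + (norm (u - v))\<^sup>2 = 2 * (norm (x - u))\<^sup>2 + 2 * (norm (x - v))\<^sup>2"
      by (simp add: power2_norm_eq_inner inner_add_left inner_add_right inner_diff_left inner_diff_right inner_commute algebra_simps)
    ultimately show ?thesis by linarith
  qed
  have lim1: "(\<lambda>n. 1 / real (Suc n)) \<longlonglongrightarrow> 0"
    using LIMSEQ_inverse_real_of_nat by (simp add: inverse_eq_divide)
  have tends: "(\<lambda>n. 2 * (d + 1 / Suc n)\<^sup>2 + 2 * (d + 1 / Suc n)\<^sup>2 - 4 * d\<^sup>2) \<longlonglongrightarrow> 0"
  proof -
    have "(\<lambda>n. d + 1 / Suc n) \<longlonglongrightarrow> d + 0" by (intro tendsto_intros lim1)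
    then have "(\<lambda>n. 2 * (d + 1 / Suc n)\<^sup>2 + 2 * (d + 1 / Suc n)\<^sup>2 - 4 * d\<^sup>2) \<longlonglongrightarrow> 2 * (d+0)\<^sup>2 + 2 * (d+0)\<^sup>2 - 4 * d\<^sup>2"
      by (intro tendsto_intros lim1)
    then show ?thesis by simp
  qed
  have "Cauchy y"
  proof (rule metric_CauchyI)
    fix e :: real assume e: "e > 0"
    have "eventually (\<lambda>n. 2 * (d + 1 / Suc n)\<^sup>2 + 2 * (d + 1 / Suc n)\<^sup>2 - 4 * d\<^sup>2 < e\<^sup>2) sequentially"
      using order_tendstoD(2)[OF tends, of "e\<^sup>2"] e by simp
    then obtain N where N: "2 * (d + 1 / Suc N)\<^sup>2 + 2 * (d + 1 / Suc N)\<^sup>2 - 4 * d\<^sup>2 < e\<^sup>2"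
      by (auto simp: eventually_sequentially)
    have le: "(norm (x - y n))\<^sup>2 \<le> (d + 1 / Suc N)\<^sup>2" if "n \<ge> N" for n
    proof -
      have "norm (x - y n) \<le> d + 1 / Suc n" using y(2)[of n] by simp
      also have "\<dots> \<le> d + 1 / Suc N" using that by (simp add: frac_le)
      finally show ?thesis by (simp add: power_mono)
    qed
    show "\<exists>M. \<forall>m\<ge>M. \<forall>n\<ge>M. dist (y m) (y n) < e"
    proof (intro exI allI impI)
      fix m n assume "N \<le> m" "N \<le> n"
      then have "(norm (y m - y n))\<^sup>2 < e\<^sup>2"
        using par[OF y(1)[of m] y(1)[of n]] le[of m] le[of n] N by linarith
      then show "dist (y m) (y n) < e" using e by (simp add: dist_norm power_less_imp_less_base)
    qed
  qed
  then obtain p where p: "y \<longlonglongrightarrow> p" using Cauchy_convergent convergent_def by blast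
  have pS: "p \<in> S" using assms(1) y(1) p closed_sequentially by blast
  have "norm (x - p) \<le> d"
  proof (rule LIMSEQ_le)
    show "(\<lambda>n. norm (x - y n)) \<longlonglongrightarrow> norm (x - p)" by (intro tendsto_intros p)
    have "(\<lambda>n. d + 1 / Suc n) \<longlonglongrightarrow> d + 0" by (intro tendsto_intros lim1)
    then show "(\<lambda>n. d + 1 / Suc n) \<longlonglongrightarrow> d" by simp
    show "\<exists>N. \<forall>n\<ge>N. norm (x - y n) \<le> d + 1 / Suc n" using y(2) less_imp_le by blast
  qed
  have "inner (x - p) z = 0" if "z \<in> S" for z
  proof (cases "z = 0")
    case False
    \<comment> \<open>The minimiser of the quadratic
      \<open>\<lambda>t. (norm (x - p - t *\<^sub>R z))\<^sup>2\<close>.\<close>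
    define t where "t = inner (x - p) z / inner z z"
    have zz: "inner z z > 0" using False by simp
    have "p + t *\<^sub>R z \<in> S" using pS that assms(2) by (simp add: subspace_add subspace_scale)
    from d_le[OF this] \<open>norm (x - p) \<le> d\<close> have "norm (x - p) \<le> norm ((x - p) - t *\<^sub>R z)"
      by (simp add: diff_diff_eq)
    then have "(norm (x - p))\<^sup>2 \<le> (norm ((x - p) - t *\<^sub>R z))\<^sup>2" by (simp add: power_mono)
    also have "\<dots> = (norm (x - p))\<^sup>2 - 2 * t * inner (x - p) z + t * t * inner z z"
      by (simp only: norm_diff_sq[of "x - p"]) (simp add: power_mult_distrib power2_norm_eq_inner power2_eq_square[of t])
    also have "t * t * inner z z = t * inner (x - p) z" using zz by (simp add: t_def)
    finally have "t * inner (x - p) z \<le> 0" by simp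
    then have "(inner (x - p) z)\<^sup>2 \<le> 0" using zz by (simp add: t_def power2_eq_square divide_le_0_iff)
    then show ?thesis by simp
  qed simp
  with pS that show ?thesis by blast
qed

text \<open>The kernel has codimension one, so a vector orthogonal to it represents \<open>f\<close>
  after rescaling.\<close>

lemma riesz_representation:
  fixes f :: "'a::{real_inner,complete_space} \<Rightarrow> real"
  assumes "bounded_linear f"
  obtains y where "\<And>x. f x = inner x y"
proof (cases "\<forall>x. f x = 0")
  case True
  then show ?thesis using that[of 0] by simp
next
  case False
  then obtain x0 where x0: "f x0 \<noteq> 0" by blast
  interpret f: bounded_linear f by fact
  define S where "S = {x. f x = 0}"
  have "closed S"
    unfolding S_def by (rule closed_Collect_eq) (auto intro!: f.continuous_on continuous_intros)
  moreover have "subspace S" by (auto simp: S_def subspace_def f.add f.scaleR f.zero)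
  ultimately obtain y where y: "y \<in> S" "\<And>z. z \<in> S \<Longrightarrow> inner (x0 - y) z = 0"
    using closed_subspace_projection by blast
  define w where "w = x0 - y"
  have fw: "f w = f x0" using y(1) by (simp add: w_def f.diff S_def)
  then have w0: "w \<noteq> 0" using x0 f.zero by auto
  have "f x = inner x ((f w / inner w w) *\<^sub>R w)" for x
  proof -
    have "x - (f x / f w) *\<^sub>R w \<in> S" using fw x0 by (simp add: S_def f.diff f.scaleR)
    from y(2)[OF this] have "inner w x = (f x / f w) * inner w w"
      by (simp add: w_def[symmetric] inner_diff_right)
    then show ?thesis using w0 fw x0 by (simp add: inner_commute field_simps)
  qed
  then show ?thesis using that by blast
qed

text \<open>Riesz representation of each functional \<open>\<lambda>x. inner (T x) y\<close>. The
  real-linear form with two different spaces is what the intertwiners from \<open>'h\<close> to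
  \<open>'k\<close> call for: they are constructed as real-linear maps.\<close>

lemma adjoint_exists:
  fixes T :: "'a::{real_inner,complete_space} \<Rightarrow>\<^sub>L 'b::{real_inner,complete_space}"
  obtains S :: "'b \<Rightarrow>\<^sub>L 'a" where "\<And>x y. inner (blinfun_apply T x) y = inner x (blinfun_apply S y)"
proof -
  have "\<exists>z. \<forall>x. inner (blinfun_apply T x) y = inner x z" for y
  proof -
    have "bounded_linear (\<lambda>x. inner (blinfun_apply T x) y)"
      by (intro bounded_linear_intros)
    from riesz_representation[OF this] show ?thesis by metis
  qed
  then obtain s where s: "\<And>x y. inner (blinfun_apply T x) y = inner x (s y)" by metis
  have eqI: "u = v" if "\<And>x. inner x u = inner x v" for u v :: 'a
    using that by (metis inner_commute inner_eq_zero_iff inner_diff_left right_minus_eq)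
  have "bounded_linear s"
  proof (rule bounded_linear_intro[where K = "norm T"])
    show "s (x + y) = s x + s y" for x y
      by (rule eqI) (simp add: inner_add_right s[symmetric])
    show "s (r *\<^sub>R x) = r *\<^sub>R s x" for r x
      by (rule eqI) (simp add: s[symmetric])
    show "norm (s y) \<le> norm y * norm T" for y
    proof (cases "s y = 0")
      case False
      have "norm (s y) * norm (s y) = inner (blinfun_apply T (s y)) y"
        by (simp add: s power2_norm_eq_inner[symmetric] power2_eq_square[symmetric])
      also have "\<dots> \<le> norm (blinfun_apply T (s y)) * norm y" by (rule norm_cauchy_schwarz)
      also have "\<dots> \<le> norm T * norm (s y) * norm y" by (intro mult_right_mono norm_blinfun) auto
      finally have "norm (s y) * norm (s y) \<le> (norm y * norm T) * norm (s y)" by (simp add: mult_ac)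
      then show ?thesis using False by (simp add: mult_le_cancel_right)
    qed simp
  qed
  then have "blinfun_apply (Blinfun s) = s" by (rule bounded_linear_Blinfun_apply)
  then show ?thesis using that s by metis
qed

lemma inner_eq_all_imp_eq:
  fixes u v :: "'a::real_inner"
  assumes "\<And>x. inner x u = inner x v"
  shows "u = v"
  by (metis assms inner_commute inner_eq_zero_iff inner_diff_left right_minus_eq)

section \<open>The complex inner product\<close>

lemma cinner_add_left: "cinner (x + y) z = cinner x z + cinner y z"
  by (metis cinner_add_right cinner_commute complex_cnj_add)

lemma cinner_scaleC_left: "cinner (c *\<^sub>C x) y = cnj c * cinner x y"
  by (metis cinner_commute cinner_scaleC_right complex_cnj_mult)

lemma scaleC_one [simp]: "1 *\<^sub>C x = (x::'a::complex_hilbert_space)"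
  using scaleC_of_real[of 1 x] by simp

lemma scaleC_minus1: "(-1) *\<^sub>C x = - (x::'a::complex_hilbert_space)"
  using scaleC_of_real[of "-1" x] by simp

lemma scaleC_zero_right [simp]: "c *\<^sub>C (0::'a::complex_hilbert_space) = 0"
  using scaleC_add_right[of c 0 "0::'a"] by simp

lemma scaleC_zero_left [simp]: "0 *\<^sub>C (x::'a::complex_hilbert_space) = 0"
  using scaleC_of_real[of 0 x] by simp

lemma scaleC_diff_right: "c *\<^sub>C (x - y) = c *\<^sub>C x - c *\<^sub>C (y::'a::complex_hilbert_space)"
  using scaleC_add_right[of c "x - y" y] by simp

lemma cinner_minus_right [simp]: "cinner x (- y) = - cinner x y"
  using cinner_scaleC_right[of x "-1" y] by (simp add: scaleC_minus1)

lemma cinner_minus_left [simp]: "cinner (- x) y = - cinner x y"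
  using cinner_scaleC_left[of "-1" x y] by (simp add: scaleC_minus1)

lemma cinner_diff_right: "cinner x (y - z) = cinner x y - cinner x z"
  using cinner_add_right[of x y "- z"] by simp

lemma cinner_diff_left: "cinner (x - y) z = cinner x z - cinner y z"
  using cinner_add_left[of x "- y" z] by simp

lemma cinner_zero_right [simp]: "cinner x 0 = 0"
  using cinner_scaleC_right[of x 0 x] by simp

lemma cinner_zero_left [simp]: "cinner 0 x = 0"
  using cinner_scaleC_left[of 0 x x] by simp

lemma Im_cinner: "Im (cinner x y) = inner (\<i> *\<^sub>C x) y"
  by (simp add: inner_eq_Re_cinner cinner_scaleC_left)

lemma cinner_eq_inner: "cinner x y = Complex (inner x y) (inner (\<i> *\<^sub>C x) y)"
  by (simp add: complex_eq_iff Im_cinner inner_eq_Re_cinner)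

lemma cinner_same: "cinner x x = complex_of_real ((norm x)\<^sup>2)"
proof -
  have "cinner x x = cnj (cinner x x)" by (rule cinner_commute)
  then have "Im (cinner x x) = 0" by (metis Reals_cnj_iff complex_is_Real_iff)
  then show ?thesis by (simp add: complex_eq_iff power2_norm_eq_inner inner_eq_Re_cinner)
qed

text \<open>Multiplying \<open>x\<close> by the phase of \<open>cinner x y\<close> makes the complex
  inner product real and nonnegative; the real Cauchy-Schwarz inequality then applies.\<close>

lemma cmod_cinner_le: "cmod (cinner x y) \<le> norm x * norm y"
proof (cases "cinner x y = 0")
  case False
  define u where "u = cinner x y / cmod (cinner x y)"
  have u1: "cmod u = 1" using False by (simp add: u_def norm_divide)
  have "cnj (cinner x y) * cinner x y = complex_of_real ((cmod (cinner x y))\<^sup>2)"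
    by (metis complex_norm_square mult.commute of_real_power)
  then have e: "cnj u * cinner x y = complex_of_real (cmod (cinner x y))"
    using False by (simp add: u_def power2_eq_square)
  have "cmod (cinner x y) = Re (cinner (u *\<^sub>C x) y)"
    by (simp add: cinner_scaleC_left e)
  also have "\<dots> = inner (u *\<^sub>C x) y" by (simp add: inner_eq_Re_cinner)
  also have "\<dots> \<le> norm (u *\<^sub>C x) * norm y" by (rule norm_cauchy_schwarz)
  finally show ?thesis by (simp add: norm_scaleC u1)
qed simp

lemma bounded_bilinear_cinner:
  "bounded_bilinear (cinner :: 'a::complex_hilbert_space \<Rightarrow> 'a \<Rightarrow> complex)"
proof
  fix a a' b b' :: 'a and r :: real
  show "cinner (a + a') b = cinner a b + cinner a' b" by (rule cinner_add_left)
  show "cinner a (b + b') = cinner a b + cinner a b'" by (rule cinner_add_right)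
  show "cinner (r *\<^sub>R a) b = r *\<^sub>R cinner a b"
    by (simp add: scaleC_of_real[symmetric] cinner_scaleC_left scaleR_conv_of_real)
  show "cinner a (r *\<^sub>R b) = r *\<^sub>R cinner a b"
    by (simp add: scaleC_of_real[symmetric] cinner_scaleC_right scaleR_conv_of_real)
  show "\<exists>K. \<forall>a b. norm (cinner a b) \<le> norm (a::'a) * norm b * K"
    by (rule exI[of _ 1]) (simp add: cmod_cinner_le)
qed

lemmas tendsto_cinner [tendsto_intros] = bounded_bilinear.tendsto[OF bounded_bilinear_cinner]
lemmas continuous_on_cinner [continuous_intros] =
  bounded_bilinear.continuous_on[OF bounded_bilinear_cinner]
lemma bounded_linear_scaleC: "bounded_linear (\<lambda>x::'a::complex_hilbert_space. c *\<^sub>C x)"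
  using blinfun.bounded_linear_right[of "scalar_op c"] by simp

lemma cinner_ext:
  assumes "\<And>x. cinner x u = cinner x v"
  shows "u = v"
  by (rule inner_eq_all_imp_eq) (simp add: inner_eq_Re_cinner assms)

section \<open>Complex-linear operators and their adjoints\<close>

lemma blinfun_cinner_ext:
  assumes "\<And>x y. cinner x (blinfun_apply S y) = cinner x (blinfun_apply T y)"
  shows "S = T"
  by (rule blinfun_eqI) (rule cinner_ext, rule assms)

lemma bounded_opsD: "T \<in> bounded_ops \<Longrightarrow> blinfun_apply T (c *\<^sub>C x) = c *\<^sub>C blinfun_apply T x"
  by (simp add: bounded_ops_def)

lemma op_adj_unique:
  assumes "\<And>x y. cinner (blinfun_apply S x) y = cinner x (blinfun_apply T y)"
  shows "op_adj T = S"
  unfolding op_adj_def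
proof (rule the_equality)
  fix R assume R: "\<forall>x y. cinner (blinfun_apply R x) y = cinner x (blinfun_apply T y)"
  show "R = S"
    by (rule blinfun_cinner_ext) (metis R assms cinner_commute)
qed (use assms in blast)

text \<open>The real adjoint is also the complex one: the imaginary part of
  \<open>cinner x y\<close> is the real inner product of \<open>\<i> *\<^sub>C x\<close> with
  \<open>y\<close>, and a complex-linear \<open>T\<close> commutes with \<open>\<i>\<close>.\<close>

lemma op_adj_left:
  assumes "T \<in> bounded_ops"
  shows "cinner (blinfun_apply (op_adj T) x) y = cinner x (blinfun_apply T y)"
proof -
  obtain S where S: "\<And>x y. inner (blinfun_apply T x) y = inner x (blinfun_apply S y)"
    using adjoint_exists by blast
  have S': "cinner (blinfun_apply T x) y = cinner x (blinfun_apply S y)" for x y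
    by (simp add: cinner_eq_inner S bounded_opsD[OF assms, symmetric])
  have "cinner (blinfun_apply S x) y = cinner x (blinfun_apply T y)" for x y
    by (metis S' cinner_commute)
  then show ?thesis using op_adj_unique by metis
qed

lemma op_adj_right:
  assumes "T \<in> bounded_ops"
  shows "cinner x (blinfun_apply (op_adj T) y) = cinner (blinfun_apply T x) y"
  by (metis op_adj_left[OF assms] cinner_commute)

lemma op_adj_bounded_ops:
  assumes "T \<in> bounded_ops"
  shows "op_adj T \<in> bounded_ops"
proof -
  have "blinfun_apply (op_adj T) (c *\<^sub>C x) = c *\<^sub>C blinfun_apply (op_adj T) x" for c x
    by (rule cinner_ext) (simp add: op_adj_right[OF assms] cinner_scaleC_right)
  then show ?thesis by (simp add: bounded_ops_def)
qed

lemma op_adj_adj [simp]: "T \<in> bounded_ops \<Longrightarrow> op_adj (op_adj T) = T"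
  by (rule op_adj_unique) (simp add: op_adj_right)

lemma id_bounded_ops [simp]: "id_blinfun \<in> bounded_ops"
  by (simp add: bounded_ops_def)

lemma zero_bounded_ops [simp]: "0 \<in> bounded_ops"
  by (simp add: bounded_ops_def)

lemma scalar_bounded_ops [simp]: "scalar_op c \<in> bounded_ops"
  by (simp add: bounded_ops_def scaleC_scaleC mult.commute)

lemma add_bounded_ops: "S \<in> bounded_ops \<Longrightarrow> T \<in> bounded_ops \<Longrightarrow> S + T \<in> bounded_ops"
  by (simp add: bounded_ops_def blinfun.add_left scaleC_add_right)

lemma comp_bounded_ops: "S \<in> bounded_ops \<Longrightarrow> T \<in> bounded_ops \<Longrightarrow> S o\<^sub>L T \<in> bounded_ops"
  by (simp add: bounded_ops_def)

lemma op_adj_comp: "S \<in> bounded_ops \<Longrightarrow> T \<in> bounded_ops \<Longrightarrow> op_adj (S o\<^sub>L T) = op_adj T o\<^sub>L op_adj S"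
  by (rule op_adj_unique) (simp add: op_adj_left)

lemma op_adj_add: "S \<in> bounded_ops \<Longrightarrow> T \<in> bounded_ops \<Longrightarrow> op_adj (S + T) = op_adj S + op_adj T"
  by (rule op_adj_unique) (simp add: op_adj_left blinfun.add_left cinner_add_left cinner_add_right)

lemma op_adj_id [simp]: "op_adj id_blinfun = id_blinfun"
  by (rule op_adj_unique) simp

lemma op_adj_scalar [simp]: "op_adj (scalar_op c) = scalar_op (cnj c)"
  by (rule op_adj_unique) (simp add: cinner_scaleC_left cinner_scaleC_right)

lemma op_adj_zero [simp]: "op_adj 0 = 0"
  by (rule op_adj_unique) simp

lemma scalar_op_comm: "T \<in> bounded_ops \<Longrightarrow> T o\<^sub>L scalar_op c = scalar_op c o\<^sub>L T"
  by (rule blinfun_eqI) (simp add: bounded_opsD)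

lemma scalar_op_of_real: "scalar_op (of_real r) o\<^sub>L T = r *\<^sub>R T"
  by (rule blinfun_eqI) (simp add: scaleC_of_real blinfun.scaleR_left)

lemma scalar_op_minus1: "scalar_op (-1) o\<^sub>L T = - T"
  by (rule blinfun_eqI) (simp add: scaleC_minus1 blinfun.minus_left)

lemma scalar_op_1 [simp]: "scalar_op 1 = id_blinfun"
  by (rule blinfun_eqI) simp

lemma blinfun_comp_id [simp]: "T o\<^sub>L id_blinfun = T" "id_blinfun o\<^sub>L T = T"
  by (rule blinfun_eqI, simp)+

lemma blinfun_compose_assoc: "(R o\<^sub>L S) o\<^sub>L T = R o\<^sub>L (S o\<^sub>L T)"
  by (rule blinfun_eqI) simp

lemma comp_add_left: "(S + T) o\<^sub>L R = (S o\<^sub>L R) + (T o\<^sub>L R)"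
  and comp_add_right: "R o\<^sub>L (S + T) = (R o\<^sub>L S) + (R o\<^sub>L T)"
  and comp_diff_left: "(S - T) o\<^sub>L R = (S o\<^sub>L R) - (T o\<^sub>L R)"
  and comp_diff_right: "R o\<^sub>L (S - T) = (R o\<^sub>L S) - (R o\<^sub>L T)"
  by (rule blinfun_eqI, simp add: blinfun.add_left blinfun.add_right blinfun.diff_left blinfun.diff_right blinfun.minus_left blinfun.minus_right)+

section \<open>Von Neumann algebras\<close>

locale vn_alg =
  fixes A :: "('h::complex_hilbert_space \<Rightarrow>\<^sub>L 'h) set"
  assumes vn: "von_neumann_algebra A"
begin

lemma in_bounded_ops: "X \<in> A \<Longrightarrow> X \<in> bounded_ops"
  using vn by (auto simp: von_neumann_algebra_def)
lemma id_in: "id_blinfun \<in> A"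
  using vn by (auto simp: von_neumann_algebra_def)
lemma add_in: "X \<in> A \<Longrightarrow> Y \<in> A \<Longrightarrow> X + Y \<in> A"
  using vn by (auto simp: von_neumann_algebra_def)
lemma comp_in: "X \<in> A \<Longrightarrow> Y \<in> A \<Longrightarrow> X o\<^sub>L Y \<in> A"
  using vn by (auto simp: von_neumann_algebra_def)
lemma scalar_comp_in: "X \<in> A \<Longrightarrow> scalar_op c o\<^sub>L X \<in> A"
  using vn by (auto simp: von_neumann_algebra_def)
lemma adj_in: "X \<in> A \<Longrightarrow> op_adj X \<in> A"
  using vn by (auto simp: von_neumann_algebra_def)
lemma closed_sot: "closedin strong_operator_topology A"
  using vn by (auto simp: von_neumann_algebra_def)
lemma scaleR_in: "X \<in> A \<Longrightarrow> r *\<^sub>R X \<in> A"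
  using scalar_comp_in[of X "of_real r"] by (simp add: scalar_op_of_real)
lemma minus_in: "X \<in> A \<Longrightarrow> - X \<in> A"
  using scalar_comp_in[of X "-1"] by (simp add: scalar_op_minus1)
lemma diff_in: "X \<in> A \<Longrightarrow> Y \<in> A \<Longrightarrow> X - Y \<in> A"
  using add_in[of X "- Y"] minus_in[of Y] by simp
lemma zero_in: "0 \<in> A"
  using diff_in[OF id_in id_in] by simp
lemma scalar_in: "scalar_op c \<in> A"
  using scalar_comp_in[OF id_in] by simp
lemma sum_in: "(\<And>i. i \<in> I \<Longrightarrow> f i \<in> A) \<Longrightarrow> (\<Sum>i\<in>I. f i) \<in> A"
  by (induction I rule: infinite_finite_induct) (auto intro: zero_in add_in)

lemmas ops_in = id_in add_in comp_in scalar_comp_in adj_in scaleR_in minus_in diff_in zero_in scalar_in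

end

text \<open>This guarantees that the intersection defining \<open>vn_generated S\<close> runs over a
  nonempty family when \<open>S\<close> consists of complex-linear operators. Complex linearity is a
  family of equations, each continuous for the strong operator topology.\<close>

lemma vn_bounded_ops: "von_neumann_algebra bounded_ops"
proof -
  have "closedin strong_operator_topology (bounded_ops :: ('a \<Rightarrow>\<^sub>L 'a) set)"
  proof -
    have "closedin strong_operator_topology {T::'a \<Rightarrow>\<^sub>L 'a. blinfun_apply T (c *\<^sub>C x) - c *\<^sub>C blinfun_apply T x = 0}" for c x
    proof -
      have "continuous_map strong_operator_topology euclidean (\<lambda>T::'a \<Rightarrow>\<^sub>L 'a. blinfun_apply T (c *\<^sub>C x) - c *\<^sub>C blinfun_apply T x)"
        by (intro continuous_map_diff strong_operator_topology_continuous_evaluation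
            continuous_map_compose[OF strong_operator_topology_continuous_evaluation, unfolded o_def, where g = "\<lambda>x. c *\<^sub>C x"])
           (simp add: linear_continuous_on[OF bounded_linear_scaleC])
      from closedin_continuous_map_preimage[OF this, of "{0}"] show ?thesis
        by (simp add: strong_operator_topology_topspace)
    qed
    then have "closedin strong_operator_topology (\<Inter>(c,x). {T::'a \<Rightarrow>\<^sub>L 'a. blinfun_apply T (c *\<^sub>C x) - c *\<^sub>C blinfun_apply T x = 0})"
      by (intro closedin_Inter) auto
    also have "(\<Inter>(c,x). {T::'a \<Rightarrow>\<^sub>L 'a. blinfun_apply T (c *\<^sub>C x) - c *\<^sub>C blinfun_apply T x = 0}) = bounded_ops"
      by (auto simp: bounded_ops_def)
    finally show ?thesis .
  qed
  then show ?thesis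
    by (auto simp: von_neumann_algebra_def add_bounded_ops comp_bounded_ops op_adj_bounded_ops)
qed

lemma vn_Inter:
  assumes "\<N> \<noteq> {}" "\<And>N. N \<in> \<N> \<Longrightarrow> von_neumann_algebra N"
  shows "von_neumann_algebra (\<Inter>\<N>)"
proof -
  obtain N where N: "N \<in> \<N>" using assms(1) by blast
  have "\<Inter>\<N> \<subseteq> bounded_ops" using assms(2)[OF N] N by (auto simp: von_neumann_algebra_def)
  then show ?thesis
    using assms unfolding von_neumann_algebra_def by (auto intro!: closedin_Inter)
qed

lemma vn_generated_vn:
  assumes "S \<subseteq> bounded_ops"
  shows "von_neumann_algebra (vn_generated S)"
  unfolding vn_generated_def by (rule vn_Inter) (use assms vn_bounded_ops in auto)

lemma vn_generated_superset: "S \<subseteq> vn_generated S"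
  by (auto simp: vn_generated_def)

lemma vn_generated_least: "von_neumann_algebra N \<Longrightarrow> S \<subseteq> N \<Longrightarrow> vn_generated S \<subseteq> N"
  by (auto simp: vn_generated_def)

lemma vn_generated_mono: "S \<subseteq> T \<Longrightarrow> vn_generated S \<subseteq> vn_generated T"
  by (auto simp: vn_generated_def)

definition commutant :: "('h::complex_hilbert_space \<Rightarrow>\<^sub>L 'h) set \<Rightarrow> ('h \<Rightarrow>\<^sub>L 'h) set" where
  "commutant S = {T \<in> bounded_ops. \<forall>X\<in>S. T o\<^sub>L X = X o\<^sub>L T}"

lemma commutant_adj:
  assumes "S \<subseteq> bounded_ops" "op_adj ` S \<subseteq> S" "T \<in> commutant S"
  shows "op_adj T \<in> commutant S"
proof -
  have T: "T \<in> bounded_ops" using assms(3) by (simp add: commutant_def)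
  have "op_adj T o\<^sub>L X = X o\<^sub>L op_adj T" if "X \<in> S" for X
  proof -
    have "X \<in> bounded_ops" "op_adj X \<in> S" using that assms by auto
    moreover have "T o\<^sub>L op_adj X = op_adj X o\<^sub>L T" using assms(3) \<open>op_adj X \<in> S\<close> by (simp add: commutant_def)
    ultimately show ?thesis
      using T op_adj_comp[of T "op_adj X"] op_adj_comp[of "op_adj X" T] by (simp add: op_adj_bounded_ops)
  qed
  then show ?thesis using T by (simp add: commutant_def op_adj_bounded_ops)
qed

lemma vn_commutant:
  fixes S :: "('h::complex_hilbert_space \<Rightarrow>\<^sub>L 'h) set"
  assumes "S \<subseteq> bounded_ops" "op_adj ` S \<subseteq> S"
  shows "von_neumann_algebra (commutant S)"
proof -
  interpret B: vn_alg "bounded_ops :: ('h \<Rightarrow>\<^sub>L 'h) set" by unfold_locales (rule vn_bounded_ops)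
  have cl: "closedin strong_operator_topology {T::'h \<Rightarrow>\<^sub>L 'h. blinfun_apply T (blinfun_apply X x) - blinfun_apply X (blinfun_apply T x) = 0}" for X x
  proof -
    have "continuous_map strong_operator_topology euclidean (\<lambda>T::'h \<Rightarrow>\<^sub>L 'h. blinfun_apply T (blinfun_apply X x) - blinfun_apply X (blinfun_apply T x))"
      by (intro continuous_map_diff strong_operator_topology_continuous_evaluation
          continuous_map_compose[OF strong_operator_topology_continuous_evaluation, unfolded o_def, where g = "blinfun_apply X"])
         (simp add: linear_continuous_on[OF blinfun.bounded_linear_right])
    from closedin_continuous_map_preimage[OF this, of "{0}"] show ?thesis
      by (simp add: strong_operator_topology_topspace)
  qed
  have "closedin strong_operator_topology
    (\<Inter>(insert bounded_ops ((\<lambda>(X,x). {T::'h \<Rightarrow>\<^sub>L 'h. blinfun_apply T (blinfun_apply X x) - blinfun_apply X (blinfun_apply T x) = 0}) ` (S \<times> UNIV))))"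
    by (intro closedin_Inter) (use cl B.closed_sot in auto)
  also have "(\<Inter>(insert bounded_ops ((\<lambda>(X,x). {T::'h \<Rightarrow>\<^sub>L 'h. blinfun_apply T (blinfun_apply X x) - blinfun_apply X (blinfun_apply T x) = 0}) ` (S \<times> UNIV)))) = commutant S"
    by (auto simp: commutant_def intro!: blinfun_eqI) (metis blinfun_apply_blinfun_compose)
  finally have closed: "closedin strong_operator_topology (commutant S)" .
  have comp: "(T o\<^sub>L T') o\<^sub>L X = X o\<^sub>L (T o\<^sub>L T')" if "T o\<^sub>L X = X o\<^sub>L T" "T' o\<^sub>L X = X o\<^sub>L T'" for T T' X :: "'h \<Rightarrow>\<^sub>L 'h"
    using that by (metis blinfun_compose_assoc)
  have scal: "(scalar_op c o\<^sub>L T) o\<^sub>L X = X o\<^sub>L (scalar_op c o\<^sub>L T)" if "T o\<^sub>L X = X o\<^sub>L T" "X \<in> S" for T X c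
    by (rule comp[OF _ that(1)]) (use that assms(1) scalar_op_comm[of X c] in auto)
  show ?thesis
    unfolding von_neumann_algebra_def
    using closed commutant_adj[OF assms] comp scal
    by (auto simp: commutant_def comp_add_left comp_add_right add_bounded_ops comp_bounded_ops)
qed

text \<open>The elementary half of the double commutant theorem: the bicommutant is itself a von
  Neumann algebra containing \<open>S\<close>.\<close>

lemma vn_generated_subset_bicommutant:
  assumes "S \<subseteq> bounded_ops" "op_adj ` S \<subseteq> S"
  shows "vn_generated S \<subseteq> commutant (commutant S)"
proof (rule vn_generated_least)
  show "von_neumann_algebra (commutant (commutant S))"
    by (rule vn_commutant) (use commutant_adj[OF assms] in \<open>auto simp: commutant_def\<close>)
  show "S \<subseteq> commutant (commutant S)"
    using assms(1) by (auto simp: commutant_def)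
qed


section \<open>Positivity and monotone limits\<close>

lemma op_le_iff: "op_le S T \<longleftrightarrow> (\<forall>x. inner x (blinfun_apply S x) \<le> inner x (blinfun_apply T x))"
  by (simp add: op_le_def inner_eq_Re_cinner)

lemma op_le_refl [simp]: "op_le S S"
  by (simp add: op_le_def)

lemma op_le_trans: "op_le S T \<Longrightarrow> op_le T R \<Longrightarrow> op_le S R"
  unfolding op_le_def by (meson order_trans)

lemma op_adj_eq_iff:
  assumes "T \<in> bounded_ops"
  shows "op_adj T = T \<longleftrightarrow> (\<forall>x y. cinner (blinfun_apply T x) y = cinner x (blinfun_apply T y))"
  using op_adj_left[OF assms] op_adj_unique by metis

lemma sa_inner:
  assumes "T \<in> bounded_ops" "op_adj T = T"
  shows "inner (blinfun_apply T x) y = inner x (blinfun_apply T y)"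
  using op_adj_left[OF assms(1), of x y] assms(2) by (simp add: inner_eq_Re_cinner)

text \<open>This is \<open>T T \<le> T\<close> for \<open>0 \<le> T \<le> 1\<close>, obtained
  without functional calculus: expand the quadratic form of \<open>T\<close> at
  \<open>x - T x\<close>, which is nonnegative, and estimate its last term by
  \<open>T \<le> 1\<close> at \<open>T x\<close>.\<close>

lemma pos_contraction_sq_le:
  assumes "T \<in> bounded_ops" "op_adj T = T" "op_le 0 T" "op_le T id_blinfun"
  shows "(norm (blinfun_apply T x))\<^sup>2 \<le> inner x (blinfun_apply T x)"
proof -
  note sa = sa_inner[OF assms(1,2)]
  define u where "u = blinfun_apply T x"
  have "0 \<le> inner u (blinfun_apply T u)" "inner u (blinfun_apply T u) \<le> inner u u"
    "0 \<le> inner (x - u) (blinfun_apply T (x - u))"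
    using assms(3,4) by (auto simp: op_le_iff)
  moreover have "inner (x - u) (blinfun_apply T (x - u)) = inner x u - 2 * inner u u + inner u (blinfun_apply T u)"
    using sa[of x u] by (simp add: blinfun.diff_right inner_diff_left inner_diff_right u_def[symmetric] inner_commute)
  ultimately show ?thesis
    unfolding u_def power2_norm_eq_inner by linarith
qed

lemma sa_contraction_norm:
  assumes "T \<in> bounded_ops" "op_adj T = T" "op_le 0 T" "op_le T id_blinfun"
  shows "norm T \<le> 1"
proof (rule norm_blinfun_bound)
  fix x
  have "(norm (blinfun_apply T x))\<^sup>2 \<le> (norm x)\<^sup>2"
    using pos_contraction_sq_le[OF assms, of x] assms(4)
    by (auto simp: op_le_iff power2_norm_eq_inner elim!: order_trans)
  then show "norm (blinfun_apply T x) \<le> 1 * norm x" using power2_le_imp_le by fastforce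
qed simp

text \<open>The difference has vanishing quadratic form, hence is trivially a positive contraction,
  and \<open>pos_contraction_sq_le\<close> annihilates it.\<close>

lemma op_le_antisym:
  assumes "S \<in> bounded_ops" "op_adj S = S" "T \<in> bounded_ops" "op_adj T = T" "op_le S T" "op_le T S"
  shows "S = T"
proof -
  have D: "S + (scalar_op (-1) o\<^sub>L T) = S - T" by (simp add: scalar_op_minus1)
  have "S - T \<in> bounded_ops" unfolding D[symmetric] using assms by (intro add_bounded_ops comp_bounded_ops) auto
  moreover have "op_adj (S - T) = S - T"
    unfolding D[symmetric] using assms
    by (simp add: op_adj_add op_adj_comp comp_bounded_ops scalar_op_comm)
  moreover have q: "inner x (blinfun_apply (S - T) x) = 0" for x
    using assms(5,6) by (auto simp: op_le_iff blinfun.diff_left inner_diff_right intro!: antisym)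
  ultimately have "(norm (blinfun_apply (S - T) x))\<^sup>2 \<le> 0" for x
    using pos_contraction_sq_le[of "S - T" x] q by (simp add: op_le_iff)
  then have "S - T = 0" by (intro blinfun_eqI) simp
  then show ?thesis by simp
qed

lemma limitin_sot:
  assumes "\<And>x. ((\<lambda>h. blinfun_apply h x) \<longlongrightarrow> blinfun_apply S x) F"
  shows "limitin strong_operator_topology (\<lambda>h. h) S F"
  unfolding limitin_def
proof (intro conjI allI impI)
  have l: "limitin euclidean (\<lambda>h. blinfun_apply h) (blinfun_apply S) F"
    unfolding euclidean_product_topology[symmetric] limitin_componentwise using assms by simp
  fix U assume "openin strong_operator_topology U \<and> S \<in> U"
  then obtain V where V: "open V" "U = blinfun_apply -` V" "S \<in> U"
    by (auto simp: strong_operator_topology_def openin_pullback_topology)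
  then show "\<forall>\<^sub>F x in F. x \<in> U" using l by (auto simp: tendsto_def)
qed (simp add: strong_operator_topology_topspace)

lemma sot_closed_imp_closed:
  assumes "closedin strong_operator_topology A"
  shows "closed A"
  using closedin_continuous_map_preimage[OF strong_operator_topology_weaker_than_euclidean assms] by simp

context vn_alg
begin

lemma sa_partD: "h \<in> sa_part A \<Longrightarrow> h \<in> A" "h \<in> sa_part A \<Longrightarrow> op_adj h = h"
  "h \<in> sa_part A \<Longrightarrow> h \<in> bounded_ops"
  by (auto simp: sa_part_def in_bounded_ops)

lemma op_adj_diff: "X \<in> A \<Longrightarrow> Y \<in> A \<Longrightarrow> op_adj (X - Y) = op_adj X - op_adj Y"
  by (rule op_adj_unique)
     (simp add: op_adj_left in_bounded_ops blinfun.diff_left cinner_diff_left cinner_diff_right)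

lemma op_adj_scaleR: "X \<in> A \<Longrightarrow> op_adj (r *\<^sub>R X) = r *\<^sub>R op_adj X"
  by (rule op_adj_unique)
     (simp add: op_adj_left in_bounded_ops blinfun.scaleR_left scaleC_of_real[symmetric] cinner_scaleC_left cinner_scaleC_right)

lemma sa_diff: "X \<in> sa_part A \<Longrightarrow> Y \<in> sa_part A \<Longrightarrow> X - Y \<in> sa_part A"
  by (simp add: sa_part_def diff_in op_adj_diff)
lemma sa_add: "X \<in> sa_part A \<Longrightarrow> Y \<in> sa_part A \<Longrightarrow> X + Y \<in> sa_part A"
  by (simp add: sa_part_def add_in op_adj_add in_bounded_ops)
lemma sa_scaleR: "X \<in> sa_part A \<Longrightarrow> r *\<^sub>R X \<in> sa_part A"
  by (simp add: sa_part_def scaleR_in op_adj_scaleR)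
lemma sa_id: "id_blinfun \<in> sa_part A"
  by (simp add: sa_part_def id_in)
lemma sa_zero: "0 \<in> sa_part A"
  by (simp add: sa_part_def zero_in)

lemma closed_norm: "closed A"
  by (rule sot_closed_imp_closed[OF closed_sot])

lemma closed_sa: "closed (sa_part A)"
proof -
  have "sa_part A = A \<inter> (\<Inter>x y. {T. cinner (blinfun_apply T x) y = cinner x (blinfun_apply T y)})"
    using op_adj_eq_iff in_bounded_ops by (auto simp: sa_part_def)
  moreover have "closed {T::'h \<Rightarrow>\<^sub>L 'h. cinner (blinfun_apply T x) y = cinner x (blinfun_apply T y)}" for x y
    by (intro closed_Collect_eq continuous_on_cinner blinfun.continuous_on continuous_on_const continuous_on_id)
  ultimately show ?thesis by (auto intro!: closed_Int closed_norm closed_INT)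
qed

text \<open>Vigier's theorem: a bounded increasing net converges strongly. The last conclusion says
  that the quadratic form of \<open>S\<close> is the supremum of the quadratic forms, which is
  stronger than being a least upper bound and is the form in which the supremum is used.\<close>

lemma directed_sup:
  assumes D: "D \<subseteq> sa_part A" "D \<noteq> {}"
    and dir: "\<And>X Y. X \<in> D \<Longrightarrow> Y \<in> D \<Longrightarrow> \<exists>Z\<in>D. op_le X Z \<and> op_le Y Z"
    and bd: "\<And>X. X \<in> D \<Longrightarrow> op_le 0 X \<and> op_le X id_blinfun"
  obtains S where "S \<in> sa_part A" "\<And>X. X \<in> D \<Longrightarrow> op_le X S"
    "\<And>x a. (\<And>X. X \<in> D \<Longrightarrow> inner x (blinfun_apply X x) \<le> a) \<Longrightarrow> inner x (blinfun_apply S x) \<le> a"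
proof -
  \<comment> \<open>The filter of tails of \<open>D\<close>; it takes the place of a net indexed by
    \<open>D\<close>.\<close>
  define F where "F = (INF h\<in>D. principal {k\<in>D. op_le h k})"
  have evF: "eventually P F \<longleftrightarrow> (\<exists>h\<in>D. \<forall>k\<in>D. op_le h k \<longrightarrow> P k)" for P
    unfolding F_def
  proof (subst eventually_INF_base)
    fix a b assume "a \<in> D" "b \<in> D"
    then obtain z where "z \<in> D" "op_le a z" "op_le b z" using dir by blast
    then show "\<exists>x\<in>D. principal {k \<in> D. op_le x k} \<le> inf (principal {k \<in> D. op_le a k}) (principal {k \<in> D. op_le b k})"
      by (intro bexI[of _ z]) (auto intro: op_le_trans)
  qed (use D(2) in \<open>auto simp: eventually_principal\<close>)
  have Fne: "F \<noteq> bot"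
    using D(2) by (auto simp: trivial_limit_def evF intro: op_le_refl)
  have evD: "eventually (\<lambda>k. k \<in> D) F" using D(2) by (auto simp: evF)
  \<comment> \<open>\<open>k - h\<close> is again a positive contraction, so its square is below
    itself. Convergence of the increasing numbers \<open>inner x (h x)\<close> therefore controls
    \<open>h x\<close> in norm.\<close>
  have cle: "(norm (blinfun_apply (k - h) x))\<^sup>2 \<le> inner x (blinfun_apply k x) - inner x (blinfun_apply h x)"
    if "h \<in> D" "k \<in> D" "op_le h k" for h k x
  proof -
    have "k - h \<in> sa_part A" using D that sa_diff by blast
    moreover have "op_le 0 (k - h)" using that by (simp add: op_le_iff blinfun.diff_left inner_diff_right)
    moreover have "op_le (k - h) id_blinfun"
    proof -
      have "inner x (blinfun_apply k x) \<le> inner x x" "0 \<le> inner x (blinfun_apply h x)" for x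
        using bd[OF that(1)] bd[OF that(2)] by (auto simp: op_le_iff)
      then show ?thesis by (auto simp: op_le_iff blinfun.diff_left inner_diff_right) (smt (verit))
    qed
    ultimately show ?thesis
      using pos_contraction_sq_le[of "k - h" x] sa_partD by (auto simp: blinfun.diff_left inner_diff_right)
  qed
  have "\<exists>y. ((\<lambda>h. blinfun_apply h x) \<longlongrightarrow> y) F" for x
  proof -
    define s where "s = (SUP h\<in>D. inner x (blinfun_apply h x))"
    have bdd: "bdd_above ((\<lambda>h. inner x (blinfun_apply h x)) ` D)"
      using bd by (intro bdd_aboveI[of _ "inner x x"]) (auto simp: op_le_iff)
    have "cauchy_filter (filtermap (\<lambda>h. blinfun_apply h x) F)"
      unfolding cauchy_filter_metric_filtermap
    proof (intro allI impI)
      fix e :: real assume e: "e > 0"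
      then have "s - (e/2)\<^sup>2 < s" by simp
      then obtain h where h: "h \<in> D" "s - (e/2)\<^sup>2 < inner x (blinfun_apply h x)"
        unfolding s_def using less_cSUP_iff[OF D(2) bdd] by blast
      have near: "norm (blinfun_apply k x - blinfun_apply h x) < e/2" if "k \<in> D" "op_le h k" for k
      proof -
        have "inner x (blinfun_apply k x) \<le> s" unfolding s_def by (rule cSUP_upper[OF that(1) bdd])
        then have "(norm (blinfun_apply (k - h) x))\<^sup>2 < (e/2)\<^sup>2" using cle[OF h(1) that, of x] h(2) by linarith
        then show ?thesis using e power_less_imp_less_base by (fastforce simp: blinfun.diff_left)
      qed
      show "\<exists>P. eventually P F \<and> (\<forall>k k'. P k \<and> P k' \<longrightarrow> dist (blinfun_apply k x) (blinfun_apply k' x) < e)"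
      proof (intro exI conjI allI impI)
        show "eventually (\<lambda>k. k \<in> D \<and> op_le h k) F" using h(1) by (auto simp: evF)
        fix k k' assume "(k \<in> D \<and> op_le h k) \<and> (k' \<in> D \<and> op_le h k')"
        then have "dist (blinfun_apply k x) (blinfun_apply h x) < e/2" "dist (blinfun_apply k' x) (blinfun_apply h x) < e/2"
          using near by (auto simp: dist_norm)
        then show "dist (blinfun_apply k x) (blinfun_apply k' x) < e" by (rule dist_triangle_half_l)
      qed
    qed
    then have "\<exists>c. filtermap (\<lambda>h. blinfun_apply h x) F \<le> nhds c"
      by (rule cauchy_filter_complete_converges[OF _ complete_UNIV]) (auto simp: filtermap_bot_iff Fne)
    then show ?thesis by (simp add: filterlim_def)
  qed
  then obtain L where L: "\<And>x. ((\<lambda>h. blinfun_apply h x) \<longlongrightarrow> L x) F" by metis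
  have "bounded_linear L"
  proof (rule bounded_linear_intro[where K = 1])
    show "L (x + y) = L x + L y" for x y
    proof (rule tendsto_unique[OF Fne L])
      show "((\<lambda>h. blinfun_apply h (x + y)) \<longlongrightarrow> L x + L y) F"
        using tendsto_add[OF L[of x] L[of y]] by (simp add: blinfun.add_right)
    qed
    show "L (r *\<^sub>R x) = r *\<^sub>R L x" for x r
    proof (rule tendsto_unique[OF Fne L])
      show "((\<lambda>h. blinfun_apply h (r *\<^sub>R x)) \<longlongrightarrow> r *\<^sub>R L x) F"
        using tendsto_scaleR[OF tendsto_const L[of x]] by (simp add: blinfun.scaleR_right)
    qed
    show "norm (L x) \<le> norm x * 1" for x
    proof (rule tendsto_upperbound[OF tendsto_norm[OF L] _ Fne])
      show "\<forall>\<^sub>F h in F. norm (blinfun_apply h x) \<le> norm x * 1"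
      proof (rule eventually_mono[OF evD])
        fix h assume "h \<in> D"
        then have "h \<in> sa_part A" "op_le 0 h" "op_le h id_blinfun" using D(1) bd by auto
        then have "norm h \<le> 1" by (intro sa_contraction_norm sa_partD)
        then show "norm (blinfun_apply h x) \<le> norm x * 1"
          using norm_blinfun[of h x] mult_right_mono[of "norm h" 1 "norm x"] by simp
      qed
    qed
  qed
  define S where "S = Blinfun L"
  have S: "((\<lambda>h. blinfun_apply h x) \<longlongrightarrow> blinfun_apply S x) F" for x
    using L \<open>bounded_linear L\<close> by (simp add: S_def bounded_linear_Blinfun_apply)
  have qf: "((\<lambda>h. inner x (blinfun_apply h x)) \<longlongrightarrow> inner x (blinfun_apply S x)) F" for x
    by (intro tendsto_intros S)
  have "S \<in> A"
  proof (rule limitin_closedin[OF limitin_sot[OF S] closed_sot _ Fne])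
    show "\<forall>\<^sub>F x in F. x \<in> A" using evD by eventually_elim (use D sa_partD in blast)
  qed
  moreover have "cinner (blinfun_apply S x) y = cinner x (blinfun_apply S y)" for x y
  proof (rule tendsto_unique[OF Fne])
    show "((\<lambda>h. cinner (blinfun_apply h x) y) \<longlongrightarrow> cinner (blinfun_apply S x) y) F" by (intro tendsto_intros S)
    have "((\<lambda>h. cinner x (blinfun_apply h y)) \<longlongrightarrow> cinner x (blinfun_apply S y)) F" by (intro tendsto_intros S)
    moreover have "\<forall>\<^sub>F h in F. cinner x (blinfun_apply h y) = cinner (blinfun_apply h x) y"
      using evD
    proof eventually_elim
      fix h assume "h \<in> D"
      then have "h \<in> bounded_ops" "op_adj h = h" using D sa_partD by blast+
      then show "cinner x (blinfun_apply h y) = cinner (blinfun_apply h x) y" using op_adj_left[of h x y] by simp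
    qed
    ultimately show "((\<lambda>h. cinner (blinfun_apply h x) y) \<longlongrightarrow> cinner x (blinfun_apply S y)) F"
      by (rule Lim_transform_eventually)
  qed
  ultimately have SA: "S \<in> sa_part A" using op_adj_unique by (auto simp: sa_part_def)
  show ?thesis
  proof
    show "S \<in> sa_part A" by fact
    show "op_le X S" if "X \<in> D" for X
      unfolding op_le_iff
    proof
      fix x
      show "inner x (blinfun_apply X x) \<le> inner x (blinfun_apply S x)"
        by (rule tendsto_lowerbound[OF qf _ Fne]) (use that in \<open>auto simp: evF op_le_iff\<close>)
    qed
    show "inner x (blinfun_apply S x) \<le> a" if "\<And>X. X \<in> D \<Longrightarrow> inner x (blinfun_apply X x) \<le> a" for x a
      by (rule tendsto_upperbound[OF qf _ Fne]) (use that in \<open>auto intro!: eventually_mono[OF evD]\<close>)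
  qed
qed

text \<open>With \<open>Z = 1 - Y\<close> the equation \<open>Z Z = 1 - X\<close> becomes the fixed
  point equation \<open>Y = (X + Y Y) / 2\<close>. On the ball of radius \<open>r < 1\<close> the
  right-hand side is a contraction with constant \<open>r\<close>, and
  \<open>2 * r - r\<^sup>2\<close> is exactly the bound on \<open>X\<close> that keeps this ball
  invariant.\<close>

lemma square_root:
  assumes X: "X \<in> sa_part A" and r: "0 \<le> r" "r < 1" and nX: "norm X \<le> 2 * r - r\<^sup>2"
  obtains Z where "Z \<in> sa_part A" "Z o\<^sub>L Z = id_blinfun - X"
proof -
  define s where "s = sa_part A \<inter> cball 0 r"
  define f where "f = (\<lambda>Y. (1/2) *\<^sub>R (X + (Y o\<^sub>L Y)))"
  have "\<exists>!Y\<in>s. f Y = Y"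
  proof (rule Banach_fix[where c = r])
    show "complete s" unfolding s_def by (simp add: complete_eq_closed closed_Int closed_sa)
    show "s \<noteq> {}" using sa_zero r by (auto simp: s_def)
    show "f ` s \<subseteq> s"
    proof
      fix Z assume "Z \<in> f ` s"
      then obtain Y where Y: "Z = f Y" "Y \<in> sa_part A" "norm Y \<le> r" by (auto simp: s_def)
      have "norm (X + (Y o\<^sub>L Y)) \<le> norm X + norm ((Y o\<^sub>L Y))" by (rule norm_triangle_ineq)
      also have "\<dots> \<le> (2 * r - r\<^sup>2) + r * r"
        using nX Y(3) r by (intro add_mono order_trans[OF norm_blinfun_compose] mult_mono) auto
      finally have "norm (f Y) \<le> r" by (simp add: f_def power2_eq_square)
      moreover have "(Y o\<^sub>L Y) \<in> sa_part A" using Y(2) by (simp add: sa_part_def comp_in op_adj_comp in_bounded_ops)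
      ultimately show "Z \<in> s" using Y(1) X by (auto simp: s_def f_def intro!: sa_scaleR sa_add)
    qed
    show "dist (f Y) (f Z) \<le> r * dist Y Z" if "Y \<in> s" "Z \<in> s" for Y Z
    proof -
      have n: "norm Y \<le> r" "norm Z \<le> r" using that by (auto simp: s_def)
      have "f Y - f Z = (1/2) *\<^sub>R ((Y o\<^sub>L (Y - Z)) + ((Y - Z) o\<^sub>L Z))"
        by (simp add: f_def comp_diff_left comp_diff_right algebra_simps)
      then have "norm (f Y - f Z) \<le> 1/2 * (norm (Y o\<^sub>L (Y - Z)) + norm ((Y - Z) o\<^sub>L Z))"
        by (simp add: norm_triangle_ineq)
      also have "\<dots> \<le> 1/2 * (r * norm (Y - Z) + norm (Y - Z) * r)"
        using n r by (intro mult_left_mono add_mono order_trans[OF norm_blinfun_compose] mult_mono) auto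
      finally show ?thesis by (simp add: dist_norm mult.commute)
    qed
  qed (use r in auto)
  then obtain Y where Y: "Y \<in> sa_part A" "f Y = Y" by (auto simp: s_def)
  have "X = Y + Y - (Y o\<^sub>L Y)"
  proof -
    have "2 *\<^sub>R f Y = 2 *\<^sub>R Y" using Y(2) by simp
    then have "X + (Y o\<^sub>L Y) = Y + Y" by (simp add: f_def scaleR_2)
    then show ?thesis by (simp add: algebra_simps)
  qed
  then have "(id_blinfun - Y) o\<^sub>L (id_blinfun - Y) = id_blinfun - X"
    by (simp add: comp_diff_left comp_diff_right algebra_simps)
  moreover have "id_blinfun - Y \<in> sa_part A" by (intro sa_diff sa_id Y(1))
  ultimately show ?thesis using that by blast
qed

end


section \<open>The trace\<close>

locale nc_prob = vn_alg A for A :: "('h::complex_hilbert_space \<Rightarrow>\<^sub>L 'h) set" +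
  fixes \<tau> :: "('h \<Rightarrow>\<^sub>L 'h) \<Rightarrow> complex"
  assumes nc: "nc_prob_space A \<tau>"
begin

lemma tr_add: "X \<in> A \<Longrightarrow> Y \<in> A \<Longrightarrow> \<tau> (X + Y) = \<tau> X + \<tau> Y"
  using nc by (auto simp: nc_prob_space_def)
lemma tr_scalar: "X \<in> A \<Longrightarrow> \<tau> (scalar_op c o\<^sub>L X) = c * \<tau> X"
  using nc by (auto simp: nc_prob_space_def)
lemma tr_adj_comp_nonneg: "X \<in> A \<Longrightarrow> \<tau> (op_adj X o\<^sub>L X) \<in> \<real>\<^sub>\<ge>\<^sub>0"
  using nc by (auto simp: nc_prob_space_def)
lemma tr_id: "\<tau> id_blinfun = 1"
  using nc by (auto simp: nc_prob_space_def)
lemma tr_comm: "X \<in> A \<Longrightarrow> Y \<in> A \<Longrightarrow> \<tau> (X o\<^sub>L Y) = \<tau> (Y o\<^sub>L X)"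
  using nc by (auto simp: nc_prob_space_def)

lemma tr_scaleR: "X \<in> A \<Longrightarrow> \<tau> (r *\<^sub>R X) = of_real r * \<tau> X"
  using tr_scalar[of X "of_real r"] by (simp add: scalar_op_of_real)
lemma tr_minus: "X \<in> A \<Longrightarrow> \<tau> (- X) = - \<tau> X"
  using tr_scaleR[of X "-1"] by simp
lemma tr_diff: "X \<in> A \<Longrightarrow> Y \<in> A \<Longrightarrow> \<tau> (X - Y) = \<tau> X - \<tau> Y"
  using tr_add[of X "- Y"] by (simp add: minus_in tr_minus)
lemma tr_zero: "\<tau> 0 = 0"
  using tr_diff[OF id_in id_in] by simp
lemma tr_scalar_op: "\<tau> (scalar_op c) = c"
  using tr_scalar[OF id_in, of c] by (simp add: tr_id)
lemma Re_tr_adj_comp: "X \<in> A \<Longrightarrow> 0 \<le> Re (\<tau> (op_adj X o\<^sub>L X))"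
  using tr_adj_comp_nonneg[of X] by (auto simp: nonneg_Reals_def)

text \<open>The trace is assumed positive only on products of an element with its adjoint.
  \<open>X\<close> itself is out of reach of \<open>square_root\<close>, but
  \<open>1 - r (1 - X)\<close> with \<open>r < 1\<close> is a square, and
  \<open>r = 1 / (1 + e)\<close> yields nonnegativity up to \<open>e\<close>.\<close>

lemma tr_contraction_nonneg:
  assumes X: "X \<in> sa_part A" "op_le 0 X" "op_le X id_blinfun"
  shows "0 \<le> Re (\<tau> X)"
proof (rule field_le_epsilon)
  fix e :: real assume e: "e > 0"
  define r where "r = 1 / (1 + e)"
  have r: "0 < r" "r < 1" "r * (1 + e) = 1" using e by (auto simp: r_def field_simps)
  then have "r * r \<le> r * 1" by (intro mult_left_mono) auto
  then have r2: "r \<le> 2 * r - r\<^sup>2" by (simp add: power2_eq_square)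
  have Y: "id_blinfun - X \<in> sa_part A" by (intro sa_diff sa_id X)
  have le: "op_le 0 (id_blinfun - X)" "op_le (id_blinfun - X) id_blinfun"
    using X by (auto simp: op_le_iff blinfun.diff_left inner_diff_right)
  have "norm (r *\<^sub>R (id_blinfun - X)) \<le> r * 1"
    using sa_contraction_norm[OF sa_partD(3)[OF Y] sa_partD(2)[OF Y] le] r by (simp add: mult_left_le)
  then have "norm (r *\<^sub>R (id_blinfun - X)) \<le> 2 * r - r\<^sup>2" using r2 by linarith
  from square_root[OF sa_scaleR[OF Y] less_imp_le[OF r(1)] r(2) this]
  obtain Z where Z: "Z \<in> sa_part A" "Z o\<^sub>L Z = id_blinfun - r *\<^sub>R (id_blinfun - X)" by blast
  have "0 \<le> Re (\<tau> (Z o\<^sub>L Z))" using Re_tr_adj_comp[of Z] Z(1) by (simp add: sa_partD)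
  also have "Re (\<tau> (Z o\<^sub>L Z)) = 1 - r * (1 - Re (\<tau> X))"
    using sa_partD[OF X(1)] by (simp add: Z(2) tr_diff tr_scaleR tr_id ops_in)
  finally have "0 \<le> r * (1 + e) - r * (1 - Re (\<tau> X))" using r by simp
  then have "0 \<le> r * (Re (\<tau> X) + e)" by (simp add: algebra_simps)
  then show "0 \<le> Re (\<tau> X) + e" using r(1) by (simp add: zero_le_mult_iff)
qed

lemma norm_op_bound: "op_le X ((norm X) *\<^sub>R id_blinfun)"
proof -
  have "inner x (blinfun_apply X x) \<le> norm X * inner x x" for x
  proof -
    have "inner x (blinfun_apply X x) \<le> norm x * norm (blinfun_apply X x)" by (rule norm_cauchy_schwarz)
    also have "\<dots> \<le> norm x * (norm X * norm x)" by (intro mult_left_mono norm_blinfun) simp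
    finally show ?thesis by (simp add: power2_norm_eq_inner[symmetric] power2_eq_square mult_ac)
  qed
  then show ?thesis by (simp add: op_le_iff blinfun.scaleR_left)
qed

lemma tr_pos:
  assumes X: "X \<in> sa_part A" "op_le 0 X"
  shows "0 \<le> Re (\<tau> X)"
proof (cases "X = 0")
  case False
  then have n: "norm X > 0" by simp
  have "0 \<le> Re (\<tau> ((1 / norm X) *\<^sub>R X))"
  proof (rule tr_contraction_nonneg)
    show "(1 / norm X) *\<^sub>R X \<in> sa_part A" by (intro sa_scaleR X)
    show "op_le 0 ((1 / norm X) *\<^sub>R X)" using X(2) by (simp add: op_le_iff blinfun.scaleR_left)
    show "op_le ((1 / norm X) *\<^sub>R X) id_blinfun"
      using norm_op_bound[of X] n by (simp add: op_le_iff blinfun.scaleR_left field_simps)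
  qed
  then show ?thesis using n sa_partD[OF X(1)] by (simp add: tr_scaleR zero_le_divide_iff)
qed (simp add: tr_zero)

lemma tr_mono:
  assumes "X \<in> sa_part A" "Y \<in> sa_part A" "op_le X Y"
  shows "Re (\<tau> X) \<le> Re (\<tau> Y)"
  using tr_pos[OF sa_diff[OF assms(2,1)]] assms sa_partD
  by (simp add: tr_diff op_le_iff blinfun.diff_left inner_diff_right)

lemma adj_conj_sa: "X \<in> sa_part A \<Longrightarrow> Y \<in> A \<Longrightarrow> op_adj Y o\<^sub>L (X o\<^sub>L Y) \<in> sa_part A"
  by (auto simp: sa_part_def ops_in op_adj_comp in_bounded_ops blinfun_compose_assoc)

lemma adj_conj_pos: "op_le 0 X \<Longrightarrow> Y \<in> A \<Longrightarrow> op_le 0 (op_adj Y o\<^sub>L (X o\<^sub>L Y))"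
  using op_adj_right[OF in_bounded_ops[of Y]] by (simp add: op_le_def)

end

section \<open>The standard representation\<close>

locale nc_L2 = nc_prob A \<tau> for A :: "('h::complex_hilbert_space \<Rightarrow>\<^sub>L 'h) set" and \<tau> +
  fixes \<iota> :: "('h \<Rightarrow>\<^sub>L 'h) \<Rightarrow> 'k::complex_hilbert_space"
  assumes L2: "L2_completion A \<tau> \<iota>"
begin

lemma io_add: "X \<in> A \<Longrightarrow> Y \<in> A \<Longrightarrow> \<iota> (X + Y) = \<iota> X + \<iota> Y"
  using L2 by (auto simp: L2_completion_def)
lemma io_scalar: "X \<in> A \<Longrightarrow> \<iota> (scalar_op c o\<^sub>L X) = c *\<^sub>C \<iota> X"
  using L2 by (auto simp: L2_completion_def)
lemma io_inner: "X \<in> A \<Longrightarrow> Y \<in> A \<Longrightarrow> cinner (\<iota> X) (\<iota> Y) = \<tau> (op_adj X o\<^sub>L Y)"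
  using L2 by (auto simp: L2_completion_def)
lemma io_dense: "closure (\<iota> ` A) = UNIV"
  using L2 by (auto simp: L2_completion_def)
lemma io_scaleR: "X \<in> A \<Longrightarrow> \<iota> (r *\<^sub>R X) = r *\<^sub>R \<iota> X"
  using io_scalar[of X "of_real r"] by (simp add: scalar_op_of_real scaleC_of_real)
lemma io_minus: "X \<in> A \<Longrightarrow> \<iota> (- X) = - \<iota> X"
  using io_scaleR[of X "-1"] by simp
lemma io_diff: "X \<in> A \<Longrightarrow> Y \<in> A \<Longrightarrow> \<iota> (X - Y) = \<iota> X - \<iota> Y"
  using io_add[of X "- Y"] by (simp add: minus_in io_minus)
lemma io_zero: "\<iota> 0 = 0"
  using io_diff[OF id_in id_in] by simp
lemma io_sum: "(\<And>i. i \<in> I \<Longrightarrow> f i \<in> A) \<Longrightarrow> \<iota> (\<Sum>i\<in>I. f i) = (\<Sum>i\<in>I. \<iota> (f i))"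
  by (induction I rule: infinite_finite_induct) (auto simp: io_zero io_add sum_in)
lemma io_norm: "X \<in> A \<Longrightarrow> (norm (\<iota> X))\<^sup>2 = Re (\<tau> (op_adj X o\<^sub>L X))"
  by (simp add: power2_norm_eq_inner inner_eq_Re_cinner io_inner)

lemma io_adj_norm: "X \<in> A \<Longrightarrow> norm (\<iota> (op_adj X)) = norm (\<iota> X)"
proof -
  assume X: "X \<in> A"
  have "(norm (\<iota> (op_adj X)))\<^sup>2 = (norm (\<iota> X))\<^sup>2"
    using X by (simp add: io_norm adj_in in_bounded_ops tr_comm[of X "op_adj X"])
  then show ?thesis by (simp add: power2_eq_iff_nonneg)
qed

lemma io_inner_comp_left:
  assumes "X \<in> A" "Y \<in> A" "Z \<in> A"
  shows "cinner (\<iota> (X o\<^sub>L Y)) (\<iota> Z) = cinner (\<iota> Y) (\<iota> (op_adj X o\<^sub>L Z))"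
  using assms by (simp add: io_inner ops_in op_adj_comp in_bounded_ops blinfun_compose_assoc)

text \<open>The operator \<open>norm X\<close> squared times the identity minus
  \<open>op_adj X o\<^sub>L X\<close> is positive, stays positive after conjugation by
  \<open>Y\<close>, and so has nonnegative trace.\<close>

lemma io_comp_le:
  assumes X: "X \<in> A" and Y: "Y \<in> A"
  shows "norm (\<iota> (X o\<^sub>L Y)) \<le> norm X * norm (\<iota> Y)"
proof -
  define Z where "Z = (norm X)\<^sup>2 *\<^sub>R id_blinfun - (op_adj X o\<^sub>L X)"
  have Z: "Z \<in> sa_part A"
    unfolding Z_def using X
    by (intro sa_diff sa_scaleR sa_id) (auto simp: sa_part_def op_adj_comp ops_in in_bounded_ops)
  have "op_le 0 Z"
  proof -
    have "inner x (blinfun_apply (op_adj X o\<^sub>L X) x) \<le> (norm X)\<^sup>2 * inner x x" for x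
    proof -
      have "inner x (blinfun_apply (op_adj X o\<^sub>L X) x) = (norm (blinfun_apply X x))\<^sup>2"
        using op_adj_right[OF in_bounded_ops[OF X]] by (simp add: inner_eq_Re_cinner power2_norm_eq_inner)
      also have "\<dots> \<le> (norm X * norm x)\<^sup>2" by (intro power_mono norm_blinfun) simp
      finally show ?thesis by (simp add: power_mult_distrib power2_norm_eq_inner)
    qed
    then show ?thesis
      unfolding op_le_iff Z_def by (simp add: blinfun.diff_left blinfun.scaleR_left inner_diff_right)
  qed
  then have "0 \<le> Re (\<tau> (op_adj Y o\<^sub>L (Z o\<^sub>L Y)))"
    by (intro tr_pos adj_conj_sa adj_conj_pos Z Y)
  also have "op_adj Y o\<^sub>L (Z o\<^sub>L Y) = (norm X)\<^sup>2 *\<^sub>R (op_adj Y o\<^sub>L Y) - (op_adj (X o\<^sub>L Y) o\<^sub>L (X o\<^sub>L Y))"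
    using X Y unfolding Z_def
    by (intro blinfun_eqI) (simp add: op_adj_comp in_bounded_ops blinfun.diff_left blinfun.diff_right blinfun.scaleR_left blinfun.scaleR_right)
  finally have "(norm (\<iota> (X o\<^sub>L Y)))\<^sup>2 \<le> (norm X)\<^sup>2 * (norm (\<iota> Y))\<^sup>2"
    using X Y by (simp add: io_norm ops_in tr_diff tr_scaleR)
  then have "(norm (\<iota> (X o\<^sub>L Y)))\<^sup>2 \<le> (norm X * norm (\<iota> Y))\<^sup>2" by (simp add: power_mult_distrib)
  then show ?thesis by (rule power2_le_imp_le) simp
qed

lemma io_subspace:
  assumes "P \<subseteq> A" "0 \<in> P" "\<And>X Y. X \<in> P \<Longrightarrow> Y \<in> P \<Longrightarrow> X + Y \<in> P" "\<And>X r. X \<in> P \<Longrightarrow> r *\<^sub>R X \<in> P"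
  shows "subspace (\<iota> ` P)"
proof -
  have "\<iota> X + \<iota> Y \<in> \<iota> ` P" if "X \<in> P" "Y \<in> P" for X Y
    using that assms by (metis image_eqI io_add subsetD)
  moreover have "r *\<^sub>R \<iota> X \<in> \<iota> ` P" if "X \<in> P" for X r
    using that assms by (metis image_eqI io_scaleR subsetD)
  moreover have "0 \<in> \<iota> ` P" using assms(2) io_zero by (metis image_eqI)
  ultimately show ?thesis by (auto simp: subspace_def)
qed

end

lemma subspace_closure:
  fixes S :: "'a::real_normed_vector set"
  assumes "subspace S"
  shows "subspace (closure S)"
  unfolding subspace_def
proof (intro conjI ballI allI)
  show "0 \<in> closure S" using subspace_0[OF assms] closure_subset by blast
  fix x assume x: "x \<in> closure S"
  then obtain s where s: "\<And>n. s n \<in> S" "s \<longlonglongrightarrow> x" unfolding closure_sequential by blast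
  show "c *\<^sub>R x \<in> closure S" for c
    unfolding closure_sequential
    by (rule exI[of _ "\<lambda>n. c *\<^sub>R s n"]) (use s assms in \<open>auto intro!: tendsto_intros subspace_scale\<close>)
  fix y assume "y \<in> closure S"
  then obtain t where t: "\<And>n. t n \<in> S" "t \<longlonglongrightarrow> y" unfolding closure_sequential by blast
  show "x + y \<in> closure S"
    unfolding closure_sequential
    by (rule exI[of _ "\<lambda>n. s n + t n"]) (use s t assms in \<open>auto intro!: tendsto_intros subspace_add\<close>)
qed

text \<open>A bounded operator given on a subspace by its graph extends to the closure of the domain
  and by zero to the orthogonal complement. Working with the relation avoids a separate proof of
  well-definedness, since the norm bound applied to differences gives single-valuedness. It yields
  projections, left multiplications, intertwiners and the involution.\<close>

lemma extend_bounded_relation: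
  fixes R :: "('a::{real_inner,complete_space} \<times> 'b::{real_inner,complete_space}) set"
  assumes R: "subspace R" and le: "\<And>x y. (x, y) \<in> R \<Longrightarrow> norm y \<le> C * norm x"
  shows "\<exists>V :: 'a \<Rightarrow>\<^sub>L 'b. (\<forall>x y. (x, y) \<in> R \<longrightarrow> blinfun_apply V x = y) \<and>
    (\<forall>z. (\<forall>x y. (x, y) \<in> R \<longrightarrow> inner z x = 0) \<longrightarrow> blinfun_apply V z = 0)"
proof -
  define R' where "R' = closure R"
  have R': "subspace R'" unfolding R'_def by (rule subspace_closure[OF R])
  have le': "norm y \<le> C * norm x" if "(x, y) \<in> R'" for x y
  proof -
    have "closed {p::'a\<times>'b. norm (snd p) \<le> C * norm (fst p)}"
      by (intro closed_Collect_le continuous_intros)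
    then have "R' \<subseteq> {p. norm (snd p) \<le> C * norm (fst p)}"
      unfolding R'_def by (rule closure_minimal[rotated]) (use le in auto)
    then show ?thesis using that by auto
  qed
  have add': "(x + x', y + y') \<in> R'" if "(x,y) \<in> R'" "(x',y') \<in> R'" for x x' y y'
    using subspace_add[OF R' that] by simp
  have scale': "(r *\<^sub>R x, r *\<^sub>R y) \<in> R'" if "(x,y) \<in> R'" for x y r
    using subspace_scale[OF R' that] by simp
  have diff': "(x - x', y - y') \<in> R'" if "(x,y) \<in> R'" "(x',y') \<in> R'" for x x' y y'
    using subspace_diff[OF R' that] by simp
  have uniq: "y = y'" if "(x,y) \<in> R'" "(x,y') \<in> R'" for x y y'
    using le'[OF diff'[OF that]] by simp
  define M where "M = closure (fst ` R)"
  have M: "closed M" "subspace M"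
    unfolding M_def using linear_subspace_image[OF linear_fst R] by (auto intro: subspace_closure)
  have ex: "\<exists>y. (x,y) \<in> R'" if x: "x \<in> M" for x
  proof -
    obtain s where s: "\<And>n. s n \<in> fst ` R" "s \<longlonglongrightarrow> x"
      using x unfolding M_def closure_sequential by blast
    then have "\<forall>n. \<exists>y. (s n, y) \<in> R" by force
    then obtain t where t: "\<And>n. (s n, t n) \<in> R" by metis
    have Rsub: "R \<subseteq> R'" by (simp add: R'_def closure_subset)
    have "Cauchy t"
    proof (rule metric_CauchyI)
      fix e :: real assume e: "e > 0"
      have "Cauchy s" using s(2) by (rule LIMSEQ_imp_Cauchy)
      moreover have "e / (\<bar>C\<bar> + 1) > 0" using e by simp
      ultimately obtain N where N: "\<And>m n. m \<ge> N \<Longrightarrow> n \<ge> N \<Longrightarrow> dist (s m) (s n) < e / (\<bar>C\<bar> + 1)"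
        by (meson metric_CauchyD)
      show "\<exists>M. \<forall>m\<ge>M. \<forall>n\<ge>M. dist (t m) (t n) < e"
      proof (intro exI allI impI)
        fix m n assume mn: "N \<le> m" "N \<le> n"
        have "norm (t m - t n) \<le> C * norm (s m - s n)"
          using le'[OF diff'] t Rsub by blast
        also have "\<dots> \<le> (\<bar>C\<bar> + 1) * norm (s m - s n)" by (intro mult_right_mono) auto
        also have "\<dots> < e" using N[OF mn] by (simp add: dist_norm field_simps)
        finally show "dist (t m) (t n) < e" by (simp add: dist_norm)
      qed
    qed
    then obtain y where "t \<longlonglongrightarrow> y" using Cauchy_convergent convergent_def by blast
    with s(2) have "(\<lambda>n. (s n, t n)) \<longlonglongrightarrow> (x, y)" by (rule tendsto_Pair)
    then have "(x, y) \<in> R'" unfolding R'_def closure_sequential using t by (intro exI[of _ "\<lambda>n. (s n, t n)"]) auto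
    then show ?thesis by blast
  qed
  \<comment> \<open>The operator sought is the closed relation composed with the orthogonal
    projection onto its closed domain \<open>M\<close>.\<close>
  have "\<exists>p y. (p, y) \<in> R' \<and> (\<forall>m\<in>M. inner (u - p) m = 0) \<and> p \<in> M" for u
    using closed_subspace_projection[OF M, of u] ex by metis
  then obtain p v where pv: "\<And>u. (p u, v u) \<in> R'" "\<And>u m. m \<in> M \<Longrightarrow> inner (u - p u) m = 0" "\<And>u. p u \<in> M"
    by metis
  have p_unique: "p u = q" if "q \<in> M" "\<And>m. m \<in> M \<Longrightarrow> inner (u - q) m = 0" for u q
  proof -
    have "p u - q \<in> M" using that pv M(2) by (simp add: subspace_diff)
    then have "inner (u - p u) (p u - q) = 0" "inner (u - q) (p u - q) = 0" using that(2) pv(2) by auto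
    then have "inner (p u - q) (p u - q) = 0" by (simp add: inner_diff_left)
    then show ?thesis by simp
  qed
  have M_fst: "x \<in> M" if "(x,y) \<in> R" for x y
    unfolding M_def using that closure_subset[of "fst ` R"] by force
  have "norm (p u) \<le> norm u" for u
  proof -
    have "(norm u)\<^sup>2 = (norm (u - p u))\<^sup>2 + (norm (p u))\<^sup>2"
      using pv(2)[OF pv(3), of u] norm_add_sq[of "u - p u" "p u"] by simp
    then have "(norm (p u))\<^sup>2 \<le> (norm u)\<^sup>2" by simp
    then show ?thesis by (rule power2_le_imp_le) simp
  qed
  note p_le = this
  have "bounded_linear v"
  proof (rule bounded_linear_intro[where K = "\<bar>C\<bar>"])
    show "v (x + y) = v x + v y" for x y
    proof -
      have "p (x + y) = p x + p y"
      proof (rule p_unique)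
        show "p x + p y \<in> M" using pv M(2) by (simp add: subspace_add)
        fix m assume "m \<in> M"
        then have "inner (x - p x) m = 0" "inner (y - p y) m = 0" using pv(2) by auto
        then show "inner (x + y - (p x + p y)) m = 0" by (simp add: inner_diff_left inner_add_left)
      qed
      then show ?thesis using uniq[OF pv(1)[of "x + y"]] add'[OF pv(1) pv(1), of x y] by simp
    qed
    show "v (r *\<^sub>R x) = r *\<^sub>R v x" for r x
    proof -
      have "p (r *\<^sub>R x) = r *\<^sub>R p x"
      proof (rule p_unique)
        show "r *\<^sub>R p x \<in> M" using pv M(2) by (simp add: subspace_scale)
        fix m assume "m \<in> M"
        then have "inner (x - p x) m = 0" using pv(2) by auto
        then show "inner (r *\<^sub>R x - r *\<^sub>R p x) m = 0" by (simp add: inner_diff_left)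
      qed
      then show ?thesis using uniq[OF pv(1)[of "r *\<^sub>R x"]] scale'[OF pv(1), of r x] by simp
    qed
    show "norm (v u) \<le> norm u * \<bar>C\<bar>" for u
    proof -
      have "norm (v u) \<le> C * norm (p u)" using le' pv(1) by blast
      also have "\<dots> \<le> \<bar>C\<bar> * norm u" using p_le[of u] by (intro mult_mono) auto
      finally show ?thesis by (simp add: mult.commute)
    qed
  qed
  then have V: "blinfun_apply (Blinfun v) = v" by (rule bounded_linear_Blinfun_apply)
  show ?thesis
  proof (intro exI[of _ "Blinfun v"] conjI allI impI)
    fix x y assume xy: "(x, y) \<in> R"
    have "p x = x" by (rule p_unique) (use M_fst[OF xy] in auto)
    moreover have "(x, y) \<in> R'" using xy closure_subset R'_def by blast
    ultimately show "blinfun_apply (Blinfun v) x = y" using pv(1)[of x] uniq V by metis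
  next
    fix z assume z: "\<forall>x y. (x, y) \<in> R \<longrightarrow> inner z x = 0"
    have "M \<subseteq> {x. inner z x = 0}" unfolding M_def
      by (rule closure_minimal) (use z in \<open>auto intro!: closed_Collect_eq continuous_intros\<close>)
    then have "p z = 0" using subspace_0[OF M(2)] by (intro p_unique) auto
    moreover have "(0, 0) \<in> R'" using subspace_0[OF R'] by (simp add: zero_prod_def)
    ultimately show "blinfun_apply (Blinfun v) z = 0" using pv(1)[of z] uniq V by metis
  qed
qed


section \<open>Generated von Neumann algebras are the weak closures\<close>

context nc_L2
begin

text \<open>\<open>Y \<eta> \<mapsto> \<iota> (Y g)\<close> is a contraction for dominated \<open>g\<close>; normality of the trace supplies enough of them.\<close>

definition dominated :: "('h \<Rightarrow>\<^sub>L 'h) \<Rightarrow> 'h \<Rightarrow> bool" where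
  "dominated g \<eta> \<longleftrightarrow> g \<in> A \<and> (\<forall>Y\<in>A. norm (\<iota> (Y o\<^sub>L g)) \<le> norm (blinfun_apply Y \<eta>))"

text \<open>A chain is directed, so \<open>directed_sup\<close> provides its upper bound. The
  hypothesis \<open>sup\<close> hands over the quadratic-form description of the supremum, from
  which membership in \<open>C\<close> is checked in both applications.\<close>

lemma sup_Zorn:
  assumes C: "C \<subseteq> {h \<in> sa_part A. op_le 0 h \<and> op_le h id_blinfun}" "0 \<in> C"
    and sup: "\<And>D S. D \<subseteq> C \<Longrightarrow> D \<noteq> {} \<Longrightarrow> (\<And>X Y. X \<in> D \<Longrightarrow> Y \<in> D \<Longrightarrow> \<exists>Z\<in>D. op_le X Z \<and> op_le Y Z) \<Longrightarrow> S \<in> sa_part A \<Longrightarrow>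
        (\<And>X. X \<in> D \<Longrightarrow> op_le X S) \<Longrightarrow>
        (\<And>x a. (\<And>X. X \<in> D \<Longrightarrow> inner x (blinfun_apply X x) \<le> a) \<Longrightarrow> inner x (blinfun_apply S x) \<le> a) \<Longrightarrow> S \<in> C"
  obtains m where "m \<in> C" "\<And>a. a \<in> C \<Longrightarrow> op_le m a \<Longrightarrow> a = m"
proof -
  have "\<exists>m\<in>C. \<forall>a\<in>C. op_le m a \<longrightarrow> a = m"
  proof (rule predicate_Zorn)
    show "partial_order_on C (relation_of op_le C)"
    proof (rule partial_order_on_relation_ofI)
      show "op_le a a" for a :: "'h \<Rightarrow>\<^sub>L 'h" by simp
      show "op_le a c" if "op_le a b" "op_le b c" for a b c :: "'h \<Rightarrow>\<^sub>L 'h" using that by (rule op_le_trans)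
      show "a = b" if "a \<in> C" "b \<in> C" "op_le a b" "op_le b a" for a b
      proof -
        have "a \<in> sa_part A" "b \<in> sa_part A" using that C(1) by auto
        then show ?thesis
          using op_le_antisym[OF sa_partD(3) sa_partD(2) sa_partD(3) sa_partD(2) that(3,4)] by blast
      qed
    qed
    fix D assume D: "D \<in> Chains (relation_of op_le C)"
    then have DC: "D \<subseteq> C" by (auto simp: Chains_def relation_of_def)
    have lin: "op_le X Y \<or> op_le Y X" if "X \<in> D" "Y \<in> D" for X Y
      using D that by (auto simp: Chains_def relation_of_def)
    show "\<exists>u\<in>C. \<forall>a\<in>D. op_le a u"
    proof (cases "D = {}")
      case True
      then show ?thesis using C(2) by blast
    next
      case False
      have dir: "\<exists>Z\<in>D. op_le X Z \<and> op_le Y Z" if "X \<in> D" "Y \<in> D" for X Y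
        using lin[OF that] that by (auto intro: op_le_refl)
      have D': "D \<subseteq> sa_part A" "\<And>X. X \<in> D \<Longrightarrow> op_le 0 X \<and> op_le X id_blinfun" using DC C(1) by auto
      obtain S where S: "S \<in> sa_part A" "\<And>X. X \<in> D \<Longrightarrow> op_le X S"
        "\<And>x a. (\<And>X. X \<in> D \<Longrightarrow> inner x (blinfun_apply X x) \<le> a) \<Longrightarrow> inner x (blinfun_apply S x) \<le> a"
        using directed_sup[OF D'(1) False dir D'(2)] by metis
      have "S \<in> C" by (rule sup[OF DC False dir S])
      then show ?thesis using S(2) by blast
    qed
  qed
  then show ?thesis using that by blast
qed

text \<open>A Hahn-decomposition argument comparing the trace with a vector functional. The vector
  \<open>\<xi>\<close> is so long that its functional exceeds the trace at \<open>h\<close>.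
  Removing from \<open>h\<close> a maximal part \<open>m\<close> on which the functional is below
  the trace leaves a nonzero \<open>g\<close> such that every positive element below
  \<open>g\<close> has trace at most the value of the functional. Applied to compressions of
  \<open>g\<close> this gives domination with \<open>\<eta> = g \<xi>\<close>.\<close>

lemma dominated_below:
  assumes h: "h \<in> sa_part A" "op_le 0 h" "op_le h id_blinfun" "h \<noteq> 0"
  obtains g \<eta> where "g \<in> sa_part A" "op_le 0 g" "op_le g h" "g \<noteq> 0" "dominated g \<eta>"
proof -
  obtain v where v: "blinfun_apply h v \<noteq> 0" using h(4) by (metis blinfun_eqI blinfun.zero_left)
  have "0 < (norm (blinfun_apply h v))\<^sup>2" using v by simp
  then have hv: "0 < inner v (blinfun_apply h v)"
    using pos_contraction_sq_le[OF sa_partD(3)[OF h(1)] sa_partD(2)[OF h(1)] h(2,3), of v] by linarith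
  \<comment> \<open>Scales \<open>v\<close> so that the quadratic form of \<open>h\<close> at
    \<open>\<xi>\<close> equals \<open>\<bar>Re (\<tau> h)\<bar> + 1\<close>.\<close>
  define c where "c = sqrt ((\<bar>Re (\<tau> h)\<bar> + 1) / inner v (blinfun_apply h v))"
  define \<xi> where "\<xi> = c *\<^sub>R v"
  have "inner \<xi> (blinfun_apply h \<xi>) = c\<^sup>2 * inner v (blinfun_apply h v)"
    by (simp add: \<xi>_def blinfun.scaleR_right power2_eq_square)
  also have "\<dots> = \<bar>Re (\<tau> h)\<bar> + 1" using hv by (simp add: c_def)
  finally have \<xi>: "Re (\<tau> h) < inner \<xi> (blinfun_apply h \<xi>)" by simp
  define C where "C = {k \<in> sa_part A. op_le 0 k \<and> op_le k h \<and> inner \<xi> (blinfun_apply k \<xi>) \<le> Re (\<tau> k)}"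
  obtain m where m: "m \<in> C" "\<And>a. a \<in> C \<Longrightarrow> op_le m a \<Longrightarrow> a = m"
  proof (rule sup_Zorn[of C])
    show "C \<subseteq> {h \<in> sa_part A. op_le 0 h \<and> op_le h id_blinfun}"
      using op_le_trans[OF _ h(3)] by (auto simp: C_def)
    show "0 \<in> C" using h by (simp add: C_def sa_zero tr_zero)
    fix D S assume D: "D \<subseteq> C" "D \<noteq> {}" and S: "S \<in> sa_part A" "\<And>X. X \<in> D \<Longrightarrow> op_le X S"
      "\<And>x a. (\<And>X. X \<in> D \<Longrightarrow> inner x (blinfun_apply X x) \<le> a) \<Longrightarrow> inner x (blinfun_apply S x) \<le> a"
    obtain X0 where X0: "X0 \<in> D" using D by blast
    have "op_le 0 S" using op_le_trans[OF _ S(2)[OF X0]] D X0 by (auto simp: C_def)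
    moreover have "op_le S h" unfolding op_le_iff using S(3) D by (auto simp: C_def op_le_iff)
    moreover have "inner \<xi> (blinfun_apply S \<xi>) \<le> Re (\<tau> S)"
      using D tr_mono[OF _ S(1) S(2)] by (intro S(3)) (force simp: C_def)
    ultimately show "S \<in> C" using S(1) by (simp add: C_def)
  qed blast
  define g where "g = h - m"
  have g: "g \<in> sa_part A" using m(1) h(1) by (simp add: g_def C_def sa_diff)
  have g0: "op_le 0 g" and gh: "op_le g h"
    using m(1) by (auto simp: g_def C_def op_le_iff blinfun.diff_left inner_diff_right)
  have "g \<noteq> 0" using \<xi> m(1) by (auto simp: g_def C_def)
  \<comment> \<open>Otherwise \<open>m + k\<close> would be a strictly larger member of
    \<open>C\<close>.\<close>
  have neg: "Re (\<tau> k) \<le> inner \<xi> (blinfun_apply k \<xi>)" if k: "k \<in> sa_part A" "op_le 0 k" "op_le k g" for k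
  proof (rule ccontr)
    assume "\<not> ?thesis"
    then have lt: "inner \<xi> (blinfun_apply k \<xi>) < Re (\<tau> k)" by simp
    have "m + k \<in> C"
      unfolding C_def mem_Collect_eq
    proof (intro conjI)
      have mC: "m \<in> sa_part A" "op_le 0 m" "inner \<xi> (blinfun_apply m \<xi>) \<le> Re (\<tau> m)" using m(1) by (auto simp: C_def)
      show "m + k \<in> sa_part A" using mC(1) k(1) by (rule sa_add)
      show "op_le 0 (m + k)" using mC(2) k(2) by (auto simp: op_le_iff blinfun.add_left inner_add_right)
      show "op_le (m + k) h" using k(3) by (auto simp: g_def op_le_iff blinfun.add_left blinfun.diff_left inner_add_right inner_diff_right algebra_simps)
      show "inner \<xi> (blinfun_apply (m + k) \<xi>) \<le> Re (\<tau> (m + k))"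
        using lt mC k(1) sa_partD by (simp add: tr_add blinfun.add_left inner_add_right)
    qed
    moreover have "op_le m (m + k)" using k(2) by (simp add: op_le_iff blinfun.add_left inner_add_right)
    ultimately have "m + k = m" by (rule m(2))
    then show False using lt by (simp add: tr_zero)
  qed
  have g1: "op_le g id_blinfun" using gh h(3) by (rule op_le_trans)
  have "dominated g (blinfun_apply g \<xi>)"
    unfolding dominated_def
  proof (intro conjI ballI)
    show gA: "g \<in> A" using g by (rule sa_partD)
    fix Y assume Y: "Y \<in> A"
    show "norm (\<iota> (Y o\<^sub>L g)) \<le> norm (blinfun_apply Y (blinfun_apply g \<xi>))"
    proof (cases "Y = 0")
      case False
      define n where "n = norm Y"
      have n: "n > 0" using False by (simp add: n_def)
      \<comment> \<open>The product of \<open>Y g\<close> with its adjoint is at most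
        \<open>n\<^sup>2\<close> times \<open>g g\<close>, and \<open>g g \<le> g\<close>; after
        division by \<open>n\<^sup>2\<close> it lies below \<open>g\<close>, where
        \<open>neg\<close> applies.\<close>
      define k where "k = (1 / n\<^sup>2) *\<^sub>R (op_adj (Y o\<^sub>L g) o\<^sub>L (Y o\<^sub>L g))"
      have YgA: "Y o\<^sub>L g \<in> A" using Y gA by (rule comp_in)
      have qk: "inner x (blinfun_apply k x) = (norm (blinfun_apply Y (blinfun_apply g x)))\<^sup>2 / n\<^sup>2" for x
      proof -
        have "inner x (blinfun_apply (op_adj (Y o\<^sub>L g) o\<^sub>L (Y o\<^sub>L g)) x) = (norm (blinfun_apply Y (blinfun_apply g x)))\<^sup>2"
          using op_adj_right[OF in_bounded_ops[OF YgA]] by (simp add: inner_eq_Re_cinner power2_norm_eq_inner)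
        then show ?thesis by (simp add: k_def blinfun.scaleR_left)
      qed
      have k: "k \<in> sa_part A" unfolding k_def
        using YgA by (intro sa_scaleR) (auto simp: sa_part_def op_adj_comp[of _ "Y o\<^sub>L g"] in_bounded_ops ops_in)
      have "Re (\<tau> k) \<le> inner \<xi> (blinfun_apply k \<xi>)"
      proof (rule neg[OF k])
        show "op_le 0 k" by (simp add: op_le_iff qk)
        show "op_le k g"
          unfolding op_le_iff qk
        proof
          fix x
          have "(norm (blinfun_apply Y (blinfun_apply g x)))\<^sup>2 \<le> (n * norm (blinfun_apply g x))\<^sup>2"
            unfolding n_def by (intro power_mono norm_blinfun) simp
          also have "\<dots> \<le> n\<^sup>2 * inner x (blinfun_apply g x)"
            unfolding power_mult_distrib
            by (intro mult_left_mono pos_contraction_sq_le sa_partD[OF g] g0 g1) simp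
          finally show "(norm (blinfun_apply Y (blinfun_apply g x)))\<^sup>2 / n\<^sup>2 \<le> inner x (blinfun_apply g x)"
            using n by (simp add: divide_le_eq mult.commute)
        qed
      qed
      also have "Re (\<tau> k) = (norm (\<iota> (Y o\<^sub>L g)))\<^sup>2 / n\<^sup>2"
        using YgA by (simp add: k_def tr_scaleR io_norm ops_in)
      finally have "(norm (\<iota> (Y o\<^sub>L g)))\<^sup>2 \<le> (norm (blinfun_apply Y (blinfun_apply g \<xi>)))\<^sup>2"
        unfolding qk using n by (simp add: divide_le_cancel)
      then show ?thesis by (rule power2_le_imp_le) simp
    qed (simp add: io_zero)
  qed
  then show ?thesis using that[OF g g0 gh \<open>g \<noteq> 0\<close>] by blast
qed

text \<open>Exhaustion: among the positive contractions whose image lies in \<open>Q\<close> there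
  is a maximal one, and if it differed from the identity, a dominated element below the gap could be
  added to it. This is how statements verified on dominated elements reach the vector
  \<open>\<iota> id_blinfun\<close>.\<close>

lemma io_id_in_dominated:
  assumes Q: "closed Q" "subspace Q" "\<And>g \<eta>. dominated g \<eta> \<Longrightarrow> \<iota> g \<in> Q"
  shows "\<iota> id_blinfun \<in> Q"
proof -
  define C where "C = {k \<in> sa_part A. op_le 0 k \<and> op_le k id_blinfun \<and> \<iota> k \<in> Q}"
  obtain m where m: "m \<in> C" "\<And>a. a \<in> C \<Longrightarrow> op_le m a \<Longrightarrow> a = m"
  proof (rule sup_Zorn[of C])
    show "C \<subseteq> {h \<in> sa_part A. op_le 0 h \<and> op_le h id_blinfun}" by (auto simp: C_def)
    show "0 \<in> C" using subspace_0[OF Q(2)] by (simp add: C_def sa_zero io_zero op_le_iff)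
    fix D S assume D: "D \<subseteq> C" "D \<noteq> {}" "\<And>X Y. X \<in> D \<Longrightarrow> Y \<in> D \<Longrightarrow> \<exists>Z\<in>D. op_le X Z \<and> op_le Y Z"
      and S: "S \<in> sa_part A" "\<And>X. X \<in> D \<Longrightarrow> op_le X S"
      "\<And>x a. (\<And>X. X \<in> D \<Longrightarrow> inner x (blinfun_apply X x) \<le> a) \<Longrightarrow> inner x (blinfun_apply S x) \<le> a"
    obtain X0 where X0: "X0 \<in> D" using D by blast
    have DA: "X \<in> sa_part A" "op_le 0 X" "op_le X id_blinfun" "\<iota> X \<in> Q" if "X \<in> D" for X
      using that D by (auto simp: C_def)
    have S0: "op_le 0 S" using op_le_trans[OF _ S(2)[OF X0]] DA X0 by auto
    have S1: "op_le S id_blinfun" unfolding op_le_iff using S(3) DA by (auto simp: op_le_iff)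
    have lub: "op_le S R" if "\<forall>X\<in>D. op_le X R" for R
      unfolding op_le_iff using S(3) that by (auto simp: op_le_iff)
    have normal: "Re (\<tau> S) = (SUP X\<in>D. Re (\<tau> X))"
      using nc S(1,2) D(2,3) DA(1) lub unfolding nc_prob_space_def normal_functional_def by (smt (verit) subsetI)
    \<comment> \<open>Normality makes the trace of \<open>d = S - X\<close> small. As
      \<open>d d \<le> d\<close>, the squared L^2 norm of \<open>d\<close> is bounded by that
      trace.\<close>
    have "\<iota> S \<in> closure Q"
      unfolding closure_approachable
    proof (intro allI impI)
      fix e :: real assume e: "e > 0"
      then have "Re (\<tau> S) - e\<^sup>2 < (SUP X\<in>D. Re (\<tau> X))" using normal by simp
      moreover have "bdd_above ((\<lambda>X. Re (\<tau> X)) ` D)"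
        using tr_mono[OF DA(1) S(1) S(2)] by (intro bdd_aboveI[of _ "Re (\<tau> S)"]) auto
      ultimately obtain X where X: "X \<in> D" "Re (\<tau> S) - e\<^sup>2 < Re (\<tau> X)"
        using less_cSUP_iff[OF D(2)] by blast
      define d where "d = S - X"
      have d: "d \<in> sa_part A" using S(1) DA(1)[OF X(1)] by (simp add: d_def sa_diff)
      have d0: "op_le 0 d" using S(2)[OF X(1)] by (simp add: d_def op_le_iff blinfun.diff_left inner_diff_right)
      have d1: "op_le d id_blinfun"
        unfolding op_le_iff
      proof
        fix x
        have "inner x (blinfun_apply S x) \<le> inner x x" "0 \<le> inner x (blinfun_apply X x)"
          using S1 DA(2)[OF X(1)] by (auto simp: op_le_iff)
        then show "inner x (blinfun_apply d x) \<le> inner x (blinfun_apply id_blinfun x)"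
          by (simp add: d_def blinfun.diff_left inner_diff_right)
      qed
      have dd: "d o\<^sub>L d \<in> sa_part A" using d by (auto simp: sa_part_def ops_in op_adj_comp in_bounded_ops)
      have "op_le (d o\<^sub>L d) d"
        unfolding op_le_iff
        using pos_contraction_sq_le[OF sa_partD(3)[OF d] sa_partD(2)[OF d] d0 d1]
          sa_inner[OF sa_partD(3)[OF d] sa_partD(2)[OF d]]
        by (simp add: power2_norm_eq_inner)
      then have "(norm (\<iota> d))\<^sup>2 \<le> Re (\<tau> d)"
        using tr_mono[OF dd d] io_norm[OF sa_partD(1)[OF d]] sa_partD(2)[OF d] by simp
      also have "Re (\<tau> d) < e\<^sup>2" using X(2) S(1) DA(1)[OF X(1)] sa_partD by (simp add: d_def tr_diff)
      finally have "norm (\<iota> d) < e" using e by (simp add: power_less_imp_less_base)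
      then have "dist (\<iota> X) (\<iota> S) < e"
        using S(1) DA(1)[OF X(1)] sa_partD by (simp add: d_def dist_norm io_diff norm_minus_commute)
      then show "\<exists>y\<in>Q. dist y (\<iota> S) < e" using DA(4)[OF X(1)] by blast
    qed
    then show "S \<in> C" using Q(1) S(1) S0 S1 by (simp add: C_def)
  qed blast
  have mC: "m \<in> sa_part A" "op_le 0 m" "op_le m id_blinfun" "\<iota> m \<in> Q" using m(1) by (auto simp: C_def)
  have "id_blinfun - m = 0"
  proof (rule ccontr)
    assume ne: "id_blinfun - m \<noteq> 0"
    have "id_blinfun - m \<in> sa_part A" using mC(1) by (intro sa_diff sa_id)
    moreover have "op_le 0 (id_blinfun - m)" "op_le (id_blinfun - m) id_blinfun"
      using mC(2,3) by (auto simp: op_le_iff blinfun.diff_left inner_diff_right)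
    ultimately obtain g \<eta> where g: "g \<in> sa_part A" "op_le 0 g" "op_le g (id_blinfun - m)" "g \<noteq> 0" "dominated g \<eta>"
      using dominated_below ne by metis
    have "m + g \<in> C"
      unfolding C_def mem_Collect_eq
    proof (intro conjI)
      show "m + g \<in> sa_part A" by (intro sa_add mC g)
      show "op_le 0 (m + g)" using mC(2) g(2) by (auto simp: op_le_iff blinfun.add_left inner_add_right)
      show "op_le (m + g) id_blinfun" using g(3)
        by (auto simp: op_le_iff blinfun.add_left blinfun.diff_left inner_add_right inner_diff_right algebra_simps)
      show "\<iota> (m + g) \<in> Q" using mC(1,4) g(1) Q(3)[OF g(5)] Q(2) sa_partD by (simp add: io_add subspace_add)
    qed
    moreover have "op_le m (m + g)" using g(2) by (simp add: op_le_iff blinfun.add_left inner_add_right)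
    ultimately have "m + g = m" by (rule m(2))
    then show False using g(4) by simp
  qed
  then show ?thesis using mC(4) by simp
qed

section \<open>Left multiplication on L^2, intertwiners and density\<close>

lemma left_mult_exists:
  assumes X: "X \<in> A"
  obtains L :: "'k \<Rightarrow>\<^sub>L 'k" where "\<And>Y. Y \<in> A \<Longrightarrow> blinfun_apply L (\<iota> Y) = \<iota> (X o\<^sub>L Y)"
proof -
  define R where "R = (\<lambda>Y. (\<iota> Y, \<iota> (X o\<^sub>L Y))) ` A"
  have sub: "subspace R"
    unfolding subspace_def R_def
  proof (intro conjI ballI allI)
    show "0 \<in> (\<lambda>Y. (\<iota> Y, \<iota> (X o\<^sub>L Y))) ` A" by (rule image_eqI[OF _ zero_in]) (simp add: io_zero zero_prod_def)
    fix p assume "p \<in> (\<lambda>Y. (\<iota> Y, \<iota> (X o\<^sub>L Y))) ` A"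
    then obtain Y where Y: "Y \<in> A" "p = (\<iota> Y, \<iota> (X o\<^sub>L Y))" by blast
    show "c *\<^sub>R p \<in> (\<lambda>Y. (\<iota> Y, \<iota> (X o\<^sub>L Y))) ` A" for c
      by (rule image_eqI[of _ _ "c *\<^sub>R Y"])
         (use Y X in \<open>auto simp: io_scaleR ops_in bounded_bilinear.scaleR_right[OF bounded_bilinear_blinfun_compose]\<close>)
    fix q assume "q \<in> (\<lambda>Y. (\<iota> Y, \<iota> (X o\<^sub>L Y))) ` A"
    then obtain Z where Z: "Z \<in> A" "q = (\<iota> Z, \<iota> (X o\<^sub>L Z))" by blast
    show "p + q \<in> (\<lambda>Y. (\<iota> Y, \<iota> (X o\<^sub>L Y))) ` A"
      by (rule image_eqI[of _ _ "Y + Z"]) (use Y Z X in \<open>auto simp: io_add ops_in comp_add_right\<close>)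
  qed
  have le_R: "norm y \<le> norm X * norm x" if "(x,y) \<in> R" for x y
    using that X by (auto simp: R_def io_comp_le)
  obtain V where "\<And>x y. (x, y) \<in> R \<Longrightarrow> blinfun_apply V x = y"
    "\<And>z. (\<And>x y. (x, y) \<in> R \<Longrightarrow> inner z x = 0) \<Longrightarrow> blinfun_apply V z = 0"
    using extend_bounded_relation[OF sub le_R] by metis
  then have "blinfun_apply V (\<iota> Y) = \<iota> (X o\<^sub>L Y)" if "Y \<in> A" for Y using that by (auto simp: R_def)
  then show ?thesis using that by blast
qed

text \<open>Domination bounds the map \<open>Y \<eta> \<mapsto> \<iota> (Y g)\<close>, which is
  extended by zero off the closure of the orbit of \<open>\<eta>\<close>. That closure is invariant
  under \<open>A\<close>; since \<open>A\<close> contains adjoints, so is its orthogonal complement,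
  and the intertwining relation holds on both parts.\<close>

lemma dominated_intertwiner:
  assumes "dominated g \<eta>"
  obtains V :: "'h \<Rightarrow>\<^sub>L 'k" where
    "\<And>Y. Y \<in> A \<Longrightarrow> blinfun_apply V (blinfun_apply Y \<eta>) = \<iota> (Y o\<^sub>L g)"
    "\<And>X L v. X \<in> A \<Longrightarrow> (\<And>Y. Y \<in> A \<Longrightarrow> blinfun_apply L (\<iota> Y) = \<iota> (X o\<^sub>L Y)) \<Longrightarrow>
       blinfun_apply V (blinfun_apply X v) = blinfun_apply L (blinfun_apply V v)"
proof -
  have g: "g \<in> A" and le: "\<And>Y. Y \<in> A \<Longrightarrow> norm (\<iota> (Y o\<^sub>L g)) \<le> norm (blinfun_apply Y \<eta>)"
    using assms by (auto simp: dominated_def)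
  define R where "R = (\<lambda>Y. (blinfun_apply Y \<eta>, \<iota> (Y o\<^sub>L g))) ` A"
  have sub: "subspace R"
    unfolding subspace_def R_def
  proof (intro conjI ballI allI)
    show "0 \<in> (\<lambda>Y. (blinfun_apply Y \<eta>, \<iota> (Y o\<^sub>L g))) ` A" by (rule image_eqI[OF _ zero_in]) (simp add: io_zero zero_prod_def)
    fix p assume "p \<in> (\<lambda>Y. (blinfun_apply Y \<eta>, \<iota> (Y o\<^sub>L g))) ` A"
    then obtain Y where Y: "Y \<in> A" "p = (blinfun_apply Y \<eta>, \<iota> (Y o\<^sub>L g))" by blast
    show "c *\<^sub>R p \<in> (\<lambda>Y. (blinfun_apply Y \<eta>, \<iota> (Y o\<^sub>L g))) ` A" for c
      by (rule image_eqI[of _ _ "c *\<^sub>R Y"])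
         (use Y g in \<open>auto simp: io_scaleR ops_in bounded_bilinear.scaleR_left[OF bounded_bilinear_blinfun_compose] blinfun.scaleR_left\<close>)
    fix q assume "q \<in> (\<lambda>Y. (blinfun_apply Y \<eta>, \<iota> (Y o\<^sub>L g))) ` A"
    then obtain Z where Z: "Z \<in> A" "q = (blinfun_apply Z \<eta>, \<iota> (Z o\<^sub>L g))" by blast
    show "p + q \<in> (\<lambda>Y. (blinfun_apply Y \<eta>, \<iota> (Y o\<^sub>L g))) ` A"
      by (rule image_eqI[of _ _ "Y + Z"]) (use Y Z g in \<open>auto simp: io_add ops_in comp_add_left blinfun.add_left\<close>)
  qed
  have le_R: "norm y \<le> 1 * norm x" if "(x,y) \<in> R" for x y
    using that le by (auto simp: R_def)
  obtain V where V: "\<And>x y. (x, y) \<in> R \<Longrightarrow> blinfun_apply V x = y"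
    and V0: "\<And>z. (\<And>x y. (x, y) \<in> R \<Longrightarrow> inner z x = 0) \<Longrightarrow> blinfun_apply V z = 0"
    using extend_bounded_relation[OF sub le_R] by metis
  have VY: "blinfun_apply V (blinfun_apply Y \<eta>) = \<iota> (Y o\<^sub>L g)" if "Y \<in> A" for Y
    using V that by (auto simp: R_def)
  show ?thesis
  proof
    show "blinfun_apply V (blinfun_apply Y \<eta>) = \<iota> (Y o\<^sub>L g)" if "Y \<in> A" for Y using VY that .
    fix X v and L :: "'k \<Rightarrow>\<^sub>L 'k" assume X: "X \<in> A" and L: "\<And>Y. Y \<in> A \<Longrightarrow> blinfun_apply L (\<iota> Y) = \<iota> (X o\<^sub>L Y)"
    define M where "M = closure (fst ` R)"
    have "subspace M" unfolding M_def using linear_subspace_image[OF linear_fst sub] by (rule subspace_closure)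
    moreover have "closed M" by (simp add: M_def)
    ultimately obtain p where p: "p \<in> M" "\<And>z. z \<in> M \<Longrightarrow> inner (v - p) z = 0"
      using closed_subspace_projection by blast
    have inM: "blinfun_apply Y \<eta> \<in> M" if "Y \<in> A" for Y
      unfolding M_def using closure_subset[of "fst ` R"] that by (force simp: R_def)
    have "M \<subseteq> {u. blinfun_apply V (blinfun_apply X u) = blinfun_apply L (blinfun_apply V u)}"
      unfolding M_def
    proof (rule closure_minimal)
      show "fst ` R \<subseteq> {u. blinfun_apply V (blinfun_apply X u) = blinfun_apply L (blinfun_apply V u)}"
      proof
        fix u assume "u \<in> fst ` R"
        then obtain Y where Y: "Y \<in> A" "u = blinfun_apply Y \<eta>" by (auto simp: R_def)
        have "blinfun_apply V (blinfun_apply X u) = \<iota> ((X o\<^sub>L Y) o\<^sub>L g)"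
          using VY[of "X o\<^sub>L Y"] X Y by (simp add: ops_in)
        also have "\<dots> = blinfun_apply L (\<iota> (Y o\<^sub>L g))" using L Y g by (simp add: ops_in blinfun_compose_assoc)
        finally show "u \<in> {u. blinfun_apply V (blinfun_apply X u) = blinfun_apply L (blinfun_apply V u)}"
          using VY Y by simp
      qed
      show "closed {u. blinfun_apply V (blinfun_apply X u) = blinfun_apply L (blinfun_apply V u)}"
        by (intro closed_Collect_eq blinfun.continuous_on continuous_on_const continuous_on_id)
    qed
    then have "blinfun_apply V (blinfun_apply X p) = blinfun_apply L (blinfun_apply V p)" using p(1) by blast
    moreover have "blinfun_apply V (v - p) = 0"
      by (rule V0) (use p(2) inM in \<open>auto simp: R_def\<close>)
    moreover have "blinfun_apply V (blinfun_apply X (v - p)) = 0"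
    proof (rule V0)
      fix x y assume "(x, y) \<in> R"
      then obtain Y where Y: "Y \<in> A" "x = blinfun_apply Y \<eta>" by (auto simp: R_def)
      have "inner (blinfun_apply X (v - p)) x = inner (v - p) (blinfun_apply (op_adj X o\<^sub>L Y) \<eta>)"
        using op_adj_right[OF in_bounded_ops[OF X]] Y(2) by (simp add: inner_eq_Re_cinner)
      also have "\<dots> = 0" by (intro p(2) inM ops_in X Y(1))
      finally show "inner (blinfun_apply X (v - p)) x = 0" .
    qed
    ultimately show "blinfun_apply V (blinfun_apply X v) = blinfun_apply L (blinfun_apply V v)"
      by (simp add: blinfun.diff_right)
  qed
qed

theorem vn_generated_L2_dense:
  assumes P: "P \<subseteq> A" "id_blinfun \<in> P" "\<And>S T. S \<in> P \<Longrightarrow> T \<in> P \<Longrightarrow> S + T \<in> P"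
    "\<And>S T. S \<in> P \<Longrightarrow> T \<in> P \<Longrightarrow> S o\<^sub>L T \<in> P" "\<And>c T. T \<in> P \<Longrightarrow> scalar_op c o\<^sub>L T \<in> P"
    "\<And>T. T \<in> P \<Longrightarrow> op_adj T \<in> P"
    and X: "X \<in> vn_generated P"
  shows "\<iota> X \<in> closure (\<iota> ` P)"
proof -
  have XA: "X \<in> A" using vn_generated_least[OF vn P(1)] X by blast
  have XP: "X \<in> commutant (commutant P)"
    using vn_generated_subset_bicommutant[of P] P(1,6) in_bounded_ops X by blast
  have "\<exists>L. \<forall>Y\<in>A. \<forall>Z\<in>A. blinfun_apply (L Y) (\<iota> Z) = \<iota> (Y o\<^sub>L Z)"
    using left_mult_exists by (intro bchoice) metis
  then obtain L where L: "\<And>Y Z. Y \<in> A \<Longrightarrow> Z \<in> A \<Longrightarrow> blinfun_apply (L Y) (\<iota> Z) = \<iota> (Y o\<^sub>L Z)" by metis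
  have dense: "C = UNIV" if "closed C" "\<And>Y. Y \<in> A \<Longrightarrow> \<iota> Y \<in> C" for C
    using closure_minimal[of "\<iota> ` A" C] that io_dense by auto
  have Ladj: "inner (blinfun_apply (L Y) u) w = inner u (blinfun_apply (L (op_adj Y)) w)" if Y: "Y \<in> A" for Y u w
  proof -
    have "{u. \<forall>w. inner (blinfun_apply (L Y) u) w = inner u (blinfun_apply (L (op_adj Y)) w)} = UNIV"
    proof (rule dense)
      show "closed {u. \<forall>w. inner (blinfun_apply (L Y) u) w = inner u (blinfun_apply (L (op_adj Y)) w)}"
        by (intro closed_Collect_all closed_Collect_eq continuous_intros)
      fix Z assume Z: "Z \<in> A"
      have "{w. inner (blinfun_apply (L Y) (\<iota> Z)) w = inner (\<iota> Z) (blinfun_apply (L (op_adj Y)) w)} = UNIV"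
      proof (rule dense)
        show "closed {w. inner (blinfun_apply (L Y) (\<iota> Z)) w = inner (\<iota> Z) (blinfun_apply (L (op_adj Y)) w)}"
          by (intro closed_Collect_eq continuous_intros)
      qed (use Y Z in \<open>simp add: L ops_in inner_eq_Re_cinner io_inner_comp_left\<close>)
      then show "\<iota> Z \<in> {u. \<forall>w. inner (blinfun_apply (L Y) u) w = inner u (blinfun_apply (L (op_adj Y)) w)}" by blast
    qed
    then show ?thesis by blast
  qed
  define K where "K = closure (\<iota> ` P)"
  have zeroP: "0 \<in> P" using P(5)[OF P(2), of 0] scalar_op_of_real[of 0 "id_blinfun :: 'h \<Rightarrow>\<^sub>L 'h"] by simp
  have K: "closed K" "subspace K" unfolding K_def
    using P(1,3,5) zeroP by (auto intro!: subspace_closure io_subspace simp: scalar_op_of_real[symmetric])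
  have "subspace ((\<lambda>x. (x, x)) ` K)"
    by (intro linear_subspace_image K) (auto intro!: linearI)
  then obtain e where e: "\<And>x. x \<in> K \<Longrightarrow> blinfun_apply e x = x" "\<And>z. (\<And>x. x \<in> K \<Longrightarrow> inner z x = 0) \<Longrightarrow> blinfun_apply e z = 0"
    using extend_bounded_relation[of "(\<lambda>x. (x, x)) ` K" 1] by (auto simp: image_iff)
  \<comment> \<open>\<open>K\<close> is invariant under \<open>L Z\<close> for all \<open>Z\<close>
    in \<open>P\<close>. As \<open>P\<close> contains adjoints, the orthogonal complement of
    \<open>K\<close> is invariant as well.\<close>
  have e_comm: "blinfun_apply e (blinfun_apply (L Y) w) = blinfun_apply (L Y) (blinfun_apply e w)" if Y: "Y \<in> P" for Y w
  proof -
    have YA: "Y \<in> A" using Y P(1) by blast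
    obtain p where p: "p \<in> K" "\<And>z. z \<in> K \<Longrightarrow> inner (w - p) z = 0" using closed_subspace_projection[OF K] by blast
    have inv: "blinfun_apply (L Z) x \<in> K" if "Z \<in> P" "x \<in> K" for Z x
    proof -
      have "K \<subseteq> blinfun_apply (L Z) -` K" unfolding K_def
      proof (rule closure_minimal)
        show "closed (blinfun_apply (L Z) -` closure (\<iota> ` P))"
          by (intro continuous_closed_vimage closed_closure) (intro continuous_intros)
        have "blinfun_apply (L Z) (\<iota> Y') \<in> closure (\<iota> ` P)" if Y': "Y' \<in> P" for Y'
        proof -
          have "blinfun_apply (L Z) (\<iota> Y') = \<iota> (Z o\<^sub>L Y')" using L P(1) Y' \<open>Z \<in> P\<close> by blast
          then show ?thesis using P(4)[OF \<open>Z \<in> P\<close> Y'] closure_subset[of "\<iota> ` P"] by auto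
        qed
        then show "\<iota> ` P \<subseteq> blinfun_apply (L Z) -` closure (\<iota> ` P)" by blast
      qed
      then show ?thesis using that by blast
    qed
    have "blinfun_apply e (w - p) = 0" by (rule e(2)) (use p in auto)
    moreover have "blinfun_apply e (blinfun_apply (L Y) (w - p)) = 0"
      by (rule e(2)) (use p(2) inv P(6)[OF Y] Ladj[OF YA] in auto)
    ultimately show ?thesis using e(1)[OF p(1)] e(1)[OF inv[OF Y p(1)]] by (simp add: blinfun.diff_right)
  qed
  define D where "D = (e o\<^sub>L L X) - (L X o\<^sub>L e)"
  have D0: "inner (\<iota> (Y' o\<^sub>L g')) (blinfun_apply D (\<iota> (Y o\<^sub>L g))) = 0"
    if g: "dominated g \<eta>" "dominated g' \<eta>'" and Y: "Y \<in> A" "Y' \<in> A" for g g' \<eta> \<eta>' Y Y'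
  proof -
    obtain V where V: "\<And>Y. Y \<in> A \<Longrightarrow> blinfun_apply V (blinfun_apply Y \<eta>) = \<iota> (Y o\<^sub>L g)"
      "\<And>Y v. Y \<in> A \<Longrightarrow> blinfun_apply V (blinfun_apply Y v) = blinfun_apply (L Y) (blinfun_apply V v)"
      using dominated_intertwiner[OF g(1)] L by metis
    obtain V' where V': "\<And>Y. Y \<in> A \<Longrightarrow> blinfun_apply V' (blinfun_apply Y \<eta>') = \<iota> (Y o\<^sub>L g')"
      "\<And>Y v. Y \<in> A \<Longrightarrow> blinfun_apply V' (blinfun_apply Y v) = blinfun_apply (L Y) (blinfun_apply V' v)"
      using dominated_intertwiner[OF g(2)] L by metis
    obtain S where S: "\<And>x y. inner (blinfun_apply V' x) y = inner x (blinfun_apply S y)"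
      using adjoint_exists by blast
    have SL: "blinfun_apply S (blinfun_apply (L Y) w) = blinfun_apply Y (blinfun_apply S w)" if Y: "Y \<in> A" for Y w
    proof (rule inner_eq_all_imp_eq)
      fix x
      have "inner x (blinfun_apply S (blinfun_apply (L Y) w)) = inner (blinfun_apply (L (op_adj Y)) (blinfun_apply V' x)) w"
        using Ladj[OF adj_in[OF Y]] Y by (simp add: S[symmetric] in_bounded_ops)
      also have "\<dots> = inner (blinfun_apply (op_adj Y) x) (blinfun_apply S w)"
        using Y by (simp add: V'(2)[symmetric] adj_in S)
      also have "\<dots> = inner x (blinfun_apply Y (blinfun_apply S w))"
        using Y by (simp add: inner_eq_Re_cinner op_adj_left in_bounded_ops)
      finally show "inner x (blinfun_apply S (blinfun_apply (L Y) w)) = inner x (blinfun_apply Y (blinfun_apply S w))" .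
    qed
    \<comment> \<open>\<open>S\<close> is the adjoint of \<open>V'\<close>, so \<open>T\<close> is
      an operator on \<open>'h\<close>, where the commutation property of \<open>X\<close> can be
      used.\<close>
    define T where "T = S o\<^sub>L (e o\<^sub>L V)"
    have comm: "T o\<^sub>L Y = Y o\<^sub>L T" if "Y \<in> P" for Y
      using that P(1) by (intro blinfun_eqI) (auto simp: T_def V(2) e_comm SL)
    \<comment> \<open>The factors are only real-linear by construction; complex linearity of
      \<open>T\<close> follows because \<open>P\<close> contains the scalar operators.\<close>
    have "T \<in> bounded_ops"
      unfolding bounded_ops_def
    proof (intro CollectI allI)
      fix c x
      have "scalar_op c \<in> P" using P(5)[OF P(2), of c] by simp
      from comm[OF this] show "blinfun_apply T (c *\<^sub>C x) = c *\<^sub>C blinfun_apply T x"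
        by (metis blinfun_apply_blinfun_compose scalar_op_apply)
    qed
    then have "T \<in> commutant P" using comm by (simp add: commutant_def)
    then have "X o\<^sub>L T = T o\<^sub>L X" using XP by (simp add: commutant_def)
    then have XT: "blinfun_apply X (blinfun_apply T v) = blinfun_apply T (blinfun_apply X v)" for v
      by (metis blinfun_apply_blinfun_compose)
    have "blinfun_apply S (blinfun_apply D (blinfun_apply V v)) = 0" for v
      using XT[of v] by (simp add: D_def blinfun.diff_left blinfun.diff_right SL[OF XA] V(2)[OF XA] T_def)
    then have "inner (blinfun_apply V' v') (blinfun_apply D (blinfun_apply V v)) = 0" for v v'
      by (simp add: S)
    from this[of "blinfun_apply Y' \<eta>'" "blinfun_apply Y \<eta>"] show ?thesis
      by (simp only: V(1)[OF Y(1)] V'(1)[OF Y(2)])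
  qed
  \<comment> \<open>First removal: \<open>D0\<close> says that the vector is orthogonal to all
    translates of dominated elements, so by \<open>io_id_in_dominated\<close> it is orthogonal to
    the dense image of \<open>A\<close>.\<close>
  have D1: "blinfun_apply D (\<iota> (Y o\<^sub>L g)) = 0" if g: "dominated g \<eta>" and Y: "Y \<in> A" for g \<eta> Y
  proof -
    let ?w = "blinfun_apply D (\<iota> (Y o\<^sub>L g))"
    define Q where "Q = {u. \<forall>Z\<in>A. inner (blinfun_apply (L Z) u) ?w = 0}"
    have "Q = (\<Inter>Z\<in>A. {u. inner (blinfun_apply (L Z) u) ?w = 0})" by (auto simp: Q_def)
    then have "closed Q" by (auto intro!: closed_INT closed_Collect_eq continuous_intros)
    moreover have "subspace Q" by (auto simp: Q_def subspace_def blinfun.add_right blinfun.scaleR_right inner_add_left)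
    moreover have "\<iota> g' \<in> Q" if "dominated g' \<eta>'" for g' \<eta>'
      using D0[OF g that Y] that L by (auto simp: Q_def dominated_def)
    ultimately have "\<iota> id_blinfun \<in> Q" by (rule io_id_in_dominated)
    then have *: "inner (\<iota> Z) ?w = 0" if "Z \<in> A" for Z using that L[OF that id_in] by (auto simp: Q_def)
    have "{u. inner u ?w = 0} = UNIV"
      by (rule dense) (auto intro!: closed_Collect_eq continuous_intros *)
    then have "inner ?w ?w = 0" by blast
    then show ?thesis by simp
  qed
  define Q where "Q = {u. blinfun_apply D u = 0}"
  have "closed Q" unfolding Q_def by (intro closed_Collect_eq continuous_intros)
  moreover have "subspace Q" by (auto simp: Q_def subspace_def blinfun.add_right blinfun.scaleR_right)
  moreover have "\<iota> g \<in> Q" if "dominated g \<eta>" for g \<eta>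
    using D1[OF that id_in] unfolding Q_def by simp
  ultimately have "\<iota> id_blinfun \<in> Q" by (rule io_id_in_dominated)
  moreover have "\<iota> id_blinfun \<in> K" unfolding K_def
    using imageI[OF P(2), of \<iota>] closure_subset[of "\<iota> ` P"] by (rule rev_subsetD)
  ultimately have eX: "blinfun_apply e (\<iota> X) = \<iota> X"
    using L[OF XA id_in] e(1) by (simp add: Q_def D_def blinfun.diff_left)
  obtain p where p: "p \<in> K" "\<And>z. z \<in> K \<Longrightarrow> inner (\<iota> X - p) z = 0" using closed_subspace_projection[OF K] by blast
  have "blinfun_apply e (\<iota> X - p) = 0" by (rule e(2)) (use p in auto)
  then have "\<iota> X = p" using eX e(1)[OF p(1)] by (simp add: blinfun.diff_right)
  then show ?thesis using p(1) by (simp add: K_def)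
qed

end


section \<open>Moments of the semicircle law\<close>

lemma semicircle_first_moment:
  "integral {- 2 * sqrt v..2 * sqrt v} (\<lambda>x. x ^ 1 * (sqrt (4 * v - x\<^sup>2) / (2 * pi * v))) = 0"
proof -
  let ?f = "\<lambda>x. x ^ 1 * (sqrt (4 * v - x\<^sup>2) / (2 * pi * v)) :: real"
  have "integral {- (2 * sqrt v)..- (- (2 * sqrt v))} (\<lambda>x. ?f (- x)) = integral {- (2 * sqrt v)..2 * sqrt v} ?f"
    by (rule Henstock_Kurzweil_Integration.integral_reflect_real)
  moreover have "(\<lambda>x. ?f (- x)) = (\<lambda>x. - ?f x)" by simp
  ultimately have "- integral {- (2 * sqrt v)..2 * sqrt v} ?f = integral {- (2 * sqrt v)..2 * sqrt v} ?f"
    by (simp only: integral_neg minus_minus)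
  then show ?thesis by simp
qed

text \<open>The function \<open>x (4 v - x\<^sup>2)\<close> to the power \<open>3/2\<close> in its
  second factor vanishes at both ends and has derivative \<open>4 (v - x\<^sup>2)\<close> times the
  square root. This relates the second moment to the total mass without computing either.\<close>

lemma semicircle_second_moment:
  assumes v: "v > 0"
  shows "integral {- 2 * sqrt v..2 * sqrt v} (\<lambda>x. x ^ 2 * (sqrt (4 * v - x\<^sup>2) / (2 * pi * v))) =
    v * integral {- 2 * sqrt v..2 * sqrt v} (\<lambda>x. x ^ 0 * (sqrt (4 * v - x\<^sup>2) / (2 * pi * v)))"
proof -
  define a where "a = 2 * sqrt v"
  have a: "a > 0" "a * a = 4 * v" using v by (auto simp: a_def)
  let ?w = "\<lambda>x. sqrt (4 * v - x\<^sup>2)"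
  let ?F = "\<lambda>x. x * (4 * v - x\<^sup>2) * ?w x"
  have "((\<lambda>x. 4 * (v * ?w x - x\<^sup>2 * ?w x)) has_integral (?F a - ?F (- a))) {-a..a}"
  proof (rule fundamental_theorem_of_calculus_interior)
    show "continuous_on {-a..a} ?F" by (intro continuous_intros)
    fix x assume x: "x \<in> {-a<..<a}"
    have "\<bar>x\<bar> < a" using x by auto
    then have "x\<^sup>2 < a\<^sup>2" using power_strict_mono[of "\<bar>x\<bar>" a 2] by simp
    then have pos: "4 * v - x\<^sup>2 > 0" using a(2) by (simp add: power2_eq_square)
    have "(?F has_real_derivative (1 * (4 * v - x\<^sup>2) + x * (- 2 * x)) * ?w x + x * (4 * v - x\<^sup>2) * ((- 2 * x) * (inverse (?w x) / 2))) (at x)"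
      by (rule derivative_eq_intros refl | use pos in \<open>simp; fail\<close>)+
    moreover have "(1 * (4 * v - x\<^sup>2) + x * (- 2 * x)) * ?w x + x * (4 * v - x\<^sup>2) * ((- 2 * x) * (inverse (?w x) / 2)) = 4 * (v * ?w x - x\<^sup>2 * ?w x)"
    proof -
      have "(4 * v - x\<^sup>2) * inverse (?w x) = ?w x"
        using pos by (simp add: real_div_sqrt divide_inverse[symmetric])
      then have "x * (4 * v - x\<^sup>2) * ((- 2 * x) * (inverse (?w x) / 2)) = - x\<^sup>2 * ?w x"
        by (simp add: power2_eq_square)
      moreover have "(4 * v - x\<^sup>2) * ?w x = 4 * v * ?w x - x\<^sup>2 * ?w x" by (simp add: algebra_simps)
      ultimately show ?thesis by (simp add: algebra_simps power2_eq_square)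
    qed
    ultimately show "(?F has_vector_derivative 4 * (v * ?w x - x\<^sup>2 * ?w x)) (at x)"
      by (simp add: has_real_derivative_iff_has_vector_derivative)
  qed (use a in auto)
  moreover have "?F a = 0" "?F (- a) = 0" using a(2) by (simp_all add: power2_eq_square)
  ultimately have "integral {-a..a} (\<lambda>x. 4 * (v * ?w x - x\<^sup>2 * ?w x)) = 0"
    by (simp add: integral_unique)
  moreover have "integral {-a..a} (\<lambda>x. 4 * (v * ?w x - x\<^sup>2 * ?w x)) =
    4 * (v * integral {-a..a} ?w - integral {-a..a} (\<lambda>x. x\<^sup>2 * ?w x))"
  proof -
    have "?w integrable_on {-a..a}" "(\<lambda>x. v * ?w x) integrable_on {-a..a}" "(\<lambda>x. x\<^sup>2 * ?w x) integrable_on {-a..a}"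
      by (intro integrable_continuous_real continuous_intros)+
    then show ?thesis by (simp add: Henstock_Kurzweil_Integration.integral_diff)
  qed
  ultimately have *: "integral {-a..a} (\<lambda>x. x\<^sup>2 * ?w x) = v * integral {-a..a} ?w" by simp
  have "integral {-a..a} (\<lambda>x. x ^ 2 * (?w x / (2 * pi * v))) = integral {-a..a} (\<lambda>x. x\<^sup>2 * ?w x) / (2 * pi * v)"
    by (simp add: times_divide_eq_right)
  moreover have "integral {-a..a} (\<lambda>x. x ^ 0 * (?w x / (2 * pi * v))) = integral {-a..a} ?w / (2 * pi * v)"
    by simp
  ultimately have "integral {-a..a} (\<lambda>x. x ^ 2 * (?w x / (2 * pi * v))) = v * integral {-a..a} (\<lambda>x. x ^ 0 * (?w x / (2 * pi * v)))"
    using * by simp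
  then show ?thesis by (simp only: a_def mult_minus_left)
qed

section \<open>Freeness of the increments from the past\<close>

text \<open>The complex linear span, set up as an inductive set so that identities linear in one
  argument extend by rule induction.\<close>

inductive_set op_span :: "('h::complex_hilbert_space \<Rightarrow>\<^sub>L 'h) set \<Rightarrow> ('h \<Rightarrow>\<^sub>L 'h) set" for S where
  op_span_zero: "0 \<in> op_span S"
| op_span_step: "X \<in> S \<Longrightarrow> Y \<in> op_span S \<Longrightarrow> (scalar_op c o\<^sub>L X) + Y \<in> op_span S"

lemma op_span_scalar_base: "X \<in> S \<Longrightarrow> scalar_op c o\<^sub>L X \<in> op_span S"
  using op_span_step[OF _ op_span_zero, of X S c] by simp

lemma op_span_base: "X \<in> S \<Longrightarrow> X \<in> op_span S"
  using op_span_scalar_base[of X S 1] by simp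

lemma op_span_add: "X \<in> op_span S \<Longrightarrow> Y \<in> op_span S \<Longrightarrow> X + Y \<in> op_span S"
  by (induction rule: op_span.induct) (auto simp: add.assoc intro: op_span.intros)

lemma scalar_op_mult: "scalar_op c o\<^sub>L (scalar_op d o\<^sub>L X) = scalar_op (c * d) o\<^sub>L X"
  by (rule blinfun_eqI) (simp add: scaleC_scaleC)

lemma op_span_scalar: "X \<in> op_span S \<Longrightarrow> scalar_op c o\<^sub>L X \<in> op_span S"
  by (induction rule: op_span.induct)
     (auto simp: comp_add_right scalar_op_mult intro: op_span.intros)

lemma op_prod_Nil [simp]: "op_prod [] = id_blinfun"
  and op_prod_Cons [simp]: "op_prod (X # Xs) = X o\<^sub>L op_prod Xs"
  by (simp_all add: op_prod_def)

lemma op_prod_append [simp]: "op_prod (Xs @ Ys) = op_prod Xs o\<^sub>L op_prod Ys"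
  by (induction Xs) (simp_all add: blinfun_compose_assoc)

lemma free_familyD:
  assumes "free_family \<tau> I B" "xs \<noteq> []" "\<And>i X. (i, X) \<in> set xs \<Longrightarrow> i \<in> I \<and> X \<in> B i \<and> \<tau> X = 0"
    "distinct_adj (map fst xs)"
  shows "\<tau> (op_prod (map snd xs)) = 0"
proof -
  have "\<forall>(i, X)\<in>set xs. i \<in> I \<and> X \<in> B i \<and> \<tau> X = 0" using assms(3) by blast
  then show ?thesis using assms(1,2,4) unfolding free_family_def by simp
qed

context vn_alg
begin

lemma op_span_in: "S \<subseteq> A \<Longrightarrow> X \<in> op_span S \<Longrightarrow> X \<in> A"
  by (rotate_tac, induction rule: op_span.induct) (auto simp: ops_in)

lemma op_prod_in: "set Xs \<subseteq> A \<Longrightarrow> op_prod Xs \<in> A"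
  by (induction Xs) (auto simp: ops_in)

end

locale free_bm = nc_L2 A \<tau> \<iota> for A :: "('h::complex_hilbert_space \<Rightarrow>\<^sub>L 'h) set" and \<tau>
    and \<iota> :: "('h \<Rightarrow>\<^sub>L 'h) \<Rightarrow> 'k::complex_hilbert_space" +
  fixes W :: "real \<Rightarrow> ('h \<Rightarrow>\<^sub>L 'h)" and U0 :: "'h \<Rightarrow>\<^sub>L 'h"
  assumes bm: "free_brownian_motion A \<tau> W"
    and U0: "U0 \<in> sa_part A" and U0_free: "free_from \<tau> {U0} (W ` {0..})"
begin

abbreviation "F \<equiv> past W U0"
abbreviation "alg0 \<equiv> vn_generated {U0}"
abbreviation "algW s \<equiv> vn_generated (W ` {0..s})"
abbreviation "algW_all \<equiv> vn_generated (W ` {0..})"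

lemma W_sa: "t \<ge> 0 \<Longrightarrow> W t \<in> sa_part A"
  using bm by (auto simp: free_brownian_motion_def)

lemma W_in: "t \<ge> 0 \<Longrightarrow> W t \<in> A"
  using W_sa sa_partD by blast

lemma U0_in: "U0 \<in> A"
  using U0 sa_partD by blast

lemma F_subset: "F t \<subseteq> A"
  unfolding past_def by (rule vn_generated_least[OF vn]) (auto simp: U0_in W_in)

lemma F_vn: "von_neumann_algebra (F t)"
  unfolding past_def by (rule vn_generated_vn) (use U0_in W_in in_bounded_ops in auto)

lemma F_mono: "s \<le> t \<Longrightarrow> F s \<subseteq> F t"
  unfolding past_def by (rule vn_generated_mono) auto

lemma W_in_F: "0 \<le> s \<Longrightarrow> s \<le> t \<Longrightarrow> W s \<in> F t"
  unfolding past_def using vn_generated_superset by (metis atLeastAtMost_iff image_eqI insertI2 subsetD)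

lemma U0_in_F: "U0 \<in> F t"
  unfolding past_def using vn_generated_superset by blast

lemma F_in: "X \<in> F t \<Longrightarrow> X \<in> A"
  using F_subset by blast

lemma alg_vn: "von_neumann_algebra alg0" "von_neumann_algebra (algW s)" "von_neumann_algebra algW_all"
  by (intro vn_generated_vn; use U0_in W_in in_bounded_ops in auto)+

lemma alg_subset: "alg0 \<subseteq> A" "algW s \<subseteq> A" "algW_all \<subseteq> A" "algW s \<subseteq> algW_all"
  by (intro vn_generated_least[OF vn]; use U0_in W_in in auto)+ (intro vn_generated_mono; auto)

lemma alg_mem: "X \<in> alg0 \<Longrightarrow> X \<in> A" "X \<in> algW s \<Longrightarrow> X \<in> A" "X \<in> algW_all \<Longrightarrow> X \<in> A" "X \<in> algW s \<Longrightarrow> X \<in> algW_all"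
  using alg_subset by blast+

lemma incr_in: "0 \<le> s \<Longrightarrow> 0 \<le> t \<Longrightarrow> W t - W s \<in> A"
  by (intro diff_in W_in)

lemma incr_in_algW_all: "0 \<le> s \<Longrightarrow> 0 \<le> t \<Longrightarrow> W t - W s \<in> algW_all"
proof -
  assume "0 \<le> s" "0 \<le> t"
  then have "W s \<in> algW_all" "W t \<in> algW_all" using vn_generated_superset[of "W ` {0..}"] by auto
  then show ?thesis using vn_alg.diff_in[OF vn_alg.intro[OF alg_vn(3)]] by blast
qed

lemma incr_tr:
  assumes "0 \<le> s" "s < t"
  shows "\<tau> (W t - W s) = 0" "\<tau> ((W t - W s) o\<^sub>L (W t - W s)) = of_real (t - s)"
proof -
  have c: "\<tau> (op_prod (replicate n (W t - W s))) =
        complex_of_real (integral {- 2 * sqrt (t - s)..2 * sqrt (t - s)}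
          (\<lambda>x. x ^ n * (sqrt (4 * (t - s) - x\<^sup>2) / (2 * pi * (t - s)))))" for n
    using bm assms by (auto simp: free_brownian_motion_def centered_semicircular_def)
  show "\<tau> (W t - W s) = 0" using c[of 1] semicircle_first_moment[of "t - s"] by simp
  \<comment> \<open>The total mass is the moment of order \<open>0\<close>: the empty product is the
    identity, whose trace is \<open>1\<close>.\<close>
  have "integral {- 2 * sqrt (t - s)..2 * sqrt (t - s)}
          (\<lambda>x. x ^ 0 * (sqrt (4 * (t - s) - x\<^sup>2) / (2 * pi * (t - s)))) = 1"
  proof -
    have "\<tau> (op_prod (replicate 0 (W t - W s))) = 1" by (simp only: replicate_0 op_prod_Nil tr_id)
    then show ?thesis unfolding c[of 0] by (simp only: of_real_eq_1_iff)
  qed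
  then show "\<tau> ((W t - W s) o\<^sub>L (W t - W s)) = of_real (t - s)"
  proof -
    assume "integral {- 2 * sqrt (t - s)..2 * sqrt (t - s)}
          (\<lambda>x. x ^ 0 * (sqrt (4 * (t - s) - x\<^sup>2) / (2 * pi * (t - s)))) = 1"
    then have "\<tau> (op_prod (replicate 2 (W t - W s))) = of_real (t - s)"
      using c[of 2] semicircle_second_moment[of "t - s"] assms(2) by (simp only: mult_1_right diff_gt_0_iff_gt)
    then show ?thesis by (simp add: numeral_2_eq_2)
  qed
qed

definition cent :: "('h \<Rightarrow>\<^sub>L 'h) \<Rightarrow> ('h \<Rightarrow>\<^sub>L 'h)" where
  "cent X = X - scalar_op (\<tau> X)"

lemma cent_tr [simp]: "X \<in> A \<Longrightarrow> \<tau> (cent X) = 0"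
  by (simp add: cent_def tr_diff scalar_in tr_scalar_op)

lemma cent_in: "von_neumann_algebra N \<Longrightarrow> X \<in> N \<Longrightarrow> cent X \<in> N"
  unfolding cent_def using vn_alg.diff_in vn_alg.scalar_in vn_alg.intro by metis

lemma cent_split: "X = cent X + scalar_op (\<tau> X)"
  by (simp add: cent_def)

lemma tr_comp_scalar: "X \<in> A \<Longrightarrow> Y \<in> A \<Longrightarrow> \<tau> (X o\<^sub>L (scalar_op c o\<^sub>L Y)) = c * \<tau> (X o\<^sub>L Y)"
proof -
  assume XY: "X \<in> A" "Y \<in> A"
  have "X o\<^sub>L (scalar_op c o\<^sub>L Y) = scalar_op c o\<^sub>L (X o\<^sub>L Y)"
    using scalar_op_comm[OF in_bounded_ops[OF XY(1)], of c] by (metis blinfun_compose_assoc)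
  then show ?thesis using XY by (simp add: tr_scalar comp_in)
qed

lemma past_free:
  assumes "0 \<le> s" "s < t" "xs \<noteq> []"
    "\<And>i X. (i, X) \<in> set xs \<Longrightarrow> X \<in> (if i then {W t - W s} else algW s) \<and> \<tau> X = 0"
    "distinct_adj (map fst xs)"
  shows "\<tau> (op_prod (map snd xs)) = 0"
proof -
  have "free_from \<tau> {W t - W s} (W ` {0..s})" using bm assms(1,2) by (auto simp: free_brownian_motion_def)
  then have "free_family \<tau> UNIV (\<lambda>first. if first then vn_generated {W t - W s} else algW s)"
    by (simp add: free_from_def)
  then show ?thesis
  proof (rule free_familyD)
    fix i X assume "(i, X) \<in> set xs"
    then show "i \<in> UNIV \<and> X \<in> (if i then vn_generated {W t - W s} else algW s) \<and> \<tau> X = 0"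
      using assms(4)[of i X] vn_generated_superset[of "{W t - W s}"] by (cases i) auto
  qed (use assms in auto)
qed

lemma start_free:
  assumes "xs \<noteq> []" "\<And>i X. (i, X) \<in> set xs \<Longrightarrow> X \<in> (if i then alg0 else algW_all) \<and> \<tau> X = 0"
    "distinct_adj (map fst xs)"
  shows "\<tau> (op_prod (map snd xs)) = 0"
  by (rule free_familyD[OF U0_free[unfolded free_from_def]]) (use assms in auto)

lemma algW_incr:
  assumes st: "0 \<le> s" "s < t" and x: "x \<in> algW s"
  shows "\<tau> (x o\<^sub>L (W t - W s)) = 0"
proof -
  define D where "D = W t - W s"
  have D: "D \<in> A" "\<tau> D = 0" using incr_in incr_tr st by (auto simp: D_def)
  have xA: "x \<in> A" using x alg_mem by blast
  have "\<tau> (op_prod (map snd [(False, cent x), (True, D)])) = 0"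
    by (rule past_free[OF st]) (use x D xA cent_in[OF alg_vn(2)] in \<open>auto simp: D_def\<close>)
  then have "\<tau> (cent x o\<^sub>L D) = 0" by simp
  moreover have "x o\<^sub>L D = (cent x o\<^sub>L D) + (scalar_op (\<tau> x) o\<^sub>L D)"
    by (subst cent_split[of x]) (simp add: comp_add_left)
  ultimately show ?thesis using xA D
    by (simp add: D_def[symmetric] tr_add tr_scalar ops_in cent_def)
qed

text \<open>Splitting \<open>x\<close> and \<open>y\<close> into centred part and mean leaves
  alternating products of centred elements, which vanish by freeness, and the term with both means,
  which contains the variance of \<open>D\<close>.\<close>

lemma algW_incr2:
  assumes st: "0 \<le> s" "s < t" and x: "x \<in> algW s" and y: "y \<in> algW s"
  defines "D \<equiv> W t - W s"
  shows "\<tau> (x o\<^sub>L (D o\<^sub>L (y o\<^sub>L D))) = \<tau> x * \<tau> y * of_real (t - s)"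
proof -
  have D: "D \<in> A" "\<tau> D = 0" "\<tau> (D o\<^sub>L D) = of_real (t - s)" using incr_in incr_tr st by (auto simp: D_def)
  have xA: "x \<in> A" "y \<in> A" using x y alg_mem by blast+
  have c: "cent x \<in> algW s" "cent y \<in> algW s" "cent x \<in> A" "cent y \<in> A"
    using x y xA cent_in alg_vn vn by auto
  have "\<tau> (op_prod (map snd [(False, cent x), (True, D), (False, cent y), (True, D)])) = 0"
    by (rule past_free[OF st]) (use D c xA in \<open>auto simp: D_def\<close>)
  then have 1: "\<tau> (cent x o\<^sub>L (D o\<^sub>L (cent y o\<^sub>L D))) = 0" by simp
  have "\<tau> (op_prod (map snd [(True, D), (False, cent y), (True, D)])) = 0"
    by (rule past_free[OF st]) (use D c xA in \<open>auto simp: D_def\<close>)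
  then have 2: "\<tau> (D o\<^sub>L (cent y o\<^sub>L D)) = 0" by simp
  have "\<tau> (op_prod (map snd [(True, D), (False, cent x), (True, D)])) = 0"
    by (rule past_free[OF st]) (use D c xA in \<open>auto simp: D_def\<close>)
  then have "\<tau> (D o\<^sub>L (cent x o\<^sub>L D)) = 0" by simp
  \<comment> \<open>The word with two adjacent \<open>D\<close> does not alternate; traciality moves
    one of them to the front, where it does.\<close>
  then have 3: "\<tau> (cent x o\<^sub>L (D o\<^sub>L D)) = 0"
    using tr_comm[of "cent x o\<^sub>L D" D] D c by (simp add: ops_in blinfun_compose_assoc)
  have "x o\<^sub>L (D o\<^sub>L (y o\<^sub>L D)) =
     ((cent x o\<^sub>L (D o\<^sub>L (cent y o\<^sub>L D))) + (cent x o\<^sub>L (scalar_op (\<tau> y) o\<^sub>L (D o\<^sub>L D))))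
     + (scalar_op (\<tau> x) o\<^sub>L ((D o\<^sub>L (cent y o\<^sub>L D)) + (scalar_op (\<tau> y) o\<^sub>L (D o\<^sub>L D))))"
    using in_bounded_ops[OF D(1)]
    by (subst cent_split[of x], subst cent_split[of y])
       (auto intro!: blinfun_eqI simp: blinfun.add_left blinfun.add_right bounded_opsD scaleC_add_right)
  then show ?thesis using D c 1 2 3
    by (simp add: tr_add tr_scalar ops_in tr_comp_scalar)
qed

text \<open>Alternating words in centred letters, where \<open>True\<close> marks a letter from
  \<open>alg0\<close>. Words begin and end in \<open>alg0\<close>, so that an arbitrary element on
  the side of \<open>W\<close> may be put next to either end and the result still
  alternates.\<close>

definition good_word :: "real \<Rightarrow> (bool \<times> ('h \<Rightarrow>\<^sub>L 'h)) list \<Rightarrow> bool" where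
  "good_word s xs \<longleftrightarrow> (\<forall>(i, X)\<in>set xs. X \<in> (if i then alg0 else algW s) \<and> \<tau> X = 0) \<and> distinct_adj (map fst xs) \<and>
     (xs \<noteq> [] \<longrightarrow> fst (hd xs) \<and> fst (last xs))"

abbreviation wprod where "wprod xs \<equiv> op_prod (map snd xs)"

text \<open>The outer factors come from the past of \<open>W\<close> and need not be centred. In
  \<open>X D Y D\<close> the increment thus meets only elements generated by \<open>W\<close>, and
  the products around it merge into single letters free from \<open>alg0\<close>.\<close>

definition sandwiches :: "real \<Rightarrow> ('h \<Rightarrow>\<^sub>L 'h) set" where
  "sandwiches s = {x o\<^sub>L (wprod us o\<^sub>L y) | x us y. x \<in> algW s \<and> y \<in> algW s \<and> good_word s us}"

lemma good_wordD: "good_word s xs \<Longrightarrow> (i, X) \<in> set xs \<Longrightarrow> X \<in> (if i then alg0 else algW s) \<and> \<tau> X = 0"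
  by (auto simp: good_word_def)

lemma good_word_in: "good_word s us \<Longrightarrow> wprod us \<in> A"
proof (rule op_prod_in)
  assume g: "good_word s us"
  have "X \<in> A" if "(i, X) \<in> set us" for i X
    using good_wordD[OF g that] alg_mem by (auto split: if_splits)
  then show "set (map snd us) \<subseteq> A" by auto
qed

lemma word_tr:
  assumes us: "good_word s us" "us \<noteq> []" and b: "b \<in> algW_all"
  shows "\<tau> (wprod us o\<^sub>L b) = 0"
proof -
  have bA: "b \<in> A" "cent b \<in> A" "cent b \<in> algW_all" using b alg_mem cent_in[OF vn] cent_in[OF alg_vn(3)] by auto
  have d: "distinct_adj (map fst us)" "last (map fst us)" using us by (auto simp: good_word_def last_map)
  have e: "X \<in> (if i then alg0 else algW_all) \<and> \<tau> X = 0" if "(i, X) \<in> set us" for i X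
    using good_wordD[OF us(1) that] alg_mem by (auto split: if_splits)
  have "\<tau> (wprod (us @ [(False, cent b)])) = 0"
  proof (rule start_free)
    fix i X assume "(i, X) \<in> set (us @ [(False, cent b)])"
    then show "X \<in> (if i then alg0 else algW_all) \<and> \<tau> X = 0" using e[of i X] bA by auto
  qed (use d us(2) in \<open>auto simp: distinct_adj_append_iff\<close>)
  then have "\<tau> (wprod us o\<^sub>L cent b) = 0" by simp
  moreover have "\<tau> (wprod us) = 0"
    by (rule start_free[OF us(2) e d(1)])
  moreover have "wprod us o\<^sub>L b = (wprod us o\<^sub>L cent b) + (scalar_op (\<tau> b) o\<^sub>L wprod us)"
    using scalar_op_comm[OF in_bounded_ops[OF good_word_in[OF us(1)]]]
    by (subst cent_split[of b]) (simp add: comp_add_right)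
  ultimately show ?thesis using good_word_in[OF us(1)] bA by (simp add: tr_add tr_scalar ops_in)
qed

lemma word_tr2:
  assumes us: "good_word s us" "us \<noteq> []" and vs: "good_word s vs" "vs \<noteq> []"
    and b: "b \<in> algW_all" "\<tau> b = 0" and c: "c \<in> algW_all" "\<tau> c = 0"
  shows "\<tau> (wprod us o\<^sub>L (b o\<^sub>L (wprod vs o\<^sub>L c))) = 0"
proof -
  have d: "distinct_adj (map fst us)" "last (map fst us)" "distinct_adj (map fst vs)" "last (map fst vs)" "hd (map fst vs)"
    using us vs by (auto simp: good_word_def last_map hd_map)
  have e: "X \<in> (if i then alg0 else algW_all) \<and> \<tau> X = 0" if "(i, X) \<in> set us \<union> set vs" for i X
    using that good_wordD[OF us(1), of i X] good_wordD[OF vs(1), of i X] alg_mem by (auto split: if_splits)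
  have "\<tau> (wprod (us @ [(False, b)] @ vs @ [(False, c)])) = 0"
  proof (rule start_free)
    show "distinct_adj (map fst (us @ [(False, b)] @ vs @ [(False, c)]))"
      using d us(2) vs(2) by (auto simp: distinct_adj_append_iff distinct_adj_Cons)
    fix i X assume "(i, X) \<in> set (us @ [(False, b)] @ vs @ [(False, c)])"
    then show "X \<in> (if i then alg0 else algW_all) \<and> \<tau> X = 0"
      using e[of i X] b c by auto
  qed simp
  then show ?thesis by (simp add: blinfun_compose_assoc)
qed

text \<open>Traciality brings the left factor \<open>x\<close> behind the increment. If the word is
  nonempty, \<open>y D x\<close> is one element of \<open>algW_all\<close> following a word that
  ends in \<open>alg0\<close>; if it is empty, the claim concerns \<open>W\<close> alone.\<close>

lemma sandwich_incr:
  assumes st: "0 \<le> s" "s < t" and X: "X \<in> sandwiches s"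
  shows "\<tau> (X o\<^sub>L (W t - W s)) = 0"
proof -
  define D where "D = W t - W s"
  obtain x us y where X: "X = x o\<^sub>L (wprod us o\<^sub>L y)" "x \<in> algW s" "y \<in> algW s" "good_word s us"
    using X by (auto simp: sandwiches_def)
  have D: "D \<in> A" "D \<in> algW_all" using incr_in incr_in_algW_all st by (auto simp: D_def)
  have xA: "x \<in> A" "y \<in> A" "x \<in> algW_all" "y \<in> algW_all" using X alg_mem by auto
  interpret B: vn_alg algW_all by unfold_locales (rule alg_vn)
  interpret Bs: vn_alg "algW s" by unfold_locales (rule alg_vn)
  have "\<tau> (X o\<^sub>L D) = \<tau> (wprod us o\<^sub>L (y o\<^sub>L (D o\<^sub>L x)))"
    using tr_comm[of x "wprod us o\<^sub>L (y o\<^sub>L D)"] xA D good_word_in[OF X(4)]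
    by (simp add: X(1) ops_in blinfun_compose_assoc)
  also have "\<dots> = 0"
  proof (cases "us = []")
    case True
    have "\<tau> (y o\<^sub>L (D o\<^sub>L x)) = \<tau> ((x o\<^sub>L y) o\<^sub>L D)"
      using tr_comm[of "y o\<^sub>L D" x] xA D by (simp add: ops_in blinfun_compose_assoc)
    also have "\<dots> = 0" unfolding D_def by (intro algW_incr st Bs.comp_in X)
    finally show ?thesis using True by simp
  next
    case False
    then show ?thesis by (intro word_tr[OF X(4)] B.comp_in D xA)
  qed
  finally show ?thesis by (simp add: D_def)
qed

lemma sandwich_tr:
  assumes "x \<in> algW s" "y \<in> algW s" "good_word s us" "us \<noteq> []"
  shows "\<tau> (x o\<^sub>L (wprod us o\<^sub>L y)) = 0"
proof -
  interpret B: vn_alg algW_all by unfold_locales (rule alg_vn)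
  have xA: "x \<in> A" "y \<in> A" "x \<in> algW_all" "y \<in> algW_all" using assms alg_mem by auto
  have "\<tau> (x o\<^sub>L (wprod us o\<^sub>L y)) = \<tau> (wprod us o\<^sub>L (y o\<^sub>L x))"
    using tr_comm[of x "wprod us o\<^sub>L y"] xA good_word_in[OF assms(3)] by (simp add: ops_in blinfun_compose_assoc)
  also have "\<dots> = 0" by (intro word_tr[OF assms(3,4)] B.comp_in xA)
  finally show ?thesis .
qed

text \<open>After a cyclic rotation the increments sit in \<open>b = y D x'\<close> and
  \<open>c = y' D x\<close>, both of trace zero by \<open>algW_incr\<close>. If both words are
  nonempty, the product alternates between \<open>alg0\<close> and \<open>algW_all\<close> and has
  trace zero; if just one is, \<open>b\<close> and \<open>c\<close> are adjacent up to rotation and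
  \<open>word_tr\<close> applies. In these cases a factor on the right-hand side vanishes too, by
  \<open>sandwich_tr\<close>. With both words empty only \<open>W\<close> is involved.\<close>

lemma sandwich_incr2:
  assumes st: "0 \<le> s" "s < t" and X: "X \<in> sandwiches s" and Y: "Y \<in> sandwiches s"
  defines "D \<equiv> W t - W s"
  shows "\<tau> (X o\<^sub>L (D o\<^sub>L (Y o\<^sub>L D))) = \<tau> X * \<tau> Y * of_real (t - s)"
proof -
  obtain x us y where X: "X = x o\<^sub>L (wprod us o\<^sub>L y)" "x \<in> algW s" "y \<in> algW s" "good_word s us"
    using X by (auto simp: sandwiches_def)
  obtain x' vs y' where Y: "Y = x' o\<^sub>L (wprod vs o\<^sub>L y')" "x' \<in> algW s" "y' \<in> algW s" "good_word s vs"
    using Y by (auto simp: sandwiches_def)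
  have D: "D \<in> A" "D \<in> algW_all" using incr_in incr_in_algW_all st by (auto simp: D_def)
  have xA: "x \<in> A" "y \<in> A" "x \<in> algW_all" "y \<in> algW_all" using X alg_mem by auto
  have yA: "x' \<in> A" "y' \<in> A" "x' \<in> algW_all" "y' \<in> algW_all" using Y alg_mem by auto
  interpret B: vn_alg algW_all by unfold_locales (rule alg_vn)
  interpret Bs: vn_alg "algW s" by unfold_locales (rule alg_vn)
  note inA = xA yA D good_word_in[OF X(4)] good_word_in[OF Y(4)]
  define b where "b = y o\<^sub>L (D o\<^sub>L x')"
  define c where "c = y' o\<^sub>L (D o\<^sub>L x)"
  have bc: "b \<in> algW_all" "c \<in> algW_all" unfolding b_def c_def by (intro B.comp_in D xA yA)+
  have bcA: "b \<in> A" "c \<in> A" using bc alg_mem by auto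
  have "\<tau> b = \<tau> ((x' o\<^sub>L y) o\<^sub>L D)"
    using tr_comm[of "y o\<^sub>L D" x'] inA by (simp add: b_def ops_in blinfun_compose_assoc)
  then have b0: "\<tau> b = 0" using algW_incr[OF st, of "x' o\<^sub>L y"] X Y by (simp add: D_def Bs.comp_in)
  have "\<tau> c = \<tau> ((x o\<^sub>L y') o\<^sub>L D)"
    using tr_comm[of "y' o\<^sub>L D" x] inA by (simp add: c_def ops_in blinfun_compose_assoc)
  then have c0: "\<tau> c = 0" using algW_incr[OF st, of "x o\<^sub>L y'"] X Y by (simp add: D_def Bs.comp_in)
  have *: "\<tau> (X o\<^sub>L (D o\<^sub>L (Y o\<^sub>L D))) = \<tau> (wprod us o\<^sub>L (b o\<^sub>L (wprod vs o\<^sub>L c)))"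
    using tr_comm[of x "wprod us o\<^sub>L (y o\<^sub>L (D o\<^sub>L (Y o\<^sub>L D)))"] inA
    by (simp add: X(1) Y(1) b_def c_def ops_in blinfun_compose_assoc)
  consider "us \<noteq> []" "vs \<noteq> []" | "us \<noteq> []" "vs = []" | "us = []" "vs \<noteq> []" | "us = []" "vs = []" by blast
  then show ?thesis
  proof cases
    case 1
    then show ?thesis unfolding * using word_tr2[OF X(4) 1(1) Y(4) 1(2) bc(1) b0 bc(2) c0]
      sandwich_tr[OF X(2-4)] by (simp add: X(1))
  next
    case 2
    then show ?thesis unfolding * using word_tr[OF X(4) 2(1) B.comp_in[OF bc]]
      sandwich_tr[OF X(2-4)] by (simp add: X(1))
  next
    case 3
    have "\<tau> (b o\<^sub>L (wprod vs o\<^sub>L c)) = \<tau> (wprod vs o\<^sub>L (c o\<^sub>L b))"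
      using tr_comm[of b "wprod vs o\<^sub>L c"] inA bcA by (simp add: ops_in blinfun_compose_assoc)
    then show ?thesis unfolding * using 3 word_tr[OF Y(4) 3(2) B.comp_in[OF bc(2,1)]]
      sandwich_tr[OF Y(2-4)] by (simp add: Y(1))
  next
    case 4
    then have "X = x o\<^sub>L y" "Y = x' o\<^sub>L y'" by (simp_all add: X(1) Y(1))
    then show ?thesis unfolding D_def
      using algW_incr2[OF st, of X Y] X(2,3) Y(2,3) by (simp add: Bs.comp_in)
  qed
qed

text \<open>Induction by appending one letter on the right. A letter of \<open>algW s\<close> is
  absorbed by the right outer factor; a letter of \<open>alg0\<close> has to be centred and either
  extends the word or merges with its last letter.\<close>

lemma op_prod_sandwich:
  assumes "set Xs \<subseteq> alg0 \<union> algW s"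
  shows "op_prod Xs \<in> op_span (sandwiches s)"
  using assms
proof (induction Xs rule: rev_induct)
  case Nil
  interpret Bs: vn_alg "algW s" by unfold_locales (rule alg_vn)
  have "id_blinfun \<in> sandwiches s"
    unfolding sandwiches_def
    by (intro CollectI exI[of _ id_blinfun] exI[of _ "[]"]) (simp add: good_word_def Bs.id_in)
  then show ?case by (simp add: op_span_base)
next
  case (snoc Z Xs)
  interpret A0: vn_alg alg0 by unfold_locales (rule alg_vn)
  interpret Bs: vn_alg "algW s" by unfold_locales (rule alg_vn)
  have Z: "Z \<in> alg0 \<or> Z \<in> algW s" and ZA: "Z \<in> A" using snoc.prems alg_mem by auto
  have SI: "x o\<^sub>L (wprod us o\<^sub>L y) \<in> sandwiches s" if "x \<in> algW s" "y \<in> algW s" "good_word s us" for x us y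
    using that unfolding sandwiches_def by blast
  have base: "X o\<^sub>L Z \<in> op_span (sandwiches s)" if XS: "X \<in> sandwiches s" for X
  proof -
    obtain x us y where X: "X = x o\<^sub>L (wprod us o\<^sub>L y)" "x \<in> algW s" "y \<in> algW s" "good_word s us"
      using XS by (auto simp: sandwiches_def)
    have xA: "x \<in> A" "y \<in> A" using X alg_mem by auto
    have xb: "x \<in> bounded_ops" "wprod us \<in> bounded_ops" using xA good_word_in[OF X(4)] in_bounded_ops by auto
    from Z show ?thesis
    proof
      assume "Z \<in> algW s"
      then show ?thesis using SI[OF X(2) Bs.comp_in[OF X(3)] X(4)]
        by (simp add: X(1) blinfun_compose_assoc op_span_base)
    next
      assume Z0: "Z \<in> alg0"
      have cZ: "cent Z \<in> alg0" "\<tau> (cent Z) = 0" using cent_in[OF alg_vn(1) Z0] ZA by auto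
      have cy: "cent y \<in> algW s" "\<tau> (cent y) = 0" using cent_in[OF alg_vn(2) X(3)] xA by auto
      text \<open>Splitting off the mean of \<open>y\<close> leaves a good word times \<open>cent y\<close>, or a good word alone.\<close>
      have e1: "x o\<^sub>L (wprod us o\<^sub>L (cent y o\<^sub>L cent Z)) \<in> op_span (sandwiches s)"
      proof (cases "us = []")
        case True
        have "good_word s [(True, cent Z)]" using cZ by (simp add: good_word_def)
        from SI[OF Bs.comp_in[OF X(2) cy(1)] Bs.id_in this] show ?thesis
          using True by (simp add: blinfun_compose_assoc op_span_base)
      next
        case False
        have "good_word s (us @ [(False, cent y), (True, cent Z)])"
          using X(4) False cZ cy by (auto simp: good_word_def distinct_adj_append_iff last_map)
        from SI[OF X(2) Bs.id_in this] show ?thesis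
          by (simp add: blinfun_compose_assoc op_span_base)
      qed
      have e2: "x o\<^sub>L (wprod us o\<^sub>L cent y) \<in> op_span (sandwiches s)"
        using SI[OF X(2) cy(1) X(4)] by (rule op_span_base)
      have e3: "x o\<^sub>L (wprod us o\<^sub>L Z) \<in> op_span (sandwiches s)"
      proof (cases us rule: rev_cases)
        case Nil
        have "good_word s [(True, cent Z)]" using cZ by (simp add: good_word_def)
        from SI[OF X(2) Bs.id_in this] have "x o\<^sub>L cent Z \<in> op_span (sandwiches s)"
          by (simp add: op_span_base)
        moreover have "x \<in> op_span (sandwiches s)"
          using SI[OF X(2) Bs.id_in, of "[]"] by (simp add: good_word_def op_span_base)
        ultimately have "(x o\<^sub>L cent Z) + (scalar_op (\<tau> Z) o\<^sub>L x) \<in> op_span (sandwiches s)"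
          by (intro op_span_add op_span_scalar)
        also have "(x o\<^sub>L cent Z) + (scalar_op (\<tau> Z) o\<^sub>L x) = x o\<^sub>L Z"
          using scalar_op_comm[OF xb(1)] by (subst (3) cent_split[of Z]) (simp add: comp_add_right)
        finally show ?thesis using Nil by simp
      next
        case (snoc us' p)
        then obtain a where p: "p = (True, a)" using X(4) by (cases p) (auto simp: good_word_def)
        have a: "a \<in> alg0" "\<tau> a = 0" using good_wordD[OF X(4), of True a] snoc p by auto
        \<comment> \<open>With the mean of \<open>y\<close> in place of \<open>y\<close>, the new
          letter \<open>Z\<close> touches the last letter \<open>a\<close> of the word. Their
          product replaces \<open>a\<close> once it is centred.\<close>
        define d where "d = a o\<^sub>L Z"
        have d: "d \<in> alg0" "d \<in> A" unfolding d_def using A0.comp_in[OF a(1) Z0] alg_mem by auto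
        have cd: "cent d \<in> alg0" "\<tau> (cent d) = 0" using cent_in[OF alg_vn(1) d(1)] d by auto
        have "good_word s (us' @ [(True, cent d)])"
          using X(4) cd unfolding snoc p by (auto simp: good_word_def distinct_adj_append_iff) (cases us'; simp)+
        from SI[OF X(2) Bs.id_in this]
        have f1: "x o\<^sub>L (wprod us' o\<^sub>L cent d) \<in> op_span (sandwiches s)"
          by (simp add: blinfun_compose_assoc op_span_base)
        \<comment> \<open>The mean of \<open>d\<close> leaves the word without its last letter. What
          remains ends in a letter \<open>b\<close> of \<open>algW s\<close>, which becomes the
          right outer factor.\<close>
        have f2: "x o\<^sub>L wprod us' \<in> op_span (sandwiches s)"
        proof (cases us' rule: rev_cases)
          case Nil
          then show ?thesis using SI[OF X(2) Bs.id_in, of "[]"] by (simp add: good_word_def op_span_base)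
        next
          case (snoc us'' q)
          then obtain b where q: "q = (False, b)"
            using X(4) \<open>us = us' @ [p]\<close> p by (cases q) (auto simp: good_word_def distinct_adj_append_iff)
          have b: "b \<in> algW s" using good_wordD[OF X(4), of False b] snoc q \<open>us = us' @ [p]\<close> by auto
          have us: "us = us'' @ [(False, b), (True, a)]" using \<open>us = us' @ [p]\<close> snoc q p by simp
          have "distinct_adj (map fst us'' @ [False, True])" using X(4) by (simp add: good_word_def us)
          then have "distinct_adj (map fst us'')" "us'' \<noteq> [] \<Longrightarrow> last (map fst us'')"
            by (auto simp: distinct_adj_append_iff)
          then have "good_word s us''"
            using X(4) by (auto simp: good_word_def us last_map)
          from SI[OF X(2) b this] show ?thesis using snoc q by (simp add: op_span_base)
        qed
        have "wprod us' \<in> bounded_ops"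
        proof -
          have "set (map snd us') \<subseteq> A"
          proof
            fix Y assume "Y \<in> set (map snd us')"
            then obtain i where "(i, Y) \<in> set us" using \<open>us = us' @ [p]\<close> by force
            from good_wordD[OF X(4) this] show "Y \<in> A" using alg_mem by (cases i) auto
          qed
          then show ?thesis using op_prod_in in_bounded_ops by blast
        qed
        then have comm: "x o\<^sub>L wprod us' \<in> bounded_ops" using xb by (intro comp_bounded_ops)
        have "(x o\<^sub>L (wprod us' o\<^sub>L cent d)) + (scalar_op (\<tau> d) o\<^sub>L (x o\<^sub>L wprod us')) \<in> op_span (sandwiches s)"
          by (intro op_span_add op_span_scalar f1 f2)
        also have "(x o\<^sub>L (wprod us' o\<^sub>L cent d)) + (scalar_op (\<tau> d) o\<^sub>L (x o\<^sub>L wprod us')) = x o\<^sub>L (wprod us' o\<^sub>L (cent d + scalar_op (\<tau> d)))"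
          using scalar_op_comm[OF comm] by (simp add: comp_add_right blinfun_compose_assoc)
        also have "\<dots> = x o\<^sub>L (wprod us o\<^sub>L Z)"
          unfolding cent_split[symmetric] by (simp add: d_def snoc p blinfun_compose_assoc)
        finally show ?thesis .
      qed
      have "X o\<^sub>L Z = ((x o\<^sub>L (wprod us o\<^sub>L (cent y o\<^sub>L cent Z))) + (scalar_op (\<tau> Z) o\<^sub>L (x o\<^sub>L (wprod us o\<^sub>L cent y)))) + (scalar_op (\<tau> y) o\<^sub>L (x o\<^sub>L (wprod us o\<^sub>L Z)))"
        using xb in_bounded_ops[OF xA(2)] unfolding X(1)
        by (auto intro!: blinfun_eqI simp: bounded_opsD cent_def blinfun.add_left
            blinfun.add_right blinfun.diff_left blinfun.diff_right scaleC_add_right scaleC_diff_right scaleC_scaleC mult.commute)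
      then show ?thesis using e1 e2 e3 by (simp add: op_span_add op_span_scalar)
    qed
  qed
  have "X o\<^sub>L Z \<in> op_span (sandwiches s)" if "X \<in> op_span (sandwiches s)" for X
    using that
  proof (induction rule: op_span.induct)
    case (op_span_step X Y c)
    have "((scalar_op c o\<^sub>L X) + Y) o\<^sub>L Z = (scalar_op c o\<^sub>L (X o\<^sub>L Z)) + (Y o\<^sub>L Z)"
      by (simp add: comp_add_left blinfun_compose_assoc)
    then show ?case using op_span_step base by (simp only: op_span_add op_span_scalar)
  qed (simp add: op_span_zero)
  then show ?case using snoc by (simp add: blinfun_compose_assoc)
qed

end


section \<open>From words to the generated von Neumann algebra\<close>

context free_bm
begin

definition words_alg :: "real \<Rightarrow> ('h \<Rightarrow>\<^sub>L 'h) set" where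
  "words_alg s = op_span {op_prod Xs | Xs. set Xs \<subseteq> alg0 \<union> algW s}"

lemma op_span_mono: "X \<in> op_span S \<Longrightarrow> (\<And>Y. Y \<in> S \<Longrightarrow> Y \<in> op_span T) \<Longrightarrow> X \<in> op_span T"
  by (induction rule: op_span.induct) (auto intro: op_span_zero op_span_add op_span_scalar)

lemma words_alg_sandwiches: "X \<in> words_alg s \<Longrightarrow> X \<in> op_span (sandwiches s)"
  unfolding words_alg_def by (erule op_span_mono) (use op_prod_sandwich in blast)

lemma words_in: "set Xs \<subseteq> alg0 \<union> algW s \<Longrightarrow> op_prod Xs \<in> A"
  by (rule op_prod_in) (use alg_mem in blast)

lemma words_alg_subset: "words_alg s \<subseteq> A"
  unfolding words_alg_def using op_span_in[of "{op_prod Xs | Xs. set Xs \<subseteq> alg0 \<union> algW s}"] words_in by blast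

lemma words_alg_comp: "X \<in> words_alg s \<Longrightarrow> Y \<in> words_alg s \<Longrightarrow> X o\<^sub>L Y \<in> words_alg s"
  unfolding words_alg_def
proof (induction rule: op_span.induct)
  case (op_span_step X X' c)
  then obtain Xs where Xs: "X = op_prod Xs" "set Xs \<subseteq> alg0 \<union> algW s" by blast
  have "X o\<^sub>L Y \<in> op_span {op_prod Xs | Xs. set Xs \<subseteq> alg0 \<union> algW s}"
    using op_span_step.prems
  proof (induction rule: op_span.induct)
    case (op_span_step Y Y' d)
    then obtain Ys where Ys: "Y = op_prod Ys" "set Ys \<subseteq> alg0 \<union> algW s" by blast
    have "X o\<^sub>L Y = op_prod (Xs @ Ys)" "set (Xs @ Ys) \<subseteq> alg0 \<union> algW s" using Xs Ys by auto
    then have "X o\<^sub>L Y \<in> op_span {op_prod Xs | Xs. set Xs \<subseteq> alg0 \<union> algW s}" by (intro op_span_base) blast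
    moreover have "X o\<^sub>L ((scalar_op d o\<^sub>L Y) + Y') = (scalar_op d o\<^sub>L (X o\<^sub>L Y)) + (X o\<^sub>L Y')"
      using scalar_op_comm[OF in_bounded_ops[OF words_in[OF Xs(2)]], of d] Xs(1)
      by (simp add: comp_add_right) (metis blinfun_compose_assoc)
    ultimately show ?case using op_span_step.IH by (simp add: op_span_add op_span_scalar)
  qed (simp add: op_span_zero)
  then show ?case using op_span_step by (simp add: comp_add_left blinfun_compose_assoc op_span_add op_span_scalar)
qed (simp add: op_span_zero)

lemma words_alg_adj: "X \<in> words_alg s \<Longrightarrow> op_adj X \<in> words_alg s"
  unfolding words_alg_def
proof (induction rule: op_span.induct)
  case (op_span_step X Y c)
  then obtain Xs where Xs: "X = op_prod Xs" "set Xs \<subseteq> alg0 \<union> algW s" by blast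
  have a: "op_adj (op_prod Xs) = op_prod (rev (map op_adj Xs)) \<and> set (map op_adj Xs) \<subseteq> alg0 \<union> algW s"
    using Xs(2)
  proof (induction Xs)
    case (Cons Z Xs)
    have "op_adj Z \<in> alg0 \<union> algW s"
      using Cons.prems vn_alg.adj_in[OF vn_alg.intro[OF alg_vn(1)]] vn_alg.adj_in[OF vn_alg.intro[OF alg_vn(2)]] by auto
    moreover have "Z \<in> A" "op_prod Xs \<in> A" using Cons.prems alg_mem words_in by auto
    ultimately show ?case using Cons by (simp add: op_adj_comp in_bounded_ops)
  qed simp
  have "op_adj X \<in> op_span {op_prod Xs | Xs. set Xs \<subseteq> alg0 \<union> algW s}"
    unfolding Xs(1) using a by (intro op_span_base CollectI exI[of _ "rev (map op_adj Xs)"]) auto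
  moreover have XY: "X \<in> A" "Y \<in> A"
    using words_in Xs subsetD[OF words_alg_subset[unfolded words_alg_def] op_span_step.hyps(2)] by auto
  moreover from this have "op_adj ((scalar_op c o\<^sub>L X) + Y) = (scalar_op (cnj c) o\<^sub>L op_adj X) + op_adj Y"
    using scalar_op_comm[OF in_bounded_ops[OF adj_in]]
    by (simp add: op_adj_add op_adj_comp in_bounded_ops scalar_comp_in)
  ultimately show ?case using op_span_step.IH by (simp add: op_span_add op_span_scalar)
qed (simp add: op_span_zero)

lemma words_alg_gen:
  assumes "Z \<in> alg0 \<union> algW s"
  shows "Z \<in> words_alg s"
proof -
  have "op_prod [Z] \<in> op_span {op_prod Xs | Xs. set Xs \<subseteq> alg0 \<union> algW s}"
    by (intro op_span_base CollectI exI[of _ "[Z]"]) (use assms in auto)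
  then show ?thesis by (simp add: words_alg_def)
qed

text \<open>\<open>words_alg s\<close> is a unital *-algebra containing the generators of
  \<open>F s\<close>, so \<open>vn_generated_L2_dense\<close> applies to it.\<close>

lemma io_past_dense:
  assumes "X \<in> F s"
  shows "\<iota> X \<in> closure (\<iota> ` words_alg s)"
proof (rule vn_generated_L2_dense)
  show "words_alg s \<subseteq> A" by (rule words_alg_subset)
  show "id_blinfun \<in> words_alg s"
    by (rule words_alg_gen) (use vn_alg.id_in[OF vn_alg.intro[OF alg_vn(1)]] in blast)
  show "\<And>S T. S \<in> words_alg s \<Longrightarrow> T \<in> words_alg s \<Longrightarrow> S + T \<in> words_alg s"
    unfolding words_alg_def by (rule op_span_add)
  show "\<And>c T. T \<in> words_alg s \<Longrightarrow> scalar_op c o\<^sub>L T \<in> words_alg s"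
    unfolding words_alg_def by (rule op_span_scalar)
  have "insert U0 (W ` {0..s}) \<subseteq> words_alg s"
    using words_alg_gen vn_generated_superset[of "{U0}"] vn_generated_superset[of "W ` {0..s}"] by auto
  also have "\<dots> \<subseteq> vn_generated (words_alg s)" by (rule vn_generated_superset)
  finally have "F s \<subseteq> vn_generated (words_alg s)"
    unfolding past_def using words_alg_subset in_bounded_ops
    by (intro vn_generated_least vn_generated_vn) auto
  then show "X \<in> vn_generated (words_alg s)" using assms by blast
qed (fact words_alg_comp words_alg_adj)+

text \<open>For fixed \<open>Z\<close> the trace \<open>\<tau> (Z o\<^sub>L X)\<close> is the inner
  product of \<open>\<iota> (op_adj Z)\<close> with \<open>\<iota> X\<close>. It is thus linear and
  L^2-continuous in \<open>X\<close>, and sandwiches span a dense subspace of the past.\<close>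

lemma past_tr_ext:
  assumes Z: "Z \<in> A" "Z' \<in> A" and eq: "\<And>X. X \<in> sandwiches s \<Longrightarrow> \<tau> (Z o\<^sub>L X) = \<tau> (Z' o\<^sub>L X)" and X: "X \<in> F s"
  shows "\<tau> (Z o\<^sub>L X) = \<tau> (Z' o\<^sub>L X)"
proof -
  have sA: "sandwiches s \<subseteq> A"
    using alg_mem good_word_in by (auto simp: sandwiches_def intro!: comp_in)
  have eq': "\<tau> (Z o\<^sub>L X) = \<tau> (Z' o\<^sub>L X)" if "X \<in> op_span (sandwiches s)" for X
    using that
  proof (induction rule: op_span.induct)
    case (op_span_step X Y c)
    have "X \<in> A" "Y \<in> A" using op_span_step.hyps sA op_span_in[OF sA] by auto
    then show ?case using op_span_step.IH eq[OF op_span_step.hyps(1)] Z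
      by (simp add: comp_add_right tr_add tr_comp_scalar ops_in)
  qed simp
  have tr: "\<tau> (Z o\<^sub>L X) = cinner (\<iota> (op_adj Z)) (\<iota> X)" if "X \<in> A" "Z \<in> A" for X Z
    using that by (simp add: io_inner adj_in in_bounded_ops)
  have "closure (\<iota> ` words_alg s) \<subseteq> {\<xi>. cinner (\<iota> (op_adj Z)) \<xi> = cinner (\<iota> (op_adj Z')) \<xi>}"
  proof (rule closure_minimal)
    show "closed {\<xi>. cinner (\<iota> (op_adj Z)) \<xi> = cinner (\<iota> (op_adj Z')) \<xi>}"
      by (intro closed_Collect_eq continuous_intros)
    show "\<iota> ` words_alg s \<subseteq> {\<xi>. cinner (\<iota> (op_adj Z)) \<xi> = cinner (\<iota> (op_adj Z')) \<xi>}"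
      using words_alg_sandwiches words_alg_subset eq' tr Z by fastforce
  qed
  then show ?thesis using io_past_dense[OF X] tr Z F_in[OF X] by auto
qed

lemma past_incr:
  assumes st: "0 \<le> s" "s \<le> t" and X: "X \<in> F s"
  shows "\<tau> (X o\<^sub>L (W t - W s)) = 0"
proof (cases "s = t")
  case False
  then have st': "0 \<le> s" "s < t" using st by auto
  have D: "W t - W s \<in> A" using incr_in st by auto
  have sA: "X \<in> A" if "X \<in> sandwiches s" for X
    using that alg_mem good_word_in by (auto simp: sandwiches_def intro!: comp_in)
  have "\<tau> ((W t - W s) o\<^sub>L X) = \<tau> (0 o\<^sub>L X)"
    by (rule past_tr_ext[OF D zero_in _ X])
       (use sandwich_incr[OF st'] tr_comm[OF D] sA in \<open>auto simp: tr_zero\<close>)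
  then show ?thesis using tr_comm[OF D] F_in[OF X] by (simp add: tr_zero)
qed (simp add: tr_zero)

text \<open>One factor at a time: first \<open>X\<close> is extended from sandwiches to
  \<open>F s\<close> with \<open>Y\<close> a sandwich, then \<open>Y\<close>. In each stage
  traciality moves the variable factor to the end, where \<open>past_tr_ext\<close>
  operates.\<close>

lemma past_incr2:
  assumes st: "0 \<le> s" "s \<le> t" and X: "X \<in> F s" and Y: "Y \<in> F s"
  defines "D \<equiv> W t - W s"
  shows "\<tau> (X o\<^sub>L (D o\<^sub>L (Y o\<^sub>L D))) = \<tau> X * \<tau> Y * of_real (t - s)"
proof (cases "s = t")
  case False
  then have st': "0 \<le> s" "s < t" using st by auto
  have D: "D \<in> A" unfolding D_def using incr_in st by auto
  have sA: "X \<in> A" if "X \<in> sandwiches s" for X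
    using that alg_mem good_word_in by (auto simp: sandwiches_def intro!: comp_in)
  have sc: "\<tau> (scalar_op c o\<^sub>L X) = c * \<tau> X" if "X \<in> A" for X c using that by (rule tr_scalar)
  have cyc: "\<tau> (X o\<^sub>L (D o\<^sub>L (Y o\<^sub>L D))) = \<tau> ((D o\<^sub>L (Y o\<^sub>L D)) o\<^sub>L X)" if "X \<in> A" "Y \<in> A" for X Y
    using that D by (intro tr_comm comp_in)
  have cyc2: "\<tau> (X o\<^sub>L (D o\<^sub>L (Y o\<^sub>L D))) = \<tau> ((D o\<^sub>L (X o\<^sub>L D)) o\<^sub>L Y)" if "X \<in> A" "Y \<in> A" for X Y
    using that D tr_comm[of "X o\<^sub>L (D o\<^sub>L Y)" D] by (simp add: comp_in blinfun_compose_assoc)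
  have 1: "\<tau> (X o\<^sub>L (D o\<^sub>L (Y o\<^sub>L D))) = \<tau> X * \<tau> Y * of_real (t - s)" if X: "X \<in> F s" and Y: "Y \<in> sandwiches s" for X Y
  proof -
    have "\<tau> ((D o\<^sub>L (Y o\<^sub>L D)) o\<^sub>L X) = \<tau> (scalar_op (\<tau> Y * of_real (t - s)) o\<^sub>L X)"
    proof (rule past_tr_ext[OF _ _ _ X])
      show "D o\<^sub>L (Y o\<^sub>L D) \<in> A" "scalar_op (\<tau> Y * of_real (t - s)) \<in> A" using D sA[OF Y] by (auto intro: ops_in)
      fix X assume X: "X \<in> sandwiches s"
      have "\<tau> ((D o\<^sub>L (Y o\<^sub>L D)) o\<^sub>L X) = \<tau> (X o\<^sub>L (D o\<^sub>L (Y o\<^sub>L D)))" using cyc[OF sA[OF X] sA[OF Y]] by simp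
      also have "\<dots> = \<tau> X * \<tau> Y * of_real (t - s)" unfolding D_def by (rule sandwich_incr2[OF st' X Y])
      finally show "\<tau> ((D o\<^sub>L (Y o\<^sub>L D)) o\<^sub>L X) = \<tau> (scalar_op (\<tau> Y * of_real (t - s)) o\<^sub>L X)"
        using sc[OF sA[OF X]] by simp
    qed
    then show ?thesis using cyc[OF F_in[OF X] sA[OF Y]] sc[OF F_in[OF X]] by simp
  qed
  have "\<tau> ((D o\<^sub>L (X o\<^sub>L D)) o\<^sub>L Y) = \<tau> (scalar_op (\<tau> X * of_real (t - s)) o\<^sub>L Y)"
  proof (rule past_tr_ext[OF _ _ _ Y])
    show "D o\<^sub>L (X o\<^sub>L D) \<in> A" "scalar_op (\<tau> X * of_real (t - s)) \<in> A" using D F_in[OF X] by (auto intro: ops_in)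
    fix Y assume Y: "Y \<in> sandwiches s"
    show "\<tau> ((D o\<^sub>L (X o\<^sub>L D)) o\<^sub>L Y) = \<tau> (scalar_op (\<tau> X * of_real (t - s)) o\<^sub>L Y)"
      using cyc2[OF F_in[OF X] sA[OF Y]] 1[OF X Y] sc[OF sA[OF Y]] by (simp only: mult_ac)
  qed
  then have "\<tau> (X o\<^sub>L (D o\<^sub>L (Y o\<^sub>L D))) = (\<tau> X * of_real (t - s)) * \<tau> Y"
    by (simp only: cyc2[OF F_in[OF X] F_in[OF Y]] sc[OF F_in[OF Y]])
  then show ?thesis by (simp only: mult_ac)
qed (simp add: D_def tr_zero)

section \<open>The Ito covariance\<close>

definition ito :: "('h \<Rightarrow>\<^sub>L 'h) \<Rightarrow> real \<Rightarrow> real \<Rightarrow> ('h \<Rightarrow>\<^sub>L 'h) \<Rightarrow> 'k" where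
  "ito b p q c = \<iota> (b o\<^sub>L (W q - W p) o\<^sub>L c)"

lemma ito_in: "0 \<le> p \<Longrightarrow> 0 \<le> q \<Longrightarrow> b \<in> A \<Longrightarrow> c \<in> A \<Longrightarrow> b o\<^sub>L (W q - W p) o\<^sub>L c \<in> A"
  by (intro comp_in incr_in)

lemma ito_same [simp]: "ito b p p c = 0"
  by (simp add: ito_def io_zero)

lemma ito_split:
  assumes "0 \<le> p" "0 \<le> q" "0 \<le> r" "b \<in> A" "c \<in> A"
  shows "ito b p r c = ito b p q c + ito b q r c"
proof -
  have "b o\<^sub>L (W r - W p) o\<^sub>L c = (b o\<^sub>L (W q - W p) o\<^sub>L c) + (b o\<^sub>L (W r - W q) o\<^sub>L c)"
    by (simp add: comp_add_left[symmetric] comp_add_right[symmetric])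
  then show ?thesis unfolding ito_def using io_add ito_in assms by simp
qed

lemma ito_inner_tr:
  assumes "0 \<le> p" "0 \<le> q" "0 \<le> p'" "0 \<le> q'" "b \<in> A" "c \<in> A" "b' \<in> A" "c' \<in> A"
  shows "cinner (ito b p q c) (ito b' p' q' c') =
     \<tau> ((c' o\<^sub>L op_adj c) o\<^sub>L ((W q - W p) o\<^sub>L ((op_adj b o\<^sub>L b') o\<^sub>L (W q' - W p'))))"
proof -
  have D: "W q - W p \<in> A" "op_adj (W q - W p) = W q - W p" "W q' - W p' \<in> A"
    using sa_diff[OF W_sa W_sa, of q p] incr_in assms sa_partD by auto
  have "op_adj (b o\<^sub>L (W q - W p) o\<^sub>L c) = op_adj c o\<^sub>L ((W q - W p) o\<^sub>L op_adj b)"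
    using D assms by (simp add: op_adj_comp in_bounded_ops ops_in)
  then have "cinner (ito b p q c) (ito b' p' q' c') =
    \<tau> ((op_adj c o\<^sub>L ((W q - W p) o\<^sub>L op_adj b)) o\<^sub>L (b' o\<^sub>L (W q' - W p') o\<^sub>L c'))"
    using assms ito_in by (simp add: ito_def io_inner)
  also have "\<dots> = \<tau> ((op_adj c o\<^sub>L ((W q - W p) o\<^sub>L ((op_adj b o\<^sub>L b') o\<^sub>L (W q' - W p')))) o\<^sub>L c')"
    by (simp add: blinfun_compose_assoc)
  also have "\<dots> = \<tau> (c' o\<^sub>L (op_adj c o\<^sub>L ((W q - W p) o\<^sub>L ((op_adj b o\<^sub>L b') o\<^sub>L (W q' - W p')))))"
    using D assms by (intro tr_comm comp_in adj_in)
  finally show ?thesis by (simp add: blinfun_compose_assoc)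
qed

lemma F_comp: "X \<in> F s \<Longrightarrow> Y \<in> F s \<Longrightarrow> X o\<^sub>L Y \<in> F s"
  and F_adj: "X \<in> F s \<Longrightarrow> op_adj X \<in> F s"
  and F_diff: "X \<in> F s \<Longrightarrow> Y \<in> F s \<Longrightarrow> X - Y \<in> F s"
  using vn_alg.comp_in[OF vn_alg.intro[OF F_vn]] vn_alg.adj_in[OF vn_alg.intro[OF F_vn]]
    vn_alg.diff_in[OF vn_alg.intro[OF F_vn]] by blast+

text \<open>The earlier increment belongs to the past of \<open>p'\<close>, so the trace contains
  the later one only once and \<open>past_incr\<close> gives zero.\<close>

lemma ito_disjoint:
  assumes "0 \<le> p" "p \<le> q" "q \<le> p'" "p' \<le> q'" "b \<in> F p'" "c \<in> F p'" "b' \<in> F p'" "c' \<in> F p'"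
  shows "cinner (ito b p q c) (ito b' p' q' c') = 0"
proof -
  have "W q - W p \<in> F p'" using W_in_F assms by (intro F_diff) auto
  then have "\<tau> (((c' o\<^sub>L op_adj c) o\<^sub>L ((W q - W p) o\<^sub>L (op_adj b o\<^sub>L b'))) o\<^sub>L (W q' - W p')) = 0"
    using assms by (intro past_incr F_comp F_adj) auto
  then show ?thesis using assms F_in by (subst ito_inner_tr) (auto simp: blinfun_compose_assoc)
qed

lemma ito_same_interval:
  assumes "0 \<le> p" "p \<le> q" "b \<in> F p" "c \<in> F p" "b' \<in> F p" "c' \<in> F p"
  shows "cinner (ito b p q c) (ito b' p q c') = of_real (q - p) * (cinner (\<iota> b) (\<iota> b') * cinner (\<iota> c) (\<iota> c'))"
proof -
  have "cinner (ito b p q c) (ito b' p q c') = \<tau> (c' o\<^sub>L op_adj c) * \<tau> (op_adj b o\<^sub>L b') * of_real (q - p)"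
    using assms F_in past_incr2[OF assms(1,2), of "c' o\<^sub>L op_adj c" "op_adj b o\<^sub>L b'"]
    by (subst ito_inner_tr) (auto simp: F_comp F_adj)
  then show ?thesis using assms F_in adj_in tr_comm[of c' "op_adj c"] by (simp add: io_inner)
qed

text \<open>Both intervals are cut at the later left end and the earlier right end. Pieces outside
  the overlap are orthogonal to the other integral, and the overlap contributes its length.\<close>

lemma ito_cov_aux:
  assumes pq: "0 \<le> p" "p \<le> q" "p \<le> p'" "p' \<le> q'" and "b \<in> F p" "c \<in> F p" "b' \<in> F p'" "c' \<in> F p'"
  shows "cinner (ito b p q c) (ito b' p' q' c') =
    of_real (max 0 (min q q' - max p p')) * (cinner (\<iota> b) (\<iota> b') * cinner (\<iota> c) (\<iota> c'))"
proof -
  have F': "b \<in> F p'" "c \<in> F p'" using F_mono[of p p'] assms by auto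
  note inF = F' assms(5-8)
  have inA: "b \<in> A" "c \<in> A" "b' \<in> A" "c' \<in> A" using inF F_in by auto
  show ?thesis
  proof (cases "q \<le> p'")
    case True
    then show ?thesis using ito_disjoint[OF pq(1,2) True pq(4) inF(1,2,5,6)] pq by simp
  next
    case False
    have 1: "cinner (ito b p q c) (ito b' p' q' c') = cinner (ito b p' q c) (ito b' p' q' c')"
      using ito_split[of p p' q b c] ito_disjoint[OF pq(1) pq(3) order_refl pq(4) inF(1,2,5,6)] pq False inA
      by (simp add: cinner_add_left)
    show ?thesis
    proof (cases "q \<le> q'")
      case True
      have "cinner (ito b p' q c) (ito b' q q' c') = 0"
        using pq False True F_mono[of p' q] inF by (intro ito_disjoint) auto
      then have "cinner (ito b p' q c) (ito b' p' q' c') = cinner (ito b p' q c) (ito b' p' q c')"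
        using ito_split[of p' q q' b' c'] pq False inA by (simp add: cinner_add_right)
      also have "\<dots> = of_real (q - p') * (cinner (\<iota> b) (\<iota> b') * cinner (\<iota> c) (\<iota> c'))"
        using pq False inF by (intro ito_same_interval) auto
      finally show ?thesis using 1 pq False True by simp
    next
      case F2: False
      have "cinner (ito b' p' q' c') (ito b q' q c) = 0"
        using pq False F2 F_mono[of p' q'] inF by (intro ito_disjoint) auto
      then have "cinner (ito b q' q c) (ito b' p' q' c') = 0" by (metis cinner_commute complex_cnj_zero)
      then have "cinner (ito b p' q c) (ito b' p' q' c') = cinner (ito b p' q' c) (ito b' p' q' c')"
        using ito_split[of p' q' q b c] pq False inA by (simp add: cinner_add_left)
      also have "\<dots> = of_real (q' - p') * (cinner (\<iota> b) (\<iota> b') * cinner (\<iota> c) (\<iota> c'))"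
        using pq False inF by (intro ito_same_interval) auto
      finally show ?thesis using 1 pq False F2 by simp
    qed
  qed
qed

lemma ito_cov:
  assumes pq: "0 \<le> p" "p \<le> q" "0 \<le> p'" "p' \<le> q'" and "b \<in> F p" "c \<in> F p" "b' \<in> F p'" "c' \<in> F p'"
  shows "cinner (ito b p q c) (ito b' p' q' c') =
    of_real (max 0 (min q q' - max p p')) * (cinner (\<iota> b) (\<iota> b') * cinner (\<iota> c) (\<iota> c'))"
proof (cases "p \<le> p'")
  case True
  then show ?thesis using assms by (intro ito_cov_aux)
next
  case False
  have "cinner (ito b p q c) (ito b' p' q' c') = cnj (cinner (ito b' p' q' c') (ito b p q c))"
    by (rule cinner_commute)
  also have "\<dots> = cnj (of_real (max 0 (min q' q - max p' p)) * (cinner (\<iota> b') (\<iota> b) * cinner (\<iota> c') (\<iota> c)))"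
    using assms False by (subst ito_cov_aux) auto
  also have "\<dots> = of_real (max 0 (min q q' - max p p')) * (cinner (\<iota> b) (\<iota> b') * cinner (\<iota> c) (\<iota> c'))"
    by (simp add: cinner_commute[symmetric] min.commute max.commute)
  finally show ?thesis .
qed

end


section \<open>The free stochastic integral\<close>

lemma simple_adaptedD:
  assumes "simple_adapted F T n p b"
  shows "p 0 = 0" "p n = T" "k < n \<Longrightarrow> p k < p (Suc k)" "k < n \<Longrightarrow> b (p k) \<in> F (p k)"
    "k < n \<Longrightarrow> p k \<le> r \<Longrightarrow> r < p (Suc k) \<Longrightarrow> b r = b (p k)"
  using assms unfolding simple_adapted_def Ball_def atLeastLessThan_iff by blast+

lemma partition_mono:
  fixes p :: "nat \<Rightarrow> real"
  assumes "\<And>k. k < n \<Longrightarrow> p k < p (Suc k)"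
  shows "i \<le> j \<Longrightarrow> j \<le> n \<Longrightarrow> p i \<le> p j"
proof (induction j)
  case (Suc j)
  then show ?case using assms[of j] by (cases "i = Suc j") auto
qed simp

lemma partition_cover:
  fixes p :: "nat \<Rightarrow> real"
  assumes "\<And>k. k < n \<Longrightarrow> p k < p (Suc k)" "p 0 \<le> r" "r < p n"
  shows "\<exists>k<n. p k \<le> r \<and> r < p (Suc k)"
  using assms
proof (induction n)
  case (Suc n)
  then show ?case by (cases "r < p n") (auto intro: less_SucI)
qed simp

lemma partition_cover_unique:
  fixes p :: "nat \<Rightarrow> real"
  assumes "\<And>k. k < n \<Longrightarrow> p k < p (Suc k)" "k < n" "p k \<le> r" "r < p (Suc k)" "j < n" "p j \<le> r" "r < p (Suc j)"
  shows "j = k"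
proof (rule ccontr)
  assume "j \<noteq> k"
  then consider "Suc j \<le> k" | "Suc k \<le> j" by linarith
  then show False
    using partition_mono[where n = n and p = p, OF assms(1), of "Suc j" k] partition_mono[where n = n and p = p, OF assms(1), of "Suc k" j] assms(2-7)
    by cases auto
qed

lemma has_free_integralE:
  assumes "has_free_integral \<iota> W F T b c \<xi>"
  obtains n p bs cs where
    "\<forall>m. simple_adapted F T (n m) (p m) (bs m) \<and> simple_adapted F T (n m) (p m) (cs m)"
    "\<forall>m. (\<lambda>t. tensor_dist_sq (b t) (c t) (\<iota> (bs m t)) (\<iota> (cs m t))) integrable_on {0..T}"
    "(\<lambda>m. integral {0..T} (\<lambda>t. tensor_dist_sq (b t) (c t) (\<iota> (bs m t)) (\<iota> (cs m t)))) \<longlonglongrightarrow> 0"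
    "(\<lambda>m. \<iota> (simple_integral W (n m) (p m) (bs m) (cs m))) \<longlonglongrightarrow> \<xi>"
  using assms unfolding has_free_integral_def by (elim conjE exE) (rule that)

section \<open>Tensor-valued step functions and their integrals\<close>

context free_bm
begin

abbreviation "L2F t \<equiv> L2_sub \<iota> (F t)"

lemma L2F_mono: "s \<le> t \<Longrightarrow> L2F s \<subseteq> L2F t"
  unfolding L2_sub_def by (intro closure_mono image_mono F_mono)

lemma L2F_mem_mono: "b \<in> L2F s \<Longrightarrow> s \<le> t \<Longrightarrow> b \<in> L2F t"
  using L2F_mono by blast

lemma io_L2F: "X \<in> F t \<Longrightarrow> \<iota> X \<in> L2F t"
  unfolding L2_sub_def by (rule rev_subsetD[OF _ closure_subset]) simp

lemma L2F_closed: "closed (L2F t)"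
  by (simp add: L2_sub_def)

lemma L2F_subspace: "subspace (L2F t)"
proof -
  interpret Ft: vn_alg "F t" by unfold_locales (rule F_vn)
  show ?thesis unfolding L2_sub_def
    by (intro subspace_closure io_subspace F_subset Ft.zero_in Ft.add_in Ft.scaleR_in)
qed

text \<open>A realisation of the Hilbert space tensor product on the past: free increments turn
  \<open>(X, Y) \<mapsto> X \<Delta>W Y\<close> into an isometric copy of it inside the standard representation.\<close>

definition tensor_map :: "real \<Rightarrow> ('k \<Rightarrow> 'k \<Rightarrow> 'k) \<Rightarrow> bool" where
  "tensor_map T \<Phi> \<longleftrightarrow> (\<forall>b\<in>L2F T. \<forall>c\<in>L2F T. \<forall>b'\<in>L2F T. \<forall>c'\<in>L2F T.
     inner (\<Phi> b c) (\<Phi> b' c') = Re (cinner b b' * cinner c c'))"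

lemma tensor_mapD: "tensor_map T \<Phi> \<Longrightarrow> b \<in> L2F T \<Longrightarrow> c \<in> L2F T \<Longrightarrow> b' \<in> L2F T \<Longrightarrow> c' \<in> L2F T \<Longrightarrow>
   inner (\<Phi> b c) (\<Phi> b' c') = Re (cinner b b' * cinner c c')"
  by (simp add: tensor_map_def)

lemma tensor_dist_eq:
  assumes i: "inner u v = Re (cinner b b' * cinner c c')" "inner u u = Re (cinner b b * cinner c c)"
    "inner v v = Re (cinner b' b' * cinner c' c')"
  shows "(norm (u - v))\<^sup>2 = tensor_dist_sq b c b' c'"
proof -
  have "(norm (u - v))\<^sup>2 = inner u u - 2 * inner u v + inner v v"
    using norm_diff_sq[of u v] by (simp only: power2_norm_eq_inner)
  then show ?thesis by (simp only: i tensor_dist_sq_def cinner_same of_real_mult[symmetric] Re_complex_of_real)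
qed

lemma tensor_dist_same: "tensor_dist_sq b c b' c = (norm (b - b'))\<^sup>2 * (norm c)\<^sup>2"
  "tensor_dist_sq b c b c' = (norm b)\<^sup>2 * (norm (c - c'))\<^sup>2"
  by (simp_all add: tensor_dist_sq_def cinner_same norm_diff_sq inner_eq_Re_cinner algebra_simps)

text \<open>On operators the map is an integral over one increment after time \<open>T\<close>. It
  is Lipschitz for the L^2 norms on bounded sets, hence extends along a fixed approximating sequence
  of each vector.\<close>

lemma tensor_map_exists:
  assumes T: "0 \<le> T"
  obtains \<Phi> where "tensor_map T \<Phi>"
proof -
  have "\<exists>x. \<forall>b. b \<in> L2F T \<longrightarrow> (\<forall>n. x b n \<in> F T) \<and> (\<lambda>n. \<iota> (x b n)) \<longlonglongrightarrow> b"
  proof (rule choice, rule allI)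
    fix b
    have "\<exists>y. (\<forall>n. y n \<in> \<iota> ` F T) \<and> y \<longlonglongrightarrow> b" if "b \<in> L2F T"
      using that unfolding L2_sub_def closure_sequential by blast
    then show "\<exists>x. b \<in> L2F T \<longrightarrow> (\<forall>n. x n \<in> F T) \<and> (\<lambda>n. \<iota> (x n)) \<longlonglongrightarrow> b"
    proof (cases "b \<in> L2F T")
      case True
      then obtain y where y: "\<And>n. y n \<in> \<iota> ` F T" "y \<longlonglongrightarrow> b"
        unfolding L2_sub_def closure_sequential by blast
      then have "\<forall>n. \<exists>X. X \<in> F T \<and> y n = \<iota> X" by blast
      then obtain X where "\<And>n. X n \<in> F T \<and> y n = \<iota> (X n)" by metis
      moreover from this have "y = (\<lambda>n. \<iota> (X n))" by auto
      ultimately show ?thesis using y by blast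
    qed simp
  qed
  then obtain x where x: "\<And>b n. b \<in> L2F T \<Longrightarrow> x b n \<in> F T" "\<And>b. b \<in> L2F T \<Longrightarrow> (\<lambda>n. \<iota> (x b n)) \<longlonglongrightarrow> b" by blast
  \<comment> \<open>The interval has length one, so that the variance factor in
    \<open>ito_same_interval\<close> is \<open>1\<close>.\<close>
  define J where "J = (\<lambda>X Y. ito X T (T + 1) Y)"
  have J: "inner (J X Y) (J X' Y') = Re (cinner (\<iota> X) (\<iota> X') * cinner (\<iota> Y) (\<iota> Y'))"
    if "X \<in> F T" "Y \<in> F T" "X' \<in> F T" "Y' \<in> F T" for X Y X' Y'
    using ito_same_interval[of T "T + 1" X Y X' Y'] that T by (simp add: J_def inner_eq_Re_cinner)
  have lip: "norm (J X Y - J X' Y') \<le> norm (\<iota> X - \<iota> X') * norm (\<iota> Y) + norm (\<iota> X') * norm (\<iota> Y - \<iota> Y')"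
    if m: "X \<in> F T" "Y \<in> F T" "X' \<in> F T" "Y' \<in> F T" for X Y X' Y'
  proof -
    have "(norm (J X Y - J X' Y))\<^sup>2 = (norm (\<iota> X - \<iota> X') * norm (\<iota> Y))\<^sup>2"
      using tensor_dist_eq[OF J[OF m(1,2,3,2)] J[OF m(1,2,1,2)] J[OF m(3,2,3,2)]]
      by (simp add: tensor_dist_same power_mult_distrib)
    then have 1: "norm (J X Y - J X' Y) = norm (\<iota> X - \<iota> X') * norm (\<iota> Y)" by (simp add: power2_eq_iff_nonneg)
    have "(norm (J X' Y - J X' Y'))\<^sup>2 = (norm (\<iota> X') * norm (\<iota> Y - \<iota> Y'))\<^sup>2"
      using tensor_dist_eq[OF J[OF m(3,2,3,4)] J[OF m(3,2,3,2)] J[OF m(3,4,3,4)]]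
      by (simp add: tensor_dist_same power_mult_distrib)
    then have 2: "norm (J X' Y - J X' Y') = norm (\<iota> X') * norm (\<iota> Y - \<iota> Y')" by (simp add: power2_eq_iff_nonneg)
    have "J X Y - J X' Y' = (J X Y - J X' Y) + (J X' Y - J X' Y')" by simp
    then show ?thesis using norm_triangle_ineq[of "J X Y - J X' Y" "J X' Y - J X' Y'"] 1 2 by simp
  qed
  have conv: "\<exists>u. (\<lambda>n. J (x b n) (x c n)) \<longlonglongrightarrow> u" if bc: "b \<in> L2F T" "c \<in> L2F T" for b c
  proof -
    have "Bseq (\<lambda>n. \<iota> (x b n))" "Bseq (\<lambda>n. \<iota> (x c n))"
      using x(2) bc by (auto intro!: convergent_imp_Bseq convergentI)
    then obtain K1 K2 where K: "\<And>n. norm (\<iota> (x b n)) \<le> K1" "\<And>n. norm (\<iota> (x c n)) \<le> K2" "K1 > 0" "K2 > 0"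
      unfolding Bseq_def by blast
    have "Cauchy (\<lambda>n. J (x b n) (x c n))"
    proof (rule metric_CauchyI)
      fix e :: real assume e: "e > 0"
      have C: "Cauchy (\<lambda>n. \<iota> (x b n))" "Cauchy (\<lambda>n. \<iota> (x c n))"
        using x(2) bc by (auto intro: LIMSEQ_imp_Cauchy)
      have "e / (2 * K2) > 0" "e / (2 * K1) > 0" using e K by auto
      then obtain N1 N2 where N: "\<And>m n. N1 \<le> m \<Longrightarrow> N1 \<le> n \<Longrightarrow> dist (\<iota> (x b m)) (\<iota> (x b n)) < e / (2 * K2)"
        "\<And>m n. N2 \<le> m \<Longrightarrow> N2 \<le> n \<Longrightarrow> dist (\<iota> (x c m)) (\<iota> (x c n)) < e / (2 * K1)"
        using C by (meson metric_CauchyD)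
      show "\<exists>M. \<forall>m\<ge>M. \<forall>n\<ge>M. dist (J (x b m) (x c m)) (J (x b n) (x c n)) < e"
      proof (intro exI allI impI)
        fix m n assume mn: "max N1 N2 \<le> m" "max N1 N2 \<le> n"
        have "norm (J (x b m) (x c m) - J (x b n) (x c n)) \<le>
          norm (\<iota> (x b m) - \<iota> (x b n)) * norm (\<iota> (x c m)) + norm (\<iota> (x b n)) * norm (\<iota> (x c m) - \<iota> (x c n))"
          using x(1) bc by (intro lip)
        also have "\<dots> \<le> norm (\<iota> (x b m) - \<iota> (x b n)) * K2 + K1 * norm (\<iota> (x c m) - \<iota> (x c n))"
          using K by (intro add_mono mult_left_mono mult_right_mono) auto
        also have "\<dots> < e / (2 * K2) * K2 + K1 * (e / (2 * K1))"
          using N mn K by (intro add_strict_mono mult_strict_right_mono mult_strict_left_mono) (auto simp: dist_norm)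
        also have "\<dots> = e" using K by simp
        finally show "dist (J (x b m) (x c m)) (J (x b n) (x c n)) < e" by (simp add: dist_norm)
      qed
    qed
    then show ?thesis using Cauchy_convergent convergent_def by blast
  qed
  define \<Phi> where "\<Phi> = (\<lambda>b c. lim (\<lambda>n. J (x b n) (x c n)))"
  have \<Phi>: "(\<lambda>n. J (x b n) (x c n)) \<longlonglongrightarrow> \<Phi> b c" if "b \<in> L2F T" "c \<in> L2F T" for b c
    using conv[OF that] limI unfolding \<Phi>_def by blast
  have "tensor_map T \<Phi>"
    unfolding tensor_map_def
  proof (intro ballI)
    fix b c b' c' assume m: "b \<in> L2F T" "c \<in> L2F T" "b' \<in> L2F T" "c' \<in> L2F T"
    have "(\<lambda>n. inner (J (x b n) (x c n)) (J (x b' n) (x c' n))) \<longlonglongrightarrow> inner (\<Phi> b c) (\<Phi> b' c')"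
      by (intro tendsto_intros \<Phi> m)
    moreover have "(\<lambda>n. inner (J (x b n) (x c n)) (J (x b' n) (x c' n))) =
       (\<lambda>n. Re (cinner (\<iota> (x b n)) (\<iota> (x b' n)) * cinner (\<iota> (x c n)) (\<iota> (x c' n))))"
      using J x(1) m by auto
    moreover have "(\<lambda>n. Re (cinner (\<iota> (x b n)) (\<iota> (x b' n)) * cinner (\<iota> (x c n)) (\<iota> (x c' n)))) \<longlonglongrightarrow>
       Re (cinner b b' * cinner c c')"
      by (intro tendsto_intros x(2) m)
    ultimately show "inner (\<Phi> b c) (\<Phi> b' c') = Re (cinner b b' * cinner c c')"
      using LIMSEQ_unique by metis
  qed
  then show ?thesis using that by blast
qed

context
  fixes T \<Phi> assumes \<Phi>: "tensor_map T \<Phi>"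
begin

lemma tensor_dist:
  "b \<in> L2F T \<Longrightarrow> c \<in> L2F T \<Longrightarrow> b' \<in> L2F T \<Longrightarrow> c' \<in> L2F T \<Longrightarrow> (norm (\<Phi> b c - \<Phi> b' c'))\<^sup>2 = tensor_dist_sq b c b' c'"
  by (intro tensor_dist_eq tensor_mapD[OF \<Phi>])

lemma tensor_norm: "b \<in> L2F T \<Longrightarrow> c \<in> L2F T \<Longrightarrow> norm (\<Phi> b c) = norm b * norm c"
proof -
  assume "b \<in> L2F T" "c \<in> L2F T"
  then have "(norm (\<Phi> b c))\<^sup>2 = (norm b * norm c)\<^sup>2"
    using tensor_mapD[OF \<Phi>, of b c b c] by (simp add: power2_norm_eq_inner[of "\<Phi> b c"] cinner_same power_mult_distrib)
  then show ?thesis by (simp add: power2_eq_iff_nonneg)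
qed

lemma tensor_lip:
  assumes m: "b \<in> L2F T" "c \<in> L2F T" "b' \<in> L2F T" "c' \<in> L2F T"
  shows "norm (\<Phi> b c - \<Phi> b' c') \<le> norm (b - b') * norm c + norm b' * norm (c - c')"
proof -
  have "(norm (\<Phi> b c - \<Phi> b' c))\<^sup>2 = (norm (b - b') * norm c)\<^sup>2"
    using tensor_dist[OF m(1,2,3,2)] by (simp add: tensor_dist_same power_mult_distrib)
  then have 1: "norm (\<Phi> b c - \<Phi> b' c) = norm (b - b') * norm c" by (simp add: power2_eq_iff_nonneg)
  have "(norm (\<Phi> b' c - \<Phi> b' c'))\<^sup>2 = (norm b' * norm (c - c'))\<^sup>2"
    using tensor_dist[OF m(3,2,3,4)] by (simp add: tensor_dist_same power_mult_distrib)
  then have 2: "norm (\<Phi> b' c - \<Phi> b' c') = norm b' * norm (c - c')" by (simp add: power2_eq_iff_nonneg)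
  have "\<Phi> b c - \<Phi> b' c' = (\<Phi> b c - \<Phi> b' c) + (\<Phi> b' c - \<Phi> b' c')" by simp
  then show ?thesis using norm_triangle_ineq[of "\<Phi> b c - \<Phi> b' c" "\<Phi> b' c - \<Phi> b' c'"] 1 2 by simp
qed

lemma tensor_dist_sq_le:
  assumes m: "b \<in> L2F T" "c \<in> L2F T" "b' \<in> L2F T" "c' \<in> L2F T"
  shows "tensor_dist_sq b c b' c' \<le> (norm (b - b') * norm c + norm b' * norm (c - c'))\<^sup>2"
  unfolding tensor_dist[OF m, symmetric] by (intro power_mono tensor_lip m) simp

lemma tensor_dist_sq_nonneg:
  assumes m: "b \<in> L2F T" "c \<in> L2F T" "b' \<in> L2F T" "c' \<in> L2F T"
  shows "0 \<le> tensor_dist_sq b c b' c'"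
  unfolding tensor_dist[OF m, symmetric] by simp

text \<open>\<open>elem f x\<close>: the vector \<open>x\<close> is the integral of the tensor-valued step function \<open>f\<close>.\<close>

inductive elem :: "(real \<Rightarrow> 'k) \<Rightarrow> 'k \<Rightarrow> bool" where
  elem_base: "0 \<le> p \<Longrightarrow> p \<le> q \<Longrightarrow> q \<le> T \<Longrightarrow> b \<in> F p \<Longrightarrow> c \<in> F p \<Longrightarrow>
     elem (\<lambda>r. indicat_real {p..<q} r *\<^sub>R \<Phi> (\<iota> b) (\<iota> c)) (ito b p q c)"
| elem_zero: "elem (\<lambda>r. 0) 0"
| elem_add: "elem f x \<Longrightarrow> elem g y \<Longrightarrow> elem (\<lambda>r. f r + g r) (x + y)"
| elem_scale: "elem f x \<Longrightarrow> elem (\<lambda>r. a *\<^sub>R f r) (a *\<^sub>R x)"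

lemma elem_diff: "elem f x \<Longrightarrow> elem g y \<Longrightarrow> elem (\<lambda>r. f r - g r) (x - y)"
  using elem_add[of f x "\<lambda>r. (-1) *\<^sub>R g r" "(-1) *\<^sub>R y"] elem_scale[of g y "-1"] by simp

lemma elem_sum: "(\<And>i. i \<in> I \<Longrightarrow> elem (f i) (x i)) \<Longrightarrow> elem (\<lambda>r. \<Sum>i\<in>I. f i r) (\<Sum>i\<in>I. x i)"
  by (induction I rule: infinite_finite_induct) (auto intro: elem_zero elem_add)

lemma has_integral_interval_overlap:
  assumes "0 \<le> p" "p \<le> q" "q \<le> T" "0 \<le> p'" "p' \<le> q'" "q' \<le> T"
  shows "((\<lambda>r. indicat_real {p..<q} r * indicat_real {p'..<q'} r) has_integral (max 0 (min q q' - max p p'))) {0..T}"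
proof -
  define l u where "l = max p p'" and "u = max (max p p') (min q q')"
  have lu: "l \<le> u" "0 \<le> l" "u \<le> T" using assms by (auto simp: l_def u_def)
  have "((\<lambda>r. 1) has_integral (u - l)) {l..u}" using has_integral_const_real[of "1::real" l u] lu by simp
  then have "((\<lambda>r. if r \<in> {l..u} then 1 else 0) has_integral (u - l)) {0..T}"
    by (subst has_integral_restrict) (use lu in auto)
  then have "((\<lambda>r. indicat_real {p..<q} r * indicat_real {p'..<q'} r) has_integral (u - l)) {0..T}"
  proof (rule has_integral_spike_finite[rotated 2])
    show "finite {l, u}" by simp
    show "indicat_real {p..<q} r * indicat_real {p'..<q'} r = (if r \<in> {l..u} then 1 else 0)" if "r \<in> {0..T} - {l,u}" for r
      using that assms by (auto simp: l_def u_def indicator_def max_def min_def split: if_splits)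
  qed
  moreover have "u - l = max 0 (min q q' - max p p')" by (auto simp: l_def u_def max_def)
  ultimately show ?thesis by simp
qed

text \<open>Both sides are bilinear, so induction over both derivations reduces to two elementary
  integrals. There \<open>ito_cov\<close> and the integral of the product of indicators both give
  the length of the overlap.\<close>

lemma elem_isometry:
  assumes "elem f x" "elem g y"
  shows "((\<lambda>r. inner (f r) (g r)) has_integral inner x y) {0..T}"
  using assms(1)
proof (induction rule: elem.induct)
  case base: (elem_base p q b c)
  show ?case
    using assms(2)
  proof (induction rule: elem.induct)
    case base': (elem_base p' q' b' c')
    have m: "\<iota> b \<in> L2F T" "\<iota> c \<in> L2F T" "\<iota> b' \<in> L2F T" "\<iota> c' \<in> L2F T"
      using base base' by (auto intro!: L2F_mem_mono[OF io_L2F])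
    have "((\<lambda>r. inner (\<Phi> (\<iota> b) (\<iota> c)) (\<Phi> (\<iota> b') (\<iota> c')) * (indicat_real {p..<q} r * indicat_real {p'..<q'} r))
       has_integral inner (\<Phi> (\<iota> b) (\<iota> c)) (\<Phi> (\<iota> b') (\<iota> c')) * max 0 (min q q' - max p p')) {0..T}"
      using base base' by (intro has_integral_mult_right has_integral_interval_overlap) auto
    moreover have "inner (ito b p q c) (ito b' p' q' c') = inner (\<Phi> (\<iota> b) (\<iota> c)) (\<Phi> (\<iota> b') (\<iota> c')) * max 0 (min q q' - max p p')"
      using base base' tensor_mapD[OF \<Phi> m] ito_cov[of p q p' q' b c b' c'] by (simp add: inner_eq_Re_cinner)
    moreover have "(\<lambda>r. inner (indicat_real {p..<q} r *\<^sub>R \<Phi> (\<iota> b) (\<iota> c)) (indicat_real {p'..<q'} r *\<^sub>R \<Phi> (\<iota> b') (\<iota> c'))) =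
       (\<lambda>r. inner (\<Phi> (\<iota> b) (\<iota> c)) (\<Phi> (\<iota> b') (\<iota> c')) * (indicat_real {p..<q} r * indicat_real {p'..<q'} r))"
      by (simp add: mult_ac fun_eq_iff)
    ultimately show ?case by simp
  next
    case (elem_add f x g y)
    then show ?case using has_integral_add by (simp only: inner_add_right) blast
  next
    case (elem_scale f x a)
    from has_integral_mult_right[OF elem_scale.IH, of a] show ?case by (simp only: inner_scaleR_right)
  qed simp
next
  case (elem_add f x g y)
  then show ?case using has_integral_add by (simp only: inner_add_left) blast
next
  case (elem_scale f x a)
  from has_integral_mult_right[OF elem_scale.IH, of a] show ?case by (simp only: inner_scaleR_left)
qed simp

lemma elem_norm:
  assumes "elem f x"
  shows "((\<lambda>r. (norm (f r))\<^sup>2) has_integral (norm x)\<^sup>2) {0..T}"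
  using elem_isometry[OF assms assms] by (simp add: power2_norm_eq_inner)

text \<open>The cells of the partition are half-open, whence the value zero at
  \<open>r = s\<close>.\<close>

lemma simple_elem:
  assumes s: "0 \<le> s" "s \<le> T" and b: "simple_adapted F s n p b" and c: "simple_adapted F s n p c"
  shows "elem (\<lambda>r. if 0 \<le> r \<and> r < s then \<Phi> (\<iota> (b r)) (\<iota> (c r)) else 0) (\<iota> (simple_integral W n p b c))"
proof -
  note p = simple_adaptedD(1,2)[OF b] and bF = simple_adaptedD(4)[OF b] and b_const = simple_adaptedD(5)[OF b]
    and cF = simple_adaptedD(4)[OF c] and c_const = simple_adaptedD(5)[OF c]
  have incr: "\<And>k. k < n \<Longrightarrow> p k < p (Suc k)" by (rule simple_adaptedD(3)[OF b])
  have pk: "0 \<le> p k" "p k \<le> s" if "k \<le> n" for k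
    using partition_mono[of n p 0 k, OF incr] partition_mono[of n p k n, OF incr] that p by auto
  have "elem (\<lambda>r. \<Sum>k<n. indicat_real {p k..<p (Suc k)} r *\<^sub>R \<Phi> (\<iota> (b (p k))) (\<iota> (c (p k)))) (\<Sum>k<n. ito (b (p k)) (p k) (p (Suc k)) (c (p k)))"
  proof (rule elem_sum)
    fix k assume k: "k \<in> {..<n}"
    then show "elem (\<lambda>r. indicat_real {p k..<p (Suc k)} r *\<^sub>R \<Phi> (\<iota> (b (p k))) (\<iota> (c (p k)))) (ito (b (p k)) (p k) (p (Suc k)) (c (p k)))"
      using pk[of k] pk[of "Suc k"] incr[of k] bF[of k] cF[of k] s by (intro elem_base) auto
  qed
  moreover have "(\<Sum>k<n. ito (b (p k)) (p k) (p (Suc k)) (c (p k))) = \<iota> (simple_integral W n p b c)"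
    unfolding simple_integral_def ito_def
    by (rule io_sum[symmetric]) (auto intro!: ito_in pk bF cF intro: F_in)
  moreover have "(\<Sum>k<n. indicat_real {p k..<p (Suc k)} r *\<^sub>R \<Phi> (\<iota> (b (p k))) (\<iota> (c (p k)))) =
      (if 0 \<le> r \<and> r < s then \<Phi> (\<iota> (b r)) (\<iota> (c r)) else 0)" for r
  proof (cases "0 \<le> r \<and> r < s")
    case True
    then obtain k where k: "k < n" "p k \<le> r" "r < p (Suc k)" using partition_cover[of n p r, OF incr] p by auto
    have "(\<Sum>j<n. indicat_real {p j..<p (Suc j)} r *\<^sub>R \<Phi> (\<iota> (b (p j))) (\<iota> (c (p j)))) =
      (\<Sum>j<n. if j = k then \<Phi> (\<iota> (b (p k))) (\<iota> (c (p k))) else 0)"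
    proof (rule sum.cong[OF refl])
      fix j assume j: "j \<in> {..<n}"
      show "indicat_real {p j..<p (Suc j)} r *\<^sub>R \<Phi> (\<iota> (b (p j))) (\<iota> (c (p j))) =
        (if j = k then \<Phi> (\<iota> (b (p k))) (\<iota> (c (p k))) else 0)"
      proof (cases "j = k")
        case True
        then show ?thesis using k(2,3) by simp
      next
        case False
        then have "\<not> (p j \<le> r \<and> r < p (Suc j))"
          using partition_cover_unique[of n p k r j, OF incr k] j by auto
        then show ?thesis using False by simp
      qed
    qed
    then show ?thesis using True k(1) by (simp add: b_const[OF k] c_const[OF k])
  next
    case False
    have "indicat_real {p k..<p (Suc k)} r = 0" if "k < n" for k
      using False pk[of k] pk[of "Suc k"] that by (auto simp: indicator_def)
    then show ?thesis unfolding if_not_P[OF False] by (intro sum.neutral) simp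
  qed
  ultimately show ?thesis by simp
qed

text \<open>The martingale property for step functions: cutting at time \<open>s\<close> changes the
  integral by increments after \<open>s\<close>, and those are orthogonal to the past by
  \<open>past_incr\<close>.\<close>

lemma elem_restrict:
  assumes s: "0 \<le> s" "s \<le> T" and e: "elem f x"
  shows "\<exists>y. elem (\<lambda>r. if r < s then f r else 0) y \<and> (\<forall>Z\<in>F s. inner (\<iota> Z) (x - y) = 0)"
  using e
proof (induction rule: elem.induct)
  case (elem_base p q b c)
  show ?case
  proof (cases "p \<le> s")
    case True
    define q' where "q' = min q s"
    have q': "p \<le> q'" "q' \<le> T" "q' \<le> q" "q' \<le> s" using True elem_base s by (auto simp: q'_def)
    have 1: "elem (\<lambda>r. indicat_real {p..<q'} r *\<^sub>R \<Phi> (\<iota> b) (\<iota> c)) (ito b p q' c)"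
      using elem_base q' by (intro elem.elem_base)
    have 2: "(\<lambda>r. if r < s then indicat_real {p..<q} r *\<^sub>R \<Phi> (\<iota> b) (\<iota> c) else 0) = (\<lambda>r. indicat_real {p..<q'} r *\<^sub>R \<Phi> (\<iota> b) (\<iota> c))"
      by (auto simp: q'_def indicator_def fun_eq_iff)
    have bA: "b \<in> A" "c \<in> A" "b \<in> F s" "c \<in> F s" using elem_base F_in F_mono[OF True] by auto
    have "inner (\<iota> Z) (ito b p q c - ito b p q' c) = 0" if Z: "Z \<in> F s" for Z
    proof -
      have "ito b p q c - ito b p q' c = ito b q' q c"
        using ito_split[of p q' q b c] elem_base q' bA by simp
      moreover have "inner (\<iota> Z) (ito b q' q c) = 0"
      proof (cases "q \<le> s")
        case True
        then show ?thesis by (simp add: q'_def)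
      next
        case False
        then have q'': "q' = s" "s \<le> q" by (auto simp: q'_def)
        have "cinner (\<iota> Z) (ito b s q c) = \<tau> (op_adj Z o\<^sub>L (b o\<^sub>L ((W q - W s) o\<^sub>L c)))"
          unfolding ito_def using Z bA s q'' F_in ito_in[of s q b c] by (subst io_inner) (auto simp: blinfun_compose_assoc)
        also have "\<dots> = \<tau> ((c o\<^sub>L (op_adj Z o\<^sub>L b)) o\<^sub>L (W q - W s))"
          using tr_comm[of "op_adj Z o\<^sub>L (b o\<^sub>L (W q - W s))" c] Z bA s q'' F_in incr_in[of s q]
          by (simp add: ops_in blinfun_compose_assoc)
        also have "\<dots> = 0" using Z bA s q'' by (intro past_incr F_comp F_adj)
        finally show ?thesis by (simp add: q'' inner_eq_Re_cinner)
      qed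
      ultimately show ?thesis by simp
    qed
    then show ?thesis using 1 2 by auto
  next
    case False
    have "(\<lambda>r. if r < s then indicat_real {p..<q} r *\<^sub>R \<Phi> (\<iota> b) (\<iota> c) else 0) = (\<lambda>r. 0)"
      using False by (auto simp: indicator_def)
    moreover have "inner (\<iota> Z) (ito b p q c) = 0" if "Z \<in> F s" for Z
    proof -
      have m: "Z \<in> F p" using that F_mono[of s p] False by auto
      have mA: "b \<in> A" "c \<in> A" "Z \<in> A" using elem_base F_in m by auto
      have "cinner (\<iota> Z) (ito b p q c) = \<tau> (op_adj Z o\<^sub>L (b o\<^sub>L ((W q - W p) o\<^sub>L c)))"
        unfolding ito_def using mA elem_base ito_in[of p q b c] by (subst io_inner) (auto simp: blinfun_compose_assoc)
      also have "\<dots> = \<tau> ((c o\<^sub>L (op_adj Z o\<^sub>L b)) o\<^sub>L (W q - W p))"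
        using tr_comm[of "op_adj Z o\<^sub>L (b o\<^sub>L (W q - W p))" c] mA elem_base incr_in[of p q]
        by (simp add: ops_in blinfun_compose_assoc)
      also have "\<dots> = 0" using m elem_base by (intro past_incr F_comp F_adj)
      finally show ?thesis by (simp add: inner_eq_Re_cinner)
    qed
    ultimately show ?thesis using elem_zero by auto
  qed
next
  case elem_zero
  then show ?case using elem.elem_zero by (intro exI[of _ 0]) simp
next
  case (elem_add f x g y)
  then obtain x' y' where xy: "elem (\<lambda>r. if r < s then f r else 0) x'" "\<forall>Z\<in>F s. inner (\<iota> Z) (x - x') = 0"
    "elem (\<lambda>r. if r < s then g r else 0) y'" "\<forall>Z\<in>F s. inner (\<iota> Z) (y - y') = 0" by blast
  have "(\<lambda>r. (if r < s then f r else 0) + (if r < s then g r else 0)) = (\<lambda>r. if r < s then f r + g r else 0)" by auto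
  then have "elem (\<lambda>r. if r < s then f r + g r else 0) (x' + y')" using elem.elem_add[OF xy(1,3)] by simp
  moreover have "\<forall>Z\<in>F s. inner (\<iota> Z) (x + y - (x' + y')) = 0"
    using xy(2,4) by (simp add: inner_add_right inner_diff_right)
  ultimately show ?case by blast
next
  case (elem_scale f x a)
  then obtain x' where x: "elem (\<lambda>r. if r < s then f r else 0) x'" "\<forall>Z\<in>F s. inner (\<iota> Z) (x - x') = 0" by blast
  have "(\<lambda>r. a *\<^sub>R (if r < s then f r else 0)) = (\<lambda>r. if r < s then a *\<^sub>R f r else 0)" by auto
  then have "elem (\<lambda>r. if r < s then a *\<^sub>R f r else 0) (a *\<^sub>R x')" using elem.elem_scale[OF x(1), of a] by simp
  moreover have "\<forall>Z\<in>F s. inner (\<iota> Z) (a *\<^sub>R x - a *\<^sub>R x') = 0"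
    using x(2) by (simp add: scaleR_diff_right[symmetric])
  ultimately show ?case by blast
qed

end

end


text \<open>The weighted Young inequality. A small \<open>e\<close> keeps the coefficient of
  \<open>u\<close> close to \<open>1\<close>, so that no factor is lost in
  \<open>free_lim_bound\<close> and \<open>energy_estimate\<close>.\<close>

lemma norm_add_sq_le:
  fixes u v :: "'a::real_inner"
  assumes "e > 0"
  shows "(norm (u + v))\<^sup>2 \<le> (1 + e) * (norm u)\<^sup>2 + (1 + 1 / e) * (norm v)\<^sup>2"
proof -
  have "0 \<le> (norm (sqrt e *\<^sub>R u - (1 / sqrt e) *\<^sub>R v))\<^sup>2" by simp
  also have "\<dots> = e * (norm u)\<^sup>2 - 2 * inner u v + (1 / e) * (norm v)\<^sup>2"
    using assms by (simp add: norm_diff_sq power_mult_distrib power_divide)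
  finally show ?thesis by (simp add: norm_add_sq algebra_simps)
qed

lemma norm_diff_sq_le2:
  fixes u v :: "'a::real_inner"
  shows "(norm (u - v))\<^sup>2 \<le> 2 * (norm u)\<^sup>2 + 2 * (norm v)\<^sup>2"
  using norm_add_sq_le[of 1 u "- v"] by simp

section \<open>Limits of step functions and the isometry bound\<close>

context free_bm
begin

lemma ito_past: "0 \<le> p \<Longrightarrow> p \<le> q \<Longrightarrow> q \<le> t \<Longrightarrow> b \<in> F p \<Longrightarrow> c \<in> F p \<Longrightarrow> b o\<^sub>L (W q - W p) o\<^sub>L c \<in> F t"
  using F_mono[of p t] by (intro F_comp F_diff W_in_F) auto

lemma simple_integral_in:
  assumes b: "simple_adapted F t n p b" and c: "simple_adapted F t n p c"
  shows "simple_integral W n p b c \<in> F t"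
proof -
  interpret Ft: vn_alg "F t" by unfold_locales (rule F_vn)
  have incr: "\<And>k. k < n \<Longrightarrow> p k < p (Suc k)" by (rule simple_adaptedD(3)[OF b])
  have pk: "0 \<le> p k" "p k \<le> t" if "k \<le> n" for k
    using partition_mono[of n p 0 k, OF incr] partition_mono[of n p k n, OF incr] that simple_adaptedD(1,2)[OF b] by auto
  show ?thesis unfolding simple_integral_def
  proof (rule Ft.sum_in)
    fix k assume "k \<in> {..<n}"
    then have k: "k < n" by simp
    then show "b (p k) o\<^sub>L (W (p (Suc k)) - W (p k)) o\<^sub>L c (p k) \<in> F t"
      using pk[of k] pk[of "Suc k"] incr[of k] simple_adaptedD(4)[OF b k] simple_adaptedD(4)[OF c k]
      by (intro ito_past) auto
  qed
qed

lemma free_integral_adapted: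
  assumes "has_free_integral \<iota> W F t b c \<xi>"
  shows "\<xi> \<in> L2F t"
proof -
  from assms obtain n p bs cs where
    a: "\<forall>m. simple_adapted F t (n m) (p m) (bs m) \<and> simple_adapted F t (n m) (p m) (cs m)"
    and lim: "(\<lambda>m. \<iota> (simple_integral W (n m) (p m) (bs m) (cs m))) \<longlonglongrightarrow> \<xi>"
    by (rule has_free_integralE)
  have "\<iota> (simple_integral W (n m) (p m) (bs m) (cs m)) \<in> L2F t" for m
    using a by (intro io_L2F simple_integral_in) auto
  then show ?thesis
    using closed_sequentially[OF L2F_closed _ lim] by blast
qed

context
  fixes T \<Phi> assumes \<Phi>: "tensor_map T \<Phi>"
begin

text \<open>Mean-square approximation of \<open>f0\<close> by step functions, expressed through
  integrable majorants \<open>H m\<close> of the squared distance. In this form neither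
  \<open>f0\<close> nor the distance itself has to be integrable, and sums and differences need no
  measurability argument.\<close>

definition free_lim :: "(real \<Rightarrow> 'k) \<Rightarrow> 'k \<Rightarrow> bool" where
  "free_lim f0 \<xi> \<longleftrightarrow> (\<exists>f x H. (\<forall>m::nat. elem T \<Phi> (f m) (x m) \<and> H m integrable_on {0..T} \<and>
      (\<forall>r\<in>{0..T}. (norm (f m r - f0 r))\<^sup>2 \<le> H m r)) \<and>
      (\<lambda>m. integral {0..T} (H m)) \<longlonglongrightarrow> 0 \<and> x \<longlonglongrightarrow> \<xi>)"

lemma free_lim_zero: "free_lim (\<lambda>r. 0) 0"
  unfolding free_lim_def
  by (rule exI[of _ "\<lambda>m r. 0"], rule exI[of _ "\<lambda>m. 0"], rule exI[of _ "\<lambda>m r. 0"])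
     (auto intro: elem.elem_zero[OF \<Phi>])

lemma free_lim_diff:
  assumes "free_lim f \<xi>" "free_lim g \<eta>"
  shows "free_lim (\<lambda>r. f r - g r) (\<xi> - \<eta>)"
proof -
  obtain f1 x1 H1 where 1: "\<And>m::nat. elem T \<Phi> (f1 m) (x1 m)" "\<And>m. H1 m integrable_on {0..T}"
    "\<And>m r. r \<in> {0..T} \<Longrightarrow> (norm (f1 m r - f r))\<^sup>2 \<le> H1 m r" "(\<lambda>m. integral {0..T} (H1 m)) \<longlonglongrightarrow> 0" "x1 \<longlonglongrightarrow> \<xi>"
    using assms(1) unfolding free_lim_def by blast
  obtain f2 x2 H2 where 2: "\<And>m::nat. elem T \<Phi> (f2 m) (x2 m)" "\<And>m. H2 m integrable_on {0..T}"
    "\<And>m r. r \<in> {0..T} \<Longrightarrow> (norm (f2 m r - g r))\<^sup>2 \<le> H2 m r" "(\<lambda>m. integral {0..T} (H2 m)) \<longlonglongrightarrow> 0" "x2 \<longlonglongrightarrow> \<eta>"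
    using assms(2) unfolding free_lim_def by blast
  define H where "H = (\<lambda>m r. 2 * H1 m r + 2 * H2 m r)"
  have Hi: "(H m has_integral 2 * integral {0..T} (H1 m) + 2 * integral {0..T} (H2 m)) {0..T}" for m
    unfolding H_def by (intro has_integral_add has_integral_mult_right integrable_integral 1 2)
  show ?thesis
    unfolding free_lim_def
  proof (intro exI conjI allI ballI)
    show "elem T \<Phi> ((\<lambda>m r. f1 m r - f2 m r) m) ((\<lambda>m. x1 m - x2 m) m)" for m
      using elem_diff[OF \<Phi> 1(1) 2(1)] .
    show "H m integrable_on {0..T}" for m using Hi by blast
    show "(norm ((\<lambda>m r. f1 m r - f2 m r) m r - (f r - g r)))\<^sup>2 \<le> H m r" if "r \<in> {0..T}" for m r
    proof -
      have "(norm ((f1 m r - f r) - (f2 m r - g r)))\<^sup>2 \<le> 2 * (norm (f1 m r - f r))\<^sup>2 + 2 * (norm (f2 m r - g r))\<^sup>2"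
        by (rule norm_diff_sq_le2)
      also have "\<dots> \<le> H m r" using 1(3)[OF that] 2(3)[OF that] by (simp add: H_def add_mono)
      finally show ?thesis by (simp add: algebra_simps)
    qed
    have "(\<lambda>m. 2 * integral {0..T} (H1 m) + 2 * integral {0..T} (H2 m)) \<longlonglongrightarrow> 2 * 0 + 2 * 0"
      by (intro tendsto_intros 1 2)
    then show "(\<lambda>m. integral {0..T} (H m)) \<longlonglongrightarrow> 0" using integral_unique[OF Hi] by simp
    show "(\<lambda>m. x1 m - x2 m) \<longlonglongrightarrow> \<xi> - \<eta>" by (intro tendsto_intros 1 2)
  qed
qed

lemma free_lim_add:
  assumes "free_lim f \<xi>" "free_lim g \<eta>"
  shows "free_lim (\<lambda>r. f r + g r) (\<xi> + \<eta>)"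
  using free_lim_diff[OF assms(1) free_lim_diff[OF free_lim_zero assms(2)]] by simp

lemma free_lim_sum: "(\<And>i. i \<in> I \<Longrightarrow> free_lim (f i) (x i)) \<Longrightarrow> free_lim (\<lambda>r. \<Sum>i\<in>I. f i r) (\<Sum>i\<in>I. x i)"
  by (induction I rule: infinite_finite_induct) (auto intro: free_lim_zero free_lim_add)

text \<open>The isometry as an inequality with constant \<open>1\<close> for an arbitrary integrable
  majorant \<open>G\<close>. The approximation error is separated by the Young inequality, whose
  weight tends to zero with \<open>e\<close>.\<close>

lemma free_lim_bound:
  assumes lim: "free_lim f0 \<xi>" and G: "G integrable_on {0..T}" "\<And>r. r \<in> {0..T} \<Longrightarrow> (norm (f0 r))\<^sup>2 \<le> G r"
  shows "(norm \<xi>)\<^sup>2 \<le> integral {0..T} G"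
proof (rule field_le_epsilon)
  fix e :: real assume e: "e > 0"
  obtain f x H where f: "\<And>m::nat. elem T \<Phi> (f m) (x m)" "\<And>m. H m integrable_on {0..T}"
    "\<And>m r. r \<in> {0..T} \<Longrightarrow> (norm (f m r - f0 r))\<^sup>2 \<le> H m r" "(\<lambda>m. integral {0..T} (H m)) \<longlonglongrightarrow> 0" "x \<longlonglongrightarrow> \<xi>"
    using lim unfolding free_lim_def by blast
  have G0: "0 \<le> integral {0..T} G"
    by (rule integral_nonneg[OF G(1)]) (use G(2) order_trans[OF zero_le_power2] in blast)
  \<comment> \<open>The summand \<open>1\<close> in the denominator makes
    \<open>d * integral {0..T} G \<le> e\<close> hold also for a vanishing integral.\<close>
  define d where "d = e / (integral {0..T} G + 1)"
  have d: "d > 0" using e G0 by (simp add: d_def)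
  have le: "(norm (x m))\<^sup>2 \<le> (1 + d) * integral {0..T} G + (1 + 1 / d) * integral {0..T} (H m)" for m
  proof (rule has_integral_le[OF elem_norm[OF \<Phi> f(1)]])
    show "((\<lambda>r. (1 + d) * G r + (1 + 1 / d) * H m r) has_integral
       (1 + d) * integral {0..T} G + (1 + 1 / d) * integral {0..T} (H m)) {0..T}"
      by (intro has_integral_add has_integral_mult_right integrable_integral G f)
    fix r assume r: "r \<in> {0..T}"
    have "(norm (f0 r + (f m r - f0 r)))\<^sup>2 \<le> (1 + d) * (norm (f0 r))\<^sup>2 + (1 + 1 / d) * (norm (f m r - f0 r))\<^sup>2"
      by (rule norm_add_sq_le[OF d])
    also have "\<dots> \<le> (1 + d) * G r + (1 + 1 / d) * H m r"
      using d by (intro add_mono mult_left_mono G f r) auto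
    finally show "(norm (f m r))\<^sup>2 \<le> (1 + d) * G r + (1 + 1 / d) * H m r" by simp
  qed
  have "(norm \<xi>)\<^sup>2 \<le> (1 + d) * integral {0..T} G + (1 + 1 / d) * 0"
  proof (rule LIMSEQ_le)
    show "(\<lambda>m. (norm (x m))\<^sup>2) \<longlonglongrightarrow> (norm \<xi>)\<^sup>2" by (intro tendsto_intros f)
    show "(\<lambda>m. (1 + d) * integral {0..T} G + (1 + 1 / d) * integral {0..T} (H m)) \<longlonglongrightarrow> (1 + d) * integral {0..T} G + (1 + 1 / d) * 0"
      by (intro tendsto_intros f)
  qed (use le in auto)
  also have "\<dots> = integral {0..T} G + d * integral {0..T} G" by (simp add: algebra_simps)
  also have "d * integral {0..T} G \<le> d * (integral {0..T} G + 1)" using d by (intro mult_left_mono) auto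
  also have "d * (integral {0..T} G + 1) = e" using G0 by (simp add: d_def)
  finally show "(norm \<xi>)\<^sup>2 \<le> integral {0..T} G + e" by simp
qed

text \<open>The two integrals come with unrelated approximations \<open>x1\<close> and
  \<open>x2\<close>. Cutting the first one at \<open>s\<close> gives \<open>y m\<close>, for which
  orthogonality is known, and the isometry shows that \<open>y m - x2 m\<close> tends to
  zero.\<close>

lemma free_lim_orth:
  assumes s: "0 \<le> s" "s \<le> T" and lim: "free_lim f0 \<xi>" "free_lim (\<lambda>r. if r < s then f0 r else 0) \<xi>'"
    and \<eta>: "\<eta> \<in> L2F s"
  shows "inner \<eta> (\<xi> - \<xi>') = 0"
proof -
  obtain f1 x1 H1 where 1: "\<And>m::nat. elem T \<Phi> (f1 m) (x1 m)" "\<And>m. H1 m integrable_on {0..T}"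
    "\<And>m r. r \<in> {0..T} \<Longrightarrow> (norm (f1 m r - f0 r))\<^sup>2 \<le> H1 m r" "(\<lambda>m. integral {0..T} (H1 m)) \<longlonglongrightarrow> 0" "x1 \<longlonglongrightarrow> \<xi>"
    using lim(1) unfolding free_lim_def by blast
  obtain f2 x2 H2 where 2: "\<And>m::nat. elem T \<Phi> (f2 m) (x2 m)" "\<And>m. H2 m integrable_on {0..T}"
    "\<And>m r. r \<in> {0..T} \<Longrightarrow> (norm (f2 m r - (if r < s then f0 r else 0)))\<^sup>2 \<le> H2 m r" "(\<lambda>m. integral {0..T} (H2 m)) \<longlonglongrightarrow> 0" "x2 \<longlonglongrightarrow> \<xi>'"
    using lim(2) unfolding free_lim_def by blast
  obtain y where y: "\<And>m. elem T \<Phi> (\<lambda>r. if r < s then f1 m r else 0) (y m)"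
    "\<And>m Z. Z \<in> F s \<Longrightarrow> inner (\<iota> Z) (x1 m - y m) = 0"
    using elem_restrict[OF \<Phi> s 1(1)] by metis
  have le: "(norm (y m - x2 m))\<^sup>2 \<le> 2 * integral {0..T} (H1 m) + 2 * integral {0..T} (H2 m)" for m
  proof (rule has_integral_le[OF elem_norm[OF \<Phi> elem_diff[OF \<Phi> y(1) 2(1)]]])
    show "((\<lambda>r. 2 * H1 m r + 2 * H2 m r) has_integral (2 * integral {0..T} (H1 m) + 2 * integral {0..T} (H2 m))) {0..T}"
      by (intro has_integral_add has_integral_mult_right integrable_integral 1 2)
    fix r assume r: "r \<in> {0..T}"
    let ?f = "if r < s then f0 r else 0" and ?g = "if r < s then f1 m r else 0"
    have "(norm ((?g - ?f) - (f2 m r - ?f)))\<^sup>2 \<le> 2 * (norm (?g - ?f))\<^sup>2 + 2 * (norm (f2 m r - ?f))\<^sup>2"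
      by (rule norm_diff_sq_le2)
    also have "(norm (?g - ?f))\<^sup>2 \<le> H1 m r"
      using 1(3)[OF r, of m] order_trans[OF zero_le_power2 1(3)[OF r, of m]] by simp
    finally show "(norm ((if r < s then f1 m r else 0) - f2 m r))\<^sup>2 \<le> 2 * H1 m r + 2 * H2 m r"
      using 2(3)[OF r, of m] by simp
  qed
  have lim0: "(\<lambda>m. 2 * integral {0..T} (H1 m) + 2 * integral {0..T} (H2 m)) \<longlonglongrightarrow> 0"
  proof -
    have "(\<lambda>m. 2 * integral {0..T} (H1 m) + 2 * integral {0..T} (H2 m)) \<longlonglongrightarrow> 2 * 0 + 2 * 0"
      by (intro tendsto_intros 1 2)
    then show ?thesis by simp
  qed
  have "(\<lambda>m. (norm (y m - x2 m))\<^sup>2) \<longlonglongrightarrow> 0"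
    by (rule tendsto_sandwich[OF _ _ tendsto_const lim0]) (use le in auto)
  then have "(\<lambda>m. sqrt ((norm (y m - x2 m))\<^sup>2)) \<longlonglongrightarrow> sqrt 0" by (rule tendsto_real_sqrt)
  then have yx: "(\<lambda>m. y m - x2 m) \<longlonglongrightarrow> 0" by (simp add: tendsto_norm_zero_iff)
  have "inner (\<iota> Z) (\<xi> - \<xi>') = 0" if Z: "Z \<in> F s" for Z
  proof (rule LIMSEQ_unique)
    show "(\<lambda>m. inner (\<iota> Z) (x1 m - x2 m)) \<longlonglongrightarrow> inner (\<iota> Z) (\<xi> - \<xi>')" by (intro tendsto_intros 1 2)
    have "inner (\<iota> Z) (x1 m - x2 m) = inner (\<iota> Z) (y m - x2 m)" for m
      using y(2)[OF Z, of m] by (simp add: inner_diff_right)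
    then show "(\<lambda>m. inner (\<iota> Z) (x1 m - x2 m)) \<longlonglongrightarrow> 0"
      using tendsto_inner[OF tendsto_const yx, of "\<iota> Z"] by simp
  qed
  moreover have "closed {\<zeta>. inner \<zeta> (\<xi> - \<xi>') = 0}" by (intro closed_Collect_eq continuous_intros)
  ultimately have "L2F s \<subseteq> {\<zeta>. inner \<zeta> (\<xi> - \<xi>') = 0}" unfolding L2_sub_def by (intro closure_minimal) auto
  then show ?thesis using \<eta> by blast
qed

text \<open>Cut off strictly before \<open>s\<close>, because a simple process is not constrained at
  the right end of its partition.\<close>

definition tens :: "real \<Rightarrow> (real \<Rightarrow> 'k) \<Rightarrow> (real \<Rightarrow> 'k) \<Rightarrow> real \<Rightarrow> 'k" where
  "tens s b c r = (if 0 \<le> r \<and> r < s then \<Phi> (b r) (c r) else 0)"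

lemma tens_dist_le:
  assumes s: "s \<le> T" and r: "r \<in> {0..T}"
    and m: "\<And>r. r \<in> {0..s} \<Longrightarrow> b r \<in> L2F T" "\<And>r. r \<in> {0..s} \<Longrightarrow> c r \<in> L2F T"
      "\<And>r. r \<in> {0..<s} \<Longrightarrow> b' r \<in> L2F T" "\<And>r. r \<in> {0..<s} \<Longrightarrow> c' r \<in> L2F T"
  shows "(norm (tens s b' c' r - tens s b c r))\<^sup>2 \<le>
    (if r \<in> {0..<s} then tensor_dist_sq (b r) (c r) (b' r) (c' r) else 0)"
proof (cases "r < s")
  case True
  then show ?thesis using r m tensor_dist[OF \<Phi>, of "b r" "c r" "b' r" "c' r"]
    by (simp add: tens_def norm_minus_commute)
next
  case False
  then show ?thesis by (simp add: tens_def)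
qed

text \<open>The bridge from the definition of the integral to tensor-valued functions on a common
  interval \<open>[0, T]\<close>. Integrals up to different times \<open>s\<close> become comparable
  this way.\<close>

lemma free_integral_lim:
  assumes I: "has_free_integral \<iota> W F s b c \<xi>" and s: "0 \<le> s" "s \<le> T"
  shows "free_lim (tens s b c) \<xi>"
proof -
  have bc: "b r \<in> L2F T" "c r \<in> L2F T" if "r \<in> {0..s}" for r
    using I that s unfolding has_free_integral_def by (auto intro: L2F_mem_mono[of _ r])
  from I obtain n p bs cs where a0: "\<forall>m. simple_adapted F s (n m) (p m) (bs m) \<and> simple_adapted F s (n m) (p m) (cs m)"
    "\<forall>m. (\<lambda>t. tensor_dist_sq (b t) (c t) (\<iota> (bs m t)) (\<iota> (cs m t))) integrable_on {0..s}"
    "(\<lambda>m. integral {0..s} (\<lambda>t. tensor_dist_sq (b t) (c t) (\<iota> (bs m t)) (\<iota> (cs m t)))) \<longlonglongrightarrow> 0"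
    "(\<lambda>m. \<iota> (simple_integral W (n m) (p m) (bs m) (cs m))) \<longlonglongrightarrow> \<xi>"
    by (rule has_free_integralE)
  have a: "\<And>m. simple_adapted F s (n m) (p m) (bs m)" "\<And>m. simple_adapted F s (n m) (p m) (cs m)"
    "\<And>m. (\<lambda>t. tensor_dist_sq (b t) (c t) (\<iota> (bs m t)) (\<iota> (cs m t))) integrable_on {0..s}"
    "(\<lambda>m. integral {0..s} (\<lambda>t. tensor_dist_sq (b t) (c t) (\<iota> (bs m t)) (\<iota> (cs m t)))) \<longlonglongrightarrow> 0"
    "(\<lambda>m. \<iota> (simple_integral W (n m) (p m) (bs m) (cs m))) \<longlonglongrightarrow> \<xi>"
    using a0 by auto
  have simple_mem: "\<iota> (d r) \<in> L2F T" if d: "simple_adapted F s n' p' d" and r: "r \<in> {0..<s}" for d n' p' r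
  proof -
    have incr: "\<And>k. k < n' \<Longrightarrow> p' k < p' (Suc k)" by (rule simple_adaptedD(3)[OF d])
    obtain k where k: "k < n'" "p' k \<le> r" "r < p' (Suc k)"
      using partition_cover[of n' p' r, OF incr] r simple_adaptedD(1,2)[OF d] by auto
    have "d r \<in> F (p' k)" using simple_adaptedD(4)[OF d k(1)] simple_adaptedD(5)[OF d k] by simp
    then have "\<iota> (d r) \<in> L2F (p' k)" by (rule io_L2F)
    then show ?thesis using k r s by (auto intro: L2F_mem_mono)
  qed
  define D where "D = (\<lambda>m t. tensor_dist_sq (b t) (c t) (\<iota> (bs m t)) (\<iota> (cs m t)))"
  \<comment> \<open>At \<open>r = s\<close> the simple processes may take any value, so nothing is
    known about \<open>D m\<close> there; changing it at one point leaves the integral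
    unchanged.\<close>
  define H where "H = (\<lambda>m r. if r \<in> {0..s} then (if r = s then 0 else D m r) else 0)"
  have Hi: "(H m has_integral integral {0..s} (D m)) {0..T}" for m
  proof -
    have "((\<lambda>r. if r = s then 0 else D m r) has_integral integral {0..s} (D m)) {0..s}"
      by (rule has_integral_spike_finite[of "{s}" _ _ "D m"]) (use a(3) in \<open>auto simp: D_def integrable_integral\<close>)
    then show ?thesis unfolding H_def by (subst has_integral_restrict) (use s in auto)
  qed
  show ?thesis
    unfolding free_lim_def
  proof (intro exI conjI allI ballI)
    show "elem T \<Phi> ((\<lambda>m. tens s (\<lambda>r. \<iota> (bs m r)) (\<lambda>r. \<iota> (cs m r))) m) ((\<lambda>m. \<iota> (simple_integral W (n m) (p m) (bs m) (cs m))) m)" for m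
      using simple_elem[OF \<Phi> s a(1,2), of m] by (simp add: tens_def[abs_def])
    show "H m integrable_on {0..T}" for m using Hi by blast
    show "(norm ((\<lambda>m. tens s (\<lambda>r. \<iota> (bs m r)) (\<lambda>r. \<iota> (cs m r))) m r - tens s b c r))\<^sup>2 \<le> H m r" if r: "r \<in> {0..T}" for m r
      using tens_dist_le[of s r b c "\<lambda>r. \<iota> (bs m r)" "\<lambda>r. \<iota> (cs m r)"] s r bc simple_mem[OF a(1)] simple_mem[OF a(2)]
      by (auto simp: H_def D_def)
    show "(\<lambda>m. integral {0..T} (H m)) \<longlonglongrightarrow> 0"
      using a(4) integral_unique[OF Hi] by (simp add: D_def)
    show "(\<lambda>m. \<iota> (simple_integral W (n m) (p m) (bs m) (cs m))) \<longlonglongrightarrow> \<xi>" by (rule a)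
  qed
qed

end

section \<open>Existence of stochastic integrals\<close>

lemma piecewise_integrable:
  fixes g :: "real \<Rightarrow> real"
  assumes "\<And>k. k < n \<Longrightarrow> p k < p (Suc k)" "\<And>k. k < n \<Longrightarrow> continuous_on {p k..p (Suc k)} (h k)"
    "\<And>k r. k < n \<Longrightarrow> p k \<le> r \<Longrightarrow> r < p (Suc k) \<Longrightarrow> g r = h k r"
  shows "g integrable_on {p 0..p n}"
  using assms
proof (induction n)
  case (Suc n)
  have 1: "g integrable_on {p 0..p n}" using Suc by auto
  have "h n integrable_on {p n..p (Suc n)}" using Suc.prems(2) by (intro integrable_continuous_real) auto
  then have "g integrable_on {p n..p (Suc n)}"
    by (rule integrable_spike_finite[of "{p (Suc n)}", rotated 2]) (use Suc.prems(3) in auto)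
  moreover have "p 0 \<le> p n" using partition_mono[where n = "Suc n" and p = p, OF Suc.prems(1), of 0 n] by auto
  ultimately show ?case
    using Henstock_Kurzweil_Integration.integrable_combine[OF _ _ 1] Suc.prems(1)[of n] by auto
qed (metis cbox_interval integrable_on_refl)

lemma simple_mem:
  assumes d: "simple_adapted F t n p d" and r: "0 \<le> r" "r < t"
  shows "d r \<in> F r"
proof -
  have incr: "\<And>k. k < n \<Longrightarrow> p k < p (Suc k)" by (rule simple_adaptedD(3)[OF d])
  obtain k where k: "k < n" "p k \<le> r" "r < p (Suc k)"
    using partition_cover[of n p r, OF incr] r simple_adaptedD(1,2)[OF d] by auto
  have "d r \<in> F (p k)" using simple_adaptedD(4)[OF d k(1)] simple_adaptedD(5)[OF d k] by simp
  then show ?thesis using F_mono[OF k(2)] by blast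
qed

lemma simple_adapted_integrable:
  fixes h :: "real \<Rightarrow> 'k \<Rightarrow> 'k \<Rightarrow> real"
  assumes b: "simple_adapted F t n p b" and c: "simple_adapted F t n p c"
    and h: "\<And>u v. continuous_on {0..t} (\<lambda>r. h r u v)"
  shows "(\<lambda>r. h r (\<iota> (b r)) (\<iota> (c r))) integrable_on {0..t}"
proof -
  have incr: "\<And>k. k < n \<Longrightarrow> p k < p (Suc k)" by (rule simple_adaptedD(3)[OF b])
  have pk: "0 \<le> p k" "p k \<le> t" if "k \<le> n" for k
    using partition_mono[of n p 0 k, OF incr] partition_mono[of n p k n, OF incr] that simple_adaptedD(1,2)[OF b] by auto
  have "(\<lambda>r. h r (\<iota> (b r)) (\<iota> (c r))) integrable_on {p 0..p n}"
  proof (rule piecewise_integrable[of n p "\<lambda>k r. h r (\<iota> (b (p k))) (\<iota> (c (p k)))", OF incr])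
    fix k assume k: "k < n"
    show "continuous_on {p k..p (Suc k)} (\<lambda>r. h r (\<iota> (b (p k))) (\<iota> (c (p k))))"
      by (rule continuous_on_subset[OF h]) (use pk[of k] pk[of "Suc k"] k in auto)
    fix r assume r: "p k \<le> r" "r < p (Suc k)"
    show "h r (\<iota> (b r)) (\<iota> (c r)) = h r (\<iota> (b (p k))) (\<iota> (c (p k)))"
      by (simp only: simple_adaptedD(5)[OF b k r] simple_adaptedD(5)[OF c k r])
  qed
  then show ?thesis by (simp only: simple_adaptedD(1,2)[OF b])
qed

text \<open>The constant sequence approximates. Adaptedness at time \<open>t\<close> is a separate
  hypothesis, since \<open>simple_adapted\<close> says nothing about the right end of the
  interval.\<close>

lemma simple_has_free_integral:
  assumes b: "simple_adapted F t n p b" and c: "simple_adapted F t n p c" and t: "b t \<in> F t" "c t \<in> F t"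
  shows "has_free_integral \<iota> W F t (\<lambda>r. \<iota> (b r)) (\<lambda>r. \<iota> (c r)) (\<iota> (simple_integral W n p b c))"
  unfolding has_free_integral_def
proof (intro conjI ballI)
  fix r assume r: "r \<in> {0..t}"
  show "\<iota> (b r) \<in> L2F r" using simple_mem[OF b, of r] t r by (cases "r = t") (auto intro: io_L2F)
  show "\<iota> (c r) \<in> L2F r" using simple_mem[OF c, of r] t r by (cases "r = t") (auto intro: io_L2F)
next
  show "(\<lambda>r. (norm (\<iota> (b r)))\<^sup>2 * (norm (\<iota> (c r)))\<^sup>2) integrable_on {0..t}"
    using simple_adapted_integrable[OF b c, of "\<lambda>r u v. (norm u)\<^sup>2 * (norm v)\<^sup>2"] by simp
next
  have z: "tensor_dist_sq u v u v = 0" for u v :: 'k by (simp add: tensor_dist_same)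
  show "\<exists>na pa bs cs. (\<forall>m. simple_adapted F t (na m) (pa m) (bs m) \<and> simple_adapted F t (na m) (pa m) (cs m)) \<and>
     (\<forall>m. (\<lambda>ta. tensor_dist_sq (\<iota> (b ta)) (\<iota> (c ta)) (\<iota> (bs m ta)) (\<iota> (cs m ta))) integrable_on {0..t}) \<and>
     (\<lambda>m. integral {0..t} (\<lambda>ta. tensor_dist_sq (\<iota> (b ta)) (\<iota> (c ta)) (\<iota> (bs m ta)) (\<iota> (cs m ta)))) \<longlonglongrightarrow> 0 \<and>
     (\<lambda>m. \<iota> (simple_integral W (na m) (pa m) (bs m) (cs m))) \<longlonglongrightarrow> \<iota> (simple_integral W n p b c)"
    by (rule exI[of _ "\<lambda>_. n"], rule exI[of _ "\<lambda>_. p"], rule exI[of _ "\<lambda>_. b"], rule exI[of _ "\<lambda>_. c"])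
       (use b c integrable_0[of "{0..t}"] in \<open>simp add: z\<close>)
qed

text \<open>Uniform closeness of both factors bounds the tensor distance by
  \<open>\<delta> m\<close>, so the integrals of the simple processes form a Cauchy sequence by the
  isometry. The approximating sequence is part of the conclusion because self-adjointness of the
  limit is later inherited from it.\<close>

lemma free_integral_of_limit:
  assumes t: "0 \<le> t" and cont: "continuous_on {0..t} b" "continuous_on {0..t} c"
    and ad: "\<And>r. r \<in> {0..t} \<Longrightarrow> b r \<in> L2F r" "\<And>r. r \<in> {0..t} \<Longrightarrow> c r \<in> L2F r"
    and simple: "\<And>m. simple_adapted F t (n m) (p m) (bs m)" "\<And>m. simple_adapted F t (n m) (p m) (cs m)"
    and \<epsilon>: "\<epsilon> \<longlonglongrightarrow> 0" "\<And>m. 0 \<le> \<epsilon> m" "\<And>m r. 0 \<le> r \<Longrightarrow> r < t \<Longrightarrow> norm (b r - \<iota> (bs m r)) \<le> \<epsilon> m"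
      "\<And>m r. 0 \<le> r \<Longrightarrow> r < t \<Longrightarrow> norm (c r - \<iota> (cs m r)) \<le> \<epsilon> m"
  obtains \<xi> where "has_free_integral \<iota> W F t b c \<xi>"
    "(\<lambda>m. \<iota> (simple_integral W (n m) (p m) (bs m) (cs m))) \<longlonglongrightarrow> \<xi>"
proof -
  obtain \<Phi> where \<Phi>: "tensor_map t \<Phi>" using tensor_map_exists t by blast
  have "bounded (b ` {0..t})" "bounded (c ` {0..t})"
    using cont by (auto intro!: compact_imp_bounded compact_continuous_image)
  then obtain Kb Kc where K: "\<And>r. r \<in> {0..t} \<Longrightarrow> norm (b r) \<le> Kb" "\<And>r. r \<in> {0..t} \<Longrightarrow> norm (c r) \<le> Kc" "Kb > 0" "Kc > 0"
    unfolding bounded_pos by fastforce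
  \<comment> \<open>The Lipschitz estimate for tensors with \<open>Kb + \<epsilon> m\<close> as
    bound for the approximant of \<open>b\<close>.\<close>
  define \<delta> where "\<delta> = (\<lambda>m. (\<epsilon> m * Kc + (Kb + \<epsilon> m) * \<epsilon> m)\<^sup>2)"
  have \<delta>: "\<delta> \<longlonglongrightarrow> 0"
  proof -
    have "\<delta> \<longlonglongrightarrow> (0 * Kc + (Kb + 0) * 0)\<^sup>2" unfolding \<delta>_def by (intro tendsto_intros \<epsilon>)
    then show ?thesis by simp
  qed
  define D where "D = (\<lambda>m r. tensor_dist_sq (b r) (c r) (\<iota> (bs m r)) (\<iota> (cs m r)))"
  have mem: "b r \<in> L2F t" "c r \<in> L2F t" "\<iota> (bs m r) \<in> L2F t" "\<iota> (cs m r) \<in> L2F t" if "0 \<le> r" "r < t" for r m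
    using ad[of r] io_L2F[OF simple_mem[OF simple(1)], of r m] io_L2F[OF simple_mem[OF simple(2)], of r m] that
    by (auto intro: L2F_mem_mono)
  have Dle: "D m r \<le> \<delta> m" "0 \<le> D m r" if r: "0 \<le> r" "r < t" for m r
  proof -
    note m = mem[OF r]
    have "D m r \<le> (norm (b r - \<iota> (bs m r)) * norm (c r) + norm (\<iota> (bs m r)) * norm (c r - \<iota> (cs m r)))\<^sup>2"
      unfolding D_def by (intro tensor_dist_sq_le[OF \<Phi>] m)
    also have "\<dots> \<le> \<delta> m"
      unfolding \<delta>_def
    proof (intro power_mono add_mono mult_mono)
      have "norm (\<iota> (bs m r)) \<le> norm (b r) + norm (b r - \<iota> (bs m r))" using norm_triangle_sub[of "\<iota> (bs m r)" "b r"] by (simp add: norm_minus_commute)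
      then show "norm (\<iota> (bs m r)) \<le> Kb + \<epsilon> m" using K(1)[of r] \<epsilon>(3)[OF r, of m] r by simp
    qed (use \<epsilon> r K in \<open>auto intro: less_imp_le\<close>)
    finally show "D m r \<le> \<delta> m" .
    show "0 \<le> D m r" unfolding D_def by (intro tensor_dist_sq_nonneg[OF \<Phi>] m)
  qed
  have Dint: "D m integrable_on {0..t}" for m
    unfolding D_def tensor_dist_sq_def
    by (rule simple_adapted_integrable[OF simple, of "\<lambda>r u v. (norm (b r))\<^sup>2 * (norm (c r))\<^sup>2 - 2 * Re (cinner (b r) u * cinner (c r) v) + (norm u)\<^sup>2 * (norm v)\<^sup>2"])
       (intro continuous_intros cont)
  have Dhas: "((\<lambda>r. if r = t then 0 else D m r) has_integral integral {0..t} (D m)) {0..t}" for m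
    by (rule has_integral_spike_finite[of "{t}" _ _ "D m"]) (use Dint in \<open>auto simp: integrable_integral\<close>)
  have Dto: "(\<lambda>m. integral {0..t} (D m)) \<longlonglongrightarrow> 0"
  proof (rule tendsto_sandwich)
    show "\<forall>\<^sub>F m in sequentially. 0 \<le> integral {0..t} (D m)"
    proof (intro always_eventually allI)
      fix m show "0 \<le> integral {0..t} (D m)"
        by (rule has_integral_nonneg[OF Dhas]) (use Dle in auto)
    qed
    show "\<forall>\<^sub>F m in sequentially. integral {0..t} (D m) \<le> t * \<delta> m"
    proof (intro always_eventually allI)
      fix m
      have "((\<lambda>r. \<delta> m) has_integral t * \<delta> m) {0..t}" using has_integral_const_real[of "\<delta> m" 0 t] t by simp
      then show "integral {0..t} (D m) \<le> t * \<delta> m"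
        by (rule has_integral_le[OF Dhas]) (use Dle(1)[of _ m] in \<open>auto simp: \<delta>_def\<close>)
    qed
    show "(\<lambda>m. t * \<delta> m) \<longlonglongrightarrow> 0" using tendsto_mult[OF tendsto_const \<delta>, of t] by simp
  qed auto
  define x where "x = (\<lambda>m. \<iota> (simple_integral W (n m) (p m) (bs m) (cs m)))"
  define f where "f = (\<lambda>m r. if 0 \<le> r \<and> r < t then \<Phi> (\<iota> (bs m r)) (\<iota> (cs m r)) else 0)"
  have fx: "elem t \<Phi> (f m) (x m)" for m
    unfolding f_def x_def by (rule simple_elem[OF \<Phi> t order_refl simple])
  have xle: "(norm (x m - x k))\<^sup>2 \<le> t * (2 * \<delta> m + 2 * \<delta> k)" for m k
  proof (rule has_integral_le[OF elem_norm[OF \<Phi> elem_diff[OF \<Phi> fx fx]]])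
    show "((\<lambda>r. 2 * \<delta> m + 2 * \<delta> k) has_integral t * (2 * \<delta> m + 2 * \<delta> k)) {0..t}"
      using has_integral_const_real[of "2 * \<delta> m + 2 * \<delta> k" 0 t] t by simp
    fix r assume "r \<in> {0..t}"
    show "(norm (f m r - f k r))\<^sup>2 \<le> 2 * \<delta> m + 2 * \<delta> k"
    proof (cases "0 \<le> r \<and> r < t")
      case True
      then have r: "0 \<le> r" "r < t" by auto
      let ?g = "\<Phi> (b r) (c r)"
      have d: "(norm (f j r - ?g))\<^sup>2 \<le> \<delta> j" for j
        using Dle(1)[OF r, of j] tensor_dist[OF \<Phi> mem(1,2)[OF r] mem(3,4)[OF r, of j]] r
        by (simp add: f_def D_def norm_minus_commute)
      have "(norm ((f m r - ?g) - (f k r - ?g)))\<^sup>2 \<le> 2 * (norm (f m r - ?g))\<^sup>2 + 2 * (norm (f k r - ?g))\<^sup>2"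
        by (rule norm_diff_sq_le2)
      then show ?thesis using d[of m] d[of k] by simp
    qed (auto simp: f_def \<delta>_def)
  qed
  have "Cauchy x"
  proof (rule metric_CauchyI)
    fix e :: real assume e: "e > 0"
    have "(\<lambda>m. t * \<delta> m) \<longlonglongrightarrow> 0" using tendsto_mult[OF tendsto_const \<delta>, of t] by simp
    then have "eventually (\<lambda>m. t * \<delta> m < e\<^sup>2 / 4) sequentially"
      using order_tendstoD(2)[of _ 0 sequentially "e\<^sup>2 / 4"] e by simp
    then obtain M where M: "\<And>m. m \<ge> M \<Longrightarrow> t * \<delta> m < e\<^sup>2 / 4" unfolding eventually_sequentially by blast
    show "\<exists>M. \<forall>m\<ge>M. \<forall>k\<ge>M. dist (x m) (x k) < e"
    proof (intro exI allI impI)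
      fix m k assume "M \<le> m" "M \<le> k"
      then have "(norm (x m - x k))\<^sup>2 < e\<^sup>2"
        using xle[of m k] M[of m] M[of k] by (simp add: distrib_left)
      then show "dist (x m) (x k) < e" using e power_less_imp_less_base[of "norm (x m - x k)" 2 e] by (simp add: dist_norm)
    qed
  qed
  then obtain \<xi> where \<xi>: "x \<longlonglongrightarrow> \<xi>" using Cauchy_convergent convergent_def by blast
  have "has_free_integral \<iota> W F t b c \<xi>"
    unfolding has_free_integral_def
  proof (intro conjI ballI)
    show "(\<lambda>r. (norm (b r))\<^sup>2 * (norm (c r))\<^sup>2) integrable_on {0..t}"
      by (intro integrable_continuous_real continuous_intros cont)
    show "\<exists>n p bs cs. (\<forall>m. simple_adapted F t (n m) (p m) (bs m) \<and> simple_adapted F t (n m) (p m) (cs m)) \<and>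
       (\<forall>m. (\<lambda>t. tensor_dist_sq (b t) (c t) (\<iota> (bs m t)) (\<iota> (cs m t))) integrable_on {0..t}) \<and>
       (\<lambda>m. integral {0..t} (\<lambda>t. tensor_dist_sq (b t) (c t) (\<iota> (bs m t)) (\<iota> (cs m t)))) \<longlonglongrightarrow> 0 \<and>
       (\<lambda>m. \<iota> (simple_integral W (n m) (p m) (bs m) (cs m))) \<longlonglongrightarrow> \<xi>"
      by (rule exI[of _ n], rule exI[of _ p], rule exI[of _ bs], rule exI[of _ cs])
         (use simple Dint Dto \<xi> in \<open>simp add: D_def x_def\<close>)
  qed (use ad in auto)
  then show ?thesis using that \<xi> unfolding x_def by blast
qed

end


section \<open>Self-adjoint vectors and extended coefficients\<close>

context nc_L2
begin

text \<open>Traciality makes the adjoint isometric for the L^2 norm, so it extends continuously. The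
  extension is conjugate-linear, which fits into the type of real-linear maps.\<close>

lemma L2_adj_blinfun:
  "\<exists>V :: 'k \<Rightarrow>\<^sub>L 'k. L2_adj A \<iota> = blinfun_apply V \<and> (\<forall>X\<in>A. blinfun_apply V (\<iota> X) = \<iota> (op_adj X)) \<and>
     (\<forall>u. norm (blinfun_apply V u) \<le> norm u)"
proof -
  define R where "R = (\<lambda>X. (\<iota> X, \<iota> (op_adj X))) ` A"
  have sub: "subspace R"
    unfolding subspace_def R_def
  proof (intro conjI ballI allI)
    show "0 \<in> (\<lambda>X. (\<iota> X, \<iota> (op_adj X))) ` A" by (rule image_eqI[OF _ zero_in]) (simp add: io_zero zero_prod_def)
    fix p assume "p \<in> (\<lambda>X. (\<iota> X, \<iota> (op_adj X))) ` A"
    then obtain Y where Y: "Y \<in> A" "p = (\<iota> Y, \<iota> (op_adj Y))" by blast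
    show "c *\<^sub>R p \<in> (\<lambda>X. (\<iota> X, \<iota> (op_adj X))) ` A" for c
      by (rule image_eqI[of _ _ "c *\<^sub>R Y"]) (use Y in \<open>auto simp: io_scaleR op_adj_scaleR ops_in\<close>)
    fix q assume "q \<in> (\<lambda>X. (\<iota> X, \<iota> (op_adj X))) ` A"
    then obtain Z where Z: "Z \<in> A" "q = (\<iota> Z, \<iota> (op_adj Z))" by blast
    show "p + q \<in> (\<lambda>X. (\<iota> X, \<iota> (op_adj X))) ` A"
      by (rule image_eqI[of _ _ "Y + Z"]) (use Y Z in \<open>auto simp: io_add op_adj_add in_bounded_ops ops_in\<close>)
  qed
  have le: "norm y \<le> 1 * norm x" if "(x, y) \<in> R" for x y
    using that by (auto simp: R_def io_adj_norm)
  obtain V where "\<forall>x y. (x, y) \<in> R \<longrightarrow> blinfun_apply V x = y"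
    using extend_bounded_relation[OF sub le] by blast
  then have V: "blinfun_apply V (\<iota> X) = \<iota> (op_adj X)" if "X \<in> A" for X using that by (auto simp: R_def)
  have "L2_adj A \<iota> = blinfun_apply V"
    unfolding L2_adj_def
  proof (rule the_equality)
    show "continuous_on UNIV (blinfun_apply V) \<and> (\<forall>X\<in>A. blinfun_apply V (\<iota> X) = \<iota> (op_adj X))"
      using V by (auto intro: continuous_intros)
    fix J assume J: "continuous_on UNIV J \<and> (\<forall>X\<in>A. J (\<iota> X) = \<iota> (op_adj X))"
    have "closure (\<iota> ` A) \<subseteq> {u. J u = blinfun_apply V u}"
      by (rule closure_minimal) (use J V in \<open>auto intro!: closed_Collect_eq continuous_intros\<close>)
    then show "J = blinfun_apply V" using io_dense by auto
  qed
  moreover have "closure (\<iota> ` A) \<subseteq> {u. norm (blinfun_apply V u) \<le> norm u}"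
    by (rule closure_minimal) (use V in \<open>auto intro!: closed_Collect_le continuous_intros simp: io_adj_norm\<close>)
  then have "norm (blinfun_apply V u) \<le> norm u" for u using io_dense by auto
  ultimately show ?thesis using V by blast
qed

abbreviation "Lsa \<equiv> L2_sa A \<iota>"

lemma Lsa_closed: "closed Lsa"
proof -
  obtain V where V: "L2_adj A \<iota> = blinfun_apply V" "\<And>X. X \<in> A \<Longrightarrow> blinfun_apply V (\<iota> X) = \<iota> (op_adj X)"
    "\<And>u. norm (blinfun_apply V u) \<le> norm u"
    using L2_adj_blinfun by blast
  show ?thesis unfolding L2_sa_def V(1) by (intro closed_Collect_eq continuous_intros)
qed

lemma Lsa_subspace: "subspace Lsa"
proof -
  obtain V where V: "L2_adj A \<iota> = blinfun_apply V" "\<And>X. X \<in> A \<Longrightarrow> blinfun_apply V (\<iota> X) = \<iota> (op_adj X)"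
    "\<And>u. norm (blinfun_apply V u) \<le> norm u"
    using L2_adj_blinfun by blast
  show ?thesis unfolding L2_sa_def V(1) by (auto simp: subspace_def blinfun.add_right blinfun.scaleR_right)
qed

lemma io_Lsa: "X \<in> sa_part A \<Longrightarrow> \<iota> X \<in> Lsa"
proof -
  assume X: "X \<in> sa_part A"
  obtain V where V: "L2_adj A \<iota> = blinfun_apply V" "\<And>X. X \<in> A \<Longrightarrow> blinfun_apply V (\<iota> X) = \<iota> (op_adj X)"
    "\<And>u. norm (blinfun_apply V u) \<le> norm u"
    using L2_adj_blinfun by blast
  show ?thesis using X V(2)[of X] by (simp add: L2_sa_def V(1) sa_part_def)
qed

lemma L2_trace_mult_sa: "u \<in> Lsa \<Longrightarrow> Re (L2_trace_mult A \<iota> u v) = inner u v"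
  by (simp add: L2_trace_mult_def L2_sa_def inner_eq_Re_cinner)

text \<open>An approximant \<open>Y\<close> is replaced by \<open>(Y + op_adj Y) / 2\<close>; the
  involution fixes \<open>u\<close> and does not increase norms, so the error does not grow.\<close>

lemma Lsa_approx:
  assumes N: "von_neumann_algebra N" "N \<subseteq> A" and u: "u \<in> Lsa" "u \<in> L2_sub \<iota> N" and e: "e > 0"
  shows "\<exists>X\<in>sa_part N. norm (\<iota> X - u) < e"
proof -
  interpret N: vn_alg N by unfold_locales (rule N)
  obtain V where V: "L2_adj A \<iota> = blinfun_apply V" "\<And>X. X \<in> A \<Longrightarrow> blinfun_apply V (\<iota> X) = \<iota> (op_adj X)"
    "\<And>u. norm (blinfun_apply V u) \<le> norm u"
    using L2_adj_blinfun by blast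
  obtain Y where Y: "Y \<in> N" "dist (\<iota> Y) u < e"
    using u(2) e unfolding L2_sub_def closure_approachable by blast
  define X where "X = (1/2) *\<^sub>R (Y + op_adj Y)"
  have YA: "Y \<in> A" "op_adj Y \<in> A" using Y N N.adj_in by auto
  have "X \<in> sa_part N"
    using Y(1) by (simp add: X_def sa_part_def N.ops_in N.op_adj_scaleR op_adj_add N.in_bounded_ops add.commute)
  moreover have "\<iota> X - u = (1/2) *\<^sub>R ((\<iota> Y - u) + blinfun_apply V (\<iota> Y - u))"
    using u(1) YA V by (simp add: X_def io_scaleR io_add ops_in blinfun.diff_right L2_sa_def algebra_simps scaleR_add_left[symmetric])
  then have "norm (\<iota> X - u) \<le> (1/2) * (norm (\<iota> Y - u) + norm (\<iota> Y - u))"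
    using V(3)[of "\<iota> Y - u"] norm_triangle_ineq[of "\<iota> Y - u" "blinfun_apply V (\<iota> Y - u)"] by simp
  ultimately show ?thesis using Y(2) by (intro bexI[of _ X]) (auto simp: dist_norm)
qed

lemma L2_sub_A: "L2_sub \<iota> A = UNIV"
  by (simp add: L2_sub_def io_dense)

lemma Lsa_seq:
  assumes "von_neumann_algebra N" "N \<subseteq> A" "u \<in> Lsa" "u \<in> L2_sub \<iota> N"
  obtains X where "\<And>n::nat. X n \<in> sa_part N" "(\<lambda>n. \<iota> (X n)) \<longlonglongrightarrow> u"
proof -
  have "\<forall>n::nat. \<exists>X\<in>sa_part N. norm (\<iota> X - u) < 1 / Suc n"
    using Lsa_approx[OF assms] by simp
  then obtain X where X: "\<And>n::nat. X n \<in> sa_part N" "\<And>n. norm (\<iota> (X n) - u) < 1 / Suc n" by metis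
  have "(\<lambda>n. \<iota> (X n) - u) \<longlonglongrightarrow> 0"
    by (rule Lim_null_comparison[of _ "\<lambda>n. 1 / Suc n"])
       (use X(2) less_imp_le LIMSEQ_inverse_real_of_nat in \<open>auto simp: inverse_eq_divide intro!: always_eventually\<close>)
  then have "(\<lambda>n. \<iota> (X n)) \<longlonglongrightarrow> u" by (simp add: LIM_zero_iff)
  then show ?thesis using that X(1) by blast
qed

definition loc_lip :: "('k \<Rightarrow> 'k) \<Rightarrow> bool" where
  "loc_lip g \<longleftrightarrow> (\<forall>M>0. \<exists>L>0. \<forall>u\<in>Lsa. \<forall>v\<in>Lsa. norm u \<le> M \<and> norm v \<le> M \<longrightarrow> norm (g u - g v) \<le> L * norm (u - v))"

lemma loc_lip_continuous_on:
  assumes "loc_lip g"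
  shows "continuous_on Lsa g"
  unfolding continuous_on_sequentially comp_def
proof (intro allI ballI impI)
  fix x u assume u: "u \<in> Lsa" and x: "(\<forall>n. x n \<in> Lsa) \<and> x \<longlonglongrightarrow> u"
  have "Bseq x" using x by (auto intro!: convergent_imp_Bseq convergentI)
  then obtain K where K: "\<And>n. norm (x n) \<le> K" "K > 0" unfolding Bseq_def by blast
  obtain L where L: "L > 0" "\<And>v w. v \<in> Lsa \<Longrightarrow> w \<in> Lsa \<Longrightarrow> norm v \<le> K + norm u \<Longrightarrow> norm w \<le> K + norm u \<Longrightarrow> norm (g v - g w) \<le> L * norm (v - w)"
    using assms K(2) unfolding loc_lip_def by (meson add_pos_nonneg norm_ge_zero)
  have "(\<lambda>n. g (x n) - g u) \<longlonglongrightarrow> 0"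
  proof (rule Lim_null_comparison)
    show "\<forall>\<^sub>F n in sequentially. norm (g (x n) - g u) \<le> L * norm (x n - u)"
    proof (intro always_eventually allI L(2))
      fix n
      show "norm (x n) \<le> K + norm u" using K(1)[of n] norm_ge_zero[of u] by linarith
      show "norm u \<le> K + norm u" using K(2) by linarith
    qed (use u x in auto)
    have "(\<lambda>n. x n - u) \<longlonglongrightarrow> 0" using x by (simp add: LIM_zero_iff)
    then show "(\<lambda>n. L * norm (x n - u)) \<longlonglongrightarrow> 0" using tendsto_mult[OF tendsto_const tendsto_norm_zero] by fastforce
  qed
  then show "(\<lambda>n. g (x n)) \<longlonglongrightarrow> g u" by (simp add: LIM_zero_iff)
qed

text \<open>Existence and uniqueness behind the definite description. A convergent sequence is
  bounded, so one local Lipschitz constant governs it and its image under \<open>f\<close> is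
  Cauchy.\<close>

lemma L2_extension:
  assumes maps: "f \<in> sa_part A \<rightarrow> sa_part A" and lip: "locally_L2_lipschitz A \<iota> f"
  shows "L2_extension A \<iota> f \<in> Lsa \<rightarrow> Lsa" "loc_lip (L2_extension A \<iota> f)"
    "\<And>U. U \<in> sa_part A \<Longrightarrow> L2_extension A \<iota> f (\<iota> U) = \<iota> (f U)"
proof -
  have fsa: "f X \<in> sa_part A" if "X \<in> sa_part A" for X using maps that by auto
  have lipM: "\<exists>L>0. \<forall>U\<in>sa_part A. \<forall>V\<in>sa_part A.
      norm (\<iota> U) \<le> M \<and> norm (\<iota> V) \<le> M \<longrightarrow> norm (\<iota> (f U) - \<iota> (f V)) \<le> L * norm (\<iota> U - \<iota> V)" if "M > 0" for M
    using lip that fsa sa_partD unfolding locally_L2_lipschitz_def by (simp add: io_diff)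
  have "\<forall>u. \<exists>x. u \<in> Lsa \<longrightarrow> (\<forall>n::nat. x n \<in> sa_part A) \<and> (\<lambda>n. \<iota> (x n)) \<longlonglongrightarrow> u"
    using Lsa_seq[OF vn order_refl] L2_sub_A by (metis UNIV_I)
  then obtain x where x: "\<And>u n. u \<in> Lsa \<Longrightarrow> x u n \<in> sa_part A" "\<And>u. u \<in> Lsa \<Longrightarrow> (\<lambda>n. \<iota> (x u n)) \<longlonglongrightarrow> u" by metis
  have conv: "\<exists>v. (\<lambda>n. \<iota> (f (X n))) \<longlonglongrightarrow> v" if X: "\<And>n. X n \<in> sa_part A" "(\<lambda>n. \<iota> (X n)) \<longlonglongrightarrow> u" for X u
  proof -
    have "Bseq (\<lambda>n. \<iota> (X n))" using X by (auto intro!: convergent_imp_Bseq convergentI)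
    then obtain K where K: "\<And>n. norm (\<iota> (X n)) \<le> K" "K > 0" unfolding Bseq_def by blast
    obtain L where L: "L > 0" "\<And>m n. norm (\<iota> (f (X m)) - \<iota> (f (X n))) \<le> L * norm (\<iota> (X m) - \<iota> (X n))"
      using lipM[OF K(2)] K(1) X(1) by blast
    have "Cauchy (\<lambda>n. \<iota> (f (X n)))"
    proof (rule metric_CauchyI)
      fix e :: real assume "e > 0"
      then have "e / L > 0" using L by simp
      then obtain N where N: "\<And>m n. m \<ge> N \<Longrightarrow> n \<ge> N \<Longrightarrow> dist (\<iota> (X m)) (\<iota> (X n)) < e / L"
        using LIMSEQ_imp_Cauchy[OF X(2)] by (meson metric_CauchyD)
      show "\<exists>M. \<forall>m\<ge>M. \<forall>n\<ge>M. dist (\<iota> (f (X m))) (\<iota> (f (X n))) < e"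
      proof (intro exI allI impI)
        fix m n assume "N \<le> m" "N \<le> n"
        then have "L * norm (\<iota> (X m) - \<iota> (X n)) < e" using N L(1) by (simp add: dist_norm field_simps)
        then show "dist (\<iota> (f (X m))) (\<iota> (f (X n))) < e" using L(2)[of m n] by (simp add: dist_norm)
      qed
    qed
    then show ?thesis using Cauchy_convergent convergent_def by blast
  qed
  define g where "g = (\<lambda>u. if u \<in> Lsa then lim (\<lambda>n. \<iota> (f (x u n))) else undefined)"
  have g: "(\<lambda>n. \<iota> (f (x u n))) \<longlonglongrightarrow> g u" if "u \<in> Lsa" for u
    using conv[OF x(1)[OF that] x(2)[OF that]] that limI unfolding g_def by auto
  have g_Lsa: "g u \<in> Lsa" if "u \<in> Lsa" for u
    using closed_sequentially[OF Lsa_closed _ g[OF that]] io_Lsa fsa x(1)[OF that] by blast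
  have g_lip: "loc_lip g"
    unfolding loc_lip_def
  proof (intro allI impI)
    fix M :: real assume "M > 0"
    \<comment> \<open>Approximants of vectors of norm at most \<open>M\<close> may exceed
      \<open>M\<close> slightly, hence the constant for \<open>M + 1\<close>.\<close>
    then obtain L where L: "L > 0" "\<And>U V. U \<in> sa_part A \<Longrightarrow> V \<in> sa_part A \<Longrightarrow>
       norm (\<iota> U) \<le> M + 1 \<Longrightarrow> norm (\<iota> V) \<le> M + 1 \<Longrightarrow> norm (\<iota> (f U) - \<iota> (f V)) \<le> L * norm (\<iota> U - \<iota> V)"
      using lipM[of "M + 1"] by auto
    have "norm (g u - g v) \<le> L * norm (u - v)" if uv: "u \<in> Lsa" "v \<in> Lsa" "norm u \<le> M" "norm v \<le> M" for u v
    proof (rule tendsto_le[OF sequentially_bot])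
      show "(\<lambda>n. L * norm (\<iota> (x u n) - \<iota> (x v n))) \<longlonglongrightarrow> L * norm (u - v)"
        by (intro tendsto_intros x uv)
      show "(\<lambda>n. norm (\<iota> (f (x u n)) - \<iota> (f (x v n)))) \<longlonglongrightarrow> norm (g u - g v)"
        by (intro tendsto_intros g uv)
      have ev: "\<forall>\<^sub>F n in sequentially. norm (\<iota> (x w n)) < M + 1" if "w \<in> Lsa" "norm w \<le> M" for w
        using order_tendstoD(2)[OF tendsto_norm[OF x(2)[OF that(1)]], of "M + 1"] that(2) by simp
      show "\<forall>\<^sub>F n in sequentially. norm (\<iota> (f (x u n)) - \<iota> (f (x v n))) \<le> L * norm (\<iota> (x u n) - \<iota> (x v n))"
        using ev[OF uv(1,3)] ev[OF uv(2,4)]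
        by eventually_elim (use L(2) x(1) uv in \<open>auto intro: less_imp_le\<close>)
    qed
    then show "\<exists>L>0. \<forall>u\<in>Lsa. \<forall>v\<in>Lsa. norm u \<le> M \<and> norm v \<le> M \<longrightarrow> norm (g u - g v) \<le> L * norm (u - v)"
      using L(1) by blast
  qed
  have g_io: "g (\<iota> U) = \<iota> (f U)" if U: "U \<in> sa_part A" for U
  proof -
    have u: "\<iota> U \<in> Lsa" using io_Lsa U .
    have pos: "norm (\<iota> U) + 1 > 0" by (simp add: add_nonneg_pos)
    obtain L where L0: "L > 0" "\<forall>U'\<in>sa_part A. \<forall>V\<in>sa_part A. norm (\<iota> U') \<le> norm (\<iota> U) + 1 \<and> norm (\<iota> V) \<le> norm (\<iota> U) + 1 \<longrightarrow>
        norm (\<iota> (f U') - \<iota> (f V)) \<le> L * norm (\<iota> U' - \<iota> V)"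
      using lipM[OF pos] by blast
    have L: "norm (\<iota> (f V) - \<iota> (f U)) \<le> L * norm (\<iota> V - \<iota> U)" if "V \<in> sa_part A" "norm (\<iota> V) \<le> norm (\<iota> U) + 1" for V
      using L0(2) that U by simp
    have "(\<lambda>n. \<iota> (f (x (\<iota> U) n)) - \<iota> (f U)) \<longlonglongrightarrow> 0"
    proof (rule Lim_null_comparison)
      have "\<forall>\<^sub>F n in sequentially. norm (\<iota> (x (\<iota> U) n)) < norm (\<iota> U) + 1"
        using order_tendstoD(2)[OF tendsto_norm[OF x(2)[OF u]], of "norm (\<iota> U) + 1"] by simp
      then show "\<forall>\<^sub>F n in sequentially. norm (\<iota> (f (x (\<iota> U) n)) - \<iota> (f U)) \<le> L * norm (\<iota> (x (\<iota> U) n) - \<iota> U)"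
        by eventually_elim (use L x(1)[OF u] in auto)
      have "(\<lambda>n. L * norm (\<iota> (x (\<iota> U) n) - \<iota> U)) \<longlonglongrightarrow> L * norm (\<iota> U - \<iota> U)" by (intro tendsto_intros x(2) u)
      then show "(\<lambda>n. L * norm (\<iota> (x (\<iota> U) n) - \<iota> U)) \<longlonglongrightarrow> 0" by simp
    qed
    then have "(\<lambda>n. \<iota> (f (x (\<iota> U) n))) \<longlonglongrightarrow> \<iota> (f U)" by (simp add: LIM_zero_iff)
    then show ?thesis using g[OF u] LIMSEQ_unique by blast
  qed
  have "L2_extension A \<iota> f = g"
    unfolding L2_extension_def
  proof (rule the_equality)
    show "g \<in> Lsa \<rightarrow>\<^sub>E Lsa \<and> continuous_on Lsa g \<and> (\<forall>U\<in>sa_part A. g (\<iota> U) = \<iota> (f U))"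
      using g_Lsa g_io loc_lip_continuous_on[OF g_lip] by (auto simp: PiE_def extensional_def g_def)
    fix h assume h: "h \<in> Lsa \<rightarrow>\<^sub>E Lsa \<and> continuous_on Lsa h \<and> (\<forall>U\<in>sa_part A. h (\<iota> U) = \<iota> (f U))"
    show "h = g"
    proof
      fix u
      show "h u = g u"
      proof (cases "u \<in> Lsa")
        case True
        have "continuous_on Lsa h" using h by blast
        moreover have "(\<forall>n. \<iota> (x u n) \<in> Lsa) \<and> (\<lambda>n. \<iota> (x u n)) \<longlonglongrightarrow> u" using x[OF True] io_Lsa by simp
        ultimately have "(\<lambda>n. h (\<iota> (x u n))) \<longlonglongrightarrow> h u"
          using True unfolding continuous_on_sequentially comp_def by simp
        moreover have "(\<lambda>n. h (\<iota> (x u n))) = (\<lambda>n. \<iota> (f (x u n)))" using h x(1)[OF True] by auto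
        ultimately show ?thesis using g[OF True] LIMSEQ_unique by metis
      next
        case False
        then show ?thesis using h by (auto simp: PiE_def extensional_def g_def)
      qed
    qed
  qed
  then show "L2_extension A \<iota> f \<in> Lsa \<rightarrow> Lsa" "loc_lip (L2_extension A \<iota> f)"
    "\<And>U. U \<in> sa_part A \<Longrightarrow> L2_extension A \<iota> f (\<iota> U) = \<iota> (f U)"
    using g_Lsa g_lip g_io by auto
qed

text \<open>Causality speaks about operators only. A self-adjoint vector of L^2(N) is a limit of
  self-adjoint \<open>X n\<close> in \<open>N\<close>, and \<open>W*(X n)\<close> stays inside
  \<open>N\<close>.\<close>

lemma L2_extension_adapted:
  assumes maps: "f \<in> sa_part A \<rightarrow> sa_part A" and lip: "locally_L2_lipschitz A \<iota> f" and c: "causal A f"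
    and N: "von_neumann_algebra N" "N \<subseteq> A" and u: "u \<in> Lsa" "u \<in> L2_sub \<iota> N"
  shows "L2_extension A \<iota> f u \<in> L2_sub \<iota> N"
proof -
  obtain X where X: "\<And>n::nat. X n \<in> sa_part N" "(\<lambda>n. \<iota> (X n)) \<longlonglongrightarrow> u" using Lsa_seq[OF N u] by blast
  have XA: "X n \<in> sa_part A" for n using X(1)[of n] N(2) by (auto simp: sa_part_def)
  have "f (X n) \<in> N" for n
  proof -
    have "f (X n) \<in> vn_generated {X n}" using c XA unfolding causal_def by blast
    moreover have "vn_generated {X n} \<subseteq> N" by (rule vn_generated_least[OF N(1)]) (use X(1)[of n] in \<open>auto simp: sa_part_def\<close>)
    ultimately show ?thesis by blast
  qed
  then have "L2_extension A \<iota> f (\<iota> (X n)) \<in> L2_sub \<iota> N" for n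
    unfolding L2_extension(3)[OF maps lip XA] L2_sub_def using closure_subset[of "\<iota> ` N"] by blast
  moreover have "(\<forall>n. \<iota> (X n) \<in> Lsa) \<and> (\<lambda>n. \<iota> (X n)) \<longlonglongrightarrow> u" using X(2) io_Lsa[OF XA] by simp
  then have "(\<lambda>n. L2_extension A \<iota> f (\<iota> (X n))) \<longlonglongrightarrow> L2_extension A \<iota> f u"
    using loc_lip_continuous_on[OF L2_extension(2)[OF maps lip]] u(1)
    unfolding continuous_on_sequentially comp_def by simp
  ultimately show ?thesis unfolding L2_sub_def
    by (rule closed_sequentially[OF closed_closure])
qed

end


section \<open>The Picard map\<close>

context free_bm
begin

text \<open>Between \<open>s\<close> and \<open>t\<close> the integrand is the sum of the tensors of
  \<open>b i\<close> and \<open>c i\<close>, and the triangle inequality in the tensor space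
  produces precisely the quantity squared in (A-2).\<close>

lemma martingale_incr_bound:
  assumes st: "0 \<le> s" "s \<le> t"
    and I: "\<And>i. i \<in> I \<Longrightarrow> has_free_integral \<iota> W F t (b i) (c i) (\<xi> i)"
      "\<And>i. i \<in> I \<Longrightarrow> has_free_integral \<iota> W F s (b i) (c i) (\<xi>' i)"
    and g: "g integrable_on {s..t}" "\<And>r. r \<in> {s..t} \<Longrightarrow> (\<Sum>i\<in>I. norm (b i r) * norm (c i r))\<^sup>2 \<le> g r"
  shows "(norm ((\<Sum>i\<in>I. \<xi> i) - (\<Sum>i\<in>I. \<xi>' i)))\<^sup>2 \<le> integral {s..t} g"
proof -
  obtain \<Phi> where \<Phi>: "tensor_map t \<Phi>" using tensor_map_exists st by (meson order_trans)
  have t0: "0 \<le> t" using st by simp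
  have lim: "free_lim t \<Phi> (\<lambda>r. (\<Sum>i\<in>I. tens \<Phi> t (b i) (c i) r) - (\<Sum>i\<in>I. tens \<Phi> s (b i) (c i) r)) ((\<Sum>i\<in>I. \<xi> i) - (\<Sum>i\<in>I. \<xi>' i))"
    using free_integral_lim[OF \<Phi> I(1) t0 order_refl] free_integral_lim[OF \<Phi> I(2) st]
    by (intro free_lim_diff[OF \<Phi>] free_lim_sum[OF \<Phi>])
  define G where "G = (\<lambda>r. if r \<in> {s..t} then g r else 0)"
  have G: "(G has_integral integral {s..t} g) {0..t}"
    unfolding G_def using has_integral_restrict[of "{s..t}" "{0..t}" g "integral {s..t} g"] g(1) st by auto
  have "(norm ((\<Sum>i\<in>I. \<xi> i) - (\<Sum>i\<in>I. \<xi>' i)))\<^sup>2 \<le> integral {0..t} G"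
  proof (rule free_lim_bound[OF \<Phi> lim])
    show "G integrable_on {0..t}" using G by blast
    fix r assume r: "r \<in> {0..t}"
    have bc: "b i r \<in> L2F t" "c i r \<in> L2F t" if "i \<in> I" for i
      using I(1)[OF that] r unfolding has_free_integral_def by (auto intro: L2F_mem_mono)
    consider "r < s" | "s \<le> r" "r < t" | "r = t" using r by fastforce
    then show "(norm ((\<Sum>i\<in>I. tens \<Phi> t (b i) (c i) r) - (\<Sum>i\<in>I. tens \<Phi> s (b i) (c i) r)))\<^sup>2 \<le> G r"
    proof cases
      case 1
      then have "(\<Sum>i\<in>I. tens \<Phi> t (b i) (c i) r) = (\<Sum>i\<in>I. tens \<Phi> s (b i) (c i) r)"
        using st by (intro sum.cong) (auto simp: tens_def[OF \<Phi>])
      then show ?thesis using 1 by (simp add: G_def)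
    next
      case 2
      then have "(\<Sum>i\<in>I. tens \<Phi> t (b i) (c i) r) = (\<Sum>i\<in>I. \<Phi> (b i r) (c i r))"
        using st by (intro sum.cong) (auto simp: tens_def[OF \<Phi>])
      moreover have "(\<Sum>i\<in>I. tens \<Phi> s (b i) (c i) r) = 0" using 2 by (auto simp: tens_def[OF \<Phi>])
      moreover have "norm (\<Sum>i\<in>I. \<Phi> (b i r) (c i r)) \<le> (\<Sum>i\<in>I. norm (b i r) * norm (c i r))"
        using tensor_norm[OF \<Phi>] bc by (intro sum_norm_le) auto
      ultimately show ?thesis using g(2)[of r] 2 power_mono[of "norm (\<Sum>i\<in>I. \<Phi> (b i r) (c i r))" "\<Sum>i\<in>I. norm (b i r) * norm (c i r)" 2]
        by (simp add: G_def)
    next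
      case 3
      then have "(\<Sum>i\<in>I. tens \<Phi> t (b i) (c i) r) = 0" "(\<Sum>i\<in>I. tens \<Phi> s (b i) (c i) r) = 0"
        using st by (auto simp: tens_def[OF \<Phi>])
      moreover have "0 \<le> g r" using g(2)[of r] 3 st order_trans[OF zero_le_power2] by (meson atLeastAtMost_iff order_refl)
      ultimately show ?thesis using 3 st by (simp add: G_def)
    qed
  qed
  then show ?thesis using integral_unique[OF G] by simp
qed

lemma martingale_incr_orth:
  assumes st: "0 \<le> s" "s \<le> t"
    and I: "\<And>i. i \<in> I \<Longrightarrow> has_free_integral \<iota> W F t (b i) (c i) (\<xi> i)"
      "\<And>i. i \<in> I \<Longrightarrow> has_free_integral \<iota> W F s (b i) (c i) (\<xi>' i)"
    and \<eta>: "\<eta> \<in> L2F s"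
  shows "inner \<eta> ((\<Sum>i\<in>I. \<xi> i) - (\<Sum>i\<in>I. \<xi>' i)) = 0"
proof -
  have t0: "0 \<le> t" using st by simp
  obtain \<Phi> where \<Phi>: "tensor_map t \<Phi>" using tensor_map_exists t0 by blast
  have "inner \<eta> (\<xi> i - \<xi>' i) = 0" if i: "i \<in> I" for i
  proof (rule free_lim_orth[OF \<Phi> st _ _ \<eta>])
    show "free_lim t \<Phi> (tens \<Phi> t (b i) (c i)) (\<xi> i)" by (rule free_integral_lim[OF \<Phi> I(1)[OF i] t0 order_refl])
    have "(\<lambda>r. if r < s then tens \<Phi> t (b i) (c i) r else 0) = tens \<Phi> s (b i) (c i)"
      using st by (auto simp: tens_def[OF \<Phi>] fun_eq_iff)
    then show "free_lim t \<Phi> (\<lambda>r. if r < s then tens \<Phi> t (b i) (c i) r else 0) (\<xi>' i)"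
      using free_integral_lim[OF \<Phi> I(2)[OF i] st] by simp
  qed
  then have "(\<Sum>i\<in>I. inner \<eta> (\<xi> i - \<xi>' i)) = 0" by simp
  then show ?thesis by (simp add: inner_sum_right[symmetric] sum_subtractf)
qed

text \<open>A difference of tensors is split by changing one factor at a time, which is where the
  two products in the majorant come from.\<close>

lemma martingale_diff_bound:
  assumes t0: "0 \<le> t"
    and I: "\<And>i. i \<in> I \<Longrightarrow> has_free_integral \<iota> W F t (b i) (c i) (\<xi> i)"
      "\<And>i. i \<in> I \<Longrightarrow> has_free_integral \<iota> W F t (b' i) (c' i) (\<xi>' i)"
    and g: "g integrable_on {0..t}"
      "\<And>r. r \<in> {0..t} \<Longrightarrow> (\<Sum>i\<in>I. norm (b i r - b' i r) * norm (c i r) + norm (b' i r) * norm (c i r - c' i r))\<^sup>2 \<le> g r"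
  shows "(norm ((\<Sum>i\<in>I. \<xi> i) - (\<Sum>i\<in>I. \<xi>' i)))\<^sup>2 \<le> integral {0..t} g"
proof -
  obtain \<Phi> where \<Phi>: "tensor_map t \<Phi>" using tensor_map_exists t0 by blast
  have lim: "free_lim t \<Phi> (\<lambda>r. (\<Sum>i\<in>I. tens \<Phi> t (b i) (c i) r) - (\<Sum>i\<in>I. tens \<Phi> t (b' i) (c' i) r)) ((\<Sum>i\<in>I. \<xi> i) - (\<Sum>i\<in>I. \<xi>' i))"
    using free_integral_lim[OF \<Phi> I(1) t0 order_refl] free_integral_lim[OF \<Phi> I(2) t0 order_refl]
    by (intro free_lim_diff[OF \<Phi>] free_lim_sum[OF \<Phi>])
  show ?thesis
  proof (rule free_lim_bound[OF \<Phi> lim g(1)])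
    fix r assume r: "r \<in> {0..t}"
    have bc: "b i r \<in> L2F t" "c i r \<in> L2F t" "b' i r \<in> L2F t" "c' i r \<in> L2F t" if "i \<in> I" for i
      using I(1)[OF that] I(2)[OF that] r unfolding has_free_integral_def by (auto intro: L2F_mem_mono)
    have le: "norm (tens \<Phi> t (b i) (c i) r - tens \<Phi> t (b' i) (c' i) r)
        \<le> norm (b i r - b' i r) * norm (c i r) + norm (b' i r) * norm (c i r - c' i r)" if "i \<in> I" for i
      using tensor_lip[OF \<Phi> bc[OF that]] by (simp add: tens_def[OF \<Phi>])
    have "norm ((\<Sum>i\<in>I. tens \<Phi> t (b i) (c i) r) - (\<Sum>i\<in>I. tens \<Phi> t (b' i) (c' i) r))
       \<le> (\<Sum>i\<in>I. norm (b i r - b' i r) * norm (c i r) + norm (b' i r) * norm (c i r - c' i r))"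
      unfolding sum_subtractf[symmetric] by (intro sum_norm_le le)
    then show "(norm ((\<Sum>i\<in>I. tens \<Phi> t (b i) (c i) r) - (\<Sum>i\<in>I. tens \<Phi> t (b' i) (c' i) r)))\<^sup>2 \<le> g r"
      using g(2)[OF r] power_mono[of _ _ 2] by (meson norm_ge_zero order_trans)
  qed
qed

text \<open>The Picard map as a relation: \<open>u'\<close> is an image of the process
  \<open>u\<close>. Its diagonal, \<open>step l a b c T u u\<close>, says that \<open>u\<close>
  solves the equation on \<open>[0, T]\<close>, so iteration, uniqueness and the energy bound share
  one notion. The coefficients are arbitrary maps on L^2 to cover both the original and the
  truncated equation.\<close>

definition step :: "nat \<Rightarrow> ('k \<Rightarrow> 'k) \<Rightarrow> (nat \<Rightarrow> 'k \<Rightarrow> 'k) \<Rightarrow> (nat \<Rightarrow> 'k \<Rightarrow> 'k) \<Rightarrow> real \<Rightarrow> (real \<Rightarrow> 'k) \<Rightarrow> (real \<Rightarrow> 'k) \<Rightarrow> bool" where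
  "step l a b c T u u' \<longleftrightarrow> (\<forall>t\<in>{0..T}. u' t \<in> Lsa \<and> u' t \<in> L2F t \<and>
     (\<exists>\<zeta> \<xi>. ((\<lambda>s. a (u s)) has_integral \<zeta>) {0..t} \<and>
       (\<forall>i\<in>{1..l}. has_free_integral \<iota> W F t (\<lambda>s. b i (u s)) (\<lambda>s. c i (u s)) (\<xi> i)) \<and>
       u' t = \<iota> U0 + \<zeta> + (\<Sum>i=1..l. \<xi> i)))"

lemma stepE:
  assumes "step l a b c T u u'"
  obtains \<xi> where "\<And>t. t \<in> {0..T} \<Longrightarrow> u' t \<in> Lsa" "\<And>t. t \<in> {0..T} \<Longrightarrow> u' t \<in> L2F t"
    "\<And>t. t \<in> {0..T} \<Longrightarrow> (\<lambda>s. a (u s)) integrable_on {0..t}"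
    "\<And>t i. t \<in> {0..T} \<Longrightarrow> i \<in> {1..l} \<Longrightarrow> has_free_integral \<iota> W F t (\<lambda>s. b i (u s)) (\<lambda>s. c i (u s)) (\<xi> t i)"
    "\<And>t. t \<in> {0..T} \<Longrightarrow> u' t = \<iota> U0 + integral {0..t} (\<lambda>s. a (u s)) + (\<Sum>i=1..l. \<xi> t i)"
proof -
  have "\<forall>t\<in>{0..T}. \<exists>\<xi>. u' t \<in> Lsa \<and> u' t \<in> L2F t \<and> (\<lambda>s. a (u s)) integrable_on {0..t} \<and>
     (\<forall>i\<in>{1..l}. has_free_integral \<iota> W F t (\<lambda>s. b i (u s)) (\<lambda>s. c i (u s)) (\<xi> i)) \<and>
     u' t = \<iota> U0 + integral {0..t} (\<lambda>s. a (u s)) + (\<Sum>i=1..l. \<xi> i)"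
    using assms unfolding step_def by (metis has_integral_integrable integral_unique)
  then obtain \<xi> where \<xi>: "\<forall>t\<in>{0..T}. u' t \<in> Lsa \<and> u' t \<in> L2F t \<and> (\<lambda>s. a (u s)) integrable_on {0..t} \<and>
     (\<forall>i\<in>{1..l}. has_free_integral \<iota> W F t (\<lambda>s. b i (u s)) (\<lambda>s. c i (u s)) (\<xi> t i)) \<and>
     u' t = \<iota> U0 + integral {0..t} (\<lambda>s. a (u s)) + (\<Sum>i=1..l. \<xi> t i)"
    by (rule bchoice[THEN exE])
  show ?thesis by (rule that[of \<xi>]) (insert \<xi>, blast+)
qed

lemma step_mono: "step l a b c T u u' \<Longrightarrow> T' \<le> T \<Longrightarrow> step l a b c T' u u'"
  unfolding step_def by auto

text \<open>The increments of the martingale part are controlled by those of an indefinite integral,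
  which is continuous. No continuity of \<open>u\<close> is presupposed, so this applies to every
  solution in the sense of the definition.\<close>

lemma step_continuous:
  assumes st: "step l a b c T u u'"
  shows "continuous_on {0..T} u'"
proof (cases "0 \<le> T")
  case True
  from st obtain \<xi> where \<xi>: "\<And>t. t \<in> {0..T} \<Longrightarrow> (\<lambda>s. a (u s)) integrable_on {0..t}"
    "\<And>t i. t \<in> {0..T} \<Longrightarrow> i \<in> {1..l} \<Longrightarrow> has_free_integral \<iota> W F t (\<lambda>s. b i (u s)) (\<lambda>s. c i (u s)) (\<xi> t i)"
    "\<And>t. t \<in> {0..T} \<Longrightarrow> u' t = \<iota> U0 + integral {0..t} (\<lambda>s. a (u s)) + (\<Sum>i=1..l. \<xi> t i)"
    by (rule stepE) blast
  \<comment> \<open>The definition of the integral provides integrability only of each squared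
    product; the square of the sum is dominated by \<open>l\<close> times the sum of the
    squares.\<close>
  define g where "g = (\<lambda>r. real l * (\<Sum>i=1..l. (norm (b i (u r)))\<^sup>2 * (norm (c i (u r)))\<^sup>2))"
  have gi: "g integrable_on {0..T}"
  proof -
    have "(\<lambda>r. \<Sum>i=1..l. (norm (b i (u r)))\<^sup>2 * (norm (c i (u r)))\<^sup>2) integrable_on {0..T}"
      using \<xi>(2)[of T] True by (intro integrable_sum) (auto simp: has_free_integral_def)
    from has_integral_mult_right[OF integrable_integral[OF this], of "real l"]
    show ?thesis unfolding g_def by blast
  qed
  have gle: "(\<Sum>i=1..l. norm (b i (u r)) * norm (c i (u r)))\<^sup>2 \<le> g r" for r
    using sum_squared_le_sum_of_squares[of "\<lambda>i. norm (b i (u r)) * norm (c i (u r))" "{1..l}"]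
    by (simp add: g_def power_mult_distrib mult.commute)
  define G where "G = (\<lambda>t. integral {0..t} g)"
  have G: "continuous_on {0..T} G" unfolding G_def by (rule indefinite_integral_continuous_1[OF gi])
  define M where "M = (\<lambda>t. \<Sum>i=1..l. \<xi> t i)"
  have Mle: "(norm (M t - M s))\<^sup>2 \<le> G t - G s" if st: "0 \<le> s" "s \<le> t" "t \<le> T" for s t
  proof -
    have g': "g integrable_on {s..t}" by (rule integrable_on_subinterval[OF gi]) (use st in auto)
    have "(norm (M t - M s))\<^sup>2 \<le> integral {s..t} g"
      unfolding M_def
      by (rule martingale_incr_bound[OF st(1,2) _ _ g', where b = "\<lambda>i r. b i (u r)" and c = "\<lambda>i r. c i (u r)"])
         (use \<xi>(2) st gle in auto)
    also have "integral {s..t} g = G t - G s"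
      unfolding G_def
      using Henstock_Kurzweil_Integration.integral_combine[OF st(1,2), of g] integrable_on_subinterval[OF gi, of 0 t] st by auto
    finally show ?thesis .
  qed
  have M: "continuous_on {0..T} M"
    unfolding continuous_on_iff
  proof (intro ballI allI impI)
    fix s e :: real assume s: "s \<in> {0..T}" and e: "e > 0"
    have "e\<^sup>2 > 0" using e by simp
    then obtain d where d: "d > 0" "\<And>t. t \<in> {0..T} \<Longrightarrow> dist t s < d \<Longrightarrow> dist (G t) (G s) < e\<^sup>2"
      using G s unfolding continuous_on_iff by blast
    show "\<exists>d>0. \<forall>t\<in>{0..T}. dist t s < d \<longrightarrow> dist (M t) (M s) < e"
    proof (intro exI conjI ballI impI)
      fix t assume t: "t \<in> {0..T}" "dist t s < d"
      have "(norm (M t - M s))\<^sup>2 \<le> \<bar>G t - G s\<bar>"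
      proof (cases "s \<le> t")
        case True
        then show ?thesis using Mle[of s t] s t by auto
      next
        case False
        then show ?thesis using Mle[of t s] s t by (auto simp: norm_minus_commute)
      qed
      also have "\<dots> < e\<^sup>2" using d(2)[OF t] by (simp add: dist_real_def)
      finally show "dist (M t) (M s) < e" using e power_less_imp_less_base[of "norm (M t - M s)" 2 e] by (simp add: dist_norm)
    qed (rule d)
  qed
  have "continuous_on {0..T} (\<lambda>t. \<iota> U0 + integral {0..t} (\<lambda>s. a (u s)) + M t)"
    using \<xi>(1)[of T] True by (intro continuous_intros M indefinite_integral_continuous_1) auto
  then show ?thesis
    by (rule continuous_on_eq) (use \<xi>(3) in \<open>auto simp: M_def\<close>)
qed simp

text \<open>For this \<open>lam\<close> the drift and the martingale part each contribute at most a quarter.\<close>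

lemma step_contraction:
  assumes st: "step l a b c T u u'" "step l a b c T v v'"
    and S: "\<And>t. t \<in> {0..T} \<Longrightarrow> u t \<in> S" "\<And>t. t \<in> {0..T} \<Longrightarrow> v t \<in> S"
    and lip: "\<And>x y. x \<in> S \<Longrightarrow> y \<in> S \<Longrightarrow> norm (a x - a y) \<le> L * norm (x - y)"
      "\<And>x y i. x \<in> S \<Longrightarrow> y \<in> S \<Longrightarrow> i \<in> {1..l} \<Longrightarrow> norm (b i x - b i y) \<le> L * norm (x - y)"
      "\<And>x y i. x \<in> S \<Longrightarrow> y \<in> S \<Longrightarrow> i \<in> {1..l} \<Longrightarrow> norm (c i x - c i y) \<le> L * norm (x - y)"
      "\<And>x i. x \<in> S \<Longrightarrow> i \<in> {1..l} \<Longrightarrow> norm (b i x) \<le> B" "\<And>x i. x \<in> S \<Longrightarrow> i \<in> {1..l} \<Longrightarrow> norm (c i x) \<le> B"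
      "0 \<le> L" "0 \<le> B"
    and lam: "lam = 4 * L + 32 * (real l * L * B)\<^sup>2 + 1"
    and dist: "\<And>t. t \<in> {0..T} \<Longrightarrow> norm (u t - v t) \<le> \<kappa> * exp (lam * t)" "0 \<le> \<kappa>"
    and t: "t \<in> {0..T}"
  shows "norm (u' t - v' t) \<le> \<kappa> / 2 * exp (lam * t)"
proof -
  from st(1) obtain \<xi> where \<xi>: "\<And>t. t \<in> {0..T} \<Longrightarrow> (\<lambda>s. a (u s)) integrable_on {0..t}"
    "\<And>t i. t \<in> {0..T} \<Longrightarrow> i \<in> {1..l} \<Longrightarrow> has_free_integral \<iota> W F t (\<lambda>s. b i (u s)) (\<lambda>s. c i (u s)) (\<xi> t i)"
    "\<And>t. t \<in> {0..T} \<Longrightarrow> u' t = \<iota> U0 + integral {0..t} (\<lambda>s. a (u s)) + (\<Sum>i=1..l. \<xi> t i)"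
    by (rule stepE) blast
  from st(2) obtain \<eta> where \<eta>: "\<And>t. t \<in> {0..T} \<Longrightarrow> (\<lambda>s. a (v s)) integrable_on {0..t}"
    "\<And>t i. t \<in> {0..T} \<Longrightarrow> i \<in> {1..l} \<Longrightarrow> has_free_integral \<iota> W F t (\<lambda>s. b i (v s)) (\<lambda>s. c i (v s)) (\<eta> t i)"
    "\<And>t. t \<in> {0..T} \<Longrightarrow> v' t = \<iota> U0 + integral {0..t} (\<lambda>s. a (v s)) + (\<Sum>i=1..l. \<eta> t i)"
    by (rule stepE) blast
  have lam0: "lam > 0" using lip by (simp add: lam add_nonneg_pos)
  have t0: "0 \<le> t" "t \<le> T" using t by auto
  have exp_int: "((\<lambda>r. exp (m * r)) has_integral (exp (m * t) - 1) / m) {0..t}" if "m > 0" for m :: real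
  proof -
    have "((\<lambda>r. exp (m * r)) has_integral (exp (m * t) / m - exp (m * 0) / m)) {0..t}"
    proof (rule fundamental_theorem_of_calculus[OF t0(1)])
      fix r assume "r \<in> {0..t}"
      have "((\<lambda>r. exp (m * r) / m) has_real_derivative exp (m * r)) (at r within {0..t})"
        using that by (auto intro!: derivative_eq_intros)
      then show "((\<lambda>r. exp (m * r) / m) has_vector_derivative exp (m * r)) (at r within {0..t})"
        by (simp add: has_real_derivative_iff_has_vector_derivative)
    qed
    then show ?thesis by (simp add: diff_divide_distrib)
  qed
  have exp_int_le: "(exp (m * t) - 1) / m \<le> exp (m * t) / m" if "m > 0" for m :: real
    using that by (simp add: divide_right_mono)
  have A: "norm (integral {0..t} (\<lambda>s. a (u s)) - integral {0..t} (\<lambda>s. a (v s))) \<le> \<kappa> / 4 * exp (lam * t)"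
  proof -
    have "norm (integral {0..t} (\<lambda>s. a (u s)) - integral {0..t} (\<lambda>s. a (v s))) = norm (integral {0..t} (\<lambda>s. a (u s) - a (v s)))"
      using \<xi>(1) \<eta>(1) t by (simp add: Henstock_Kurzweil_Integration.integral_diff)
    also have "\<dots> \<le> integral {0..t} (\<lambda>r. (L * \<kappa>) * exp (lam * r))"
    proof (rule integral_norm_bound_integral)
      show "(\<lambda>s. a (u s) - a (v s)) integrable_on {0..t}" using \<xi>(1) \<eta>(1) t by (intro integrable_diff)
      show "(\<lambda>r. (L * \<kappa>) * exp (lam * r)) integrable_on {0..t}"
        by (intro integrable_continuous_real continuous_intros)
      fix r assume r: "r \<in> {0..t}"
      then have r': "r \<in> {0..T}" using t0 by auto
      have "norm (a (u r) - a (v r)) \<le> L * norm (u r - v r)" by (rule lip(1)[OF S(1)[OF r'] S(2)[OF r']])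
      also have "\<dots> \<le> L * (\<kappa> * exp (lam * r))" by (intro mult_left_mono dist(1)[OF r'] lip)
      finally show "norm (a (u r) - a (v r)) \<le> (L * \<kappa>) * exp (lam * r)" by simp
    qed
    also have "\<dots> = (L * \<kappa>) * ((exp (lam * t) - 1) / lam)"
      by (rule integral_unique) (intro has_integral_mult_right exp_int lam0)
    also have "\<dots> \<le> (L * \<kappa>) * (exp (lam * t) / lam)" by (intro mult_left_mono exp_int_le lam0) (use lip dist in auto)
    also have "\<dots> = (L / lam) * (\<kappa> * exp (lam * t))" by simp
    also have "\<dots> \<le> (1 / 4) * (\<kappa> * exp (lam * t))"
    proof (rule mult_right_mono)
      show "L / lam \<le> 1 / 4" using lam0 by (simp add: divide_le_eq lam)
    qed (use dist in auto)
    finally show ?thesis by simp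
  qed
  have Bd: "norm ((\<Sum>i=1..l. \<xi> t i) - (\<Sum>i=1..l. \<eta> t i)) \<le> \<kappa> / 4 * exp (lam * t)"
  proof -
    define Q where "Q = real l * (2 * L * B * \<kappa>)"
    have "(norm ((\<Sum>i=1..l. \<xi> t i) - (\<Sum>i=1..l. \<eta> t i)))\<^sup>2 \<le> integral {0..t} (\<lambda>r. Q\<^sup>2 * exp ((2 * lam) * r))"
    proof (rule martingale_diff_bound[OF t0(1) \<xi>(2)[OF t] \<eta>(2)[OF t]])
      show "(\<lambda>r. Q\<^sup>2 * exp ((2 * lam) * r)) integrable_on {0..t}"
        by (intro integrable_continuous_real continuous_intros)
      fix r assume "r \<in> {0..t}"
      then have r: "r \<in> {0..T}" using t0 by auto
      have "(\<Sum>i=1..l. norm (b i (u r) - b i (v r)) * norm (c i (u r)) + norm (b i (v r)) * norm (c i (u r) - c i (v r)))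
         \<le> (\<Sum>i=1..l. 2 * L * B * \<kappa> * exp (lam * r))"
      proof (rule sum_mono)
        fix i assume i: "i \<in> {1..l}"
        have d: "L * norm (u r - v r) \<le> L * (\<kappa> * exp (lam * r))" by (intro mult_left_mono dist(1)[OF r] lip)
        have "norm (b i (u r) - b i (v r)) * norm (c i (u r)) \<le> (L * (\<kappa> * exp (lam * r))) * B"
          using lip(2)[OF S(1)[OF r] S(2)[OF r] i] lip(5)[OF S(1)[OF r] i] d by (intro mult_mono) (auto intro: order_trans lip(7) simp: lip dist)
        moreover have "norm (b i (v r)) * norm (c i (u r) - c i (v r)) \<le> B * (L * (\<kappa> * exp (lam * r)))"
          using lip(3)[OF S(1)[OF r] S(2)[OF r] i] lip(4)[OF S(2)[OF r] i] d by (intro mult_mono) (auto intro: order_trans lip(7) simp: lip dist)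
        ultimately show "norm (b i (u r) - b i (v r)) * norm (c i (u r)) + norm (b i (v r)) * norm (c i (u r) - c i (v r)) \<le> 2 * L * B * \<kappa> * exp (lam * r)"
          by (simp add: algebra_simps)
      qed
      also have "\<dots> = Q * exp (lam * r)" by (simp add: Q_def)
      finally have "(\<Sum>i=1..l. norm (b i (u r) - b i (v r)) * norm (c i (u r)) + norm (b i (v r)) * norm (c i (u r) - c i (v r)))\<^sup>2 \<le> (Q * exp (lam * r))\<^sup>2"
        by (intro power_mono sum_nonneg) auto
      also have "\<dots> = Q\<^sup>2 * exp ((2 * lam) * r)" by (simp add: power_mult_distrib exp_double[symmetric] mult.assoc)
      finally show "(\<Sum>i=1..l. norm (b i (u r) - b i (v r)) * norm (c i (u r)) + norm (b i (v r)) * norm (c i (u r) - c i (v r)))\<^sup>2 \<le> Q\<^sup>2 * exp ((2 * lam) * r)" .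
    qed
    also have "\<dots> = Q\<^sup>2 * ((exp ((2 * lam) * t) - 1) / (2 * lam))"
      by (rule integral_unique) (intro has_integral_mult_right exp_int, use lam0 in simp)
    also have "\<dots> \<le> Q\<^sup>2 * (exp ((2 * lam) * t) / (2 * lam))"
      by (intro mult_left_mono exp_int_le) (use lam0 in auto)
    \<comment> \<open>The estimate is for the squared norm, so the gain after taking roots is of
      order \<open>1 / sqrt lam\<close>. This is why \<open>lam\<close> contains the square of
      \<open>l * L * B\<close>.\<close>
    also have "\<dots> = (4 * (real l * L * B)\<^sup>2 / (2 * lam)) * (\<kappa> * exp (lam * t))\<^sup>2"
      by (simp add: Q_def power_mult_distrib exp_double[symmetric] mult.assoc)
    also have "\<dots> \<le> (1 / 16) * (\<kappa> * exp (lam * t))\<^sup>2"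
    proof (rule mult_right_mono)
      show "4 * (real l * L * B)\<^sup>2 / (2 * lam) \<le> 1 / 16" using lam0 lip(6) by (simp add: divide_le_eq lam)
    qed auto
    also have "\<dots> = (\<kappa> / 4 * exp (lam * t))\<^sup>2" by (simp add: power_mult_distrib power_divide)
    finally show ?thesis by (rule power2_le_imp_le) (use dist in auto)
  qed
  have "u' t - v' t = (integral {0..t} (\<lambda>s. a (u s)) - integral {0..t} (\<lambda>s. a (v s))) + ((\<Sum>i=1..l. \<xi> t i) - (\<Sum>i=1..l. \<eta> t i))"
    using \<xi>(3)[OF t] \<eta>(3)[OF t] by simp
  then have "norm (u' t - v' t) \<le> \<kappa> / 4 * exp (lam * t) + \<kappa> / 4 * exp (lam * t)"
    using norm_triangle_mono[OF A Bd] by simp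
  then show ?thesis by simp
qed

text \<open>Two fixed points differ by a bounded amount, since both are continuous; applying the
  contraction repeatedly halves the weighted bound until nothing is left.\<close>

lemma step_unique:
  assumes st: "step l a b c T u u" "step l a b c T v v"
    and S: "\<And>t. t \<in> {0..T} \<Longrightarrow> u t \<in> S" "\<And>t. t \<in> {0..T} \<Longrightarrow> v t \<in> S"
    and lip: "\<And>x y. x \<in> S \<Longrightarrow> y \<in> S \<Longrightarrow> norm (a x - a y) \<le> L * norm (x - y)"
      "\<And>x y i. x \<in> S \<Longrightarrow> y \<in> S \<Longrightarrow> i \<in> {1..l} \<Longrightarrow> norm (b i x - b i y) \<le> L * norm (x - y)"
      "\<And>x y i. x \<in> S \<Longrightarrow> y \<in> S \<Longrightarrow> i \<in> {1..l} \<Longrightarrow> norm (c i x - c i y) \<le> L * norm (x - y)"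
      "\<And>x i. x \<in> S \<Longrightarrow> i \<in> {1..l} \<Longrightarrow> norm (b i x) \<le> B" "\<And>x i. x \<in> S \<Longrightarrow> i \<in> {1..l} \<Longrightarrow> norm (c i x) \<le> B"
      "0 \<le> L" "0 \<le> B"
    and t: "t \<in> {0..T}"
  shows "u t = v t"
proof -
  define lam where "lam = 4 * L + 32 * (real l * L * B)\<^sup>2 + 1"
  have lam0: "lam \<ge> 0" using lip by (simp add: lam_def)
  have "bounded ((\<lambda>t. u t - v t) ` {0..T})"
    by (intro compact_imp_bounded compact_continuous_image continuous_intros step_continuous[OF st(1)] step_continuous[OF st(2)]) simp
  then obtain \<kappa> where \<kappa>: "\<kappa> > 0" "\<And>t. t \<in> {0..T} \<Longrightarrow> norm (u t - v t) \<le> \<kappa>" unfolding bounded_pos by auto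
  have "\<forall>t\<in>{0..T}. norm (u t - v t) \<le> \<kappa> / 2 ^ n * exp (lam * t)" for n :: nat
  proof (induction n)
    case 0
    have "\<kappa> * 1 \<le> \<kappa> * exp (lam * t)" if "t \<in> {0..T}" for t using \<kappa>(1) lam0 that by (intro mult_left_mono) auto
    then show ?case using \<kappa>(2) by fastforce
  next
    case (Suc n)
    have "norm (u t - v t) \<le> (\<kappa> / 2 ^ n) / 2 * exp (lam * t)" if "t \<in> {0..T}" for t
      by (rule step_contraction[OF st S lip lam_def _ _ that]) (use Suc \<kappa>(1) in auto)
    then show ?case by (simp add: mult.commute)
  qed
  then have le: "norm (u t - v t) \<le> \<kappa> / 2 ^ n * exp (lam * t)" for n :: nat using t by blast
  have "(\<lambda>n. \<kappa> * exp (lam * t) * (1 / 2) ^ n) \<longlonglongrightarrow> \<kappa> * exp (lam * t) * 0"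
    by (intro tendsto_intros LIMSEQ_power_zero) simp
  then have "(\<lambda>n. \<kappa> / 2 ^ n * exp (lam * t)) \<longlonglongrightarrow> 0" by (simp add: power_divide mult_ac)
  from LIMSEQ_le_const[OF this, of "norm (u t - v t)"] le have "norm (u t - v t) \<le> 0" by blast
  then show ?thesis by simp
qed

end


section \<open>Comparison and energy estimate\<close>

text \<open>Let \<open>s\<close> be the last time up to \<open>t\<close> at which \<open>h\<close>
  is not above \<open>y\<close>. By continuity the two functions touch at \<open>s\<close>, and
  there the hypothesis keeps \<open>h\<close> below \<open>y\<close> a little longer. No derivative
  of \<open>h\<close> is involved.\<close>

lemma comparison_lemma:
  fixes h y :: "real \<Rightarrow> real"
  assumes cont: "continuous_on {0..T} h" "continuous_on {0..T} y" and h0: "h 0 \<le> y 0"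
    and touch: "\<And>s. 0 \<le> s \<Longrightarrow> s < T \<Longrightarrow> h s = y s \<Longrightarrow> \<exists>\<delta>>0. \<forall>t. s < t \<and> t < s + \<delta> \<and> t \<le> T \<longrightarrow> h t \<le> y t"
    and t: "0 \<le> t" "t \<le> T"
  shows "h t \<le> y t"
proof (rule ccontr)
  assume bad: "\<not> h t \<le> y t"
  define d where "d = (\<lambda>r. h r - y r)"
  have d: "continuous_on {0..T} d" unfolding d_def by (intro continuous_intros cont)
  define C where "C = {r \<in> {0..t}. d r \<le> 0}"
  have "continuous_on {0..t} d" using d t by (auto intro: continuous_on_subset)
  then have "closed C" unfolding C_def by (intro continuous_on_closed_Collect_le closed_atLeastAtMost continuous_on_const)
  moreover have C0: "0 \<in> C" using h0 t by (simp add: C_def d_def)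
  moreover have bdd: "bdd_above C" by (auto simp: C_def bdd_above_def)
  ultimately have sC: "Sup C \<in> C" by (intro closed_contains_Sup) auto
  define s where "s = Sup C"
  have s: "0 \<le> s" "s \<le> t" "d s \<le> 0" using sC by (auto simp: C_def s_def)
  have "s \<noteq> t" using s(3) bad by (auto simp: d_def)
  then have st: "s < t" using s by simp
  have above: "0 < d r" if "s < r" "r \<le> t" for r
  proof (rule ccontr)
    assume "\<not> 0 < d r"
    then have "r \<in> C" using that s by (auto simp: C_def)
    then have "r \<le> s" unfolding s_def using bdd by (rule cSup_upper)
    then show False using that by simp
  qed
  have "0 \<le> d s"
  proof (rule tendsto_lowerbound)
    have "(d \<longlongrightarrow> d s) (at s within {0..T})" using d s st t by (auto simp: continuous_on)
    then show "(d \<longlongrightarrow> d s) (at s within {s<..<t})" by (rule tendsto_within_subset) (use s st t in auto)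
    show "\<forall>\<^sub>F r in at s within {s<..<t}. 0 \<le> d r"
      unfolding eventually_at_filter using above by (auto intro!: always_eventually less_imp_le)
    show "at s within {s<..<t} \<noteq> bot" using st
      by (simp add: at_within_eq_bot_iff islimpt_greaterThanLessThan1)
  qed
  then have "h s = y s" using s(3) by (simp add: d_def)
  then obtain \<delta> where \<delta>: "\<delta> > 0" "\<And>r. s < r \<Longrightarrow> r < s + \<delta> \<Longrightarrow> r \<le> T \<Longrightarrow> h r \<le> y r"
    using touch[of s] s st t by auto
  define r where "r = min t (s + \<delta> / 2)"
  have "s < r" "r \<le> t" "r < s + \<delta>" using st \<delta>(1) by (auto simp: r_def min_def)
  then show False using above[of r] \<delta>(2)[of r] t by (simp add: d_def)
qed

context free_bm
begin

text \<open>The Dini form of Ito's formula for \<open>\<parallel>u t\<parallel>\<^sup>2\<close>; the cross term vanishes because the martingale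
  increment is orthogonal to the past.\<close>

lemma energy_estimate:
  assumes st: "step l a b c T u u" and s: "0 \<le> s" "s < T" and e: "e > 0"
    and cont: "continuous_on {0..T} (\<lambda>r. a (u r))"
      "\<And>i. i \<in> {1..l} \<Longrightarrow> continuous_on {0..T} (\<lambda>r. b i (u r))"
      "\<And>i. i \<in> {1..l} \<Longrightarrow> continuous_on {0..T} (\<lambda>r. c i (u r))"
  shows "\<exists>\<delta>>0. \<forall>t. s < t \<and> t < s + \<delta> \<and> t \<le> T \<longrightarrow>
    (norm (u t))\<^sup>2 \<le> (norm (u s))\<^sup>2 + (t - s) * (2 * inner (u s) (a (u s)) + (\<Sum>i=1..l. norm (b i (u s)) * norm (c i (u s)))\<^sup>2 + e)"
proof -
  from st obtain \<xi> where \<xi>: "\<And>t. t \<in> {0..T} \<Longrightarrow> u t \<in> L2F t" "\<And>t. t \<in> {0..T} \<Longrightarrow> (\<lambda>s. a (u s)) integrable_on {0..t}"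
    "\<And>t i. t \<in> {0..T} \<Longrightarrow> i \<in> {1..l} \<Longrightarrow> has_free_integral \<iota> W F t (\<lambda>s. b i (u s)) (\<lambda>s. c i (u s)) (\<xi> t i)"
    "\<And>t. t \<in> {0..T} \<Longrightarrow> u t = \<iota> U0 + integral {0..t} (\<lambda>s. a (u s)) + (\<Sum>i=1..l. \<xi> t i)"
    by (rule stepE) blast
  define g where "g = (\<lambda>r. (\<Sum>i=1..l. norm (b i (u r)) * norm (c i (u r)))\<^sup>2)"
  have g: "continuous_on {0..T} g" unfolding g_def by (intro continuous_intros cont) auto
  have g0: "0 \<le> g r" for r by (simp add: g_def)
  define A0 where "A0 = a (u s)"
  \<comment> \<open>How the allowance \<open>e\<close> is spent: one half on the oscillation of
    drift and diffusion after \<open>s\<close>, through \<open>e1\<close>; a quarter on the Young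
    weight \<open>th\<close> in front of the martingale term; a quarter on the squared drift
    increment, which is of second order in \<open>t - s\<close> and is controlled by
    \<open>d3\<close>.\<close>
  define n where "n = 2 * norm (u s) + 1"
  have n0: "n > 0" by (simp add: n_def add_nonneg_pos)
  define e1 where "e1 = e / (2 * n)"
  have "e1 > 0" "e1 * n = e / 2" using e n0 by (auto simp: e1_def)
  then have e1: "e1 > 0" "e1 * (2 * norm (u s) + 1) = e / 2" by (auto simp: n_def)
  define P where "P = norm A0 + e1"
  define Q where "Q = g s + e1"
  have PQ: "P > 0" "Q > 0" using e1 g0[of s] by (auto simp: P_def Q_def add_nonneg_pos)
  define th where "th = e / (4 * Q)"
  have th: "th > 0" "th * Q = e / 4" using e PQ by (auto simp: th_def)
  obtain d1 where d1: "d1 > 0" "\<And>r. r \<in> {0..T} \<Longrightarrow> dist r s < d1 \<Longrightarrow> dist (a (u r)) A0 < e1"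
    using cont(1) s e1(1) unfolding continuous_on_iff A0_def by (meson atLeastAtMost_iff less_imp_le)
  obtain d2 where d2: "d2 > 0" "\<And>r. r \<in> {0..T} \<Longrightarrow> dist r s < d2 \<Longrightarrow> dist (g r) (g s) < e1"
    using g s e1(1) unfolding continuous_on_iff by (meson atLeastAtMost_iff less_imp_le)
  define d3 where "d3 = e / (4 * ((1 + 1 / th) * P\<^sup>2))"
  have pp: "(1 + 1 / th) * P\<^sup>2 > 0" using th PQ by (auto intro!: mult_pos_pos add_pos_pos)
  have d3: "d3 > 0" "(1 + 1 / th) * P\<^sup>2 * d3 = e / 4"
    using e pp by (auto simp: d3_def)
  define \<delta> where "\<delta> = min d1 (min d2 d3)"
  show ?thesis
  proof (intro exI conjI allI impI)
    show "\<delta> > 0" using d1 d2 d3 by (simp add: \<delta>_def)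
    fix t assume t: "s < t \<and> t < s + \<delta> \<and> t \<le> T"
    define k where "k = t - s"
    have k: "0 < k" "k < d3" using t by (auto simp: k_def \<delta>_def)
    have sT: "s \<in> {0..T}" and tT: "t \<in> {0..T}" using s t by auto
    have near: "dist (a (u r)) A0 < e1" "g r \<le> Q" if "r \<in> {s..t}" for r
    proof -
      have "r \<in> {0..T}" "dist r s < d1" "dist r s < d2" using that t s by (auto simp: dist_real_def \<delta>_def)
      then show "dist (a (u r)) A0 < e1" "g r \<le> Q" using d1(2) d2(2)[of r] by (auto simp: Q_def dist_real_def)
    qed
    define Z where "Z = integral {s..t} (\<lambda>r. a (u r))"
    define N where "N = (\<Sum>i=1..l. \<xi> t i) - (\<Sum>i=1..l. \<xi> s i)"
    have ai: "(\<lambda>r. a (u r)) integrable_on {s..t}"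
      by (rule integrable_on_subinterval[OF \<xi>(2)[OF tT]]) (use s t in auto)
    have "integral {0..t} (\<lambda>r. a (u r)) = integral {0..s} (\<lambda>r. a (u r)) + Z"
      unfolding Z_def using Henstock_Kurzweil_Integration.integral_combine[of 0 s t "\<lambda>r. a (u r)"] \<xi>(2)[OF tT] s t by simp
    then have ut: "u t = u s + (Z + N)" using \<xi>(4)[OF tT] \<xi>(4)[OF sT] by (simp add: N_def)
    have orth: "inner (u s) N = 0"
      unfolding N_def
      by (rule martingale_incr_orth[OF s(1) _ \<xi>(3)[OF tT] \<xi>(3)[OF sT] \<xi>(1)[OF sT]]) (use t in auto)
    have Nle: "(norm N)\<^sup>2 \<le> k * Q"
    proof -
      have gi: "g integrable_on {s..t}" by (intro integrable_continuous_real continuous_on_subset[OF g]) (use s t in auto)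
      have "(norm N)\<^sup>2 \<le> integral {s..t} g"
        unfolding N_def by (rule martingale_incr_bound[OF s(1) _ \<xi>(3)[OF tT] \<xi>(3)[OF sT] gi]) (use t in \<open>auto simp: g_def\<close>)
      also have "\<dots> \<le> integral {s..t} (\<lambda>r. Q)" by (intro integral_le gi near) auto
      also have "\<dots> = k * Q" using t by (simp add: k_def)
      finally show ?thesis .
    qed
    have Zd: "norm (Z - k *\<^sub>R A0) \<le> k * e1"
    proof -
      have "Z - k *\<^sub>R A0 = integral {s..t} (\<lambda>r. a (u r) - A0)"
        unfolding Z_def using t Henstock_Kurzweil_Integration.integral_diff[OF ai, of "\<lambda>_. A0"]
        by (simp add: k_def integrable_const_ivl)
      also have "norm \<dots> \<le> integral {s..t} (\<lambda>r. e1)"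
        using near(1) by (intro integral_norm_bound_integral integrable_diff ai) (auto simp: dist_norm less_imp_le)
      also have "\<dots> = k * e1" using t by (simp add: k_def)
      finally show ?thesis .
    qed
    have "norm Z \<le> norm (Z - k *\<^sub>R A0) + norm (k *\<^sub>R A0)" by (metis diff_add_cancel norm_triangle_ineq)
    then have Zn: "norm Z \<le> k * P" using Zd k by (simp add: P_def distrib_left)
    have inn: "inner (u s) Z \<le> k * inner (u s) A0 + k * e1 * norm (u s)"
    proof -
      have "inner (u s) (Z - k *\<^sub>R A0) \<le> norm (u s) * norm (Z - k *\<^sub>R A0)" by (rule norm_cauchy_schwarz)
      also have "\<dots> \<le> norm (u s) * (k * e1)" by (intro mult_left_mono Zd) simp
      finally show ?thesis by (simp add: inner_diff_right mult_ac)
    qed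
    have ZN: "(norm (Z + N))\<^sup>2 \<le> k * (Q + e / 2)"
    proof -
      have "(norm (N + Z))\<^sup>2 \<le> (1 + th) * (norm N)\<^sup>2 + (1 + 1 / th) * (norm Z)\<^sup>2" by (rule norm_add_sq_le[OF th(1)])
      also have "\<dots> \<le> (1 + th) * (k * Q) + (1 + 1 / th) * (k * P)\<^sup>2"
        using th k PQ by (intro add_mono mult_left_mono Nle power_mono Zn) auto
      also have "\<dots> = k * (Q + th * Q + (1 + 1 / th) * P\<^sup>2 * k)" by (simp add: power2_eq_square algebra_simps)
      also have "\<dots> \<le> k * (Q + e / 4 + e / 4)"
      proof -
        have "(1 + 1 / th) * P\<^sup>2 * k \<le> (1 + 1 / th) * P\<^sup>2 * d3" using pp k by (intro mult_left_mono) auto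
        then have "Q + th * Q + (1 + 1 / th) * P\<^sup>2 * k \<le> Q + e / 4 + e / 4" using th(2) d3(2) by linarith
        then show ?thesis using k by (intro mult_left_mono) auto
      qed
      finally show ?thesis by (simp add: add.commute)
    qed
    have "(norm (u t))\<^sup>2 = (norm (u s))\<^sup>2 + 2 * inner (u s) Z + (norm (Z + N))\<^sup>2"
      unfolding ut norm_add_sq[of "u s"] using orth by (simp add: inner_add_right)
    also have "\<dots> \<le> (norm (u s))\<^sup>2 + 2 * (k * inner (u s) A0 + k * e1 * norm (u s)) + k * (Q + e / 2)"
      by (intro add_mono mult_left_mono order_refl inn ZN) simp_all
    also have "\<dots> = (norm (u s))\<^sup>2 + k * (2 * inner (u s) A0 + g s + (e1 * (2 * norm (u s) + 1)) + e / 2)"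
      by (simp add: Q_def algebra_simps)
    also have "\<dots> = (norm (u s))\<^sup>2 + k * (2 * inner (u s) A0 + g s + e)" unfolding e1(2) by simp
    finally show "(norm (u t))\<^sup>2 \<le> (norm (u s))\<^sup>2 + (t - s) * (2 * inner (u s) (a (u s)) + (\<Sum>i=1..l. norm (b i (u s)) * norm (c i (u s)))\<^sup>2 + e)"
      by (simp add: k_def A0_def g_def)
  qed
qed

text \<open>The strict inequality is required only at touching times. This is essential for the
  truncated equation, whose coefficients satisfy (A-2) only where the retraction is
  inactive.\<close>

lemma energy_comparison:
  assumes st: "step l a b c T u u"
    and cont: "continuous_on {0..T} (\<lambda>r. a (u r))"
      "\<And>i. i \<in> {1..l} \<Longrightarrow> continuous_on {0..T} (\<lambda>r. b i (u r))"
      "\<And>i. i \<in> {1..l} \<Longrightarrow> continuous_on {0..T} (\<lambda>r. c i (u r))"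
    and y: "\<And>s. s \<in> {0..T} \<Longrightarrow> (y has_real_derivative y' s) (at s)" and y0: "(norm (u 0))\<^sup>2 \<le> y 0"
    and touch: "\<And>s. s \<in> {0..T} \<Longrightarrow> (norm (u s))\<^sup>2 = y s \<Longrightarrow>
       2 * inner (u s) (a (u s)) + (\<Sum>i=1..l. norm (b i (u s)) * norm (c i (u s)))\<^sup>2 < y' s"
    and t: "t \<in> {0..T}"
  shows "(norm (u t))\<^sup>2 \<le> y t"
proof (rule comparison_lemma[where T = T and h = "\<lambda>t. (norm (u t))\<^sup>2"])
  show "continuous_on {0..T} (\<lambda>t. (norm (u t))\<^sup>2)" by (intro continuous_intros step_continuous[OF st])
  show "continuous_on {0..T} y" by (intro continuous_at_imp_continuous_on ballI DERIV_isCont) (rule y)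
  show "(norm (u 0))\<^sup>2 \<le> y 0" by (rule y0)
  fix s assume s: "0 \<le> s" "s < T" "(norm (u s))\<^sup>2 = y s"
  define K where "K = 2 * inner (u s) (a (u s)) + (\<Sum>i=1..l. norm (b i (u s)) * norm (c i (u s)))\<^sup>2"
  \<comment> \<open>Half of the gap, so that \<open>K + e = y' s - e\<close>: one half is lost in
    the energy estimate, the other in the difference quotient of \<open>y\<close>.\<close>
  define e where "e = (y' s - K) / 2"
  have e: "e > 0" using touch[of s] s by (simp add: e_def K_def)
  obtain \<delta>1 where \<delta>1: "\<delta>1 > 0" "\<And>t. s < t \<Longrightarrow> t < s + \<delta>1 \<Longrightarrow> t \<le> T \<Longrightarrow> (norm (u t))\<^sup>2 \<le> (norm (u s))\<^sup>2 + (t - s) * (K + e)"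
    using energy_estimate[OF st s(1,2) e cont] unfolding K_def by blast
  have "(y has_real_derivative y' s) (at s)" using y s by auto
  then have "((\<lambda>t. (y t - y s) / (t - s)) \<longlongrightarrow> y' s) (at s)" by (simp add: has_field_derivative_iff)
  then obtain \<delta>2 where \<delta>2: "\<delta>2 > 0" "\<And>t. t \<noteq> s \<Longrightarrow> dist t s < \<delta>2 \<Longrightarrow> dist ((y t - y s) / (t - s)) (y' s) < e"
    using e unfolding tendsto_iff eventually_at by blast
  show "\<exists>\<delta>>0. \<forall>t. s < t \<and> t < s + \<delta> \<and> t \<le> T \<longrightarrow> (norm (u t))\<^sup>2 \<le> y t"
  proof (intro exI conjI allI impI)
    show "min \<delta>1 \<delta>2 > 0" using \<delta>1 \<delta>2 by simp
    fix t assume t: "s < t \<and> t < s + min \<delta>1 \<delta>2 \<and> t \<le> T"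
    have "\<bar>(y t - y s) / (t - s) - y' s\<bar> < e" using \<delta>2(2)[of t] t by (auto simp: dist_real_def)
    then have "y' s - e < (y t - y s) / (t - s)" by linarith
    then have "(t - s) * (y' s - e) \<le> y t - y s" using t by (simp add: less_divide_eq mult.commute)
    moreover have "y' s - e = K + e" by (simp add: e_def field_simps)
    moreover have "(norm (u t))\<^sup>2 \<le> (norm (u s))\<^sup>2 + (t - s) * (K + e)" using \<delta>1(2)[of t] t min.cobounded1[of \<delta>1 \<delta>2] by linarith
    ultimately show "(norm (u t))\<^sup>2 \<le> y t" using s(3) by simp
  qed
qed (use t in auto)

end

section \<open>Radial retraction\<close>

definition retract :: "real \<Rightarrow> 'a::real_normed_vector \<Rightarrow> 'a" where
  "retract M u = (if norm u \<le> M then u else (M / norm u) *\<^sub>R u)"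

lemma retract_norm: "0 \<le> M \<Longrightarrow> norm (retract M u) \<le> M"
  by (auto simp: retract_def)

text \<open>Triangle inequalities alone give the factor \<open>2\<close>, in any normed space. If
  both points lie outside the ball, the difference splits into a change of direction and a change of
  length, each of size at most \<open>norm (u - v)\<close>.\<close>

lemma retract_lip:
  assumes M: "0 \<le> M"
  shows "norm (retract M u - retract M v) \<le> 2 * norm (u - v)"
proof -
  have one: "norm (retract M u - retract M v) \<le> 2 * norm (u - v)" if u: "\<not> norm u \<le> M" for u v :: 'a
  proof -
    have u0: "norm u > 0" using u M by linarith
    show ?thesis
    proof (cases "norm v \<le> M")
      case True
      have "(M / norm u) *\<^sub>R u - v = (u - v) - (1 - M / norm u) *\<^sub>R u" by (simp add: algebra_simps)
      then have "norm ((M / norm u) *\<^sub>R u - v) \<le> norm (u - v) + norm ((1 - M / norm u) *\<^sub>R u)"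
        using norm_triangle_ineq4 by metis
      also have "norm ((1 - M / norm u) *\<^sub>R u) = norm u - M"
      proof -
        have "M / norm u \<le> 1" using u u0 by simp
        then show ?thesis using u0 by (simp add: left_diff_distrib)
      qed
      also have "norm u - M \<le> norm (u - v)" using True norm_triangle_ineq2[of u v] by linarith
      finally show ?thesis using u True by (simp add: retract_def)
    next
      case False
      have v0: "norm v > 0" using False M by linarith
      have "(M / norm u) *\<^sub>R u - (M / norm v) *\<^sub>R v = (M / norm u) *\<^sub>R (u - v) + (M / norm u - M / norm v) *\<^sub>R v"
        by (simp add: algebra_simps)
      then have "norm ((M / norm u) *\<^sub>R u - (M / norm v) *\<^sub>R v) \<le> norm ((M / norm u) *\<^sub>R (u - v)) + norm ((M / norm u - M / norm v) *\<^sub>R v)"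
        using norm_triangle_ineq by metis
      also have "norm ((M / norm u) *\<^sub>R (u - v)) = (M / norm u) * norm (u - v)" using M by simp
      also have "norm ((M / norm u - M / norm v) *\<^sub>R v) = (M / norm u) * \<bar>norm v - norm u\<bar>"
      proof -
        have "M / norm u - M / norm v = (M / norm u) * ((norm v - norm u) / norm v)"
          using u0 v0 by (simp add: field_simps)
        then show ?thesis using M u0 v0 by (simp add: abs_mult)
      qed
      also have "(M / norm u) * \<bar>norm v - norm u\<bar> \<le> (M / norm u) * norm (u - v)"
        using M norm_triangle_ineq3[of u v] by (intro mult_left_mono) auto
      finally have "norm ((M / norm u) *\<^sub>R u - (M / norm v) *\<^sub>R v) \<le> (M / norm u) * norm (u - v) + (M / norm u) * norm (u - v)"
        by simp
      also have "\<dots> \<le> 1 * norm (u - v) + 1 * norm (u - v)"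
        using u u0 by (intro add_mono mult_right_mono) auto
      finally show ?thesis using u False by (simp add: retract_def)
    qed
  qed
  show ?thesis
  proof (cases "norm u \<le> M \<and> norm v \<le> M")
    case True
    then show ?thesis by (simp add: retract_def)
  next
    case False
    then show ?thesis using one[of u v] one[of v u] by (auto simp: norm_minus_commute)
  qed
qed

lemma retract_id: "norm u \<le> M \<Longrightarrow> retract M u = u"
  by (simp add: retract_def)

lemma retract_subspace: "subspace S \<Longrightarrow> u \<in> S \<Longrightarrow> retract M u \<in> S"
  by (simp add: retract_def subspace_scale)

lemma retract_continuous: "0 \<le> M \<Longrightarrow> continuous_on S (retract M)"
  unfolding continuous_on_iff
proof (intro ballI allI impI)
  fix x :: 'a and e :: real assume M: "0 \<le> M" and e: "e > 0"
  show "\<exists>d>0. \<forall>x'\<in>S. dist x' x < d \<longrightarrow> dist (retract M x') (retract M x) < e"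
  proof (intro exI conjI ballI impI)
    show "e / 2 > 0" using e by simp
    fix x' assume "dist x' x < e / 2"
    then show "dist (retract M x') (retract M x) < e"
      using retract_lip[OF M, of x' x] by (simp add: dist_norm)
  qed
qed


section \<open>Existence and uniqueness\<close>

text \<open>The induction works for the sharper bound in which the remaining tail of the geometric
  series is subtracted.\<close>

lemma geometric_Cauchy:
  fixes x :: "nat \<Rightarrow> 'a::real_normed_vector"
  assumes "\<And>n. norm (x (Suc n) - x n) \<le> C / 2 ^ n" "0 \<le> C"
  shows "norm (x (n + k) - x n) \<le> 2 * C / 2 ^ n"
proof -
  have "norm (x (n + k) - x n) \<le> 2 * C / 2 ^ n - 2 * C / 2 ^ (n + k)"
  proof (induction k)
    case (Suc k)
    have "norm (x (n + Suc k) - x n) \<le> norm (x (Suc (n + k)) - x (n + k)) + norm (x (n + k) - x n)"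
      using norm_triangle_ineq[of "x (Suc (n + k)) - x (n + k)" "x (n + k) - x n"] by simp
    also have "\<dots> \<le> C / 2 ^ (n + k) + (2 * C / 2 ^ n - 2 * C / 2 ^ (n + k))"
      by (intro add_mono assms Suc)
    also have "\<dots> = 2 * C / 2 ^ n - 2 * C / 2 ^ (n + Suc k)" by (simp add: field_simps)
    finally show ?case .
  qed simp
  also have "\<dots> \<le> 2 * C / 2 ^ n" using assms(2) by simp
  finally show ?thesis .
qed

text \<open>The orthogonal projection onto \<open>S\<close> is bounded and linear, hence commutes
  with the integral, and it fixes the integrand.\<close>

lemma integral_in_closed_subspace:
  fixes f :: "real \<Rightarrow> 'a::complex_hilbert_space"
  assumes S: "closed S" "subspace S" and f: "f integrable_on {a..b}" "\<And>r. r \<in> {a..b} \<Longrightarrow> f r \<in> S"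
  shows "integral {a..b} f \<in> S"
proof -
  have sub: "subspace ((\<lambda>x. (x, x)) ` S)"
    by (intro linear_subspace_image S) (auto intro!: linearI)
  have le: "norm y \<le> 1 * norm x" if "(x, y) \<in> (\<lambda>x. (x, x)) ` S" for x y :: 'a using that by auto
  obtain e where e: "\<forall>x y. (x, y) \<in> (\<lambda>x. (x, x)) ` S \<longrightarrow> blinfun_apply e x = y"
    "\<forall>z. (\<forall>x y. (x, y) \<in> (\<lambda>x. (x, x)) ` S \<longrightarrow> inner z x = 0) \<longrightarrow> blinfun_apply e z = 0"
    using extend_bounded_relation[OF sub le] by blast
  have e1: "blinfun_apply e x = x" if "x \<in> S" for x using e(1) that by auto
  obtain p where p: "p \<in> S" "\<And>z. z \<in> S \<Longrightarrow> inner (integral {a..b} f - p) z = 0"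
    using closed_subspace_projection[OF S] by blast
  have "blinfun_apply e (integral {a..b} f - p) = 0" using e(2) p(2) by auto
  then have "blinfun_apply e (integral {a..b} f) = p" using e1[OF p(1)] by (simp add: blinfun.diff_right)
  moreover have "integral {a..b} (blinfun_apply e \<circ> f) = blinfun_apply e (integral {a..b} f)"
    by (rule integral_linear[OF f(1)]) (rule blinfun.bounded_linear_right)
  moreover have "integral {a..b} (blinfun_apply e \<circ> f) = integral {a..b} f"
    by (rule Henstock_Kurzweil_Integration.integral_cong) (use e1 f(2) in auto)
  ultimately show ?thesis using p(1) by simp
qed

context nc_L2
begin

lemma loc_lip_finite:
  assumes "finite G" "\<And>g. g \<in> G \<Longrightarrow> loc_lip g" "M > 0"
  shows "\<exists>L>0. \<forall>g\<in>G. \<forall>u\<in>Lsa. \<forall>v\<in>Lsa. norm u \<le> M \<and> norm v \<le> M \<longrightarrow> norm (g u - g v) \<le> L * norm (u - v)"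
  using assms(1,2)
proof (induction G rule: finite_induct)
  case empty
  then show ?case by (intro exI[of _ 1]) simp
next
  case (insert g G)
  obtain L where L: "L > 0" "\<forall>g\<in>G. \<forall>u\<in>Lsa. \<forall>v\<in>Lsa. norm u \<le> M \<and> norm v \<le> M \<longrightarrow> norm (g u - g v) \<le> L * norm (u - v)"
    using insert by auto
  obtain L' where L': "L' > 0" "\<forall>u\<in>Lsa. \<forall>v\<in>Lsa. norm u \<le> M \<and> norm v \<le> M \<longrightarrow> norm (g u - g v) \<le> L' * norm (u - v)"
    using insert.prems[of g] assms(3) unfolding loc_lip_def by auto
  have le: "L * norm (u - v) \<le> (L + L') * norm (u - v)" "L' * norm (u - v) \<le> (L + L') * norm (u - v)" for u v :: 'k
    using L L' by (auto intro!: mult_right_mono)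
  show ?case
  proof (intro exI[of _ "L + L'"] conjI ballI impI)
    show "0 < L + L'" using L L' by simp
    fix f u v assume f: "f \<in> insert g G" and uv: "u \<in> Lsa" "v \<in> Lsa" "norm u \<le> M \<and> norm v \<le> M"
    show "norm (f u - f v) \<le> (L + L') * norm (u - v)"
    proof (cases "f = g")
      case True
      then show ?thesis using L'(2) uv order_trans[OF _ le(2)] by blast
    next
      case False
      then show ?thesis using L(2) f uv order_trans[OF _ le(1)] by blast
    qed
  qed
qed

end

section \<open>Congruence rules and approximation by simple processes\<close>

context free_bm
begin

lemma free_integral_0: "has_free_integral \<iota> W F 0 b c \<xi> \<Longrightarrow> \<xi> = 0"
proof -
  assume I: "has_free_integral \<iota> W F 0 b c \<xi>"
  obtain \<Phi> where \<Phi>: "tensor_map 0 \<Phi>" using tensor_map_exists by blast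
  have lim: "free_lim 0 \<Phi> (tens \<Phi> 0 b c) \<xi>" by (rule free_integral_lim[OF \<Phi> I]) auto
  have "(norm \<xi>)\<^sup>2 \<le> integral {0..0::real} (\<lambda>r. 0)"
    by (rule free_lim_bound[OF \<Phi> lim]) (auto simp: tens_def[OF \<Phi>] intro: integrable_0)
  then show ?thesis by simp
qed

lemma has_free_integral_cong:
  assumes I: "has_free_integral \<iota> W F t b c \<xi>" and eq: "\<And>r. r \<in> {0..t} \<Longrightarrow> b r = b' r" "\<And>r. r \<in> {0..t} \<Longrightarrow> c r = c' r"
  shows "has_free_integral \<iota> W F t b' c' \<xi>"
proof -
  from I obtain n p bs cs where a: "\<forall>m. simple_adapted F t (n m) (p m) (bs m) \<and> simple_adapted F t (n m) (p m) (cs m)"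
    "\<forall>m. (\<lambda>t. tensor_dist_sq (b t) (c t) (\<iota> (bs m t)) (\<iota> (cs m t))) integrable_on {0..t}"
    "(\<lambda>m. integral {0..t} (\<lambda>t. tensor_dist_sq (b t) (c t) (\<iota> (bs m t)) (\<iota> (cs m t)))) \<longlonglongrightarrow> 0"
    "(\<lambda>m. \<iota> (simple_integral W (n m) (p m) (bs m) (cs m))) \<longlonglongrightarrow> \<xi>"
    by (rule has_free_integralE)
  have 1: "(\<lambda>t. tensor_dist_sq (b' t) (c' t) (\<iota> (bs m t)) (\<iota> (cs m t))) integrable_on {0..t}" for m
    by (rule integrable_eq[OF spec[OF a(2), of m]]) (simp add: eq)
  have 2: "integral {0..t} (\<lambda>t. tensor_dist_sq (b t) (c t) (\<iota> (bs m t)) (\<iota> (cs m t))) =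
     integral {0..t} (\<lambda>t. tensor_dist_sq (b' t) (c' t) (\<iota> (bs m t)) (\<iota> (cs m t)))" for m
    by (rule Henstock_Kurzweil_Integration.integral_cong) (simp add: eq)
  show ?thesis
    unfolding has_free_integral_def
  proof (intro conjI ballI)
    fix r assume r: "r \<in> {0..t}"
    have "b r \<in> L2F r" "c r \<in> L2F r" using I r unfolding has_free_integral_def by blast+
    then show "b' r \<in> L2F r" "c' r \<in> L2F r" using eq[OF r] by simp_all
  next
    have "(\<lambda>t. (norm (b t))\<^sup>2 * (norm (c t))\<^sup>2) integrable_on {0..t}" using I unfolding has_free_integral_def by blast
    then show "(\<lambda>t. (norm (b' t))\<^sup>2 * (norm (c' t))\<^sup>2) integrable_on {0..t}"
      by (rule integrable_eq) (simp add: eq)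
  next
    show "\<exists>n p bs cs. (\<forall>m. simple_adapted F t (n m) (p m) (bs m) \<and> simple_adapted F t (n m) (p m) (cs m)) \<and>
       (\<forall>m. (\<lambda>t. tensor_dist_sq (b' t) (c' t) (\<iota> (bs m t)) (\<iota> (cs m t))) integrable_on {0..t}) \<and>
       (\<lambda>m. integral {0..t} (\<lambda>t. tensor_dist_sq (b' t) (c' t) (\<iota> (bs m t)) (\<iota> (cs m t)))) \<longlonglongrightarrow> 0 \<and>
       (\<lambda>m. \<iota> (simple_integral W (n m) (p m) (bs m) (cs m))) \<longlonglongrightarrow> \<xi>"
      by (rule exI[of _ n], rule exI[of _ p], rule exI[of _ bs], rule exI[of _ cs])
         (use a(1,4) a(3)[unfolded 2] 1 in simp)
  qed
qed

lemma step_cong: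
  assumes st: "step l a b c T u u"
    and eq: "\<And>s. s \<in> {0..T} \<Longrightarrow> v s = u s" "\<And>s. s \<in> {0..T} \<Longrightarrow> a' (u s) = a (u s)"
      "\<And>s i. s \<in> {0..T} \<Longrightarrow> i \<in> {1..l} \<Longrightarrow> b' i (u s) = b i (u s)"
      "\<And>s i. s \<in> {0..T} \<Longrightarrow> i \<in> {1..l} \<Longrightarrow> c' i (u s) = c i (u s)"
  shows "step l a' b' c' T v v"
  unfolding step_def
proof (intro ballI conjI)
  fix t assume t: "t \<in> {0..T}"
  have sub: "s \<in> {0..T}" if "s \<in> {0..t}" for s using that t by auto
  show "v t \<in> Lsa" "v t \<in> L2F t" using st t eq(1)[OF t] unfolding step_def by auto
  obtain \<zeta> \<xi> where \<zeta>: "((\<lambda>s. a (u s)) has_integral \<zeta>) {0..t}"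
    and \<xi>: "\<And>i. i \<in> {1..l} \<Longrightarrow> has_free_integral \<iota> W F t (\<lambda>s. b i (u s)) (\<lambda>s. c i (u s)) (\<xi> i)"
    and u: "u t = \<iota> U0 + \<zeta> + (\<Sum>i=1..l. \<xi> i)"
    using st t unfolding step_def by blast
  have 1: "((\<lambda>s. a' (v s)) has_integral \<zeta>) {0..t}"
    by (rule has_integral_eq[OF _ \<zeta>]) (use sub eq in auto)
  have 2: "has_free_integral \<iota> W F t (\<lambda>s. b' i (v s)) (\<lambda>s. c' i (v s)) (\<xi> i)" if i: "i \<in> {1..l}" for i
    by (rule has_free_integral_cong[OF \<xi>[OF i]]) (use sub eq i in auto)
  show "\<exists>\<zeta> \<xi>. ((\<lambda>s. a' (v s)) has_integral \<zeta>) {0..t} \<and>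
       (\<forall>i\<in>{1..l}. has_free_integral \<iota> W F t (\<lambda>s. b' i (v s)) (\<lambda>s. c' i (v s)) (\<xi> i)) \<and>
       v t = \<iota> U0 + \<zeta> + (\<Sum>i=1..l. \<xi> i)"
    by (intro exI[of _ \<zeta>] exI[of _ \<xi>] conjI ballI 1 2) (use u eq(1)[OF t] in simp_all)
qed

text \<open>The bounds are bundled so that \<open>coef_boundsD\<close> returns them in the order in
  which \<open>step_contraction\<close> and \<open>step_unique\<close> take them.\<close>

definition coef_bounds :: "nat \<Rightarrow> 'k set \<Rightarrow> ('k \<Rightarrow> 'k) \<Rightarrow> (nat \<Rightarrow> 'k \<Rightarrow> 'k) \<Rightarrow> (nat \<Rightarrow> 'k \<Rightarrow> 'k) \<Rightarrow> real \<Rightarrow> real \<Rightarrow> bool" where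
  "coef_bounds l S a b c L B \<longleftrightarrow> 0 \<le> L \<and> 0 \<le> B \<and>
     (\<forall>x\<in>S. \<forall>y\<in>S. norm (a x - a y) \<le> L * norm (x - y)) \<and>
     (\<forall>i\<in>{1..l}. \<forall>x\<in>S. \<forall>y\<in>S. norm (b i x - b i y) \<le> L * norm (x - y)) \<and>
     (\<forall>i\<in>{1..l}. \<forall>x\<in>S. \<forall>y\<in>S. norm (c i x - c i y) \<le> L * norm (x - y)) \<and>
     (\<forall>i\<in>{1..l}. \<forall>x\<in>S. norm (b i x) \<le> B) \<and> (\<forall>i\<in>{1..l}. \<forall>x\<in>S. norm (c i x) \<le> B)"

lemma coef_boundsD:
  assumes "coef_bounds l S a b c L B"
  shows "x \<in> S \<Longrightarrow> y \<in> S \<Longrightarrow> norm (a x - a y) \<le> L * norm (x - y)"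
    "x \<in> S \<Longrightarrow> y \<in> S \<Longrightarrow> i \<in> {1..l} \<Longrightarrow> norm (b i x - b i y) \<le> L * norm (x - y)"
    "x \<in> S \<Longrightarrow> y \<in> S \<Longrightarrow> i \<in> {1..l} \<Longrightarrow> norm (c i x - c i y) \<le> L * norm (x - y)"
    "x \<in> S \<Longrightarrow> i \<in> {1..l} \<Longrightarrow> norm (b i x) \<le> B" "x \<in> S \<Longrightarrow> i \<in> {1..l} \<Longrightarrow> norm (c i x) \<le> B"
    "0 \<le> L" "0 \<le> B"
  using assms unfolding coef_bounds_def by blast+

lemma U0_sa_F: "U0 \<in> sa_part (F s)"
  using U0_in_F U0 by (auto simp: sa_part_def)

lemma io_U0: "\<iota> U0 \<in> Lsa" "\<iota> U0 \<in> L2F t"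
  using io_Lsa[OF U0] io_L2F[OF U0_in_F] by auto

text \<open>The vectors at the left grid points are replaced by self-adjoint operators of the
  corresponding past. Half of \<open>e\<close> pays for this replacement and half for the
  oscillation of \<open>V\<close> within a cell.\<close>

lemma step_process_approx:
  assumes t: "0 \<le> t" and cont: "continuous_on {0..t} V"
    and V: "\<And>r. r \<in> {0..t} \<Longrightarrow> V r \<in> Lsa" "\<And>r. r \<in> {0..t} \<Longrightarrow> V r \<in> L2F r" and e: "e > 0"
  shows "\<exists>n p X. simple_adapted F t n p X \<and> (\<forall>s. X s \<in> sa_part (F s)) \<and>
     (\<forall>r. 0 \<le> r \<and> r < t \<longrightarrow> norm (V r - \<iota> (X r)) \<le> e)"
proof (cases "t = 0")
  case True
  have "simple_adapted F t 0 (\<lambda>_. 0) (\<lambda>_. U0)" by (simp add: simple_adapted_def True)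
  then show ?thesis using U0_sa_F True by (intro exI[of _ 0] exI[of _ "\<lambda>_. 0"] exI[of _ "\<lambda>_. U0"]) auto
next
  case False
  with t have t0: "t > 0" by simp
  have "uniformly_continuous_on {0..t} V" by (rule compact_uniformly_continuous[OF cont]) simp
  moreover have "e / 2 > 0" using e by simp
  ultimately obtain d where d: "d > 0" "\<And>r s. r \<in> {0..t} \<Longrightarrow> s \<in> {0..t} \<Longrightarrow> dist r s < d \<Longrightarrow> dist (V r) (V s) < e / 2"
    unfolding uniformly_continuous_on_def by metis
  obtain n where n: "t / d < real n" using reals_Archimedean2 by blast
  have n0: "0 < real n" using n d t0 by (meson divide_pos_pos less_trans)
  have small: "t / real n < d" using n d n0 by (simp add: field_simps)
  define p where "p = (\<lambda>k. real k * t / real n)"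
  have p: "p 0 = 0" "p n = t" "p k < p (Suc k)" "p (Suc k) - p k = t / real n" for k
    using n0 t0 by (auto simp: p_def field_simps)
  have pk: "0 \<le> p k" "k \<le> n \<Longrightarrow> p k \<le> t" for k
    using n0 t0 by (auto simp: p_def field_simps)
  have "\<exists>Y\<in>sa_part (F (p k)). norm (\<iota> Y - V (p k)) < e / 2" if "k \<le> n" for k
    using V[of "p k"] pk[of k] that e by (intro Lsa_approx F_vn F_subset) auto
  then have "\<forall>k. \<exists>Y. k \<le> n \<longrightarrow> Y \<in> sa_part (F (p k)) \<and> norm (\<iota> Y - V (p k)) < e / 2" by blast
  then obtain Y where Y: "\<And>k. k \<le> n \<Longrightarrow> Y k \<in> sa_part (F (p k))" "\<And>k. k \<le> n \<Longrightarrow> norm (\<iota> (Y k) - V (p k)) < e / 2" by metis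
  \<comment> \<open>The floor is the index of the cell containing \<open>r\<close>. Outside
    \<open>[0, t)\<close> the value is \<open>U0\<close>, which lies in every \<open>F s\<close>,
    because \<open>sa_preserving\<close> asks for adaptedness at all times.\<close>
  define X where "X = (\<lambda>r. if 0 \<le> r \<and> r < t then Y (nat \<lfloor>r * real n / t\<rfloor>) else U0)"
  have X: "X r = Y k" if k: "k < n" "p k \<le> r" "r < p (Suc k)" for k r
  proof -
    have "0 \<le> r" using pk[of k] k by simp
    have "r < t" using pk[of "Suc k"] k by simp
    have "real k \<le> r * real n / t" "r * real n / t < real k + 1"
      using k n0 t0 by (auto simp: p_def field_simps)
    then have "\<lfloor>r * real n / t\<rfloor> = int k" by (intro floor_unique) auto
    then show ?thesis using \<open>0 \<le> r\<close> \<open>r < t\<close> by (simp add: X_def)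
  qed
  have cover: "\<exists>k<n. p k \<le> r \<and> r < p (Suc k)" if "0 \<le> r" "r < t" for r
    by (rule partition_cover) (use p that in auto)
  have "simple_adapted F t n p X"
    unfolding simple_adapted_def
  proof (intro conjI allI impI ballI)
    fix k assume k: "k < n"
    show "p k < p (Suc k)" by (rule p)
    show "X (p k) \<in> F (p k)" using X[OF k] p(3)[of k] Y(1)[of k] k by (auto simp: sa_part_def)
    show "X s = X (p k)" if "s \<in> {p k..<p (Suc k)}" for s using X[OF k] p(3)[of k] that by simp
  qed (rule p)+
  moreover have "X r \<in> sa_part (F r)" for r
  proof (cases "0 \<le> r \<and> r < t")
    case True
    then obtain k where k: "k < n" "p k \<le> r" "r < p (Suc k)" using cover by blast
    then show ?thesis using X[OF k] Y(1)[of k] F_mono[OF k(2)] by (auto simp: sa_part_def)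
  next
    case False
    then show ?thesis unfolding X_def if_not_P[OF False] by (intro U0_sa_F)
  qed
  moreover have "norm (V r - \<iota> (X r)) \<le> e" if r: "0 \<le> r" "r < t" for r
  proof -
    obtain k where k: "k < n" "p k \<le> r" "r < p (Suc k)" using cover[OF r] by blast
    have "dist r (p k) < d" using k p(4)[of k] small by (simp add: dist_real_def)
    then have "dist (V r) (V (p k)) < e / 2" using d(2)[of r "p k"] r pk[of k] k by auto
    moreover have "norm (\<iota> (X r) - V (p k)) < e / 2" using X[OF k] Y(2)[of k] k by simp
    ultimately have "dist (V r) (\<iota> (X r)) < e" using dist_triangle_half_l by (metis dist_norm)
    then show ?thesis by (simp add: dist_norm)
  qed
  ultimately show ?thesis by blast
qed

end

section \<open>Extended coefficients and their integrals along continuous adapted processes\<close>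

locale free_sde = free_bm A \<tau> \<iota> W U0 for A :: "('h::complex_hilbert_space \<Rightarrow>\<^sub>L 'h) set" and \<tau>
    and \<iota> :: "('h \<Rightarrow>\<^sub>L 'h) \<Rightarrow> 'k::complex_hilbert_space" and W U0 +
  fixes l :: nat and \<alpha> :: "('h \<Rightarrow>\<^sub>L 'h) \<Rightarrow> ('h \<Rightarrow>\<^sub>L 'h)" and \<beta> \<gamma> :: "nat \<Rightarrow> ('h \<Rightarrow>\<^sub>L 'h) \<Rightarrow> ('h \<Rightarrow>\<^sub>L 'h)" and d1 d2 :: real
  assumes maps: "\<And>f. f \<in> {\<alpha>} \<union> \<beta> ` {1..l} \<union> \<gamma> ` {1..l} \<Longrightarrow> f \<in> sa_part A \<rightarrow> sa_part A"
    and causality: "\<And>f. f \<in> {\<alpha>} \<union> \<beta> ` {1..l} \<union> \<gamma> ` {1..l} \<Longrightarrow> causal A f"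
    and sa_pres: "sa_preserving A \<iota> W (past W U0) l \<beta> \<gamma>"
    and lip: "\<And>f. f \<in> {\<alpha>} \<union> \<beta> ` {1..l} \<union> \<gamma> ` {1..l} \<Longrightarrow> locally_L2_lipschitz A \<iota> f"
    and growth: "d2 > 0"
      "\<And>U. U \<in> L2_sa A \<iota> \<Longrightarrow>
         2 * Re (L2_trace_mult A \<iota> U (L2_extension A \<iota> \<alpha> U)) +
         (\<Sum>i=1..l. norm (L2_extension A \<iota> (\<beta> i) U) * norm (L2_extension A \<iota> (\<gamma> i) U))\<^sup>2
         \<le> d1 * (norm U)\<^sup>2 + d2"
begin

abbreviation "aa \<equiv> L2_extension A \<iota> \<alpha>"
abbreviation "bb i \<equiv> L2_extension A \<iota> (\<beta> i)"
abbreviation "cc i \<equiv> L2_extension A \<iota> (\<gamma> i)"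

lemma coef_loc_lip: "loc_lip aa" "i \<in> {1..l} \<Longrightarrow> loc_lip (bb i)" "i \<in> {1..l} \<Longrightarrow> loc_lip (cc i)"
  by (intro L2_extension(2) maps lip; simp)+

lemma coef_cont: "continuous_on Lsa aa" "i \<in> {1..l} \<Longrightarrow> continuous_on Lsa (bb i)" "i \<in> {1..l} \<Longrightarrow> continuous_on Lsa (cc i)"
  by (intro loc_lip_continuous_on coef_loc_lip; assumption)+

lemma coef_Lsa: "u \<in> Lsa \<Longrightarrow> aa u \<in> Lsa"
proof -
  have "aa \<in> Lsa \<rightarrow> Lsa" by (intro L2_extension(1) maps lip) auto
  then show "u \<in> Lsa \<Longrightarrow> aa u \<in> Lsa" by auto
qed

lemma coef_adapted:
  assumes "u \<in> Lsa" "u \<in> L2F t"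
  shows "aa u \<in> L2F t" "i \<in> {1..l} \<Longrightarrow> bb i u \<in> L2F t" "i \<in> {1..l} \<Longrightarrow> cc i u \<in> L2F t"
  by (intro L2_extension_adapted maps lip causality F_vn F_subset assms; simp)+

lemma coef_F:
  assumes X: "X \<in> sa_part (F t)" and i: "i \<in> {1..l}"
  shows "\<beta> i X \<in> F t" "\<gamma> i X \<in> F t" "bb i (\<iota> X) = \<iota> (\<beta> i X)" "cc i (\<iota> X) = \<iota> (\<gamma> i X)"
proof -
  have XA: "X \<in> sa_part A" using X F_in by (auto simp: sa_part_def)
  have "vn_generated {X} \<subseteq> F t" by (rule vn_generated_least[OF F_vn]) (use X in \<open>auto simp: sa_part_def\<close>)
  then show "\<beta> i X \<in> F t" "\<gamma> i X \<in> F t"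
    using causality[of "\<beta> i"] causality[of "\<gamma> i"] XA i unfolding causal_def by auto
  show "bb i (\<iota> X) = \<iota> (\<beta> i X)" "cc i (\<iota> X) = \<iota> (\<gamma> i X)"
    by (intro L2_extension(3) maps lip XA; use i in simp)+
qed

lemma coef_const:
  assumes M: "M > 0"
  shows "\<exists>L B. coef_bounds l {x \<in> Lsa. norm x \<le> M} aa bb cc L B"
proof -
  define G where "G = insert aa (bb ` {1..l} \<union> cc ` {1..l})"
  have fin: "finite G" by (simp add: G_def)
  have "loc_lip g" if "g \<in> G" for g using that coef_loc_lip by (auto simp: G_def)
  from loc_lip_finite[OF fin this M] obtain L where L: "L > 0"
    "\<forall>g\<in>G. \<forall>u\<in>Lsa. \<forall>v\<in>Lsa. norm u \<le> M \<and> norm v \<le> M \<longrightarrow> norm (g u - g v) \<le> L * norm (u - v)" by blast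
  define B where "B = (\<Sum>g\<in>G. norm (g 0)) + L * M"
  have B: "norm (g u) \<le> B" if "g \<in> G" "u \<in> Lsa" "norm u \<le> M" for g u
  proof -
    have "0 \<in> Lsa" by (rule subspace_0[OF Lsa_subspace])
    moreover have "norm (0::'k) \<le> M" using M by simp
    ultimately have "norm (g u - g 0) \<le> L * norm (u - 0)" using L(2) that by blast
    also have "\<dots> \<le> L * M" using that L by simp
    finally have "norm (g u) \<le> norm (g 0) + L * M" using norm_triangle_sub[of "g u" "g 0"] by simp
    moreover have "norm (g 0) \<le> (\<Sum>g\<in>G. norm (g 0))" by (rule member_le_sum[OF that(1)]) (use fin in auto)
    ultimately show ?thesis by (simp add: B_def)
  qed
  have mem: "aa \<in> G" "\<And>i. i \<in> {1..l} \<Longrightarrow> bb i \<in> G" "\<And>i. i \<in> {1..l} \<Longrightarrow> cc i \<in> G" by (auto simp: G_def)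
  have "0 \<le> B" using L M by (simp add: B_def sum_nonneg)
  have lipG: "norm (g u - g v) \<le> L * norm (u - v)"
    if "g \<in> G" "u \<in> Lsa" "v \<in> Lsa" "norm u \<le> M" "norm v \<le> M" for g u v
    using L(2) that by blast
  have "coef_bounds l {x \<in> Lsa. norm x \<le> M} aa bb cc L B"
    unfolding coef_bounds_def
    by (intro conjI ballI less_imp_le[OF L(1)] \<open>0 \<le> B\<close> lipG B mem; blast)
  then show ?thesis by blast
qed

text \<open>Self-adjointness of the martingale part is granted for operator-valued processes only,
  whereas \<open>V\<close> takes values in L^2. One sequence \<open>X j\<close> of operator-valued
  simple processes serves all indices \<open>i\<close> at once, so for each \<open>j\<close> the
  whole sum is self-adjoint, and the limit inherits this because \<open>Lsa\<close> is
  closed.\<close>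

lemma coef_integrals:
  assumes t: "0 \<le> t" and cont: "continuous_on {0..t} V"
    and V: "\<And>r. r \<in> {0..t} \<Longrightarrow> V r \<in> Lsa" "\<And>r. r \<in> {0..t} \<Longrightarrow> V r \<in> L2F r"
  shows "\<exists>\<xi>. (\<forall>i\<in>{1..l}. has_free_integral \<iota> W F t (\<lambda>r. bb i (V r)) (\<lambda>r. cc i (V r)) (\<xi> i)) \<and> (\<Sum>i=1..l. \<xi> i) \<in> Lsa"
proof -
  have "\<forall>j::nat. \<exists>n p X. simple_adapted F t n p X \<and> (\<forall>s. X s \<in> sa_part (F s)) \<and>
     (\<forall>r. 0 \<le> r \<and> r < t \<longrightarrow> norm (V r - \<iota> (X r)) \<le> 1 / Suc j)"
    using step_process_approx[OF t cont V] by simp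
  then obtain n p X where X: "\<And>j::nat. simple_adapted F t (n j) (p j) (X j)" "\<And>j s. X j s \<in> sa_part (F s)"
    "\<And>j r. 0 \<le> r \<Longrightarrow> r < t \<Longrightarrow> norm (V r - \<iota> (X j r)) \<le> 1 / Suc j" by metis
  have "bounded (V ` {0..t})" using cont by (auto intro!: compact_imp_bounded compact_continuous_image)
  then obtain K where K: "K > 0" "\<And>r. r \<in> {0..t} \<Longrightarrow> norm (V r) \<le> K" unfolding bounded_pos by auto
  \<comment> \<open>The approximants are within distance \<open>1\<close> of \<open>V\<close>, hence
    in the ball of radius \<open>K + 1\<close>.\<close>
  obtain L B where LB: "coef_bounds l {x \<in> Lsa. norm x \<le> K + 1} aa bb cc L B"
    using coef_const[of "K + 1"] K(1) by auto
  note L = coef_boundsD(6,2,3)[OF LB]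
  have simple: "simple_adapted F t (n j) (p j) (\<lambda>r. \<beta> i (X j r))" "simple_adapted F t (n j) (p j) (\<lambda>r. \<gamma> i (X j r))"
    if i: "i \<in> {1..l}" for i j
  proof -
    note D = simple_adaptedD[OF X(1)[of j]]
    have "f (X j s) = f (X j (p j k))" if "k < n j" "s \<in> {p j k..<p j (Suc k)}" for f :: "('h \<Rightarrow>\<^sub>L 'h) \<Rightarrow> ('h \<Rightarrow>\<^sub>L 'h)" and k s
      using D(5)[OF that(1), of s] that(2) by simp
    then show "simple_adapted F t (n j) (p j) (\<lambda>r. \<beta> i (X j r))" "simple_adapted F t (n j) (p j) (\<lambda>r. \<gamma> i (X j r))"
      unfolding simple_adapted_def using D(1-3) coef_F(1,2)[OF X(2) i] by blast+
  qed
  have XL: "\<iota> (X j r) \<in> Lsa" for j r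
    by (rule io_Lsa) (use X(2)[of j r] F_in in \<open>auto simp: sa_part_def\<close>)
  define S where "S = (\<lambda>i j. \<iota> (simple_integral W (n j) (p j) (\<lambda>r. \<beta> i (X j r)) (\<lambda>r. \<gamma> i (X j r))))"
  have ex: "\<exists>\<xi>. has_free_integral \<iota> W F t (\<lambda>r. bb i (V r)) (\<lambda>r. cc i (V r)) \<xi> \<and> S i \<longlonglongrightarrow> \<xi>" if i: "i \<in> {1..l}" for i
  proof -
    have c: "continuous_on {0..t} (\<lambda>r. bb i (V r))" "continuous_on {0..t} (\<lambda>r. cc i (V r))"
      by (rule continuous_on_compose2[OF coef_cont(2)[OF i] cont], use V in auto)
         (rule continuous_on_compose2[OF coef_cont(3)[OF i] cont], use V in auto)
    have lim: "(\<lambda>j. L * (1 / real (Suc j))) \<longlonglongrightarrow> 0"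
      using tendsto_mult[OF tendsto_const LIMSEQ_inverse_real_of_nat, of L] by (simp add: inverse_eq_divide)
    have near: "norm (bb i (V r) - \<iota> (\<beta> i (X j r))) \<le> L * (1 / real (Suc j))"
      "norm (cc i (V r) - \<iota> (\<gamma> i (X j r))) \<le> L * (1 / real (Suc j))" if r: "0 \<le> r" "r < t" for j r
    proof -
      have x: "norm (V r - \<iota> (X j r)) \<le> 1 / real (Suc j)" by (rule X(3)[OF r])
      have v: "norm (V r) \<le> K" "V r \<in> Lsa" using K(2)[of r] V(1)[of r] r by auto
      have "1 / real (Suc j) \<le> 1" by simp
      then have "norm (\<iota> (X j r)) \<le> K + 1"
        using x v(1) norm_triangle_sub[of "\<iota> (X j r)" "V r"] norm_minus_commute[of "V r" "\<iota> (X j r)"] by linarith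
      moreover have "norm (V r) \<le> K + 1" "V r \<in> Lsa" using v by auto
      ultimately have "norm (bb i (V r) - bb i (\<iota> (X j r))) \<le> L * norm (V r - \<iota> (X j r))"
        "norm (cc i (V r) - cc i (\<iota> (X j r))) \<le> L * norm (V r - \<iota> (X j r))"
        using L(2,3) XL i by auto
      moreover have "L * norm (V r - \<iota> (X j r)) \<le> L * (1 / real (Suc j))" by (intro mult_left_mono x L(1))
      ultimately show "norm (bb i (V r) - \<iota> (\<beta> i (X j r))) \<le> L * (1 / real (Suc j))"
        "norm (cc i (V r) - \<iota> (\<gamma> i (X j r))) \<le> L * (1 / real (Suc j))"
        using coef_F(3,4)[OF X(2) i, of j r] by auto
    qed
    obtain \<xi> where "has_free_integral \<iota> W F t (\<lambda>r. bb i (V r)) (\<lambda>r. cc i (V r)) \<xi>"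
      "(\<lambda>j. \<iota> (simple_integral W (n j) (p j) (\<lambda>r. \<beta> i (X j r)) (\<lambda>r. \<gamma> i (X j r)))) \<longlonglongrightarrow> \<xi>"
    proof (rule free_integral_of_limit[OF t c _ _ simple[OF i] lim])
      show "bb i (V r) \<in> L2F r" "cc i (V r) \<in> L2F r" if "r \<in> {0..t}" for r
        using coef_adapted(2,3)[OF V(1)[OF that] V(2)[OF that] i] by auto
    qed (use L(1) near in auto)
    then show ?thesis by (auto simp: S_def)
  qed
  then obtain \<xi> where \<xi>: "\<And>i. i \<in> {1..l} \<Longrightarrow> has_free_integral \<iota> W F t (\<lambda>r. bb i (V r)) (\<lambda>r. cc i (V r)) (\<xi> i)"
    "\<And>i. i \<in> {1..l} \<Longrightarrow> S i \<longlonglongrightarrow> \<xi> i" by metis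
  have "(\<lambda>j. \<Sum>i=1..l. S i j) \<longlonglongrightarrow> (\<Sum>i=1..l. \<xi> i)" by (intro tendsto_sum \<xi>)
  moreover have mem: "(\<Sum>i=1..l. S i j) \<in> Lsa" for j
  proof -
    have "has_free_integral \<iota> W F t (\<lambda>s. \<iota> (\<beta> i (X j s))) (\<lambda>s. \<iota> (\<gamma> i (X j s))) (S i j)" if i: "i \<in> {1..l}" for i
      unfolding S_def by (rule simple_has_free_integral[OF simple[OF i]]) (use coef_F(1,2)[OF X(2) i] in auto)
    then have "(\<forall>s\<ge>0. X j s \<in> sa_part (F s)) \<and> 0 \<le> t \<and>
        (\<forall>i\<in>{1..l}. has_free_integral \<iota> W F t (\<lambda>s. \<iota> (\<beta> i (X j s))) (\<lambda>s. \<iota> (\<gamma> i (X j s))) (S i j))"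
      using X(2) t by blast
    from sa_pres[unfolded sa_preserving_def, rule_format, OF this] show ?thesis .
  qed
  ultimately have "(\<Sum>i=1..l. \<xi> i) \<in> Lsa" using closed_sequentially[OF Lsa_closed, of "\<lambda>j. \<Sum>i=1..l. S i j"] by simp
  then show ?thesis using \<xi>(1) by blast
qed

section \<open>The truncated equation\<close>

definition adapted_cont :: "real \<Rightarrow> (real \<Rightarrow> 'k) \<Rightarrow> bool" where
  "adapted_cont T u \<longleftrightarrow> continuous_on {0..T} u \<and> (\<forall>r\<in>{0..T}. u r \<in> Lsa \<and> u r \<in> L2F r)"

lemma step_adapted_cont: "step l a b c T u u' \<Longrightarrow> adapted_cont T u'"
  using step_continuous unfolding adapted_cont_def step_def by blast

lemma retract_L2F: "u \<in> L2F t \<Longrightarrow> retract M u \<in> L2F t" "u \<in> Lsa \<Longrightarrow> retract M u \<in> Lsa"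
  by (intro retract_subspace L2F_subspace Lsa_subspace; assumption)+

abbreviation "tstep M \<equiv> step l (\<lambda>x. aa (retract M x)) (\<lambda>i x. bb i (retract M x)) (\<lambda>i x. cc i (retract M x))"

lemma tstep_exists:
  assumes M: "0 \<le> M" and u: "adapted_cont T u"
  shows "\<exists>u'. tstep M T u u'"
proof -
  define V where "V = (\<lambda>r. retract M (u r))"
  have uc: "continuous_on {0..T} u" and uL: "\<And>r. r \<in> {0..T} \<Longrightarrow> u r \<in> Lsa" "\<And>r. r \<in> {0..T} \<Longrightarrow> u r \<in> L2F r"
    using u by (auto simp: adapted_cont_def)
  have Vc: "continuous_on {0..T} V"
    unfolding V_def by (rule continuous_on_compose2[OF retract_continuous[OF M, of UNIV] uc]) simp
  have V: "V r \<in> Lsa" "V r \<in> L2F r" if "r \<in> {0..T}" for r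
    using uL[OF that] retract_L2F by (auto simp: V_def)
  have ac: "continuous_on {0..T} (\<lambda>r. aa (V r))"
    by (rule continuous_on_compose2[OF coef_cont(1) Vc]) (use V in auto)
  have "\<exists>v. v \<in> Lsa \<and> v \<in> L2F t \<and> (\<exists>\<zeta> \<xi>. ((\<lambda>s. aa (V s)) has_integral \<zeta>) {0..t} \<and>
       (\<forall>i\<in>{1..l}. has_free_integral \<iota> W F t (\<lambda>s. bb i (V s)) (\<lambda>s. cc i (V s)) (\<xi> i)) \<and>
       v = \<iota> U0 + \<zeta> + (\<Sum>i=1..l. \<xi> i))" if t: "t \<in> {0..T}" for t
  proof -
    have sub: "{0..t} \<subseteq> {0..T}" using t by auto
    have "\<exists>\<xi>. (\<forall>i\<in>{1..l}. has_free_integral \<iota> W F t (\<lambda>r. bb i (V r)) (\<lambda>r. cc i (V r)) (\<xi> i)) \<and> (\<Sum>i=1..l. \<xi> i) \<in> Lsa"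
      by (rule coef_integrals[OF _ continuous_on_subset[OF Vc sub]]) (use V t in auto)
    then obtain \<xi> where \<xi>: "\<And>i. i \<in> {1..l} \<Longrightarrow> has_free_integral \<iota> W F t (\<lambda>r. bb i (V r)) (\<lambda>r. cc i (V r)) (\<xi> i)"
      "(\<Sum>i=1..l. \<xi> i) \<in> Lsa" by blast
    have ai: "(\<lambda>r. aa (V r)) integrable_on {0..t}"
      by (intro integrable_continuous_real continuous_on_subset[OF ac sub])
    define \<zeta> where "\<zeta> = integral {0..t} (\<lambda>r. aa (V r))"
    have "\<zeta> \<in> Lsa" unfolding \<zeta>_def
      by (rule integral_in_closed_subspace[OF Lsa_closed Lsa_subspace ai]) (use coef_Lsa V sub in blast)
    moreover have "\<zeta> \<in> L2F t" unfolding \<zeta>_def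
    proof (rule integral_in_closed_subspace[OF L2F_closed L2F_subspace ai])
      fix r assume r: "r \<in> {0..t}"
      then have "aa (V r) \<in> L2F r" using coef_adapted(1) V sub by blast
      then show "aa (V r) \<in> L2F t" using r by (auto intro: L2F_mem_mono)
    qed
    moreover have "(\<Sum>i=1..l. \<xi> i) \<in> L2F t"
      by (intro subspace_sum[OF L2F_subspace] free_integral_adapted[OF \<xi>(1)])
    ultimately have "\<iota> U0 + \<zeta> + (\<Sum>i=1..l. \<xi> i) \<in> Lsa" "\<iota> U0 + \<zeta> + (\<Sum>i=1..l. \<xi> i) \<in> L2F t"
      using io_U0 \<xi>(2) by (auto intro!: subspace_add[OF L2F_subspace] subspace_add[OF Lsa_subspace])
    moreover have "((\<lambda>s. aa (V s)) has_integral \<zeta>) {0..t}" unfolding \<zeta>_def by (rule integrable_integral[OF ai])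
    ultimately show ?thesis using \<xi>(1) by blast
  qed
  then have "\<forall>t\<in>{0..T}. \<exists>v. v \<in> Lsa \<and> v \<in> L2F t \<and> (\<exists>\<zeta> \<xi>. ((\<lambda>s. aa (V s)) has_integral \<zeta>) {0..t} \<and>
       (\<forall>i\<in>{1..l}. has_free_integral \<iota> W F t (\<lambda>s. bb i (V s)) (\<lambda>s. cc i (V s)) (\<xi> i)) \<and>
       v = \<iota> U0 + \<zeta> + (\<Sum>i=1..l. \<xi> i))" by (rule ballI)
  from bchoice[OF this] show ?thesis unfolding step_def V_def .
qed

lemma tstep_const:
  assumes M: "M > 0"
  shows "\<exists>L B. coef_bounds l Lsa (\<lambda>x. aa (retract M x)) (\<lambda>i x. bb i (retract M x)) (\<lambda>i x. cc i (retract M x)) L B"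
proof -
  obtain L B where "coef_bounds l {x \<in> Lsa. norm x \<le> M} aa bb cc L B"
    using coef_const[OF M] by blast
  note LB = coef_boundsD[OF this]
  have r: "retract M x \<in> {x \<in> Lsa. norm x \<le> M}" if "x \<in> Lsa" for x
    using retract_L2F(2)[OF that] retract_norm[of M x] M by auto
  have l: "L * norm (retract M x - retract M y) \<le> 2 * L * norm (x - y)" for x y :: 'k
    using mult_left_mono[OF retract_lip[of M x y] LB(6)] M by simp
  have "coef_bounds l Lsa (\<lambda>x. aa (retract M x)) (\<lambda>i x. bb i (retract M x)) (\<lambda>i x. cc i (retract M x)) (2 * L) B"
    unfolding coef_bounds_def
  proof (intro conjI ballI)
    show "0 \<le> 2 * L" "0 \<le> B" using LB(6,7) by auto
    fix x assume x: "x \<in> Lsa"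
    show "norm (bb i (retract M x)) \<le> B" "norm (cc i (retract M x)) \<le> B" if "i \<in> {1..l}" for i
      using LB(4)[OF r[OF x] that] LB(5)[OF r[OF x] that] by auto
    fix y assume y: "y \<in> Lsa"
    show "norm (aa (retract M x) - aa (retract M y)) \<le> 2 * L * norm (x - y)"
      by (rule order_trans[OF LB(1)[OF r[OF x] r[OF y]] l])
    show "norm (bb i (retract M x) - bb i (retract M y)) \<le> 2 * L * norm (x - y)" if "i \<in> {1..l}" for i
      by (rule order_trans[OF LB(2)[OF r[OF x] r[OF y] that] l])
    show "norm (cc i (retract M x) - cc i (retract M y)) \<le> 2 * L * norm (x - y)" if "i \<in> {1..l}" for i
      by (rule order_trans[OF LB(3)[OF r[OF x] r[OF y] that] l])
  qed
  then show ?thesis by blast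
qed

text \<open>Picard iteration from the constant process \<open>\<iota> U0\<close>. Convergence is
  uniform on \<open>[0, T]\<close> because consecutive differences halve in the weighted
  norm.\<close>

lemma tstep_solution:
  assumes M: "M > 0" and T: "0 \<le> T"
  shows "\<exists>u. tstep M T u u"
proof -
  obtain L B where "coef_bounds l Lsa (\<lambda>x. aa (retract M x)) (\<lambda>i x. bb i (retract M x)) (\<lambda>i x. cc i (retract M x)) L B"
    using tstep_const[OF M] by blast
  note LB = coef_boundsD[OF this]
  define lam where "lam = 4 * L + 32 * (real l * L * B)\<^sup>2 + 1"
  have lam0: "lam \<ge> 0" using LB by (simp add: lam_def)
  have contr: "norm (u' t - v' t) \<le> \<kappa> / 2 * exp (lam * t)"
    if "tstep M T u u'" "tstep M T v v'" "adapted_cont T u" "adapted_cont T v"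
      "\<And>t. t \<in> {0..T} \<Longrightarrow> norm (u t - v t) \<le> \<kappa> * exp (lam * t)" "0 \<le> \<kappa>" "t \<in> {0..T}" for u u' v v' \<kappa> t
    by (rule step_contraction[OF that(1,2) _ _ LB lam_def that(5-7)])
       (use that(3,4) in \<open>auto simp: adapted_cont_def\<close>)
  define nxt where "nxt = (\<lambda>u. SOME u'. tstep M T u u')"
  define U where "U = rec_nat (\<lambda>_. \<iota> U0) (\<lambda>_ u. nxt u)"
  have U0: "U 0 = (\<lambda>_. \<iota> U0)" and USuc: "\<And>n. U (Suc n) = nxt (U n)" by (simp_all add: U_def)
  have nxt: "tstep M T u (nxt u)" if "adapted_cont T u" for u
    unfolding nxt_def by (rule someI_ex[OF tstep_exists[OF _ that]]) (use M in simp)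
  have Uac: "adapted_cont T (U n)" for n
  proof (induction n)
    case 0
    show ?case unfolding U0 adapted_cont_def using io_U0 by auto
  next
    case (Suc n)
    show ?case unfolding USuc by (rule step_adapted_cont[OF nxt[OF Suc]])
  qed
  have Ust: "tstep M T (U n) (U (Suc n))" for n unfolding USuc by (rule nxt[OF Uac])
  have Uc: "continuous_on {0..T} (U n)" for n using Uac by (simp add: adapted_cont_def)
  have "bounded ((\<lambda>t. U (Suc 0) t - U 0 t) ` {0..T})"
    by (intro compact_imp_bounded compact_continuous_image continuous_on_diff Uc) simp
  then obtain \<kappa> where \<kappa>: "\<kappa> > 0" "\<And>t. t \<in> {0..T} \<Longrightarrow> norm (U (Suc 0) t - U 0 t) \<le> \<kappa>" unfolding bounded_pos by auto
  have exp1: "\<kappa>' \<le> \<kappa>' * exp (lam * t)" if "0 \<le> \<kappa>'" "t \<in> {0..T}" for \<kappa>' t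
    using that lam0 mult_left_mono[of 1 "exp (lam * t)" \<kappa>'] by simp
  have "\<forall>t\<in>{0..T}. norm (U (Suc n) t - U n t) \<le> \<kappa> / 2 ^ n * exp (lam * t)" for n
  proof (induction n)
    case 0
    show ?case
    proof
      fix t assume t: "t \<in> {0..T}"
      from order_trans[OF \<kappa>(2)[OF t] exp1[OF less_imp_le[OF \<kappa>(1)] t]]
      show "norm (U (Suc 0) t - U 0 t) \<le> \<kappa> / 2 ^ 0 * exp (lam * t)" by simp
    qed
  next
    case (Suc n)
    have "norm (U (Suc (Suc n)) t - U (Suc n) t) \<le> (\<kappa> / 2 ^ n) / 2 * exp (lam * t)" if "t \<in> {0..T}" for t
      by (rule contr[OF Ust Ust Uac Uac _ _ that]) (use Suc \<kappa>(1) in auto)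
    then show ?case by (simp add: mult.commute)
  qed
  note dec = this
  define C where "C = \<kappa> * exp (lam * T)"
  have C0: "C > 0" using \<kappa> by (simp add: C_def)
  have geo: "norm (U (Suc n) t - U n t) \<le> C / 2 ^ n" if t: "t \<in> {0..T}" for n t
  proof -
    have "norm (U (Suc n) t - U n t) \<le> \<kappa> / 2 ^ n * exp (lam * t)" using dec t by blast
    also have "\<dots> \<le> \<kappa> / 2 ^ n * exp (lam * T)"
      using \<kappa>(1) lam0 t by (intro mult_left_mono) (auto intro: mult_left_mono)
    finally show ?thesis by (simp add: C_def)
  qed
  have tail: "norm (U (n + k) t - U n t) \<le> 2 * C / 2 ^ n" if t: "t \<in> {0..T}" for n k t
    by (rule geometric_Cauchy[of "\<lambda>n. U n t", OF geo[OF t]]) (use C0 in simp)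
  have Clim: "(\<lambda>n. 2 * C / 2 ^ n) \<longlonglongrightarrow> 0"
  proof -
    have "(\<lambda>n. 2 * C * (1 / 2) ^ n) \<longlonglongrightarrow> 2 * C * 0" by (intro tendsto_intros LIMSEQ_power_zero) simp
    then show ?thesis by (simp add: power_divide)
  qed
  have "\<exists>w. (\<lambda>n. U n t) \<longlonglongrightarrow> w" if t: "t \<in> {0..T}" for t
  proof -
    have "Cauchy (\<lambda>n. U n t)"
    proof (rule metric_CauchyI)
      fix e :: real assume "e > 0"
      then have "eventually (\<lambda>n. 2 * C / 2 ^ n < e / 2) sequentially" using order_tendstoD(2)[OF Clim, of "e / 2"] by simp
      then obtain N where N: "2 * C / 2 ^ N < e / 2" unfolding eventually_sequentially by blast
      have near: "dist (U m t) (U N t) < e / 2" if "N \<le> m" for m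
        using tail[OF t, of N "m - N"] N that by (simp add: dist_norm)
      show "\<exists>M. \<forall>m\<ge>M. \<forall>n\<ge>M. dist (U m t) (U n t) < e"
        using near dist_triangle_half_l by blast
    qed
    then show ?thesis using Cauchy_convergent convergent_def by blast
  qed
  then obtain w where w: "\<And>t. t \<in> {0..T} \<Longrightarrow> (\<lambda>n. U n t) \<longlonglongrightarrow> w t" by metis
  have wU: "norm (U n t - w t) \<le> 2 * C / 2 ^ n" if t: "t \<in> {0..T}" for n t
  proof (rule tendsto_upperbound[of "\<lambda>k. norm (U n t - U (n + k) t)" _ sequentially])
    have "(\<lambda>k. U (n + k) t) \<longlonglongrightarrow> w t" using LIMSEQ_ignore_initial_segment[OF w[OF t], of n] by (simp add: add.commute)
    then show "(\<lambda>k. norm (U n t - U (n + k) t)) \<longlonglongrightarrow> norm (U n t - w t)" by (intro tendsto_intros)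
  qed (use tail[OF t] in \<open>auto simp: norm_minus_commute\<close>)
  have "uniform_limit {0..T} U w sequentially"
  proof (rule uniform_limitI)
    fix e :: real assume "e > 0"
    then have "eventually (\<lambda>n. 2 * C / 2 ^ n < e) sequentially" using order_tendstoD(2)[OF Clim] by simp
    then show "\<forall>\<^sub>F n in sequentially. \<forall>t\<in>{0..T}. dist (U n t) (w t) < e"
    proof eventually_elim
      case (elim n)
      show ?case using wU[of _ n] elim by (force simp: dist_norm)
    qed
  qed
  then have "continuous_on {0..T} w"
    by (rule uniform_limit_theorem[rotated]) (use Uc in auto)
  moreover have "w t \<in> Lsa \<and> w t \<in> L2F t" if t: "t \<in> {0..T}" for t
    using closed_sequentially[OF Lsa_closed _ w[OF t]] closed_sequentially[OF L2F_closed _ w[OF t]] Uac t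
    unfolding adapted_cont_def by blast
  ultimately have wac: "adapted_cont T w" by (simp add: adapted_cont_def)
  \<comment> \<open>To see that the limit is a fixed point, the Picard map is applied once more: the
    contraction makes the image \<open>v\<close> a limit of the same iterates, so
    \<open>v = w\<close>. No limit has to be taken inside a stochastic integral.\<close>
  define v where "v = nxt w"
  have v: "tstep M T w v" unfolding v_def by (rule nxt[OF wac])
  have "v t = w t" if t: "t \<in> {0..T}" for t
  proof -
    have le: "norm (U (Suc n) t - v t) \<le> 2 * C / 2 ^ n * (exp (lam * t) / 2)" for n
    proof -
      have "norm (U (Suc n) t - v t) \<le> (2 * C / 2 ^ n) / 2 * exp (lam * t)"
      proof (rule contr[OF Ust v Uac wac _ _ t])
        show "0 \<le> 2 * C / 2 ^ n" using C0 by simp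
        fix r assume r: "r \<in> {0..T}"
        show "norm (U n r - w r) \<le> 2 * C / 2 ^ n * exp (lam * r)"
          by (rule order_trans[OF wU[OF r] exp1[OF _ r]]) (use C0 in simp)
      qed
      then show ?thesis by simp
    qed
    have "(\<lambda>n. norm (U (Suc n) t - v t)) \<longlonglongrightarrow> 0"
    proof (rule tendsto_sandwich[OF _ _ tendsto_const])
      show "(\<lambda>n. 2 * C / 2 ^ n * (exp (lam * t) / 2)) \<longlonglongrightarrow> 0"
        using tendsto_mult[OF Clim tendsto_const, of "exp (lam * t) / 2"] by simp
    qed (use le in auto)
    then have "(\<lambda>n. U (Suc n) t) \<longlonglongrightarrow> v t" by (simp add: tendsto_norm_zero_iff LIM_zero_iff)
    then show ?thesis using LIMSEQ_Suc[OF w[OF t]] LIMSEQ_unique by blast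
  qed
  then have "tstep M T w w" using v unfolding step_def by simp
  then show ?thesis by blast
qed

section \<open>Removal of the truncation and the global solution\<close>

lemma growth_bound:
  assumes "u \<in> Lsa"
  shows "2 * inner u (aa u) + (\<Sum>i=1..l. norm (bb i u) * norm (cc i u))\<^sup>2 \<le> d1 * (norm u)\<^sup>2 + d2"
  using growth(2)[OF assms] L2_trace_mult_sa[OF assms] by simp

lemma step_initial:
  assumes "step l a b c T u u" "0 \<le> T"
  shows "u 0 = \<iota> U0"
proof -
  from assms(1) obtain \<xi> where \<xi>: "\<And>t i. t \<in> {0..T} \<Longrightarrow> i \<in> {1..l} \<Longrightarrow> has_free_integral \<iota> W F t (\<lambda>s. b i (u s)) (\<lambda>s. c i (u s)) (\<xi> t i)"
    "\<And>t. t \<in> {0..T} \<Longrightarrow> u t = \<iota> U0 + integral {0..t} (\<lambda>s. a (u s)) + (\<Sum>i=1..l. \<xi> t i)"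
    by (rule stepE) blast
  have "\<xi> 0 i = 0" if "i \<in> {1..l}" for i by (rule free_integral_0[OF \<xi>(1)]) (use assms that in auto)
  then show ?thesis using \<xi>(2)[of 0] assms(2) by simp
qed

lemma solution_exists:
  assumes T: "0 \<le> T"
  shows "\<exists>u. step l aa bb cc T u u"
proof -
  \<comment> \<open>\<open>K\<close> exceeds \<open>d1 + d2\<close>, and \<open>y \<ge> 1\<close>
    absorbs the additive constant of (A-2): \<open>d1 * y + d2 \<le> (d1 + d2) * y < K * y\<close>.
    The summand \<open>1\<close> in \<open>Y0\<close> is what gives
    \<open>y \<ge> 1\<close>.\<close>
  define K where "K = \<bar>d1\<bar> + d2 + 1"
  define Y0 where "Y0 = (norm (\<iota> U0))\<^sup>2 + 1"
  define y where "y = (\<lambda>t. Y0 * exp (K * t))"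
  have K: "K > 0" "d1 < K - d2" using growth(1) by (auto simp: K_def)
  have Y0: "Y0 \<ge> 1" by (simp add: Y0_def)
  have y1: "1 \<le> y t" "y t \<le> y T" if "t \<in> {0..T}" for t
  proof -
    have "1 * 1 \<le> Y0 * exp (K * t)" using Y0 K that by (intro mult_mono) auto
    then show "1 \<le> y t" by (simp add: y_def)
    show "y t \<le> y T" using Y0 K that by (auto simp: y_def intro!: mult_left_mono)
  qed
  \<comment> \<open>The radius bounds norms, the barrier squared norms; since
    \<open>M \<ge> 1\<close>, also \<open>y t \<le> M\<^sup>2\<close>.\<close>
  define M where "M = y T"
  have M: "M \<ge> 1" using y1[of T] T by (simp add: M_def)
  have yM: "y t \<le> M\<^sup>2" if "t \<in> {0..T}" for t
  proof -
    have "y t \<le> M * 1" using y1(2)[OF that] by (simp add: M_def)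
    also have "\<dots> \<le> M * M" using M by (intro mult_left_mono) auto
    finally show ?thesis by (simp add: power2_eq_square)
  qed
  obtain u where u: "tstep M T u u" using tstep_solution[of M T] M T by auto
  have ac: "adapted_cont T u" by (rule step_adapted_cont[OF u])
  then have uc: "continuous_on {0..T} u" and uL: "\<And>t. t \<in> {0..T} \<Longrightarrow> u t \<in> Lsa" by (auto simp: adapted_cont_def)
  have rc: "continuous_on {0..T} (\<lambda>r. retract M (u r))"
    by (rule continuous_on_compose2[OF retract_continuous[of M UNIV] uc]) (use M in auto)
  have rL: "(\<lambda>r. retract M (u r)) ` {0..T} \<subseteq> Lsa" using uL retract_L2F(2) by auto
  have bound: "(norm (u t))\<^sup>2 \<le> y t" if t: "t \<in> {0..T}" for t
  proof (rule energy_comparison[OF u _ _ _ _ _ _ t])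
    show "continuous_on {0..T} (\<lambda>r. aa (retract M (u r)))"
      by (rule continuous_on_compose2[OF coef_cont(1) rc rL])
    show "continuous_on {0..T} (\<lambda>r. bb i (retract M (u r)))" if "i \<in> {1..l}" for i
      by (rule continuous_on_compose2[OF coef_cont(2)[OF that] rc rL])
    show "continuous_on {0..T} (\<lambda>r. cc i (retract M (u r)))" if "i \<in> {1..l}" for i
      by (rule continuous_on_compose2[OF coef_cont(3)[OF that] rc rL])
    show "(y has_real_derivative K * y s) (at s)" for s
      unfolding y_def by (auto intro!: derivative_eq_intros)
    show "(norm (u 0))\<^sup>2 \<le> y 0" unfolding step_initial[OF u T] by (simp add: y_def Y0_def)
    fix s assume s: "s \<in> {0..T}" and eq: "(norm (u s))\<^sup>2 = y s"
    have "(norm (u s))\<^sup>2 \<le> M\<^sup>2" using eq yM[OF s] by simp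
    then have "norm (u s) \<le> M" using M power2_le_imp_le[of "norm (u s)" M] by simp
    then have r: "retract M (u s) = u s" by (rule retract_id)
    have "2 * inner (u s) (aa (u s)) + (\<Sum>i=1..l. norm (bb i (u s)) * norm (cc i (u s)))\<^sup>2 \<le> d1 * y s + d2"
      using growth_bound[OF uL[OF s]] eq by simp
    also have "\<dots> \<le> d1 * y s + d2 * y s" using y1(1)[OF s] growth(1) by simp
    also have "\<dots> = (d1 + d2) * y s" by (simp add: distrib_right)
    also have "\<dots> < K * y s" using K y1(1)[OF s] by (intro mult_strict_right_mono) auto
    finally show "2 * inner (u s) (aa (retract M (u s))) + (\<Sum>i=1..l. norm (bb i (retract M (u s))) * norm (cc i (retract M (u s))))\<^sup>2 < K * y s"
      unfolding r .
  qed
  have "retract M (u t) = u t" if t: "t \<in> {0..T}" for t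
  proof (rule retract_id)
    have "(norm (u t))\<^sup>2 \<le> M\<^sup>2" using bound[OF t] yM[OF t] by simp
    then show "norm (u t) \<le> M" using M power2_le_imp_le[of "norm (u t)" M] by simp
  qed
  then have "step l aa bb cc T u u" by (intro step_cong[OF u]) auto
  then show ?thesis by blast
qed

text \<open>Solutions are continuous, so both stay in one ball on \<open>[0, T]\<close>, and the
  constants of the original coefficients on that ball suffice.\<close>

lemma solution_unique:
  assumes u: "step l aa bb cc T u u" and v: "step l aa bb cc T v v" and t: "t \<in> {0..T}"
  shows "u t = v t"
proof -
  have "bounded (u ` {0..T})" "bounded (v ` {0..T})"
    using step_continuous[OF u] step_continuous[OF v] by (auto intro!: compact_imp_bounded compact_continuous_image)
  then have "bounded (u ` {0..T} \<union> v ` {0..T})" by simp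
  then obtain M where M: "M > 0" "\<And>t. t \<in> {0..T} \<Longrightarrow> norm (u t) \<le> M" "\<And>t. t \<in> {0..T} \<Longrightarrow> norm (v t) \<le> M"
    unfolding bounded_pos by auto
  obtain L B where "coef_bounds l {x \<in> Lsa. norm x \<le> M} aa bb cc L B"
    using coef_const[OF M(1)] by blast
  note LB = coef_boundsD[OF this]
  have mem: "u t \<in> Lsa" "v t \<in> Lsa" if "t \<in> {0..T}" for t
    using step_adapted_cont[OF u] step_adapted_cont[OF v] that by (auto simp: adapted_cont_def)
  show ?thesis
    by (rule step_unique[where S = "{x \<in> Lsa. norm x \<le> M}", OF u v _ _ LB t]) (use M(2,3) mem in auto)
qed

lemma free_SDE_solution_iff:
  "free_SDE_solution A \<iota> W l \<alpha> \<beta> \<gamma> U0 U \<longleftrightarrow> (\<forall>T\<ge>0. step l aa bb cc T U U)"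
proof
  assume sol: "free_SDE_solution A \<iota> W l \<alpha> \<beta> \<gamma> U0 U"
  show "\<forall>T\<ge>0. step l aa bb cc T U U"
  proof (intro allI impI)
    fix T :: real
    show "step l aa bb cc T U U"
      unfolding step_def
    proof (intro ballI conjI)
      fix t assume "t \<in> {0..T}"
      then have t: "0 \<le> t" by simp
      then show "U t \<in> Lsa" "U t \<in> L2F t"
        "\<exists>\<zeta> \<xi>. ((\<lambda>s. aa (U s)) has_integral \<zeta>) {0..t} \<and>
         (\<forall>i\<in>{1..l}. has_free_integral \<iota> W F t (\<lambda>s. bb i (U s)) (\<lambda>s. cc i (U s)) (\<xi> i)) \<and>
         U t = \<iota> U0 + \<zeta> + (\<Sum>i=1..l. \<xi> i)"
        using sol unfolding free_SDE_solution_def by blast+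
    qed
  qed
next
  assume st: "\<forall>T\<ge>0. step l aa bb cc T U U"
  have "U t \<in> Lsa \<and> U t \<in> L2F t \<and> (\<exists>\<zeta> \<xi>. ((\<lambda>s. aa (U s)) has_integral \<zeta>) {0..t} \<and>
         (\<forall>i\<in>{1..l}. has_free_integral \<iota> W F t (\<lambda>s. bb i (U s)) (\<lambda>s. cc i (U s)) (\<xi> i)) \<and>
         U t = \<iota> U0 + \<zeta> + (\<Sum>i=1..l. \<xi> i))" if t: "t \<ge> 0" for t
  proof -
    have "step l aa bb cc t U U" "t \<in> {0..t}" using st t by auto
    then show ?thesis unfolding step_def by blast
  qed
  then show "free_SDE_solution A \<iota> W l \<alpha> \<beta> \<gamma> U0 U" unfolding free_SDE_solution_def by blast
qed

theorem global_solution: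
  "\<exists>U. free_SDE_solution A \<iota> W l \<alpha> \<beta> \<gamma> U0 U \<and>
     (\<forall>V. free_SDE_solution A \<iota> W l \<alpha> \<beta> \<gamma> U0 V \<longrightarrow> (\<forall>t\<ge>0. V t = U t)) \<and>
     (\<forall>T\<ge>0. bounded (U ` {0..T})) \<and> (d1 < 0 \<longrightarrow> bounded (U ` {0..})) \<and> continuous_on {0..} U"
proof -
  have "\<forall>T. \<exists>u. 0 \<le> T \<longrightarrow> step l aa bb cc T u u" using solution_exists by blast
  then obtain u where u: "\<And>T. 0 \<le> T \<Longrightarrow> step l aa bb cc T (u T) (u T)" by metis
  \<comment> \<open>Solutions on different intervals agree where both live, by uniqueness, so the
    diagonal restricts to a solution on each \<open>[0, T]\<close>.\<close>
  define U where "U = (\<lambda>t. u t t)"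
  have Uu: "U t = u T t" if "t \<in> {0..T}" for t T
    unfolding U_def
    using solution_unique[OF u[of t] step_mono[OF u[of T], of t], of t] that by auto
  have U: "step l aa bb cc T U U" if "0 \<le> T" for T
    by (rule step_cong[OF u[OF that]]) (use Uu in auto)
  have Uc: "continuous_on {0..T} U" for T
    using step_continuous[OF U, of T] by (cases "0 \<le> T") auto
  have cont: "continuous_on {0..} U"
    unfolding continuous_on_eq_continuous_within
  proof
    fix x :: real assume x: "x \<in> {0..}"
    have "continuous (at x within {0..x + 1}) U" using Uc[of "x + 1"] x by (simp add: continuous_on_eq_continuous_within)
    moreover have "at x within {0..x + 1} = at x within {0..}"
      by (rule at_within_nhd[of _ "{..<x + 1}"]) auto
    ultimately show "continuous (at x within {0..}) U" by simp
  qed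
  have bdd: "bounded (U ` {0..})" if d1: "d1 < 0"
  proof -
    \<comment> \<open>A constant barrier: the first entry lies above the initial value, and the
      second makes \<open>d1 * K + d2 \<le> -1\<close>, so the squared norm cannot cross
      \<open>K\<close> upwards.\<close>
    define K where "K = max ((norm (\<iota> U0))\<^sup>2) ((d2 + 1) / (- d1))"
    have Kd: "d1 * K + d2 < 0"
    proof -
      have "(d2 + 1) / (- d1) \<le> K" by (simp add: K_def)
      then have "d2 + 1 \<le> K * (- d1)" by (rule iffD1[OF pos_divide_le_eq, rotated]) (use d1 in simp)
      then show ?thesis by (simp add: algebra_simps)
    qed
    have "(norm (U T))\<^sup>2 \<le> K" if T: "0 \<le> T" for T
    proof (rule energy_comparison[OF U[OF T], where y = "\<lambda>_. K" and y' = "\<lambda>_. 0"])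
      have L: "U ` {0..T} \<subseteq> Lsa" using step_adapted_cont[OF U[OF T]] by (auto simp: adapted_cont_def)
      show "continuous_on {0..T} (\<lambda>r. aa (U r))" by (rule continuous_on_compose2[OF coef_cont(1) Uc L])
      show "continuous_on {0..T} (\<lambda>r. bb i (U r))" if "i \<in> {1..l}" for i
        by (rule continuous_on_compose2[OF coef_cont(2)[OF that] Uc L])
      show "continuous_on {0..T} (\<lambda>r. cc i (U r))" if "i \<in> {1..l}" for i
        by (rule continuous_on_compose2[OF coef_cont(3)[OF that] Uc L])
      show "(norm (U 0))\<^sup>2 \<le> K" unfolding step_initial[OF U[OF T] T] by (simp add: K_def)
      fix s assume s: "s \<in> {0..T}" "(norm (U s))\<^sup>2 = K"
      show "2 * inner (U s) (aa (U s)) + (\<Sum>i=1..l. norm (bb i (U s)) * norm (cc i (U s)))\<^sup>2 < 0"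
        using growth_bound[of "U s"] L s Kd by force
    qed (use T in auto)
    then have "norm (U T) \<le> sqrt K" if "0 \<le> T" for T using that real_le_rsqrt by blast
    then show ?thesis unfolding bounded_iff by auto
  qed
  show ?thesis
  proof (intro exI[of _ U] conjI allI impI)
    show "free_SDE_solution A \<iota> W l \<alpha> \<beta> \<gamma> U0 U" using free_SDE_solution_iff U by blast
    show "V t = U t" if V: "free_SDE_solution A \<iota> W l \<alpha> \<beta> \<gamma> U0 V" and t: "0 \<le> t" for V t
      by (rule solution_unique[of t]) (use V t U free_SDE_solution_iff in auto)
    show "bounded (U ` {0..T})" for T by (intro compact_imp_bounded compact_continuous_image Uc) simp
  qed (use bdd cont in auto)
qed

end

text \<open>Uniform boundedness is meant on each \<open>[0, T]\<close>; on the whole half-line it is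
  asserted for \<open>L1 < 0\<close>. For \<open>L1 = 0\<close> the latter fails already for
  \<open>dU = dW\<close>, where the squared norm grows like \<open>t\<close>.\<close>

theorem theorem1p4:
  fixes A :: "('h::complex_hilbert_space \<Rightarrow>\<^sub>L 'h) set"
    and \<tau> :: "('h \<Rightarrow>\<^sub>L 'h) \<Rightarrow> complex"
    and \<iota> :: "('h \<Rightarrow>\<^sub>L 'h) \<Rightarrow> 'k::complex_hilbert_space"
    and W :: "real \<Rightarrow> ('h \<Rightarrow>\<^sub>L 'h)"
    and l :: nat
    and \<alpha> :: "('h \<Rightarrow>\<^sub>L 'h) \<Rightarrow> ('h \<Rightarrow>\<^sub>L 'h)"
    and \<beta> \<gamma> :: "nat \<Rightarrow> ('h \<Rightarrow>\<^sub>L 'h) \<Rightarrow> ('h \<Rightarrow>\<^sub>L 'h)"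
    and L1 L2 :: real
    and U0 :: "'h \<Rightarrow>\<^sub>L 'h"
  assumes "nc_prob_space A \<tau>"
    and "L2_completion A \<tau> \<iota>"
    and "free_brownian_motion A \<tau> W"
    and "l \<ge> 1"
    and maps: "\<And>f. f \<in> {\<alpha>} \<union> \<beta> ` {1..l} \<union> \<gamma> ` {1..l} \<Longrightarrow> f \<in> sa_part A \<rightarrow> sa_part A"
    and causality: "\<And>f. f \<in> {\<alpha>} \<union> \<beta> ` {1..l} \<union> \<gamma> ` {1..l} \<Longrightarrow> causal A f"
    and U0: "U0 \<in> sa_part A" "free_from \<tau> {U0} (W ` {0..})"
    and self_adjointness: "sa_preserving A \<iota> W (past W U0) l \<beta> \<gamma>"
    and A1: "\<And>f. f \<in> {\<alpha>} \<union> \<beta> ` {1..l} \<union> \<gamma> ` {1..l} \<Longrightarrow> locally_L2_lipschitz A \<iota> f"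
    and A2: "L2 > 0"
      "\<And>U. U \<in> L2_sa A \<iota> \<Longrightarrow>
         2 * Re (L2_trace_mult A \<iota> U (L2_extension A \<iota> \<alpha> U)) +
         (\<Sum>i=1..l. norm (L2_extension A \<iota> (\<beta> i) U) * norm (L2_extension A \<iota> (\<gamma> i) U))\<^sup>2
         \<le> L1 * (norm U)\<^sup>2 + L2"
  shows "\<exists>U. free_SDE_solution A \<iota> W l \<alpha> \<beta> \<gamma> U0 U \<and>
           (\<forall>V. free_SDE_solution A \<iota> W l \<alpha> \<beta> \<gamma> U0 V \<longrightarrow> (\<forall>t\<ge>0. V t = U t)) \<and>
           (\<forall>T\<ge>0. bounded (U ` {0..T})) \<and>
           (L1 < 0 \<longrightarrow> bounded (U ` {0..})) \<and>
           continuous_on {0..} U"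
proof -
  interpret free_sde A \<tau> \<iota> W U0 l \<alpha> \<beta> \<gamma> L1 L2
    by unfold_locales
      (use assms in \<open>auto simp: nc_prob_space_def\<close>)
  show ?thesis by (rule global_solution)
qed

end
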